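(* Let $(X_i)_{i\ge1}$ be i.i.d. real random variables with $\mathbb E X_1^2\in(0,\infty)$. Assume that $X_1$ is non-lattice and that there exist $\lambda>0$ and $\delta>0$ such that $\mathbb E X_1e^{\lambda X_1}=0$ and $\mathbb E|X_1|^{2+\delta}e^{\lambda X_1}<\infty$. Then, for any $\eta\ge1$, as $n\to\infty$, uniformly in $x\in[\eta^{-1}\sqrt n,\eta\sqrt n]$, $$\mathbb P(\tau_x>n)\sim\frac{2e^{n\Lambda(\lambda)+\lambda x}}{\sqrt{2\pi}\,\sigma_\lambda^2\,n}\,\phi^+\Big(\frac{x}{\sigma_\lambda\sqrt n}\Big)\int_{\mathbb R_+}e^{-\lambda t}V_\lambda^*(t)\,dt.$$
   Context: Notation: $\mathbb R_+=[0,\infty)$; $S_n=\sum_{i=1}^nX_i$, $S_n^*=-S_n$; for $x\ge0$, $\tau_x=\inf\{k\ge1:\ x+S_k<0\}$, $\tau_x^*=\inf\{k\ge1:\ x+S_k^*<0\}$, with $\inf\emptyset=\infty$. A random variable $X$ is non-lattice if for all $h>0$ and $a\in[0,h)$, $\mathbb P(X\in h\mathbb Z+a)\ne1$. $\Lambda(\lambda)=\log\mathbb E e^{\lambda X_1}$. $\mathbb P_\lambda$ (with expectation $\mathbb E_\lambda$) is the probability measure under which $(X_i)$ are i.i.d. with law $\mathbb P_\lambda(X_1\in dx)=e^{\lambda x-\Lambda(\lambda)}\mathbb P(X_1\in dx)$. $\sigma_\lambda^2=\mathbb E_\lambda X_1^2=e^{-\Lambda(\lambda)}\mathbb E(X_1^2e^{\lambda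 X_1})$, $\sigma_\lambda>0$. For $x\ge0$, $V_\lambda^*(x)=-\mathbb E_\lambda S^*_{\tau^*_x}$. $\phi^+(s)=se^{-s^2/2}\mathbf 1_{\{s\ge0\}}$. Uniform asymptotic equivalence: $a_n(\theta)\sim b_n(\theta)$ uniformly in $\theta\in A_n$ as $n\to\infty$ means $\lim_{n\to\infty}\sup_{\theta\in A_n}\left|\frac{a_n(\theta)}{b_n(\theta)}-1\right|=0$. *)

theory Defs
  imports "HOL-Probability.Probability"
begin

text \<open>
  Walks are encoded by their increment sequences \<open>w\<close>, indexed from 1; the dual walk
  is obtained by passing \<open>\<lambda>i. - w i\<close>.
\<close>

definition walk :: "(nat \<Rightarrow> real) \<Rightarrow> nat \<Rightarrow> real" where
  "walk w n = (\<Sum>i=1..n. w i)"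

text \<open>In \<^typ>\<open>enat\<close>, the infimum of the empty set is \<open>\<infinity>\<close>.\<close>

definition exit_time :: "real \<Rightarrow> (nat \<Rightarrow> real) \<Rightarrow> enat" where
  "exit_time x w = Inf (enat ` {k. 1 \<le> k \<and> x + walk w k < 0})"

text \<open>
  The value 0 on \<open>exit_time x w = \<infinity>\<close> is a convention for an event that is null for the
  centred, nondegenerate walks to which this is applied.
\<close>

definition walk_at_exit :: "real \<Rightarrow> (nat \<Rightarrow> real) \<Rightarrow> real" where
  "walk_at_exit x w = (case exit_time x w of enat k \<Rightarrow> walk w k | \<infinity> \<Rightarrow> 0)"

definition non_lattice :: "'a measure \<Rightarrow> ('a \<Rightarrow> real) \<Rightarrow> bool" where
  "non_lattice M Y \<longleftrightarrow>
     (\<forall>h>0. \<forall>a\<in>{0..<h}. measure M {\<omega>\<in>space M. \<exists>k::int. Y \<omega> = h * of_int k + a} \<noteq> 1)"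

text \<open>Below, \<open>\<mu>\<close> is the law of a single increment and \<open>l\<close> is the tilting parameter.\<close>

definition log_mgf :: "real measure \<Rightarrow> real \<Rightarrow> real" where
  "log_mgf \<mu> l = ln (\<integral>y. exp (l * y) \<partial>\<mu>)"

definition tilted_law :: "real measure \<Rightarrow> real \<Rightarrow> real measure" where
  "tilted_law \<mu> l = density \<mu> (\<lambda>y. ennreal (exp (l * y - log_mgf \<mu> l)))"

text \<open>
  The tilted probability measure, realised on the canonical space, where the increments
  are the coordinates.
\<close>

definition tilted_measure :: "real measure \<Rightarrow> real \<Rightarrow> (nat \<Rightarrow> real) measure" where
  "tilted_measure \<mu> l = (\<Pi>\<^sub>M i\<in>{1..}. tilted_law \<mu> l)"

definition tilted_sigma :: "real measure \<Rightarrow> real \<Rightarrow> real" where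
  "tilted_sigma \<mu> l = sqrt (\<integral>w. (w 1)\<^sup>2 \<partial>tilted_measure \<mu> l)"

definition V_star :: "real measure \<Rightarrow> real \<Rightarrow> real \<Rightarrow> real" where
  "V_star \<mu> l x = - (\<integral>w. walk_at_exit x (\<lambda>i. - w i) \<partial>tilted_measure \<mu> l)"

definition phi_plus :: "real \<Rightarrow> real" where
  "phi_plus s = s * exp (- s\<^sup>2 / 2) * indicator {0..} s"

text \<open>
  The supremum is taken in \<^typ>\<open>ennreal\<close>, because a supremum of an unbounded set of reals
  is unspecified.
\<close>

definition unif_asymp_equiv ::
  "(nat \<Rightarrow> 'b set) \<Rightarrow> (nat \<Rightarrow> 'b \<Rightarrow> real) \<Rightarrow> (nat \<Rightarrow> 'b \<Rightarrow> real) \<Rightarrow> bool" where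
  "unif_asymp_equiv A a b \<longleftrightarrow>
     (\<lambda>n. SUP \<theta>\<in>A n. ennreal \<bar>a n \<theta> / b n \<theta> - 1\<bar>) \<longlonglongrightarrow> 0"

end

theory Submission
  imports Defs "HOL-Number_Theory.Cong" "HOL-Real_Asymp.Real_Asymp"
begin

text \<open>
  Under the tilted law the walk \<open>S\<close> is centred, and the tail probability is \<open>exp (n * \<Lambda> + l * x)\<close> times
  \<open>Q\<^sub>n(x) = E[g(x + S\<^sub>n); x + S\<^sub>j \<ge> 0 for j \<le> n]\<close> with \<open>g(y) = exp (- l * y)\<close> for \<open>y \<ge> 0\<close>. Splitting the path at
  the first time of its minimum gives \<open>Q\<^sub>n(x) = \<Sum>k\<le>n. A\<^sub>k(x) * Q\<^sub>n\<^sub>-\<^sub>k(0)\<close>, where \<open>A\<^sub>k(x)\<close> is the expectation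
  of \<open>g(x + S\<^sub>k)\<close> over the event that \<open>k\<close> is a strict descending ladder time. As \<open>Q\<^sub>m(0)\<close> is of order
  \<open>m\<close> to the power \<open>-3/2\<close>, this makes \<open>n * Q\<^sub>n(x)\<close> asymptotically proportional to \<open>n * A\<^sub>n(x)\<close>.

  Averaging over cyclic rotations of the increments, the expectation of \<open>F(S\<^sub>n)\<close> times the drop of the
  running minimum at time \<open>n\<close> equals the expectation of \<open>F(S\<^sub>n)\<close> times the negative part of \<open>S\<^sub>n\<close>, divided by
  \<open>n\<close>. Decomposing the former at ladder times shows that \<open>n * A\<^sub>n(x)\<close> is in turn proportional to the
  expectation of \<open>g(x + S\<^sub>n)\<close> times the negative part of \<open>S\<^sub>n\<close>, and the local limit theorem evaluates this as
  a multiple of \<open>\<phi>\<^sup>+\<close>.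

  The remaining constant follows by integrating \<open>y * Q\<^sub>n(y)\<close> over \<open>y\<close> in two ways. By time reversal the integral
  is that of \<open>exp (- l * t) * E[t - S\<^sub>n; S\<^sub>j \<le> t for j \<le> n]\<close> over \<open>t \<ge> 0\<close>, and the expectation increases to
  \<open>V\<^sup>*(t)\<close> by optional stopping; on the other hand the asymptotics of \<open>Q\<^sub>n\<close> give a multiple of the constant.
\<close>

section \<open>Paths, minima and cyclic rotations\<close>

text \<open>Both proportionalities rest on one fact, \<open>A_regular\<close>: a fixed lag in n and
  a fixed shift in x change \<open>n * A l n x\<close> by o(1), so that A can be pulled out of a
  convolution whose other factor is summable. A local limit theorem alone does not show this, since
  \<open>A\<close> involves the whole path. It is obtained through \<open>B\<close>, which carries
  the extra weight \<open>- psum w n\<close>. Where the exponential weight is not small this is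
  nearly x, of order sqrt n, and the weighted expectation splits at all earlier ladder times into
  terms with \<open>Gneg\<close>, whose limit profile is Lipschitz and blind to fixed lags and
  shifts. Blocks to which that limit does not apply are controlled by crude bounds of orders 1 /
  sqrt n, 1 / n and 1 / (n * sqrt n). In the last step the factor y moves the mass of the integral
  to y of order sqrt n, the range where the asymptotics of Q are known.\<close>

definition psum :: "(nat \<Rightarrow> real) \<Rightarrow> nat \<Rightarrow> real" where
  "psum w n = (\<Sum>i<n. w i)"

text \<open>Time 0 counts as a ladder time; this supplies the term for paths that never fall below
  their starting point.\<close>

definition ladder :: "(nat \<Rightarrow> real) \<Rightarrow> nat \<Rightarrow> bool" where
  "ladder w n \<longleftrightarrow> (\<forall>j<n. psum w n < psum w j)"

text \<open>The index j = 0 is included, so the event is empty for negative t. Hence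
  \<open>Q\<close> vanishes on the negative half-line, and first-step recursions carry the factor
  \<open>of_bool (0 \<le> x)\<close>.\<close>

definition stays :: "real \<Rightarrow> (nat \<Rightarrow> real) \<Rightarrow> nat \<Rightarrow> bool" where
  "stays t w n \<longleftrightarrow> (\<forall>j\<le>n. 0 \<le> t + psum w j)"

primrec runmin :: "(nat \<Rightarrow> real) \<Rightarrow> nat \<Rightarrow> real" where
  "runmin w 0 = 0"
| "runmin w (Suc n) = min (runmin w n) (psum w (Suc n))"

definition drop_at :: "(nat \<Rightarrow> real) \<Rightarrow> nat \<Rightarrow> real" where
  "drop_at w n = runmin w (n - 1) - runmin w n"

definition shifted :: "nat \<Rightarrow> (nat \<Rightarrow> real) \<Rightarrow> nat \<Rightarrow> real" where
  "shifted k w i = w (i + k)"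

lemma psum_0 [simp]: "psum w 0 = 0"
  and psum_Suc: "psum w (Suc n) = psum w n + w n"
  by (simp_all add: psum_def)

lemma psum_add: "psum w (k + j) = psum w k + psum (shifted k w) j"
  by (induction j) (simp_all add: psum_Suc shifted_def add.commute)

lemma psum_comb_seq_le [simp]: "j \<le> k \<Longrightarrow> psum (comb_seq k w w') j = psum w j"
  by (simp add: psum_def comb_seq_def)

lemma shift_comb_seq [simp]: "shifted k (comb_seq k w w') = w'"
  by (auto simp: shifted_def comb_seq_def)

lemma psum_comb_seq_ge: "k \<le> n \<Longrightarrow> psum (comb_seq k w w') n = psum w k + psum w' (n - k)"
  using psum_add[of "comb_seq k w w'" k "n - k"] by simp

lemma ladder_comb_seq [simp]: "j \<le> k \<Longrightarrow> ladder (comb_seq k w w') j = ladder w j"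
  by (simp add: ladder_def)

lemma stays_comb_seq [simp]: "j \<le> k \<Longrightarrow> stays t (comb_seq k w w') j = stays t w j"
  by (simp add: stays_def)

lemma runmin_comb_seq [simp]: "j \<le> k \<Longrightarrow> runmin (comb_seq k w w') j = runmin w j"
  by (induction j) simp_all

lemma drop_at_comb_seq [simp]: "j \<le> k \<Longrightarrow> drop_at (comb_seq k w w') j = drop_at w j"
  by (simp add: drop_at_def)

lemma ladder_0 [simp]: "ladder w 0"
  by (simp add: ladder_def)

lemma stays_0: "stays t w 0 \<longleftrightarrow> 0 \<le> t"
  by (simp add: stays_def)

lemma stays_Suc: "stays t w (Suc n) \<longleftrightarrow> stays t w n \<and> 0 \<le> t + psum w (Suc n)"
  by (auto simp: stays_def le_Suc_eq)

lemma stays_antimono: "m \<le> n \<Longrightarrow> stays t w n \<Longrightarrow> stays t w m"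
  by (simp add: stays_def)

lemma psum_case_nat_Suc: "psum (case_nat x w) (Suc n) = x + psum w n"
  by (induction n) (simp_all add: psum_Suc psum_def)

lemma stays_case_nat_Suc: "stays t (case_nat x w) (Suc n) \<longleftrightarrow> 0 \<le> t \<and> stays (t + x) w n"
proof -
  have "(\<forall>j\<le>Suc n. P j) \<longleftrightarrow> P 0 \<and> (\<forall>j\<le>n. P (Suc j))" for P
    by (metis Suc_le_mono le0 not0_implies_Suc)
  then show ?thesis by (simp add: stays_def psum_case_nat_Suc add.assoc)
qed

section \<open>The running minimum and decompositions at ladder times\<close>

lemma runmin_eq_Min: "runmin w n = Min (psum w ` {..n})"
  by (induction n) (simp_all add: atMost_Suc min.commute)

lemma runmin_le: "j \<le> n \<Longrightarrow> runmin w n \<le> psum w j"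
  by (simp add: runmin_eq_Min)

lemma runmin_attained: "\<exists>j\<le>n. runmin w n = psum w j"
proof -
  have "Min (psum w ` {..n}) \<in> psum w ` {..n}" by (rule Min_in) auto
  then show ?thesis unfolding runmin_eq_Min by (metis atMost_iff imageE)
qed

lemma runmin_nonpos: "runmin w n \<le> 0"
  using runmin_le[of 0 n w] by simp

lemma runmin_ge_iff: "c \<le> runmin w n \<longleftrightarrow> (\<forall>j\<le>n. c \<le> psum w j)"
  by (auto simp: runmin_eq_Min)

lemma runmin_antimono: "m \<le> n \<Longrightarrow> runmin w n \<le> runmin w m"
  by (auto simp: runmin_ge_iff intro: runmin_le)

lemma drop_at_nonneg: "0 \<le> drop_at w n"
  by (simp add: drop_at_def runmin_antimono)

lemma ladder_iff_runmin: "ladder w (Suc n) \<longleftrightarrow> psum w (Suc n) < runmin w n"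
  unfolding ladder_def runmin_eq_Min by (auto simp: less_Suc_eq_le)

lemma drop_at_pos_iff: "1 \<le> n \<Longrightarrow> 0 < drop_at w n \<longleftrightarrow> ladder w n"
  by (cases n) (auto simp: drop_at_def ladder_iff_runmin)

lemma drop_at_Suc: "drop_at w (Suc n) = max 0 (runmin w n - psum w (Suc n))"
  by (auto simp: drop_at_def)

lemma ladder_imp_runmin: "ladder w n \<Longrightarrow> runmin w n = psum w n"
  by (cases n) (auto simp: ladder_iff_runmin)

lemma ladder_nonpos: "ladder w n \<Longrightarrow> psum w n \<le> 0"
  using ladder_imp_runmin runmin_nonpos by metis

lemma sum_drop_at: "(\<Sum>l=1..n. drop_at w l) = - runmin w n"
  by (induction n) (simp_all add: drop_at_def)

text \<open>Regeneration at a ladder time: all positions before l lie above \<open>psum w l\<close>,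
  and a ladder time of the shifted path ends at or below its start, so only the path after l has to
  be examined.\<close>

lemma ladder_add:
  assumes "ladder w l" "l \<le> n"
  shows "ladder w n \<longleftrightarrow> ladder (shifted l w) (n - l)"
proof -
  have n: "psum w n = psum w l + psum (shifted l w) (n - l)"
    using psum_add[of w l "n - l"] assms by simp
  show ?thesis
  proof
    assume L: "ladder w n"
    show "ladder (shifted l w) (n - l)" unfolding ladder_def
    proof (intro allI impI)
      fix j assume "j < n - l"
      then show "psum (shifted l w) (n - l) < psum (shifted l w) j"
        using L[unfolded ladder_def, rule_format, of "l + j"] n psum_add[of w l j] by simp
    qed
  next
    assume L: "ladder (shifted l w) (n - l)"
    show "ladder w n" unfolding ladder_def
    proof (intro allI impI)
      fix j assume "j < n"
      show "psum w n < psum w j"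
      proof (cases "j < l")
        case True
        then show ?thesis using assms(1) ladder_nonpos[OF L] n by (force simp: ladder_def)
      next
        case False
        then obtain i where "j = l + i" using le_Suc_ex not_le by (metis leI)
        then show ?thesis using L n psum_add[of w l i] \<open>j < n\<close> by (simp add: ladder_def)
      qed
    qed
  qed
qed

text \<open>The first time at which the minimum over {0..n} is attained is the only ladder time
  after which the path never goes lower. The sum with an arbitrary weight f is the form in which
  this partition of unity enters under an integral.\<close>

lemma first_argmin_partition:
  fixes f :: "nat \<Rightarrow> 'a::comm_semiring_1"
  shows "\<exists>k\<le>n. ladder w k \<and> stays 0 (shifted k w) (n - k) \<and> psum w k = runmin w n \<and>
    (\<Sum>j\<le>n. of_bool (ladder w j \<and> stays 0 (shifted j w) (n - j)) * f j) = f k"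
proof -
  define k where "k = (LEAST j. j \<le> n \<and> psum w j = runmin w n)"
  have k: "k \<le> n" "psum w k = runmin w n"
    using LeastI_ex[of "\<lambda>j. j \<le> n \<and> psum w j = runmin w n"] runmin_attained[of n w]
    unfolding k_def by metis+
  have less: "runmin w n < psum w j" if "j < k" for j
    using not_less_Least[of j "\<lambda>j. j \<le> n \<and> psum w j = runmin w n"] that k(1) runmin_le[of j n w]
    by (fastforce simp: k_def)
  have stays: "stays 0 (shifted j w) (n - j) \<longleftrightarrow> (\<forall>i. j \<le> i \<and> i \<le> n \<longrightarrow> psum w j \<le> psum w i)"
    if "j \<le> n" for j
  proof
    assume *: "stays 0 (shifted j w) (n - j)"
    show "\<forall>i. j \<le> i \<and> i \<le> n \<longrightarrow> psum w j \<le> psum w i"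
    proof (intro allI impI)
      fix i assume "j \<le> i \<and> i \<le> n"
      then show "psum w j \<le> psum w i"
        using * psum_add[of w j "i - j"] by (auto simp: stays_def)
    qed
  next
    assume *: "\<forall>i. j \<le> i \<and> i \<le> n \<longrightarrow> psum w j \<le> psum w i"
    show "stays 0 (shifted j w) (n - j)" unfolding stays_def
    proof (intro allI impI)
      fix i assume "i \<le> n - j"
      then show "0 \<le> 0 + psum (shifted j w) i"
        using * that psum_add[of w j i] by (auto dest!: spec[of _ "j + i"])
    qed
  qed
  have iff: "ladder w j \<and> stays 0 (shifted j w) (n - j) \<longleftrightarrow> j = k" if "j \<le> n" for j
  proof
    assume *: "ladder w j \<and> stays 0 (shifted j w) (n - j)"
    have "\<not> j < k" using less[of j] * stays[OF that] k by (metis less_imp_le not_le)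
    moreover have "\<not> k < j" using * k(2) runmin_le[OF that, of w] by (auto simp: ladder_def)
    ultimately show "j = k" by simp
  next
    assume "j = k"
    then show "ladder w j \<and> stays 0 (shifted j w) (n - j)"
      using less k stays[OF k(1)] by (auto simp: ladder_def runmin_le)
  qed
  have "(\<Sum>j\<le>n. of_bool (ladder w j \<and> stays 0 (shifted j w) (n - j)) * f j)
      = (\<Sum>j\<le>n. if j = k then f j else 0)"
    by (intro sum.cong refl) (simp add: iff)
  then show ?thesis
    using k iff[of k] by (intro exI[of _ k]) simp
qed

section \<open>Cyclic rotation and time reversal of finite paths\<close>

definition rotated :: "nat \<Rightarrow> nat \<Rightarrow> (nat \<Rightarrow> real) \<Rightarrow> nat \<Rightarrow> real" where
  "rotated n r w i = (if i < n then w ((i + r) mod n) else w i)"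

definition reversal :: "nat \<Rightarrow> (nat \<Rightarrow> real) \<Rightarrow> nat \<Rightarrow> real" where
  "reversal n w i = (if i < n then w (n - 1 - i) else w i)"

lemma psum_reversal:
  assumes "j \<le> n" shows "psum (reversal n w) j = psum w n - psum w (n - j)"
  using assms
proof (induction j)
  case (Suc j)
  have "psum w (n - j) = psum w (n - Suc j) + w (n - Suc j)"
    using Suc.prems psum_Suc[of w "n - Suc j"] by (simp add: Suc_diff_Suc)
  then show ?case using Suc by (simp add: psum_Suc reversal_def)
qed simp

text \<open>Over one period of the periodic extension with negative total \<open>s\<close>, the running minimum
  decreases by exactly \<open>- s\<close>; the drops at the successive times are those of the rotated paths.\<close>

lemma sum_drop_rotate:
  assumes n: "1 \<le> n"
  shows "(\<Sum>r<n. drop_at (rotated n r w) n) = max 0 (- psum w n)"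
    and "psum (rotated n r w) n = psum w n"
proof -
  define Z where "Z i = (\<Sum>j<i. w (j mod n))" for i
  have Zn: "Z n = psum w n" by (auto simp: Z_def psum_def intro!: sum.cong)
  have Zper: "Z (i + n) = Z i + psum w n" for i
  proof (induction i)
    case (Suc i)
    have "Z (Suc i + n) = Z (i + n) + w ((i + n) mod n)" by (simp add: Z_def)
    then show ?case using Suc by (simp add: Z_def)
  qed (use Zn in \<open>simp add: Z_def\<close>)
  have rot: "psum (rotated n r w) j = Z (r + j) - Z r" if "j \<le> n" for r j
    using that
  proof (induction j)
    case (Suc j)
    then show ?case by (simp add: psum_Suc rotated_def Z_def add.commute)
  qed simp
  show "psum (rotated n r w) n = psum w n" for r
    using rot[of n r] Zper[of r] by simp
  define m where "m r = Min ((\<lambda>j. Z (r + j)) ` {..<n})" for r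
  have ne: "{..<n} \<noteq> {}" using n by (auto simp: lessThan_empty_iff)
  have rm: "runmin (rotated n r w) (n - 1) = m r - Z r" for r
  proof -
    have "runmin (rotated n r w) (n - 1) = Min ((\<lambda>j. Z (r + j) + (- Z r)) ` {..<n})"
      unfolding runmin_eq_Min using n rot by (intro arg_cong[of _ _ Min] image_cong) auto
    also have "\<dots> = m r + (- Z r)" unfolding m_def using ne by (subst Min_add_commute) auto
    finally show ?thesis by simp
  qed
  have drop: "drop_at (rotated n r w) n = max 0 (m r - Z (r + n))" for r
    using n rm[of r] rot[of n r] by (cases n) (auto simp: drop_at_Suc)
  show "(\<Sum>r<n. drop_at (rotated n r w) n) = max 0 (- psum w n)"
  proof (cases "psum w n < 0")
    case False
    have "m r \<le> Z r" for r
    proof -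
      have "Z (r + 0) \<in> (\<lambda>j. Z (r + j)) ` {..<n}" using n by (intro imageI) simp
      then show ?thesis unfolding m_def by (intro Min_le) simp_all
    qed
    then have "drop_at (rotated n r w) n = 0" for r
    proof -
      have "m r \<le> Z r" by fact
      then have "m r - Z (r + n) \<le> 0" using False Zper[of r] by linarith
      then show ?thesis using drop[of r] by simp
    qed
    then show ?thesis using False by simp
  next
    case True
    \<comment> \<open>Sliding the window by one position loses \<open>Z r\<close> and gains
      \<open>Z (r + n)\<close>. The total is negative, so the gained value is the smaller one and
      the loss cannot affect the minimum.\<close>
    have step: "m (Suc r) = min (m r) (Z (r + n))" for r
    proof -
      obtain n' where n': "n = Suc n'" using n by (cases n) auto
      let ?A = "(\<lambda>j. Z (r + Suc j)) ` {..<n'}"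
      have 1: "(\<lambda>j. Z (Suc r + j)) ` {..<n} = insert (Z (r + n)) ?A"
        unfolding n' lessThan_Suc image_insert by simp
      have 2: "(\<lambda>j. Z (r + j)) ` {..<n} = insert (Z r) ?A"
        unfolding n' lessThan_Suc_eq_insert_0 image_insert image_image by simp
      have 3: "Z (r + n) < Z r" using True Zper[of r] by simp
      show ?thesis
      proof (cases "n' = 0")
        case True
        then show ?thesis unfolding m_def 1 2 using 3 by simp
      next
        case False
        then have "?A \<noteq> {}" by (simp add: lessThan_empty_iff)
        then have mi: "Min (insert a ?A) = min a (Min ?A)" for a by (intro Min_insert) auto
        have aux: "min a M = min (min c M) a" if "a < c" for a c M :: real using that by simp
        show ?thesis unfolding m_def 1 2 mi by (rule aux[OF 3])
      qed
    qed
    have "drop_at (rotated n r w) n = m r - m (Suc r)" for r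
      using drop[of r] step[of r] by simp
    then have "(\<Sum>r<n. drop_at (rotated n r w) n) = m 0 - m n"
      by (simp add: sum_lessThan_telescope')
    also have "m n = m 0 + psum w n"
    proof -
      have "m n = Min ((\<lambda>j. Z (0 + j) + psum w n) ` {..<n})"
        unfolding m_def
      proof (intro arg_cong[of _ _ Min] image_cong refl)
        fix j show "Z (n + j) = Z (0 + j) + psum w n" using Zper[of j] by (simp add: add.commute[of n j])
      qed
      also have "\<dots> = m 0 + psum w n"
        unfolding m_def by (rule Min_add_commute) (use ne in auto)
      finally show ?thesis .
    qed
    finally show ?thesis using True by simp
  qed
qed

section \<open>Random walks with centred increments\<close>

abbreviation seq_borel :: "(nat \<Rightarrow> real) measure" where
  "seq_borel \<equiv> Pi\<^sub>M UNIV (\<lambda>_. borel)"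

lemma measurable_psum [measurable (raw)]:
  assumes "f \<in> measurable M seq_borel"
  shows "(\<lambda>x. psum (f x) n) \<in> borel_measurable M"
  unfolding psum_def by (intro borel_measurable_sum measurable_compose[OF assms]) measurable

lemma measurable_ladder [measurable (raw)]:
  assumes [measurable]: "f \<in> measurable M seq_borel"
  shows "Measurable.pred M (\<lambda>x. ladder (f x) n)"
  unfolding ladder_def by measurable

lemma measurable_stays [measurable (raw)]:
  assumes [measurable]: "t \<in> borel_measurable M" "f \<in> measurable M seq_borel"
  shows "Measurable.pred M (\<lambda>x. stays (t x) (f x) n)"
  unfolding stays_def by measurable

lemma measurable_runmin [measurable (raw)]:
  assumes [measurable]: "f \<in> measurable M seq_borel"
  shows "(\<lambda>x. runmin (f x) n) \<in> borel_measurable M"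
  by (induction n) simp_all

lemma measurable_drop_at [measurable (raw)]:
  assumes [measurable]: "f \<in> measurable M seq_borel"
  shows "(\<lambda>x. drop_at (f x) n) \<in> borel_measurable M"
  unfolding drop_at_def by measurable

lemma measurable_reindex:
  assumes "f \<in> measurable M seq_borel"
  shows "(\<lambda>x i. f x (\<pi> i)) \<in> measurable M seq_borel"
proof (rule measurable_PiM_single')
  show "(\<lambda>x. f x (\<pi> i)) \<in> borel_measurable M" for i
    by (rule measurable_compose[OF assms]) simp
qed simp

lemma measurable_shifted [measurable (raw)]:
  assumes "f \<in> measurable M seq_borel"
  shows "(\<lambda>x. shifted k (f x)) \<in> measurable M seq_borel"
  using measurable_reindex[OF assms, of "\<lambda>i. i + k"] by (simp add: shifted_def[abs_def])

lemma measurable_reversal [measurable (raw)]: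
  assumes "f \<in> measurable M seq_borel"
  shows "(\<lambda>x. reversal n (f x)) \<in> measurable M seq_borel"
proof -
  have "reversal n w = (\<lambda>i. w (if i < n then n - 1 - i else i))" for w
    by (auto simp: reversal_def fun_eq_iff)
  then show ?thesis using measurable_reindex[OF assms] by simp
qed

definition gexp :: "real \<Rightarrow> real \<Rightarrow> real" where
  "gexp l y = (if 0 \<le> y then exp (- (l * y)) else 0)"

lemma gexp_measurable [measurable]: "gexp l \<in> borel_measurable borel"
  unfolding gexp_def[abs_def] by measurable

lemma gexp_nonneg [simp]: "0 \<le> gexp l y" by (simp add: gexp_def)

lemma gexp_le_1: "0 \<le> l \<Longrightarrow> gexp l y \<le> 1" by (simp add: gexp_def)

text \<open>The weight jumps upwards at 0 and otherwise decays at rate l, so moving to the right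
  costs at most an exponential factor. \<open>G\<close> and \<open>A\<close> inherit this one-sided
  regularity.\<close>

lemma gexp_shift_ge: "0 \<le> l \<Longrightarrow> 0 \<le> h \<Longrightarrow> exp (- (l * h)) * gexp l y \<le> gexp l (y + h)"
  by (auto simp: gexp_def algebra_simps simp flip: exp_add)

text \<open>The locale is used for the tilted law and again for its reflection; the second use turns
  results on staying nonnegative into results on staying below a level.\<close>

locale iid_walk =
  fixes \<nu> :: "real measure" and \<sigma> :: real
  assumes prob_space_nu: "prob_space \<nu>"
    and sets_nu [measurable_cong]: "sets \<nu> = sets borel"
    and mean_zero: "(\<integral>y. y \<partial>\<nu>) = 0"
    and square_integrable: "integrable \<nu> (\<lambda>y. y\<^sup>2)"
    and second_moment: "(\<integral>y. y\<^sup>2 \<partial>\<nu>) = \<sigma>\<^sup>2"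
    and sigma_pos: "0 < \<sigma>"

sublocale iid_walk \<subseteq> nu: prob_space \<nu> by (rule prob_space_nu)

sublocale iid_walk \<subseteq> product_prob_space "\<lambda>_::nat. \<nu>" UNIV by standard

section \<open>Splitting and permuting the increments under the product measure\<close>

context iid_walk begin

abbreviation W :: "(nat \<Rightarrow> real) measure" where "W \<equiv> Pi\<^sub>M UNIV (\<lambda>_. \<nu>)"

lemma sets_W [measurable_cong]: "sets W = sets seq_borel"
  by (intro sets_PiM_cong) (simp_all add: sets_nu)

lemma space_W [simp]: "space W = UNIV"
  using sets_eq_imp_space_eq[OF sets_W] by (simp add: space_PiM)

lemma space_nu [simp]: "space \<nu> = UNIV"
  using sets_eq_imp_space_eq[OF sets_nu] by simp

lemma measurable_W_eq: "measurable W M = measurable seq_borel M"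
  by (rule measurable_cong_sets) (simp_all add: sets_W)

lemma seqspace: "sequence_space \<nu>" by (rule sequence_space.intro) (rule product_prob_space_axioms)

lemma pair_W: "pair_prob_space W W" by standard

lemma pair_nu_W: "pair_prob_space \<nu> W" by standard

lemma measurable_case_nat_seq: "(\<lambda>p. case_nat (fst p) (snd p)) \<in> measurable (\<nu> \<Otimes>\<^sub>M W) W"
  unfolding measurable_cong_sets[OF refl sets_W]
proof (rule measurable_PiM_single')
  fix i show "(\<lambda>p. case_nat (fst p) (snd p) i) \<in> borel_measurable (\<nu> \<Otimes>\<^sub>M W)"
    by (cases i) measurable
qed auto

text \<open>The product law is the image of \<open>W \<Otimes>\<^sub>M W\<close> under concatenation
  at time k. This Fubini form takes the place of conditioning on the first k increments.\<close>

lemma split_integral: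
  fixes F :: "(nat \<Rightarrow> real) \<Rightarrow> real"
  assumes "integrable W F"
  shows "(\<integral>w. F w \<partial>W) = (\<integral>w. (\<integral>w'. F (comb_seq k w w') \<partial>W) \<partial>W)"
    and "integrable W (\<lambda>w. \<integral>w'. F (comb_seq k w w') \<partial>W)"
    and "integrable (W \<Otimes>\<^sub>M W) (\<lambda>(w, w'). F (comb_seq k w w'))"
proof -
  interpret PW: pair_prob_space W W by (rule pair_W)
  have m: "(\<lambda>(w, w'). comb_seq k w w') \<in> measurable (W \<Otimes>\<^sub>M W) W"
    by (rule measurable_comb_seq)
  have d: "distr (W \<Otimes>\<^sub>M W) W (\<lambda>(w, w'). comb_seq k w w') = W"
    by (rule sequence_space.PiM_comb_seq[OF seqspace])
  have F: "F \<in> borel_measurable W" using assms by auto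
  have i: "integrable (W \<Otimes>\<^sub>M W) (\<lambda>p. F ((\<lambda>(w, w'). comb_seq k w w') p))"
    using integrable_distr_eq[OF m F] assms unfolding d by simp
  then show i': "integrable (W \<Otimes>\<^sub>M W) (\<lambda>(w, w'). F (comb_seq k w w'))"
    by (simp add: case_prod_beta')
  have "(\<integral>w. F w \<partial>W) = (\<integral>p. F ((\<lambda>(w, w'). comb_seq k w w') p) \<partial>(W \<Otimes>\<^sub>M W))"
    using integral_distr[OF m F] unfolding d by simp
  also have "\<dots> = (\<integral>w. (\<integral>w'. F (comb_seq k w w') \<partial>W) \<partial>W)"
    using PW.integral_fst'[OF i] by (simp add: case_prod_beta')
  finally show "(\<integral>w. F w \<partial>W) = (\<integral>w. (\<integral>w'. F (comb_seq k w w') \<partial>W) \<partial>W)" .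
  show "integrable W (\<lambda>w. \<integral>w'. F (comb_seq k w w') \<partial>W)"
    using PW.integrable_fst'[OF i] by (simp add: case_prod_beta')
qed

lemma first_step_integral:
  fixes F :: "(nat \<Rightarrow> real) \<Rightarrow> real"
  assumes "integrable W F"
  shows "(\<integral>w. F w \<partial>W) = (\<integral>x. (\<integral>w. F (case_nat x w) \<partial>W) \<partial>\<nu>)"
    and "integrable (\<nu> \<Otimes>\<^sub>M W) (\<lambda>(x, w). F (case_nat x w))"
proof -
  interpret PW: pair_prob_space \<nu> W by (rule pair_nu_W)
  have m: "(\<lambda>(x, w). case_nat x w) \<in> measurable (\<nu> \<Otimes>\<^sub>M W) W"
    using measurable_case_nat_seq by (simp add: case_prod_beta')
  have d: "distr (\<nu> \<Otimes>\<^sub>M W) W (\<lambda>(x, w). case_nat x w) = W"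
    by (rule sequence_space.PiM_iter[OF seqspace])
  have F: "F \<in> borel_measurable W" using assms by auto
  have i: "integrable (\<nu> \<Otimes>\<^sub>M W) (\<lambda>p. F ((\<lambda>(x, w). case_nat x w) p))"
    using integrable_distr_eq[OF m F] assms unfolding d by simp
  then show "integrable (\<nu> \<Otimes>\<^sub>M W) (\<lambda>(x, w). F (case_nat x w))"
    by (simp add: case_prod_beta')
  have "(\<integral>w. F w \<partial>W) = (\<integral>p. F ((\<lambda>(x, w). case_nat x w) p) \<partial>(\<nu> \<Otimes>\<^sub>M W))"
    using integral_distr[OF m F] unfolding d by simp
  also have "\<dots> = (\<integral>x. (\<integral>w. F (case_nat x w) \<partial>W) \<partial>\<nu>)"
    using PW.integral_fst'[OF i] by (simp add: case_prod_beta')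
  finally show "(\<integral>w. F w \<partial>W) = (\<integral>x. (\<integral>w. F (case_nat x w) \<partial>W) \<partial>\<nu>)" .
qed

lemma distr_permute:
  assumes "bij \<pi>" shows "distr W W (\<lambda>w i. w (\<pi> i)) = W"
  using distr_PiM_reindex[of UNIV "\<lambda>_. \<nu>" \<pi> UNIV] assms
  by (simp add: bij_def prob_space_nu restrict_def)

lemma integral_permute:
  fixes F :: "(nat \<Rightarrow> real) \<Rightarrow> real"
  assumes "bij \<pi>" "F \<in> borel_measurable W"
  shows "(\<integral>w. F (\<lambda>i. w (\<pi> i)) \<partial>W) = (\<integral>w. F w \<partial>W)"
proof -
  have "(\<lambda>w i. w (\<pi> i)) \<in> measurable W W"
    unfolding measurable_cong_sets[OF refl sets_W]
    by (rule measurable_reindex) (simp add: measurable_W_eq)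
  then show ?thesis
    using integral_distr[of "\<lambda>w i. w (\<pi> i)" W W F] assms distr_permute by simp
qed

lemma integral_rotated:
  fixes F :: "(nat \<Rightarrow> real) \<Rightarrow> real"
  assumes "F \<in> borel_measurable W"
  shows "(\<integral>w. F (rotated n r w) \<partial>W) = (\<integral>w. F w \<partial>W)"
proof -
  let ?p = "\<lambda>i. if i < n then (i + r) mod n else i"
  have "inj ?p"
  proof (rule injI)
    fix x y assume *: "?p x = ?p y"
    show "x = y"
    proof (cases "x < n"; cases "y < n")
      assume "x < n" "y < n"
      then have "[x + r = y + r] (mod n)" using * by (simp add: unique_euclidean_semiring_class.cong_def)
      then have "[x = y] (mod n)" by (simp add: cong_add_rcancel_nat)
      then show ?thesis using \<open>x < n\<close> \<open>y < n\<close> by (simp add: unique_euclidean_semiring_class.cong_def)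
    qed (use * in \<open>auto split: if_splits\<close>)
  qed
  moreover have "surj ?p"
  proof -
    have im: "?p ` {..<n} = {..<n}"
    proof (rule endo_inj_surj)
      show "?p ` {..<n} \<subseteq> {..<n}" by (rule image_subsetI) simp
      show "inj_on ?p {..<n}" using \<open>inj ?p\<close> by (rule inj_on_subset) simp
    qed simp
    have "y \<in> range ?p" for y
    proof (cases "y < n")
      case True
      then have "y \<in> ?p ` {..<n}" unfolding im by simp
      then show ?thesis by (rule rev_subsetD) (rule image_mono, simp)
    next
      case False
      then have "y = ?p y" by simp
      then show ?thesis by (rule range_eqI)
    qed
    then show ?thesis by blast
  qed
  ultimately have "bij ?p" by (rule bijI)
  moreover have "rotated n r w = (\<lambda>i. w (?p i))" for w by (auto simp: rotated_def)
  ultimately show ?thesis using integral_permute[OF _ assms, of ?p] by simp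
qed

lemma integral_reversal:
  fixes F :: "(nat \<Rightarrow> real) \<Rightarrow> real"
  assumes "F \<in> borel_measurable W"
  shows "(\<integral>w. F (reversal n w) \<partial>W) = (\<integral>w. F w \<partial>W)"
proof -
  let ?p = "\<lambda>i. if i < n then n - 1 - i else i"
  have "?p (?p i) = i" for i by auto
  then have "bij ?p" by (intro o_bij[of ?p ?p]) (auto simp: fun_eq_iff)
  moreover have "reversal n w = (\<lambda>i. w (?p i))" for w by (auto simp: reversal_def)
  ultimately show ?thesis using integral_permute[OF _ assms, of ?p] by simp
qed

lemma integrable_bounded:
  fixes f :: "(nat \<Rightarrow> real) \<Rightarrow> real"
  assumes "f \<in> borel_measurable W" "\<And>w. \<bar>f w\<bar> \<le> c"
  shows "integrable W f"
  by (rule P.integrable_const_bound[where B = c]) (use assms in auto)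

lemma integrable_dom:
  fixes f g :: "(nat \<Rightarrow> real) \<Rightarrow> real"
  assumes g: "integrable W g" and f: "f \<in> borel_measurable W" and le: "\<And>w. \<bar>f w\<bar> \<le> g w"
  shows "integrable W f"
proof (rule Bochner_Integration.integrable_bound[OF g f], rule AE_I2)
  show "norm (f w) \<le> norm (g w)" for w using le[of w] by simp
qed

text \<open>The hypothesis \<open>dep\<close> expresses that F depends on the first k increments
  only; \<open>G (shifted k w)\<close> depends on the remaining ones.\<close>

lemma indep_product:
  fixes F G :: "(nat \<Rightarrow> real) \<Rightarrow> real"
  assumes F: "integrable W F" and G: "integrable W G" and dep: "\<And>w w'. F (comb_seq k w w') = F w"
  shows "integrable W (\<lambda>w. F w * G (shifted k w))"
    and "(\<integral>w. F w * G (shifted k w) \<partial>W) = (\<integral>w. F w \<partial>W) * (\<integral>w. G w \<partial>W)"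
proof -
  interpret PW: pair_prob_space W W by (rule pair_W)
  have [measurable]: "F \<in> borel_measurable W" "G \<in> borel_measurable W" using F G by auto
  have [measurable]: "shifted k \<in> measurable W W"
    unfolding measurable_cong_sets[OF refl sets_W]
    using measurable_shifted[of "\<lambda>w. w"] by (simp add: measurable_W_eq)
  have m: "(\<lambda>(w, w'). comb_seq k w w') \<in> measurable (W \<Otimes>\<^sub>M W) W"
    by (rule measurable_comb_seq)
  have d: "distr (W \<Otimes>\<^sub>M W) W (\<lambda>(w, w'). comb_seq k w w') = W"
    by (rule sequence_space.PiM_comb_seq[OF seqspace])
  have "integrable (W \<Otimes>\<^sub>M W) (\<lambda>(w, w'). F w * G w')"
    by (intro PW.Fubini_integrable) (use F G in \<open>auto simp: abs_mult\<close>)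
  then have i: "integrable (W \<Otimes>\<^sub>M W) (\<lambda>p. (\<lambda>w. F w * G (shifted k w)) ((\<lambda>(w, w'). comb_seq k w w') p))"
    by (simp add: dep case_prod_beta')
  have "integrable (distr (W \<Otimes>\<^sub>M W) W (\<lambda>(w, w'). comb_seq k w w')) (\<lambda>w. F w * G (shifted k w))"
    by (subst integrable_distr_eq[OF m]) (use i in auto)
  then show *: "integrable W (\<lambda>w. F w * G (shifted k w))" unfolding d .
  show "(\<integral>w. F w * G (shifted k w) \<partial>W) = (\<integral>w. F w \<partial>W) * (\<integral>w. G w \<partial>W)"
    by (subst split_integral(1)[OF *, of k]) (simp add: dep)
qed

text \<open>With the first block integrated inside, the second block becomes the outer path. The
  decompositions below use this to exchange the order of two blocks of increments.\<close>

lemma integral_split_swap: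
  fixes F :: "(nat \<Rightarrow> real) \<Rightarrow> real"
  assumes "integrable W F"
  shows "(\<integral>w. F w \<partial>W) = (\<integral>w'. (\<integral>w. F (comb_seq k w w') \<partial>W) \<partial>W)"
proof -
  interpret PW: pair_prob_space W W by (rule pair_W)
  show ?thesis
    using PW.Fubini_integral[OF split_integral(3)[OF assms, of k]] split_integral(1)[OF assms, of k]
    by simp
qed

lemma component_integral:
  fixes f :: "real \<Rightarrow> real"
  assumes [measurable]: "f \<in> borel_measurable borel"
  shows "(\<integral>w. f (w i) \<partial>W) = (\<integral>y. f y \<partial>\<nu>)"
    and "integrable W (\<lambda>w. f (w i)) \<longleftrightarrow> integrable \<nu> f"
proof -
  have c: "distr W \<nu> (\<lambda>w. w i) = \<nu>" by (rule PiM_component) simp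
  have m: "(\<lambda>w. w i) \<in> measurable W \<nu>" by simp
  show "(\<integral>w. f (w i) \<partial>W) = (\<integral>y. f y \<partial>\<nu>)"
    using integral_distr[OF m, of f] unfolding c by simp
  show "integrable W (\<lambda>w. f (w i)) \<longleftrightarrow> integrable \<nu> f"
    using integrable_distr_eq[OF m, of f] unfolding c by simp
qed

lemma integrable_id: "integrable \<nu> (\<lambda>y. y)"
  by (rule nu.square_integrable_imp_integrable) (use square_integrable in auto)

lemma coord_integrable: "integrable W (\<lambda>w. w i)"
  by (rule component_integral(2)[of "\<lambda>y. y", THEN iffD2]) (simp_all add: integrable_id)

lemma coord_mean: "(\<integral>w. w i \<partial>W) = 0"
  using component_integral(1)[of "\<lambda>y. y" i] mean_zero by simp

lemma coord_square_integrable: "integrable W (\<lambda>w. (w i)\<^sup>2)"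
  by (rule component_integral(2)[of "\<lambda>y. y\<^sup>2", THEN iffD2]) (simp_all add: square_integrable)

lemma coord_square: "(\<integral>w. (w i)\<^sup>2 \<partial>W) = \<sigma>\<^sup>2"
  using component_integral(1)[of "\<lambda>y. y\<^sup>2" i] second_moment by simp

lemma psum_integrable [simp]: "integrable W (\<lambda>w. psum w n)"
  unfolding psum_def by (intro Bochner_Integration.integrable_sum coord_integrable)

lemma dominated_by_psum:
  fixes f :: "(nat \<Rightarrow> real) \<Rightarrow> real"
  assumes "f \<in> borel_measurable W" "\<And>w. \<bar>f w\<bar> \<le> c * \<bar>psum w n\<bar>"
  shows "integrable W f"
  by (rule Bochner_Integration.integrable_bound[of W "\<lambda>w. c * psum w n"])
    (use assms in \<open>auto simp: abs_mult intro!: AE_I2 order_trans[OF assms(2)] mult_right_mono\<close>)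

lemma psum_square:
  "integrable W (\<lambda>w. (psum w n)\<^sup>2) \<and> (\<integral>w. (psum w n)\<^sup>2 \<partial>W) = n * \<sigma>\<^sup>2"
proof (induction n)
  case (Suc n)
  have e: "(psum w (Suc n))\<^sup>2 = (psum w n)\<^sup>2 + (2 * psum w n) * (shifted n w 0) + (w n)\<^sup>2" for w
    by (simp add: psum_Suc power2_sum shifted_def)
  have ip: "integrable W (\<lambda>w. (2 * psum w n) * (shifted n w 0))"
      "(\<integral>w. (2 * psum w n) * (shifted n w 0) \<partial>W) = 0"
    using indep_product[of "\<lambda>w. 2 * psum w n" "\<lambda>w. w 0" n] coord_integrable[of 0] coord_mean[of 0]
    by simp_all
  show ?case unfolding e using Suc coord_square_integrable[of n] coord_square[of n] ip
    by (simp add: distrib_right)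
qed simp

lemma drop_identity:
  fixes F :: "real \<Rightarrow> real"
  assumes n: "1 \<le> n" and [measurable]: "F \<in> borel_measurable borel" and F: "\<And>y. \<bar>F y\<bar> \<le> c"
  shows "(\<integral>w. drop_at w n * F (psum w n) \<partial>W) = (\<integral>w. max 0 (- psum w n) * F (psum w n) \<partial>W) / n"
    and "integrable W (\<lambda>w. drop_at w n * F (psum w n))"
proof -
  \<comment> \<open>A pathwise majorant for integrability: after a time j at which the minimum
    before n is attained, the path has to cover the whole drop.\<close>
  have bd: "\<bar>drop_at w n\<bar> \<le> (\<Sum>i<n. \<bar>w i\<bar>)" for w
  proof -
    obtain m where m: "n = Suc m" using n by (cases n) auto
    obtain j where j: "j \<le> m" "runmin w m = psum w j" using runmin_attained by blast
    have "runmin w m - psum w (Suc m) \<le> \<bar>psum (shifted j w) (Suc m - j)\<bar>"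
      using j psum_add[of w j "Suc m - j"] by simp
    also have "\<dots> \<le> (\<Sum>i<Suc m - j. \<bar>w (i + j)\<bar>)"
      unfolding psum_def shifted_def by (rule sum_abs)
    also have "\<dots> = (\<Sum>i\<in>{j..<Suc m}. \<bar>w i\<bar>)"
      using sum.shift_bounds_nat_ivl[of "\<lambda>i. \<bar>w i\<bar>" 0 j "Suc m - j"] j
      by (simp add: atLeast0LessThan)
    also have "\<dots> \<le> (\<Sum>i<n. \<bar>w i\<bar>)" unfolding m by (intro sum_mono2) auto
    finally show ?thesis unfolding m drop_at_Suc by (simp add: sum_nonneg)
  qed
  have "integrable W (\<lambda>w. c * (\<Sum>i<n. \<bar>w i\<bar>))"
    by (intro integrable_mult_right Bochner_Integration.integrable_sum integrable_abs coord_integrable)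
  then show i: "integrable W (\<lambda>w. drop_at w n * F (psum w n))"
  proof (rule integrable_dom)
    fix w
    have "\<bar>drop_at w n\<bar> * \<bar>F (psum w n)\<bar> \<le> (\<Sum>i<n. \<bar>w i\<bar>) * c"
      by (intro mult_mono bd F sum_nonneg) auto
    then show "\<bar>drop_at w n * F (psum w n)\<bar> \<le> c * (\<Sum>i<n. \<bar>w i\<bar>)"
      by (simp add: abs_mult mult.commute)
  qed measurable
  have meas: "(\<lambda>w. drop_at w n * F (psum w n)) \<in> borel_measurable W" by measurable
  have mr: "rotated n r \<in> measurable W W" for r
  proof -
    have "(\<lambda>w i. w (if i < n then (i + r) mod n else i)) \<in> measurable W seq_borel"
      by (rule measurable_reindex) (simp add: measurable_W_eq)
    moreover have "rotated n r = (\<lambda>w i. w (if i < n then (i + r) mod n else i))"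
      by (auto simp: rotated_def fun_eq_iff)
    ultimately show ?thesis unfolding measurable_cong_sets[OF refl sets_W] by simp
  qed
  have ir: "integrable W (\<lambda>w. drop_at (rotated n r w) n * F (psum w n))" for r
  proof (rule Bochner_Integration.integrable_bound)
    show "integrable W (\<lambda>w. c * \<bar>psum w n\<bar>)" by simp
    show "(\<lambda>w. drop_at (rotated n r w) n * F (psum w n)) \<in> borel_measurable W"
      using measurable_compose[OF mr[of r] meas] by (simp add: sum_drop_rotate(2)[OF n])
    show "AE w in W. norm (drop_at (rotated n r w) n * F (psum w n)) \<le> norm (c * \<bar>psum w n\<bar>)"
    proof (rule AE_I2)
      fix w
      show "norm (drop_at (rotated n r w) n * F (psum w n)) \<le> norm (c * \<bar>psum w n\<bar>)"
      proof (cases "r < n")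
        case True
        have "drop_at (rotated n r w) n \<le> (\<Sum>r<n. drop_at (rotated n r w) n)"
          using True by (intro member_le_sum) (auto simp: drop_at_nonneg)
        also have "\<dots> \<le> \<bar>psum w n\<bar>" using sum_drop_rotate(1)[OF n, of w] by simp
        finally have "drop_at (rotated n r w) n * \<bar>F (psum w n)\<bar> \<le> \<bar>psum w n\<bar> * c"
          by (intro mult_mono F) auto
        then show ?thesis using F[of 0] by (simp add: abs_mult drop_at_nonneg mult.commute)
      next
        case False
        have "rotated n r w = rotated n (r mod n) w"
          by (auto simp: rotated_def fun_eq_iff mod_simps)
        moreover have "drop_at (rotated n (r mod n) w) n \<le> (\<Sum>r<n. drop_at (rotated n r w) n)"
          using n by (intro member_le_sum) (auto simp: drop_at_nonneg)
        ultimately have "drop_at (rotated n r w) n \<le> \<bar>psum w n\<bar>"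
          using sum_drop_rotate(1)[OF n, of w] by simp
        then have "drop_at (rotated n r w) n * \<bar>F (psum w n)\<bar> \<le> \<bar>psum w n\<bar> * c"
          by (intro mult_mono F) auto
        then show ?thesis using F[of 0] by (simp add: abs_mult drop_at_nonneg mult.commute)
      qed
    qed
  qed
  have "n * (\<integral>w. drop_at w n * F (psum w n) \<partial>W)
      = (\<Sum>r<n. \<integral>w. drop_at (rotated n r w) n * F (psum (rotated n r w) n) \<partial>W)"
    using integral_rotated[OF meas] by simp
  also have "\<dots> = (\<integral>w. (\<Sum>r<n. drop_at (rotated n r w) n * F (psum w n)) \<partial>W)"
    using ir by (subst Bochner_Integration.integral_sum) (simp_all add: sum_drop_rotate(2)[OF n])
  also have "\<dots> = (\<integral>w. max 0 (- psum w n) * F (psum w n) \<partial>W)"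
    by (simp add: sum_drop_rotate(1)[OF n] flip: sum_distrib_right)
  finally show "(\<integral>w. drop_at w n * F (psum w n) \<partial>W) = (\<integral>w. max 0 (- psum w n) * F (psum w n) \<partial>W) / n"
    using n by (simp add: field_simps)
qed

section \<open>Four expectations of the walk and their ladder decompositions\<close>

text \<open>\<open>Q l n x\<close> is the tail probability of the exit time up to the factor \<open>exp (n * \<Lambda> + l * x)\<close>,
  see \<open>change_of_measure\<close>. In \<open>A\<close> the walk has to end at a strict minimum instead.\<close>

definition G :: "real \<Rightarrow> nat \<Rightarrow> real \<Rightarrow> real" where
  "G l n x = (\<integral>w. gexp l (x + psum w n) \<partial>W)"

definition Gneg :: "real \<Rightarrow> nat \<Rightarrow> real \<Rightarrow> real" where
  "Gneg l n x = (\<integral>w. max 0 (- psum w n) * gexp l (x + psum w n) \<partial>W)"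

definition A :: "real \<Rightarrow> nat \<Rightarrow> real \<Rightarrow> real" where
  "A l n x = (\<integral>w. of_bool (ladder w n) * gexp l (x + psum w n) \<partial>W)"

definition Q :: "real \<Rightarrow> nat \<Rightarrow> real \<Rightarrow> real" where
  "Q l n x = (\<integral>w. of_bool (stays x w n) * gexp l (x + psum w n) \<partial>W)"

lemma G_measurable [measurable]: "G l n \<in> borel_measurable borel"
  unfolding G_def[abs_def] by measurable

lemma Gneg_measurable [measurable]: "Gneg l n \<in> borel_measurable borel"
  unfolding Gneg_def[abs_def] by measurable

lemma A_measurable [measurable]: "A l n \<in> borel_measurable borel"
  unfolding A_def[abs_def] by measurable

lemma Q_measurable [measurable]: "Q l n \<in> borel_measurable borel"
  unfolding Q_def[abs_def] by measurable

lemma G_nonneg: "0 \<le> G l n x" and Gneg_nonneg: "0 \<le> Gneg l n x"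
  and A_nonneg: "0 \<le> A l n x" and Q_nonneg: "0 \<le> Q l n x"
  unfolding G_def Gneg_def A_def Q_def by (intro Bochner_Integration.integral_nonneg; simp)+

context
  fixes l :: real assumes l: "0 \<le> l"
begin

lemma gexp_bounded [simp]: "gexp l y \<le> 1" by (rule gexp_le_1[OF l])

lemma G_integrable: "integrable W (\<lambda>w. gexp l (x + psum w n))"
  by (rule integrable_bounded[where c = 1]) simp_all

lemma A_integrable: "integrable W (\<lambda>w. of_bool (ladder w n) * gexp l (x + psum w n))"
  by (rule integrable_bounded[where c = 1]) (auto simp: abs_mult)

lemma Q_integrable: "integrable W (\<lambda>w. of_bool (stays x w n) * gexp l (x + psum w n))"
  by (rule integrable_bounded[where c = 1]) (auto simp: abs_mult)

lemma Gneg_integrable: "integrable W (\<lambda>w. max 0 (- psum w n) * gexp l (x + psum w n))"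
proof (rule integrable_dom)
  show "\<bar>max 0 (- psum w n) * gexp l (x + psum w n)\<bar> \<le> \<bar>psum w n\<bar>" for w
    using mult_mono[of "max 0 (- psum w n)" "\<bar>psum w n\<bar>" "gexp l (x + psum w n)" 1] by (simp add: abs_mult)
qed simp_all

lemma Q_decomp: "Q l n x = (\<Sum>k\<le>n. A l k x * Q l (n - k) 0)"
proof -
  let ?a = "\<lambda>k w. of_bool (ladder w k) * gexp l (x + psum w k)"
  let ?q = "\<lambda>k w. of_bool (stays 0 w k) * gexp l (0 + psum w k)"
  have pw: "of_bool (stays x w n) * gexp l (x + psum w n)
      = (\<Sum>k\<le>n. ?a k w * ?q (n - k) (shifted k w))" for w
  proof -
    obtain k where k: "k \<le> n" "ladder w k" "stays 0 (shifted k w) (n - k)" "psum w k = runmin w n"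
      and s: "(\<Sum>j\<le>n. of_bool (ladder w j \<and> stays 0 (shifted j w) (n - j)) *
          (gexp l (x + psum w j) * gexp l (psum (shifted j w) (n - j))))
        = gexp l (x + psum w k) * gexp l (psum (shifted k w) (n - k))"
      using first_argmin_partition[of n w "\<lambda>j. gexp l (x + psum w j) * gexp l (psum (shifted j w) (n - j))"]
      by blast
    have p: "psum w n = psum w k + psum (shifted k w) (n - k)"
      using psum_add[of w k "n - k"] k(1) by simp
    \<comment> \<open>Survival depends on the minimum alone, so it is the cut-off already present in
      \<open>gexp l (x + psum w k)\<close>. The exponential splits multiplicatively because the part
      after k ends at a nonnegative height.\<close>
    have "stays x w n \<longleftrightarrow> 0 \<le> x + psum w k"
      using runmin_ge_iff[of "- x" w n] k(4) by (auto simp: stays_def)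
    moreover have "0 \<le> psum (shifted k w) (n - k)"
      using k(3) by (auto simp: stays_def)
    ultimately have "of_bool (stays x w n) * gexp l (x + psum w n)
        = gexp l (x + psum w k) * gexp l (psum (shifted k w) (n - k))"
      unfolding p gexp_def by (auto simp: algebra_simps simp flip: exp_add)
    also have "\<dots> = (\<Sum>k\<le>n. ?a k w * ?q (n - k) (shifted k w))"
      unfolding s[symmetric] by (intro sum.cong refl) auto
    finally show ?thesis .
  qed
  have ia: "integrable W (?a k)" for k by (rule A_integrable)
  have iq: "integrable W (?q k)" for k by (rule Q_integrable)
  note ip = indep_product[OF ia iq]
  have "Q l n x = (\<Sum>k\<le>n. \<integral>w. ?a k w * ?q (n - k) (shifted k w) \<partial>W)"
    unfolding Q_def pw by (intro Bochner_Integration.integral_sum ip(1)) simp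
  also have "\<dots> = (\<Sum>k\<le>n. A l k x * Q l (n - k) 0)"
    unfolding A_def Q_def by (intro sum.cong refl ip(2)) simp
  finally show ?thesis .
qed

text \<open>By \<open>drop_identity\<close> the left side is an expected drop at time n. The path is
  cut at its first minimum before n: the block after it stays nonnegative for k - 1 steps, then
  falls below 0, and its overshoot is the drop. What precedes it is a path that ends at a ladder
  time, which gives \<open>A\<close>.\<close>

lemma Gneg_decomp:
  assumes n: "1 \<le> n"
  shows "Gneg l n x / n =
    (\<Sum>k=1..n. \<integral>w. of_bool (stays 0 w (k - 1)) * max 0 (- psum w k) * A l (n - k) (x + psum w k) \<partial>W)"
proof -
  let ?f = "\<lambda>j w. of_bool (ladder w j \<and> stays 0 (shifted j w) (n - 1 - j)) *
     (max 0 (- psum (shifted j w) (n - j)) * gexp l (x + psum w j + psum (shifted j w) (n - j)))"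
  have pw: "drop_at w n * gexp l (x + psum w n) = (\<Sum>j\<le>n - 1. ?f j w)" for w
  proof -
    obtain k where k: "k \<le> n - 1" "psum w k = runmin w (n - 1)"
      and s: "(\<Sum>j\<le>n - 1. ?f j w) = max 0 (- psum (shifted k w) (n - k)) *
          gexp l (x + psum w k + psum (shifted k w) (n - k))"
      using first_argmin_partition[of "n - 1" w "\<lambda>j. max 0 (- psum (shifted j w) (n - j)) *
          gexp l (x + psum w j + psum (shifted j w) (n - j))"] by blast
    have p: "psum w n = psum w k + psum (shifted k w) (n - k)"
      using psum_add[of w k "n - k"] k(1) n by simp
    have "drop_at w n = max 0 (- psum (shifted k w) (n - k))"
      using n k p by (cases n) (auto simp: drop_at_Suc)
    then show ?thesis unfolding s p by (simp add: add.assoc)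
  qed
  have int: "integrable W (?f j)" if "j \<le> n - 1" for j
  proof (rule integrable_dom)
    show "integrable W (\<lambda>w. drop_at w n * gexp l (x + psum w n))"
      by (rule drop_identity(2)[OF n, of "\<lambda>y. gexp l (x + y)" 1]) simp_all
    fix w
    have "?f j w \<le> (\<Sum>j\<le>n - 1. ?f j w)"
      using that by (intro member_le_sum) auto
    moreover have "0 \<le> ?f j w" by simp
    ultimately show "\<bar>?f j w\<bar> \<le> drop_at w n * gexp l (x + psum w n)"
      unfolding pw by linarith
  qed measurable
  have "Gneg l n x / n = (\<integral>w. drop_at w n * gexp l (x + psum w n) \<partial>W)"
    unfolding Gneg_def by (rule drop_identity(1)[OF n, of "\<lambda>y. gexp l (x + y)" 1, symmetric]) simp_all
  also have "\<dots> = (\<Sum>j\<le>n - 1. \<integral>w. ?f j w \<partial>W)"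
    unfolding pw using int by (intro Bochner_Integration.integral_sum) simp
  also have "\<dots> = (\<Sum>j\<le>n - 1. \<integral>w. of_bool (stays 0 w (n - 1 - j)) * max 0 (- psum w (n - j)) *
      A l j (x + psum w (n - j)) \<partial>W)"
  proof (intro sum.cong refl)
    fix j assume "j \<in> {..n - 1}"
    then have j: "j \<le> n - 1" by simp
    have "(\<integral>w. ?f j w \<partial>W) = (\<integral>w'. (\<integral>w. ?f j (comb_seq j w w') \<partial>W) \<partial>W)"
      by (rule integral_split_swap[OF int[OF j]])
    also have "\<dots> = (\<integral>w'. of_bool (stays 0 w' (n - 1 - j)) * max 0 (- psum w' (n - j)) *
      A l j (x + psum w' (n - j)) \<partial>W)"
    proof (rule Bochner_Integration.integral_cong[OF refl])
      fix w'
      have "(\<integral>w. ?f j (comb_seq j w w') \<partial>W) =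
        (\<integral>w. (of_bool (stays 0 w' (n - 1 - j)) * max 0 (- psum w' (n - j))) *
          (of_bool (ladder w j) * gexp l (x + psum w' (n - j) + psum w j)) \<partial>W)"
        by (intro Bochner_Integration.integral_cong[OF refl]) (simp add: algebra_simps of_bool_conj)
      then show "(\<integral>w. ?f j (comb_seq j w w') \<partial>W) =
          of_bool (stays 0 w' (n - 1 - j)) * max 0 (- psum w' (n - j)) * A l j (x + psum w' (n - j))"
        by (simp add: A_def)
    qed
    finally show "(\<integral>w. ?f j w \<partial>W) = (\<integral>w. of_bool (stays 0 w (n - 1 - j)) * max 0 (- psum w (n - j)) *
      A l j (x + psum w (n - j)) \<partial>W)" .
  qed
  also have "\<dots> = (\<Sum>k=1..n. \<integral>w. of_bool (stays 0 w (k - 1)) * max 0 (- psum w k) * A l (n - k) (x + psum w k) \<partial>W)"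
    by (rule sum.reindex_bij_witness[of _ "\<lambda>k. n - k" "\<lambda>j. n - j"]) (use n in \<open>auto simp: diff_commute\<close>)
  finally show ?thesis .
qed

text \<open>At a ladder time the depth \<open>- psum w n\<close> is the sum of all drops made so
  far. Each drop is handled separately: the path is split at the time k of the drop, and
  \<open>drop_identity\<close> turns the first block into \<open>Gneg\<close>.\<close>

lemma ladder_weighted_decomp:
  "(\<integral>w. of_bool (ladder w n) * (- psum w n) * gexp l (x + psum w n) \<partial>W) =
    (\<Sum>k=1..n. (\<integral>w. of_bool (ladder w (n - k)) * Gneg l k (x + psum w (n - k)) \<partial>W) / k)"
proof -
  let ?f = "\<lambda>k w. drop_at w k * (of_bool (ladder (shifted k w) (n - k)) *
      gexp l (x + psum w k + psum (shifted k w) (n - k)))"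
  \<comment> \<open>Where the drop at k is positive, k is itself a ladder time and
    \<open>ladder_add\<close> applies; elsewhere both sides vanish.\<close>
  have fk: "?f k w = drop_at w k * of_bool (ladder w n) * gexp l (x + psum w n)"
    if "k \<in> {1..n}" for k w
  proof -
    have "psum w n = psum w k + psum (shifted k w) (n - k)"
      using psum_add[of w k "n - k"] that by simp
    moreover have "drop_at w k \<noteq> 0 \<Longrightarrow> ladder (shifted k w) (n - k) = ladder w n"
      using drop_at_pos_iff[of k w] drop_at_nonneg[of w k] ladder_add[of w k n] that by auto
    ultimately show ?thesis by (auto simp: add.assoc)
  qed
  have pw: "of_bool (ladder w n) * (- psum w n) * gexp l (x + psum w n) = (\<Sum>k=1..n. ?f k w)" for w
  proof -
    have "(\<Sum>k=1..n. ?f k w) = (\<Sum>k=1..n. drop_at w k) * (of_bool (ladder w n) * gexp l (x + psum w n))"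
      unfolding sum_distrib_right by (intro sum.cong refl) (simp add: fk mult.assoc)
    then show ?thesis using sum_drop_at[of w n] ladder_imp_runmin[of w n] by auto
  qed
  have int: "integrable W (?f k)" if k: "k \<in> {1..n}" for k
  proof (rule integrable_dom)
    show "integrable W (\<lambda>w. drop_at w k * 1)"
      using drop_identity(2)[of k "\<lambda>_. 1" 1] k by simp
    fix w
    have "of_bool (ladder (shifted k w) (n - k)) *
        gexp l (x + psum w k + psum (shifted k w) (n - k)) \<le> 1 * 1"
      by (intro mult_mono) auto
    then show "\<bar>?f k w\<bar> \<le> drop_at w k * 1"
      unfolding abs_mult using drop_at_nonneg[of w k] by (intro mult_mono) auto
  qed measurable
  have "(\<integral>w. of_bool (ladder w n) * (- psum w n) * gexp l (x + psum w n) \<partial>W)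
      = (\<Sum>k=1..n. \<integral>w. ?f k w \<partial>W)"
    unfolding pw using int by (intro Bochner_Integration.integral_sum) simp
  also have "\<dots> = (\<Sum>k=1..n. (\<integral>w. of_bool (ladder w (n - k)) * Gneg l k (x + psum w (n - k)) \<partial>W) / k)"
  proof (intro sum.cong refl)
    fix k assume k: "k \<in> {1..n}"
    have "(\<integral>w. ?f k w \<partial>W) = (\<integral>w'. (\<integral>w. ?f k (comb_seq k w w') \<partial>W) \<partial>W)"
      by (rule integral_split_swap[OF int[OF k]])
    also have "\<dots> = (\<integral>w'. of_bool (ladder w' (n - k)) * Gneg l k (x + psum w' (n - k)) / k \<partial>W)"
    proof (rule Bochner_Integration.integral_cong[OF refl])
      fix w'
      have "(\<integral>w. ?f k (comb_seq k w w') \<partial>W) =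
        (\<integral>w. of_bool (ladder w' (n - k)) * (drop_at w k * gexp l (x + psum w' (n - k) + psum w k)) \<partial>W)"
        by (intro Bochner_Integration.integral_cong[OF refl]) (simp add: algebra_simps)
      also have "\<dots> = of_bool (ladder w' (n - k)) * (\<integral>w. drop_at w k * gexp l (x + psum w' (n - k) + psum w k) \<partial>W)"
        by simp
      also have "(\<integral>w. drop_at w k * gexp l (x + psum w' (n - k) + psum w k) \<partial>W) = Gneg l k (x + psum w' (n - k)) / k"
        unfolding Gneg_def
        by (rule drop_identity(1)[of k "\<lambda>y. gexp l (x + psum w' (n - k) + y)" 1]) (use k in auto)
      finally show "(\<integral>w. ?f k (comb_seq k w w') \<partial>W) =
          of_bool (ladder w' (n - k)) * Gneg l k (x + psum w' (n - k)) / k" by simp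
    qed
    finally show "(\<integral>w. ?f k w \<partial>W) = (\<integral>w. of_bool (ladder w (n - k)) * Gneg l k (x + psum w (n - k)) \<partial>W) / k"
      by simp
  qed
  finally show ?thesis .
qed

end

end

section \<open>Smoothing by the Fejer kernel\<close>

definition fejer :: "real \<Rightarrow> real" where
  "fejer v = (if v = 0 then 1 / 2 else (1 - cos v) / v\<^sup>2)"

lemma fejer_measurable [measurable]: "fejer \<in> borel_measurable borel"
  unfolding fejer_def[abs_def] by measurable

lemma fejer_nonneg: "0 \<le> fejer v"
  by (simp add: fejer_def)

text \<open>The kernel is the cosine transform of a triangle on the unit interval. It is thus
  nonnegative, integrable and band-limited, so smoothing with it involves a characteristic function
  on a bounded interval only.\<close>

lemma fejer_eq_integral: "fejer v = (\<integral>\<theta>. (1 - \<theta>) * cos (\<theta> * v) * indicator {0..1} \<theta> \<partial>lborel)"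
proof (cases "v = 0")
  case True
  have "(\<integral>\<theta>. (1 - \<theta>) * indicator {0..1::real} \<theta> \<partial>lborel) = (1 - 1\<^sup>2 / 2) - (0 - 0\<^sup>2 / 2)"
    by (rule integral_FTC_Icc_real[where F = "\<lambda>\<theta>. \<theta> - \<theta>\<^sup>2 / 2"])
      (auto intro!: derivative_eq_intros)
  then show ?thesis using True by (simp add: fejer_def)
next
  case False
  have "(\<integral>\<theta>. (1 - \<theta>) * cos (\<theta> * v) * indicator {0..1} \<theta> \<partial>lborel)
      = ((1 - 1) * sin (1 * v) / v - cos (1 * v) / v\<^sup>2) - ((1 - 0) * sin (0 * v) / v - cos (0 * v) / v\<^sup>2)"
    by (rule integral_FTC_Icc_real[where F = "\<lambda>\<theta>. (1 - \<theta>) * sin (\<theta> * v) / v - cos (\<theta> * v) / v\<^sup>2"])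
      (use False in \<open>auto intro!: derivative_eq_intros simp: field_simps power2_eq_square\<close>)
  then show ?thesis using False by (simp add: fejer_def diff_divide_distrib)
qed

lemma triangle_integrable: "integrable lborel (\<lambda>\<theta>::real. (1 - \<theta>) * indicator {0..1} \<theta>)"
proof -
  have "continuous_on {0..1} (\<lambda>\<theta>::real. 1 - \<theta>)" by (intro continuous_intros)
  then show ?thesis
    using borel_integrable_atLeastAtMost'[of 0 1 "\<lambda>\<theta>::real. 1 - \<theta>"]
    by (simp add: set_integrable_def mult.commute)
qed

lemma fejer_le_half: "fejer v \<le> 1 / 2"
proof -
  note i = triangle_integrable
  have "fejer v \<le> (\<integral>\<theta>. (1 - \<theta>) * indicator {0..1::real} \<theta> \<partial>lborel)"
    unfolding fejer_eq_integral
  proof (rule integral_mono_AE')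
    show "integrable lborel (\<lambda>\<theta>::real. (1 - \<theta>) * indicator {0..1} \<theta>)" by (rule i)
    show "AE \<theta> in lborel. (1 - \<theta>) * cos (\<theta> * v) * indicator {0..1} \<theta> \<le> (1 - \<theta>) * indicator {0..1} \<theta>"
      by (rule AE_I2) (auto split: split_indicator intro!: mult_left_le)
    show "AE \<theta> in lborel. 0 \<le> (1 - \<theta>) * (indicator {0..1} \<theta> :: real)"
      by (rule AE_I2) (auto split: split_indicator)
  qed
  also have "\<dots> = fejer 0" unfolding fejer_eq_integral by simp
  finally show ?thesis by (simp add: fejer_def)
qed

lemma fejer_le_1: "fejer v \<le> 1"
  using fejer_le_half[of v] by simp

lemma fejer_le_cauchy: "fejer v \<le> 4 * inverse (1 + v\<^sup>2)"
proof (cases "v\<^sup>2 \<le> 1")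
  case True
  have "0 < 1 + v\<^sup>2" by (simp add: add_pos_nonneg)
  then have "1 / 2 \<le> 4 * inverse (1 + v\<^sup>2)" using True by (simp add: field_simps)
  then show ?thesis using fejer_le_half[of v] by linarith
next
  case False
  then have v: "v \<noteq> 0" by auto
  have "fejer v \<le> 2 / v\<^sup>2"
    using v cos_ge_minus_one[of v] by (simp add: fejer_def divide_right_mono)
  also have "\<dots> \<le> 4 * inverse (1 + v\<^sup>2)"
  proof -
    have "0 < v\<^sup>2" "0 < 1 + v\<^sup>2" using v by (simp_all add: add_pos_nonneg)
    then show ?thesis using False by (simp add: divide_simps)
  qed
  finally show ?thesis .
qed

lemma fejer_integrable: "integrable lborel fejer"
proof (rule Bochner_Integration.integrable_bound)
  show "integrable lborel (\<lambda>v::real. 4 * inverse (1 + v\<^sup>2))"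
    using integrable_inverse_1_plus_square by (simp add: set_integrable_def)
  show "AE v in lborel. norm (fejer v) \<le> norm (4 * inverse (1 + v\<^sup>2))"
    using fejer_le_cauchy fejer_nonneg by (intro AE_I2) (simp add: abs_of_nonneg)
qed simp

lemma fejer_integral_pos: "0 < (\<integral>v. fejer v \<partial>lborel)"
proof -
  have c: "cos (1::real) < 1" using cos_monotone_0_pi[of 0 1] pi_gt3 by simp
  have "(1 - cos 1) / 4 * measure lborel {1..2::real} = (\<integral>v. (1 - cos 1) / 4 * indicator {1..2::real} v \<partial>lborel)"
    by simp
  also have "\<dots> \<le> (\<integral>v. fejer v \<partial>lborel)"
  proof (rule integral_mono[OF _ fejer_integrable])
    fix v :: real
    show "(1 - cos 1) / 4 * indicator {1..2} v \<le> fejer v"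
    proof (cases "v \<in> {1..2}")
      case True
      have "cos v \<le> cos 1" using True pi_gt3 by (intro cos_monotone_0_pi_le) auto
      moreover have "v\<^sup>2 \<le> 2\<^sup>2" using True by (intro power_mono) auto
      ultimately have "(1 - cos 1) / 4 \<le> (1 - cos v) / v\<^sup>2"
        using True c by (intro frac_le) auto
      then show ?thesis using True by (simp add: fejer_def)
    qed (simp add: fejer_nonneg)
  qed simp
  finally show ?thesis using c by simp
qed

lemma integrable_pair_bounded:
  fixes f :: "real \<Rightarrow> real" and h :: "real \<Rightarrow> real \<Rightarrow> real"
  assumes "real_distribution \<mu>" and f: "integrable lborel f"
    and h: "\<And>v y. \<bar>h v y\<bar> \<le> 1" and m: "(\<lambda>(v, y). h v y) \<in> borel_measurable (lborel \<Otimes>\<^sub>M \<mu>)"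
  shows "integrable (lborel \<Otimes>\<^sub>M \<mu>) (\<lambda>(v, y). f v * h v y)"
proof (rule Bochner_Integration.integrable_bound)
  interpret real_distribution \<mu> by fact
  interpret P: pair_sigma_finite lborel \<mu> ..
  note [measurable] = m
  have [measurable]: "f \<in> borel_measurable lborel" using f by auto
  show "integrable (lborel \<Otimes>\<^sub>M \<mu>) (\<lambda>(v, y). f v)"
    by (rule P.Fubini_integrable) (use f in auto)
  show "(\<lambda>(v, y). f v * h v y) \<in> borel_measurable (lborel \<Otimes>\<^sub>M \<mu>)" by measurable
  show "AE p in lborel \<Otimes>\<^sub>M \<mu>. norm (case p of (v, y) \<Rightarrow> f v * h v y) \<le> norm (case p of (v, y) \<Rightarrow> f v)"
    using h by (intro AE_I2) (auto simp: abs_mult intro!: mult_left_le)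
qed

lemma fejer_expectation:
  assumes "real_distribution \<mu>"
  shows "(\<integral>y. fejer (z + a * y) \<partial>\<mu>) =
    (\<integral>\<theta>. (1 - \<theta>) * indicator {0..1} \<theta> * Re (iexp (\<theta> * z) * char \<mu> (a * \<theta>)) \<partial>lborel)"
proof -
  interpret real_distribution \<mu> by fact
  interpret pair_sigma_finite lborel \<mu> ..
  let ?f = "\<lambda>\<theta> y. (1 - \<theta>) * cos (\<theta> * (z + a * y)) * indicator {0..1} \<theta>"
  have "integrable (lborel \<Otimes>\<^sub>M \<mu>) (\<lambda>(\<theta>, y). ((1 - \<theta>) * indicator {0..1} \<theta>) * cos (\<theta> * (z + a * y)))"
    by (rule integrable_pair_bounded[OF assms triangle_integrable]) auto
  then have i: "integrable (lborel \<Otimes>\<^sub>M \<mu>) (\<lambda>(\<theta>, y). ?f \<theta> y)"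
    by (simp add: mult_ac)
  have "(\<integral>y. fejer (z + a * y) \<partial>\<mu>) = (\<integral>y. (\<integral>\<theta>. ?f \<theta> y \<partial>lborel) \<partial>\<mu>)"
    unfolding fejer_eq_integral by (simp add: mult_ac)
  also have "\<dots> = (\<integral>\<theta>. (\<integral>y. ?f \<theta> y \<partial>\<mu>) \<partial>lborel)"
    using Fubini_integral[OF i] by simp
  also have "\<dots> = (\<integral>\<theta>. (1 - \<theta>) * indicator {0..1} \<theta> * Re (iexp (\<theta> * z) * char \<mu> (a * \<theta>)) \<partial>lborel)"
  proof (rule Bochner_Integration.integral_cong[OF refl])
    fix \<theta> :: real
    have ie: "integrable \<mu> (\<lambda>y. iexp (\<theta> * z) * iexp (a * \<theta> * y))"
      by (intro integrable_mult_right integrable_iexp) auto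
    have "(\<integral>y. cos (\<theta> * (z + a * y)) \<partial>\<mu>) = (\<integral>y. Re (iexp (\<theta> * z) * iexp (a * \<theta> * y)) \<partial>\<mu>)"
      by (rule Bochner_Integration.integral_cong[OF refl])
        (simp add: Re_exp algebra_simps flip: exp_add)
    also have "\<dots> = Re (\<integral>y. iexp (\<theta> * z) * iexp (a * \<theta> * y) \<partial>\<mu>)"
      by (rule integral_Re[OF ie])
    also have "(\<integral>y. iexp (\<theta> * z) * iexp (a * \<theta> * y) \<partial>\<mu>) = iexp (\<theta> * z) * char \<mu> (a * \<theta>)"
      by (simp add: char_def)
    finally show "(\<integral>y. ?f \<theta> y \<partial>\<mu>) = (1 - \<theta>) * indicator {0..1} \<theta> * Re (iexp (\<theta> * z) * char \<mu> (a * \<theta>))"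
      by (simp add: mult_ac)
  qed
  finally show ?thesis .
qed

lemma integrable_on_unit_bounded:
  fixes f :: "real \<Rightarrow> real"
  assumes "f \<in> borel_measurable borel" "\<And>\<theta>. \<bar>f \<theta>\<bar> \<le> c"
  shows "integrable lborel (\<lambda>\<theta>. indicator {0..1} \<theta> * f \<theta>)"
proof (rule Bochner_Integration.integrable_bound)
  show "integrable lborel (\<lambda>\<theta>::real. indicator {0..1} \<theta> * c)" by simp
  show "AE \<theta> in lborel. norm (indicator {0..1} \<theta> * f \<theta>) \<le> norm (indicator {0..1} \<theta> * c)"
    using assms(2) by (intro AE_I2) (auto split: split_indicator intro: order_trans[OF _ abs_ge_self])
qed (use assms in measurable)

lemma fejer_comparison:
  assumes "real_distribution \<mu>" "real_distribution \<mu>'"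
  shows "\<bar>(\<integral>y. fejer (z + a * y) \<partial>\<mu>) - (\<integral>y. fejer (z + a * y) \<partial>\<mu>')\<bar>
    \<le> (\<integral>\<theta>. indicator {0..1} \<theta> * cmod (char \<mu> (a * \<theta>) - char \<mu>' (a * \<theta>)) \<partial>lborel)"
proof -
  interpret m: real_distribution \<mu> by fact
  interpret m': real_distribution \<mu>' by fact
  note [measurable] = m.char_measurable m'.char_measurable
  let ?d = "\<lambda>\<theta>. char \<mu> (a * \<theta>) - char \<mu>' (a * \<theta>)"
  have n1: "cmod (iexp (\<theta> * z) * c) = cmod c" for \<theta> c by (simp add: norm_mult)
  \<comment> \<open>Clamping \<theta> to the unit interval bounds the triangular weight on the whole
    line, as \<open>integrable_on_unit_bounded\<close> asks; under the indicator it changes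
    nothing.\<close>
  have i: "integrable lborel (\<lambda>\<theta>. indicator {0..1} \<theta> * ((1 - max 0 (min 1 \<theta>)) * Re (iexp (\<theta> * z) * char \<mu> (a * \<theta>))))"
    if "real_distribution \<mu>" for \<mu>
  proof (rule integrable_on_unit_bounded[where c = 1])
    interpret M: real_distribution \<mu> by fact
    note [measurable] = M.char_measurable
    show "(\<lambda>\<theta>. (1 - max 0 (min 1 \<theta>)) * Re (iexp (\<theta> * z) * char \<mu> (a * \<theta>))) \<in> borel_measurable borel"
      by measurable
    fix \<theta> :: real
    have "\<bar>Re (iexp (\<theta> * z) * char \<mu> (a * \<theta>))\<bar> \<le> 1"
      using abs_Re_le_cmod[of "iexp (\<theta> * z) * char \<mu> (a * \<theta>)"] M.cmod_char_le_1[of "a * \<theta>"] unfolding n1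
      by linarith
    then show "\<bar>(1 - max 0 (min 1 \<theta>)) * Re (iexp (\<theta> * z) * char \<mu> (a * \<theta>))\<bar> \<le> 1"
      unfolding abs_mult by (intro mult_le_one) auto
  qed
  have e: "(\<integral>y. fejer (z + a * y) \<partial>\<mu>) =
    (\<integral>\<theta>. indicator {0..1} \<theta> * ((1 - max 0 (min 1 \<theta>)) * Re (iexp (\<theta> * z) * char \<mu> (a * \<theta>))) \<partial>lborel)"
    if "real_distribution \<mu>" for \<mu>
    unfolding fejer_expectation[OF that]
    by (rule Bochner_Integration.integral_cong[OF refl]) (auto split: split_indicator)
  have bd: "cmod (?d \<theta>) \<le> 2" for \<theta>
    using norm_triangle_ineq4[of "char \<mu> (a * \<theta>)" "char \<mu>' (a * \<theta>)"]
      m.cmod_char_le_1[of "a * \<theta>"] m'.cmod_char_le_1[of "a * \<theta>"] by linarith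
  have "\<bar>(\<integral>y. fejer (z + a * y) \<partial>\<mu>) - (\<integral>y. fejer (z + a * y) \<partial>\<mu>')\<bar>
    = \<bar>\<integral>\<theta>. indicator {0..1} \<theta> * ((1 - max 0 (min 1 \<theta>)) * Re (iexp (\<theta> * z) * ?d \<theta>)) \<partial>lborel\<bar>"
    unfolding e[OF assms(1)] e[OF assms(2)]
    by (subst Bochner_Integration.integral_diff[symmetric, OF i[OF assms(1)] i[OF assms(2)]])
      (simp add: algebra_simps)
  also have "\<dots> \<le> (\<integral>\<theta>. indicator {0..1} \<theta> * cmod (?d \<theta>) \<partial>lborel)"
  proof (rule order_trans[OF integral_abs_bound], rule integral_mono_AE')
    show "integrable lborel (\<lambda>\<theta>. indicator {0..1} \<theta> * cmod (?d \<theta>))"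
      by (rule integrable_on_unit_bounded[where c = 2]) (use bd in auto)
    show "AE \<theta> in lborel. \<bar>indicator {0..1} \<theta> * ((1 - max 0 (min 1 \<theta>)) * Re (iexp (\<theta> * z) * ?d \<theta>))\<bar>
        \<le> indicator {0..1} \<theta> * cmod (?d \<theta>)"
    proof (rule AE_I2)
      fix \<theta> :: real
      have "\<bar>1 - max 0 (min 1 \<theta>)\<bar> * \<bar>Re (iexp (\<theta> * z) * ?d \<theta>)\<bar> \<le> 1 * cmod (?d \<theta>)"
        using abs_Re_le_cmod[of "iexp (\<theta> * z) * ?d \<theta>"] unfolding n1 by (intro mult_mono) auto
      then show "\<bar>indicator {0..1} \<theta> * ((1 - max 0 (min 1 \<theta>)) * Re (iexp (\<theta> * z) * ?d \<theta>))\<bar>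
        \<le> indicator {0..1} \<theta> * cmod (?d \<theta>)"
        unfolding abs_mult by (auto split: split_indicator)
    qed
  qed simp
  finally show ?thesis .
qed

text \<open>Convolution with the Fejer kernel on the spatial scale 1 / a. The kernel is not
  normalised, whence the factors \<open>fejer_total\<close> later on.\<close>

definition smoothed :: "real \<Rightarrow> (real \<Rightarrow> real) \<Rightarrow> real \<Rightarrow> real" where
  "smoothed a f x = (\<integral>v. fejer v * f (x - v / a) \<partial>lborel)"

lemma gexp_integral: assumes "0 < l"
  shows "integrable lborel (gexp l)" "(\<integral>s. gexp l s \<partial>lborel) = 1 / l"
proof -
  have "has_bochner_integral lborel (\<lambda>s. exponential_density l s / l) (1 / l)"
  proof -
    interpret prob_space "density lborel (exponential_density l)"
      by (rule prob_space_exponential_density[OF assms])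
    have "(\<integral>\<^sup>+s. ennreal (exponential_density l s) \<partial>lborel) = 1"
      using emeasure_space_1 by (simp add: emeasure_density)
    then have "has_bochner_integral lborel (exponential_density l) 1"
      by (intro has_bochner_integral_nn_integral) (auto simp: exponential_density_nonneg[OF assms])
    then show ?thesis by (rule has_bochner_integral_divide_zero)
  qed
  moreover have "(\<lambda>s. exponential_density l s / l) = gexp l"
    using assms by (auto simp: exponential_density_def gexp_def fun_eq_iff mult.commute)
  ultimately have h: "has_bochner_integral lborel (gexp l) (1 / l)" by simp
  show "integrable lborel (gexp l)" using h by (simp add: has_bochner_integral_iff)
  show "(\<integral>s. gexp l s \<partial>lborel) = 1 / l" using h by (simp add: has_bochner_integral_iff)
qed

text \<open>The substitution s = x + y - v / a moves the dependence on the random point from the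
  discontinuous \<open>gexp\<close> to the kernel, where the Fourier representation is
  available.\<close>

lemma smoothed_expectation:
  assumes "real_distribution \<mu>" "0 < l" "0 < a"
  shows "smoothed a (\<lambda>x. \<integral>y. gexp l (x + y) \<partial>\<mu>) x =
    (\<integral>s. a * gexp l s * (\<integral>y. fejer (a * (x - s) + a * y) \<partial>\<mu>) \<partial>lborel)"
proof -
  interpret real_distribution \<mu> by fact
  interpret P: pair_sigma_finite lborel \<mu> ..
  have fin: "emeasure \<mu> UNIV = 1" using emeasure_space_1 by simp
  have i1: "integrable (lborel \<Otimes>\<^sub>M \<mu>) (\<lambda>(v, y). fejer v * gexp l (x - v / a + y))"
    by (rule integrable_pair_bounded[OF assms(1) fejer_integrable]) (use assms in \<open>auto simp: gexp_le_1\<close>)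
  have i2: "integrable (lborel \<Otimes>\<^sub>M \<mu>) (\<lambda>(s, y). (a * gexp l s) * fejer (a * (x - s) + a * y))"
    by (rule integrable_pair_bounded)
      (use assms gexp_integral[OF assms(2)] in \<open>auto simp: fejer_le_1 fejer_nonneg\<close>)
  have "smoothed a (\<lambda>x. \<integral>y. gexp l (x + y) \<partial>\<mu>) x = (\<integral>v. (\<integral>y. fejer v * gexp l (x - v / a + y) \<partial>\<mu>) \<partial>lborel)"
    by (simp add: smoothed_def)
  also have "\<dots> = (\<integral>y. (\<integral>v. fejer v * gexp l (x - v / a + y) \<partial>lborel) \<partial>\<mu>)"
    using P.Fubini_integral[OF i1] by simp
  also have "\<dots> = (\<integral>y. (\<integral>s. (a * gexp l s) * fejer (a * (x - s) + a * y) \<partial>lborel) \<partial>\<mu>)"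
  proof (rule Bochner_Integration.integral_cong[OF refl])
    fix y
    have "(\<integral>v. fejer v * gexp l (x - v / a + y) \<partial>lborel)
      = \<bar>- a\<bar> *\<^sub>R (\<integral>s. fejer (a * (x + y) + (- a) * s) * gexp l (x - (a * (x + y) + (- a) * s) / a + y) \<partial>lborel)"
      using assms by (intro lborel_integral_real_affine) simp
    also have "\<dots> = (\<integral>s. (a * gexp l s) * fejer (a * (x - s) + a * y) \<partial>lborel)"
      using assms by (simp add: field_simps flip: integral_mult_right_zero)
    finally show "(\<integral>v. fejer v * gexp l (x - v / a + y) \<partial>lborel)
      = (\<integral>s. (a * gexp l s) * fejer (a * (x - s) + a * y) \<partial>lborel)" .
  qed
  also have "\<dots> = (\<integral>s. (\<integral>y. (a * gexp l s) * fejer (a * (x - s) + a * y) \<partial>\<mu>) \<partial>lborel)"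
    using P.Fubini_integral[OF i2] by simp
  finally show ?thesis by simp
qed

lemma smoothed_comparison:
  assumes "real_distribution \<mu>" "real_distribution \<mu>'" "0 < l" "0 < a"
  shows "\<bar>smoothed a (\<lambda>x. \<integral>y. gexp l (x + y) \<partial>\<mu>) x - smoothed a (\<lambda>x. \<integral>y. gexp l (x + y) \<partial>\<mu>') x\<bar>
    \<le> a / l * (\<integral>\<theta>. indicator {0..1} \<theta> * cmod (char \<mu> (a * \<theta>) - char \<mu>' (a * \<theta>)) \<partial>lborel)"
    (is "_ \<le> a / l * ?d")
proof -
  have ig: "integrable lborel (gexp l)" "(\<integral>s. gexp l s \<partial>lborel) = 1 / l"
    using gexp_integral[OF assms(3)] by auto
  have i: "integrable lborel (\<lambda>s. a * gexp l s * (\<integral>y. fejer (a * (x - s) + a * y) \<partial>\<mu>))"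
    if "real_distribution \<mu>" for \<mu>
  proof (rule Bochner_Integration.integrable_bound)
    interpret M: real_distribution \<mu> by fact
    show "integrable lborel (\<lambda>s. a * gexp l s)" using ig by simp
    show "(\<lambda>s. a * gexp l s * (\<integral>y. fejer (a * (x - s) + a * y) \<partial>\<mu>)) \<in> borel_measurable lborel"
      by measurable
    have "\<bar>\<integral>y. fejer (a * (x - s) + a * y) \<partial>\<mu>\<bar> \<le> 1" for s
    proof -
      have "(\<integral>y. fejer (a * (x - s) + a * y) \<partial>\<mu>) \<le> (\<integral>y. 1 \<partial>\<mu>)"
        by (intro integral_mono_AE' AE_I2) (auto simp: fejer_le_1)
      moreover have "0 \<le> (\<integral>y. fejer (a * (x - s) + a * y) \<partial>\<mu>)"
        by (intro Bochner_Integration.integral_nonneg fejer_nonneg)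
      ultimately show ?thesis using M.prob_space by simp
    qed
    then show "AE s in lborel. norm (a * gexp l s * (\<integral>y. fejer (a * (x - s) + a * y) \<partial>\<mu>)) \<le> norm (a * gexp l s)"
      by (intro AE_I2) (auto simp: abs_mult intro!: mult_left_le)
  qed
  have "\<bar>smoothed a (\<lambda>x. \<integral>y. gexp l (x + y) \<partial>\<mu>) x - smoothed a (\<lambda>x. \<integral>y. gexp l (x + y) \<partial>\<mu>') x\<bar>
    = \<bar>\<integral>s. a * gexp l s * ((\<integral>y. fejer (a * (x - s) + a * y) \<partial>\<mu>) - (\<integral>y. fejer (a * (x - s) + a * y) \<partial>\<mu>')) \<partial>lborel\<bar>"
    unfolding smoothed_expectation[OF assms(1,3,4)] smoothed_expectation[OF assms(2,3,4)]
    by (subst Bochner_Integration.integral_diff[symmetric, OF i[OF assms(1)] i[OF assms(2)]])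
      (simp add: algebra_simps)
  also have "\<dots> \<le> (\<integral>s. a * ?d * gexp l s \<partial>lborel)"
  proof (rule order_trans[OF integral_abs_bound], rule integral_mono_AE')
    show "integrable lborel (\<lambda>s. a * ?d * gexp l s)" using ig by simp
    show "AE s in lborel. \<bar>a * gexp l s * ((\<integral>y. fejer (a * (x - s) + a * y) \<partial>\<mu>) - (\<integral>y. fejer (a * (x - s) + a * y) \<partial>\<mu>'))\<bar>
        \<le> a * ?d * gexp l s"
    proof (rule AE_I2)
      fix s
      have "a * gexp l s * \<bar>(\<integral>y. fejer (a * (x - s) + a * y) \<partial>\<mu>) - (\<integral>y. fejer (a * (x - s) + a * y) \<partial>\<mu>')\<bar>
        \<le> a * gexp l s * ?d"
        using assms by (intro mult_left_mono fejer_comparison) auto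
      then show "\<bar>a * gexp l s * ((\<integral>y. fejer (a * (x - s) + a * y) \<partial>\<mu>) - (\<integral>y. fejer (a * (x - s) + a * y) \<partial>\<mu>'))\<bar>
        \<le> a * ?d * gexp l s"
        using assms by (simp add: abs_mult mult_ac)
    qed
    show "AE s in lborel. 0 \<le> a * ?d * gexp l s"
      using assms by (intro AE_I2 mult_nonneg_nonneg Bochner_Integration.integral_nonneg) auto
  qed
  also have "\<dots> = a / l * ?d" using ig by simp
  finally show ?thesis .
qed

section \<open>Recovering a function from its smoothed version\<close>

definition fejer_mass :: "real \<Rightarrow> real" where
  "fejer_mass R = (\<integral>v. fejer v * indicator {- R..R} v \<partial>lborel)"

abbreviation (input) fejer_total :: real where
  "fejer_total \<equiv> (\<integral>v. fejer v \<partial>lborel)"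

lemma fejer_truncated_integrable: "integrable lborel (\<lambda>v. fejer v * indicator {- R..R} v)"
  using integrable_real_mult_indicator[OF _ fejer_integrable, of "{-R..R}"] by (simp add: mult.commute)

lemma fejer_mass_le: "fejer_mass R \<le> fejer_total"
  unfolding fejer_mass_def
  by (rule integral_mono[OF fejer_truncated_integrable fejer_integrable])
    (simp add: fejer_nonneg split: split_indicator)

lemma fejer_mass_tendsto: "(\<lambda>k. fejer_mass (real (Suc k))) \<longlonglongrightarrow> fejer_total"
  unfolding fejer_mass_def
proof (rule integral_dominated_convergence[where w = fejer])
  show "AE v in lborel. (\<lambda>k. fejer v * indicator {- real (Suc k)..real (Suc k)} v) \<longlonglongrightarrow> fejer v"
  proof (rule AE_I2, rule tendsto_eventually)
    fix v :: real
    show "\<forall>\<^sub>F k in sequentially. fejer v * indicator {- real (Suc k)..real (Suc k)} v = fejer v"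
      using eventually_ge_at_top[of "nat \<lceil>\<bar>v\<bar>\<rceil>"]
    proof eventually_elim
      case (elim k)
      then have "\<bar>v\<bar> \<le> real (Suc k)" by linarith
      then show ?case by (auto simp: indicator_def)
    qed
  qed
  show "AE v in lborel. norm (fejer v * indicator {- real (Suc k)..real (Suc k)} v) \<le> fejer v" for k
    by (rule AE_I2) (simp add: fejer_nonneg split: split_indicator)
qed (simp_all add: fejer_integrable)

lemma fejer_mult_integrable:
  assumes [measurable]: "f \<in> borel_measurable borel" and f: "\<And>v. \<bar>f v\<bar> \<le> (M::real)"
  shows "integrable lborel (\<lambda>v. fejer v * f v)"
proof (rule Bochner_Integration.integrable_bound)
  show "integrable lborel (\<lambda>v. fejer v * M)" using fejer_integrable by simp
  show "AE v in lborel. norm (fejer v * f v) \<le> norm (fejer v * M)"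
    using f by (intro AE_I2) (auto simp: abs_mult fejer_nonneg intro!: mult_left_mono order_trans[OF f])
qed simp

text \<open>Slow decrease of \<open>f\<close> (a one-sided regularity) is what allows its values to be recovered from
  the smoothed function.\<close>

lemma slowly_decreasing_sandwich:
  fixes f g :: "real \<Rightarrow> real"
  assumes [measurable]: "f \<in> borel_measurable borel" "g \<in> borel_measurable borel"
    and f0: "\<And>x. 0 \<le> f x" and f1: "\<And>x. f x \<le> M'" and g0: "\<And>x. 0 \<le> g x" and g1: "\<And>x. g x \<le> M"
    and slow: "\<And>x h. 0 \<le> h \<Longrightarrow> exp (- (l * h)) * f x \<le> f (x + h)"
    and lip: "\<And>x y. \<bar>g x - g y\<bar> \<le> L * \<bar>x - y\<bar>"
    and close: "\<And>x. \<bar>smoothed (R / h) f x - smoothed (R / h) g x\<bar> \<le> \<epsilon>"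
    and pos: "0 < l" "0 < h" "0 < R" "0 < fejer_mass R" "0 \<le> L"
  shows "f x \<le> exp (2 * l * h) / fejer_mass R * (fejer_total * g x + (2 * h * L * fejer_total + M * (fejer_total - fejer_mass R) + \<epsilon>))"
    and "exp (- (2 * l * h)) / fejer_mass R *
      (fejer_total * g x - (2 * h * L * fejer_total + M * (fejer_total - fejer_mass R) + \<epsilon>) - M' * (fejer_total - fejer_mass R)) \<le> f x"
proof -
  let ?a = "R / h" and ?i = "indicator {- R..R} :: real \<Rightarrow> real"
  have a: "0 < ?a" using pos by simp
  \<comment> \<open>At scale \<open>R / h\<close>, kernel arguments in [-R, R] correspond to
    displacements of at most h.\<close>
  have va: "\<bar>v / ?a\<bar> \<le> h" if "v \<in> {- R..R}" for v
  proof -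
    have "\<bar>v\<bar> * h \<le> R * h" using that pos by (intro mult_right_mono) auto
    then show ?thesis using pos by (simp add: abs_mult field_simps)
  qed
  have if1: "integrable lborel (\<lambda>v. fejer v * f (z - v / ?a))" for z
    by (rule fejer_mult_integrable[where M = M']) (use f0 f1 in auto)
  have ig1: "integrable lborel (\<lambda>v. fejer v * g (z - v / ?a))" for z
    by (rule fejer_mult_integrable[where M = M]) (use g0 g1 in auto)
  have it: "integrable lborel (\<lambda>v. fejer v * ?i v)" by (rule fejer_truncated_integrable)
  have ic: "integrable lborel (\<lambda>v. fejer v - fejer v * ?i v)"
      "(\<integral>v. fejer v - fejer v * ?i v \<partial>lborel) = fejer_total - fejer_mass R"
    using fejer_integrable it by (auto simp: fejer_mass_def)
  \<comment> \<open>The window of half-width h around x + h lies to the right of x and within 2 * h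
    of it, so slow decrease bounds f from below there by
    \<open>exp (- (2 * l * h)) * f x\<close>.\<close>
  have up: "fejer_mass R * (exp (- (2 * l * h)) * f x) \<le> smoothed ?a f (x + h)"
  proof -
    have "fejer_mass R * (exp (- (2 * l * h)) * f x) = (\<integral>v. fejer v * ?i v * (exp (- (2 * l * h)) * f x) \<partial>lborel)"
      using it by (simp add: fejer_mass_def)
    also have "\<dots> \<le> smoothed ?a f (x + h)"
      unfolding smoothed_def
    proof (rule integral_mono[OF _ if1])
      show "integrable lborel (\<lambda>v. fejer v * ?i v * (exp (- (2 * l * h)) * f x))" using it by simp
      fix v
      show "fejer v * ?i v * (exp (- (2 * l * h)) * f x) \<le> fejer v * f (x + h - v / ?a)"
      proof (cases "v \<in> {- R..R}")
        case True
        have vb: "0 \<le> h - v / ?a" "h - v / ?a \<le> 2 * h" using va[OF True] by linarith+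
        have "exp (- (2 * l * h)) * f x \<le> exp (- (l * (h - v / ?a))) * f x"
        proof (intro mult_right_mono f0)
          have "l * (h - v / ?a) \<le> l * (2 * h)" using vb pos by (intro mult_left_mono) auto
          then show "exp (- (2 * l * h)) \<le> exp (- (l * (h - v / ?a)))" by simp
        qed
        also have "\<dots> \<le> f (x + (h - v / ?a))" by (rule slow[OF vb(1)])
        finally have le: "exp (- (2 * l * h)) * f x \<le> f (x + h - v / ?a)"
          by (simp only: add_diff_eq)
        have fi: "fejer v * ?i v = fejer v" using True by simp
        show ?thesis unfolding fi by (rule mult_left_mono[OF le fejer_nonneg])
      qed (simp add: fejer_nonneg f0)
    qed
    finally show ?thesis .
  qed
  \<comment> \<open>Symmetrically, the window around x - h lies to the left of x and f x bounds f
    from above there. The tail outside the window is estimated by the global bound M'.\<close>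
  have low: "smoothed ?a f (x - h) \<le> fejer_mass R * (exp (2 * l * h) * f x) + M' * (fejer_total - fejer_mass R)"
  proof -
    have "smoothed ?a f (x - h) \<le> (\<integral>v. fejer v * ?i v * (exp (2 * l * h) * f x) + M' * (fejer v - fejer v * ?i v) \<partial>lborel)"
      unfolding smoothed_def
    proof (rule integral_mono[OF if1])
      show "integrable lborel (\<lambda>v. fejer v * ?i v * (exp (2 * l * h) * f x) + M' * (fejer v - fejer v * ?i v))"
        using it ic by (intro Bochner_Integration.integrable_add integrable_mult_left integrable_mult_right) auto
      fix v
      show "fejer v * f (x - h - v / ?a) \<le> fejer v * ?i v * (exp (2 * l * h) * f x) + M' * (fejer v - fejer v * ?i v)"
      proof (cases "v \<in> {- R..R}")
        case True
        have vb: "0 \<le> h + v / ?a" "h + v / ?a \<le> 2 * h" using va[OF True] by linarith+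
        have "exp (- (l * (h + v / ?a))) * f (x - h - v / ?a) \<le> f (x - h - v / ?a + (h + v / ?a))"
          by (rule slow[OF vb(1)])
        then have "exp (- (l * (h + v / ?a))) * f (x - h - v / ?a) \<le> f x" by simp
        then have "exp (l * (h + v / ?a)) * (exp (- (l * (h + v / ?a))) * f (x - h - v / ?a))
            \<le> exp (l * (h + v / ?a)) * f x" by (rule mult_left_mono) simp
        then have "f (x - h - v / ?a) \<le> exp (l * (h + v / ?a)) * f x"
          by (simp add: exp_minus_inverse flip: mult.assoc)
        also have "\<dots> \<le> exp (2 * l * h) * f x"
        proof (intro mult_right_mono f0)
          have "l * (h + v / ?a) \<le> l * (2 * h)" using vb pos by (intro mult_left_mono) auto
          then show "exp (l * (h + v / ?a)) \<le> exp (2 * l * h)" by simp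
        qed
        finally show ?thesis using True by (simp add: fejer_nonneg mult_left_mono)
      next
        case False
        have "fejer v * f (x - h - v / ?a) \<le> fejer v * M'" by (rule mult_left_mono[OF f1 fejer_nonneg])
        also have "\<dots> = fejer v * ?i v * (exp (2 * l * h) * f x) + M' * (fejer v - fejer v * ?i v)"
          using False by simp
        finally show ?thesis .
      qed
    qed
    also have "\<dots> = fejer_mass R * (exp (2 * l * h) * f x) + M' * (fejer_total - fejer_mass R)"
      using it ic by (subst Bochner_Integration.integral_add) (auto simp: fejer_mass_def)
    finally show ?thesis .
  qed
  have mid: "\<bar>smoothed ?a g (x + d) - fejer_total * g x\<bar> \<le> 2 * h * L * fejer_total + M * (fejer_total - fejer_mass R)"
    if d: "\<bar>d\<bar> \<le> h" for d
  proof -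
    have "\<bar>smoothed ?a g (x + d) - fejer_total * g x\<bar> = \<bar>\<integral>v. fejer v * g (x + d - v / ?a) - fejer v * g x \<partial>lborel\<bar>"
      unfolding smoothed_def using ig1 fejer_integrable by (subst Bochner_Integration.integral_diff) auto
    also have "\<dots> \<le> (\<integral>v. 2 * h * L * fejer v + M * (fejer v - fejer v * ?i v) \<partial>lborel)"
    proof (rule order_trans[OF integral_abs_bound], rule integral_mono)
      show "integrable lborel (\<lambda>v. \<bar>fejer v * g (x + d - v / ?a) - fejer v * g x\<bar>)"
        using ig1[of "x + d"] fejer_integrable by (intro integrable_abs Bochner_Integration.integrable_diff) auto
      show "integrable lborel (\<lambda>v. 2 * h * L * fejer v + M * (fejer v - fejer v * ?i v))"
        using ic fejer_integrable by (intro Bochner_Integration.integrable_add integrable_mult_right) auto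
      fix v
      have "\<bar>g (x + d - v / ?a) - g x\<bar> \<le> 2 * h * L + M * (1 - ?i v)"
      proof (cases "v \<in> {- R..R}")
        case True
        have "\<bar>g (x + d - v / ?a) - g x\<bar> \<le> L * \<bar>x + d - v / ?a - x\<bar>" by (rule lip)
        also have "\<dots> \<le> L * (2 * h)" using va[OF True] d pos by (intro mult_left_mono) linarith+
        finally show ?thesis using True by (simp add: mult_ac)
      next
        case False
        have "\<bar>g (x + d - v / ?a) - g x\<bar> \<le> M"
          using g0[of x] g1[of x] g0[of "x + d - v / ?a"] g1[of "x + d - v / ?a"] by linarith
        moreover have "0 \<le> 2 * h * L" using pos by simp
        moreover have "M * (1 - ?i v) = M" using False by simp
        ultimately show ?thesis by linarith
      qed
      then have "fejer v * \<bar>g (x + d - v / ?a) - g x\<bar> \<le> fejer v * (2 * h * L + M * (1 - ?i v))"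
        by (rule mult_left_mono) (rule fejer_nonneg)
      moreover have "fejer v * \<bar>g (x + d - v / ?a) - g x\<bar> = \<bar>fejer v * g (x + d - v / ?a) - fejer v * g x\<bar>"
        by (simp add: abs_mult fejer_nonneg flip: right_diff_distrib)
      moreover have "fejer v * (2 * h * L + M * (1 - ?i v)) = 2 * h * L * fejer v + M * (fejer v - fejer v * ?i v)"
        by (simp add: algebra_simps)
      ultimately show "\<bar>fejer v * g (x + d - v / ?a) - fejer v * g x\<bar> \<le> 2 * h * L * fejer v + M * (fejer v - fejer v * ?i v)"
        by linarith
    qed
    also have "\<dots> = 2 * h * L * fejer_total + M * (fejer_total - fejer_mass R)"
      using ic fejer_integrable by (subst Bochner_Integration.integral_add) auto
    finally show ?thesis .
  qed
  let ?E = "2 * h * L * fejer_total + M * (fejer_total - fejer_mass R) + \<epsilon>"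
  have "fejer_mass R * (exp (- (2 * l * h)) * f x) \<le> fejer_total * g x + ?E"
    using up mid[of h] close[of "x + h"] pos by simp
  then have "f x * (exp (- (2 * l * h)) * fejer_mass R) \<le> fejer_total * g x + ?E"
    by (simp add: mult_ac)
  then have "f x \<le> (fejer_total * g x + ?E) / (exp (- (2 * l * h)) * fejer_mass R)"
    using pos by (simp add: pos_le_divide_eq)
  then show "f x \<le> exp (2 * l * h) / fejer_mass R * (fejer_total * g x + ?E)"
    by (simp add: exp_minus field_simps)
  have "fejer_total * g x - ?E - M' * (fejer_total - fejer_mass R) \<le> fejer_mass R * (exp (2 * l * h) * f x)"
    using low mid[of "- h"] close[of "x - h"] pos by simp
  then have "(fejer_total * g x - ?E - M' * (fejer_total - fejer_mass R)) \<le> f x * (exp (2 * l * h) * fejer_mass R)"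
    by (simp add: mult_ac)
  then have "(fejer_total * g x - ?E - M' * (fejer_total - fejer_mass R)) / (exp (2 * l * h) * fejer_mass R) \<le> f x"
    using pos by (simp add: pos_divide_le_eq)
  then show "exp (- (2 * l * h)) / fejer_mass R * (fejer_total * g x - ?E - M' * (fejer_total - fejer_mass R)) \<le> f x"
    by (simp add: exp_minus field_simps)
qed

section \<open>The Gaussian counterpart of \<open>G\<close>\<close>

definition gauss :: "real \<Rightarrow> real \<Rightarrow> real \<Rightarrow> real" where
  "gauss l b x = (\<integral>y. gexp l (x + y) \<partial>distr std_normal_distribution borel (\<lambda>y. b * y))"

lemma std_normal_density_le_1: "std_normal_density u \<le> 1"
proof -
  have "1 \<le> sqrt (2 * pi)" using pi_gt3 by (intro real_le_rsqrt) simp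
  then have "1 / sqrt (2 * pi) * exp (- u\<^sup>2 / 2) \<le> 1 * 1" by (intro mult_mono) auto
  then show ?thesis by (simp add: std_normal_density_def)
qed

lemma abs_mult_exp_le_1: "\<bar>u\<bar> * exp (- u\<^sup>2 / 2) \<le> 1" for u :: real
proof -
  have "\<bar>u\<bar> \<le> 1 + u\<^sup>2 / 2" using sum_squares_bound[of "\<bar>u\<bar>" 1] by simp
  also have "\<dots> \<le> exp (u\<^sup>2 / 2)" by (rule exp_ge_add_one_self)
  finally have "\<bar>u\<bar> * exp (- u\<^sup>2 / 2) \<le> exp (u\<^sup>2 / 2) * exp (- u\<^sup>2 / 2)" by (rule mult_right_mono) simp
  also have "\<dots> = 1" by (simp flip: exp_add)
  finally show ?thesis .
qed

lemma std_normal_density_lipschitz: "\<bar>std_normal_density u - std_normal_density v\<bar> \<le> \<bar>u - v\<bar>"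
proof -
  have d: "(std_normal_density has_field_derivative (- (u * std_normal_density u))) (at u within UNIV)" for u
    unfolding std_normal_density_def[abs_def]
    by (auto intro!: derivative_eq_intros simp: field_simps)
  have b: "norm (- (u * std_normal_density u)) \<le> 1" for u
  proof -
    have "\<bar>u\<bar> * std_normal_density u = (\<bar>u\<bar> * exp (- u\<^sup>2 / 2)) * (1 / sqrt (2 * pi))"
      by (simp add: std_normal_density_def)
    also have "\<dots> \<le> 1 * 1" using abs_mult_exp_le_1 pi_gt3 by (intro mult_mono) (auto intro!: real_le_rsqrt)
    finally show ?thesis by (simp add: abs_mult)
  qed
  show ?thesis
    using field_differentiable_bound[OF convex_UNIV d b, of u v] by simp
qed

lemma gauss_eq:
  assumes b: "0 < b"
  shows "gauss l b x = (\<integral>s. gexp l s * (std_normal_density ((s - x) / b) / b) \<partial>lborel)"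
proof -
  have "gauss l b x = (\<integral>y. gexp l (x + b * y) \<partial>std_normal_distribution)"
    unfolding gauss_def by (rule integral_distr) auto
  also have "\<dots> = (\<integral>y. std_normal_density y * gexp l (x + b * y) \<partial>lborel)"
    by (subst integral_density) auto
  also have "\<dots> = \<bar>1 / b\<bar> *\<^sub>R (\<integral>s. std_normal_density (- x / b + 1 / b * s) * gexp l (x + b * (- x / b + 1 / b * s)) \<partial>lborel)"
    using b by (intro lborel_integral_real_affine) simp
  also have "\<dots> = (\<integral>s. gexp l s * (std_normal_density ((s - x) / b) / b) \<partial>lborel)"
  proof -
    have "- x / b + 1 / b * s = (s - x) / b" for s by (simp add: diff_divide_distrib)
    moreover have "x + b * ((s - x) / b) = s" for s using b by simp
    ultimately have "\<bar>1 / b\<bar> *\<^sub>R (\<integral>s. std_normal_density (- x / b + 1 / b * s) * gexp l (x + b * (- x / b + 1 / b * s)) \<partial>lborel)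
        = (\<integral>s. 1 / b * (std_normal_density ((s - x) / b) * gexp l s) \<partial>lborel)"
      using b by (simp only: integral_mult_right_zero) simp
    also have "\<dots> = (\<integral>s. gexp l s * (std_normal_density ((s - x) / b) / b) \<partial>lborel)"
      by (rule Bochner_Integration.integral_cong) auto
    finally show ?thesis .
  qed
  finally show ?thesis .
qed

lemma gexp_mult_integrable:
  assumes "0 < l" and [measurable]: "f \<in> borel_measurable borel" and f: "\<And>v. \<bar>f v\<bar> \<le> (M::real)"
  shows "integrable lborel (\<lambda>v. gexp l v * f v)"
proof (rule Bochner_Integration.integrable_bound)
  show "integrable lborel (\<lambda>v. gexp l v * M)" using gexp_integral[OF assms(1)] by simp
  show "AE v in lborel. norm (gexp l v * f v) \<le> norm (gexp l v * M)"
    using f by (intro AE_I2) (auto simp: abs_mult intro!: mult_left_mono order_trans[OF f])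
qed simp

text \<open>The weight \<open>gexp l\<close> has mass 1 / l and a width of order 1 / l, while the
  Gaussian density varies on the scale b. Hence the Lipschitz constant of order b^(-2), and an error
  of the same order when the weight is replaced by a point mass 1 / l at 0.\<close>

lemma gauss_bounds:
  assumes b: "0 < b" and l: "0 < l"
  shows "0 \<le> gauss l b x" "gauss l b x \<le> 1 / (l * b)"
    "\<bar>gauss l b x - gauss l b y\<bar> \<le> 1 / (l * b\<^sup>2) * \<bar>x - y\<bar>"
    "\<bar>gauss l b x - std_normal_density (x / b) / (b * l)\<bar> \<le> 4 / (l\<^sup>2 * b\<^sup>2)"
proof -
  have bd: "\<bar>std_normal_density u / b\<bar> \<le> 1 / b" for u
    using std_normal_density_le_1[of u] b by (simp add: divide_right_mono)
  have i: "integrable lborel (\<lambda>s. gexp l s * (std_normal_density ((s - x) / b) / b))" for x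
    by (rule gexp_mult_integrable[OF l _ bd]) measurable
  show "0 \<le> gauss l b x" unfolding gauss_eq[OF b]
    using b by (intro Bochner_Integration.integral_nonneg) simp
  have "gauss l b x \<le> (\<integral>s. gexp l s * (1 / b) \<partial>lborel)" unfolding gauss_eq[OF b]
    using i gexp_integral[OF l] bd by (intro integral_mono mult_left_mono) (auto intro: order_trans[OF abs_ge_self])
  also have "\<dots> = 1 / (l * b)" using gexp_integral[OF l] by simp
  finally show "gauss l b x \<le> 1 / (l * b)" .
  have lip: "\<bar>std_normal_density (u / b) / b - std_normal_density (v / b) / b\<bar> \<le> \<bar>u - v\<bar> / b\<^sup>2" for u v
  proof -
    have "\<bar>std_normal_density (u / b) / b - std_normal_density (v / b) / b\<bar>
        = \<bar>std_normal_density (u / b) - std_normal_density (v / b)\<bar> / b"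
      using b by (simp flip: diff_divide_distrib)
    also have "\<dots> \<le> \<bar>u / b - v / b\<bar> / b"
      using b by (intro divide_right_mono std_normal_density_lipschitz) auto
    also have "\<dots> = \<bar>u - v\<bar> / b\<^sup>2" using b by (simp add: power2_eq_square flip: diff_divide_distrib)
    finally show ?thesis .
  qed
  have "\<bar>gauss l b x - gauss l b y\<bar> = \<bar>\<integral>s. gexp l s * (std_normal_density ((s - x) / b) / b - std_normal_density ((s - y) / b) / b) \<partial>lborel\<bar>"
    unfolding gauss_eq[OF b] by (subst Bochner_Integration.integral_diff[symmetric, OF i i]) (simp add: right_diff_distrib)
  also have "\<dots> \<le> (\<integral>s. gexp l s * (\<bar>x - y\<bar> / b\<^sup>2) \<partial>lborel)"
  proof (rule order_trans[OF integral_abs_bound], rule integral_mono_AE')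
    show "AE s in lborel. \<bar>gexp l s * (std_normal_density ((s - x) / b) / b - std_normal_density ((s - y) / b) / b)\<bar>
        \<le> gexp l s * (\<bar>x - y\<bar> / b\<^sup>2)"
    proof (rule AE_I2)
      fix s
      have "\<bar>std_normal_density ((s - x) / b) / b - std_normal_density ((s - y) / b) / b\<bar> \<le> \<bar>x - y\<bar> / b\<^sup>2"
        using lip[of "s - x" "s - y"] by (simp add: abs_minus_commute)
      then have "gexp l s * \<bar>std_normal_density ((s - x) / b) / b - std_normal_density ((s - y) / b) / b\<bar>
        \<le> gexp l s * (\<bar>x - y\<bar> / b\<^sup>2)" by (rule mult_left_mono) simp
      then show "\<bar>gexp l s * (std_normal_density ((s - x) / b) / b - std_normal_density ((s - y) / b) / b)\<bar>
        \<le> gexp l s * (\<bar>x - y\<bar> / b\<^sup>2)"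
        unfolding abs_mult by simp
    qed
  qed (use gexp_integral[OF l] in auto)
  also have "\<dots> = 1 / (l * b\<^sup>2) * \<bar>x - y\<bar>" using gexp_integral[OF l] by simp
  finally show "\<bar>gauss l b x - gauss l b y\<bar> \<le> 1 / (l * b\<^sup>2) * \<bar>x - y\<bar>" .
  have l2: "0 < l / 2" using l by simp
  \<comment> \<open>The linear factor is absorbed at the price of half the exponential rate.\<close>
  have se: "\<bar>s\<bar> * gexp l s \<le> 2 / l * gexp (l / 2) s" for s
  proof (cases "0 \<le> s")
    case True
    have "l * s / 2 \<le> exp (l * s / 2)" using exp_ge_add_one_self[of "l * s / 2"] by linarith
    then have "s \<le> 2 / l * exp (l * s / 2)" using l by (simp add: field_simps)
    then have "s * exp (- (l * s)) \<le> 2 / l * exp (l * s / 2) * exp (- (l * s))"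
      by (rule mult_right_mono) simp
    also have "\<dots> = 2 / l * exp (- (l / 2 * s))" by (simp flip: exp_add)
    finally show ?thesis using True by (simp add: gexp_def)
  qed (simp add: gexp_def)
  have c: "std_normal_density (x / b) / (b * l) = (\<integral>s. gexp l s * (std_normal_density (x / b) / b) \<partial>lborel)"
    using gexp_integral[OF l] by simp
  have "\<bar>gauss l b x - std_normal_density (x / b) / (b * l)\<bar>
    = \<bar>\<integral>s. gexp l s * (std_normal_density ((s - x) / b) / b - std_normal_density (x / b) / b) \<partial>lborel\<bar>"
    unfolding gauss_eq[OF b] c using gexp_integral[OF l]
    by (subst Bochner_Integration.integral_diff[symmetric, OF i]) (auto simp: right_diff_distrib)
  also have "\<dots> \<le> (\<integral>s. 2 / l * gexp (l / 2) s / b\<^sup>2 \<partial>lborel)"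
  proof (rule order_trans[OF integral_abs_bound], rule integral_mono_AE')
    show "AE s in lborel. \<bar>gexp l s * (std_normal_density ((s - x) / b) / b - std_normal_density (x / b) / b)\<bar>
        \<le> 2 / l * gexp (l / 2) s / b\<^sup>2"
    proof (rule AE_I2)
      fix s
      have sym: "std_normal_density (x / b) = std_normal_density (- x / b)"
        by (simp add: std_normal_density_def)
      have "\<bar>std_normal_density ((s - x) / b) / b - std_normal_density (x / b) / b\<bar> \<le> \<bar>s\<bar> / b\<^sup>2"
        unfolding sym using lip[of "s - x" "- x"] by simp
      then have "gexp l s * \<bar>std_normal_density ((s - x) / b) / b - std_normal_density (x / b) / b\<bar>
        \<le> gexp l s * (\<bar>s\<bar> / b\<^sup>2)" by (rule mult_left_mono) simp
      also have "\<dots> \<le> 2 / l * gexp (l / 2) s / b\<^sup>2"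
      proof -
        have "\<bar>s\<bar> * gexp l s / b\<^sup>2 \<le> 2 / l * gexp (l / 2) s / b\<^sup>2"
          by (rule divide_right_mono[OF se]) simp
        then show ?thesis by (simp add: mult.commute)
      qed
      finally show "\<bar>gexp l s * (std_normal_density ((s - x) / b) / b - std_normal_density (x / b) / b)\<bar>
        \<le> 2 / l * gexp (l / 2) s / b\<^sup>2"
        unfolding abs_mult by simp
    qed
  qed (use gexp_integral[OF l2] l in auto)
  also have "\<dots> = 4 / (l\<^sup>2 * b\<^sup>2)" using gexp_integral[OF l2] l by (simp add: power2_eq_square)
  finally show "\<bar>gauss l b x - std_normal_density (x / b) / (b * l)\<bar> \<le> 4 / (l\<^sup>2 * b\<^sup>2)" .
qed

lemma gaussian_integrable:
  assumes "0 < \<kappa>" shows "integrable lborel (\<lambda>u::real. exp (- (\<kappa> * u\<^sup>2)))"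
proof -
  let ?s = "1 / sqrt (2 * \<kappa>)"
  have "integrable lborel (\<lambda>u. sqrt (2 * pi * ?s\<^sup>2) * normal_density 0 ?s u)"
    using assms by (intro integrable_mult_right integrable_normal_density) simp
  also have "(\<lambda>u. sqrt (2 * pi * ?s\<^sup>2) * normal_density 0 ?s u) = (\<lambda>u. exp (- (\<kappa> * u\<^sup>2)))"
    using assms by (auto simp: fun_eq_iff normal_density_def power_divide real_sqrt_eq_0_iff)
  finally show ?thesis .
qed

section \<open>The local limit theorem\<close>

context iid_walk begin

section \<open>Characteristic functions of the increments and of the walk\<close>

lemma real_distribution_nu: "real_distribution \<nu>"
  by (simp add: real_distribution_def real_distribution_axioms_def prob_space_nu sets_nu)

lemma real_distribution_psum: "real_distribution (distr W borel (\<lambda>w. psum w n))"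
  by (rule P.real_distribution_distr) simp

lemma coord_distr: "distr W borel (\<lambda>w. w i) = \<nu>"
proof -
  have "distr W borel (\<lambda>w. w i) = distr W \<nu> (\<lambda>w. w i)"
    by (rule distr_cong) (simp_all add: sets_nu)
  then show ?thesis using PiM_component[of i] by simp
qed

lemma coord_measurable: "(\<lambda>w. w i) \<in> borel_measurable W"
  unfolding measurable_W_eq by simp

lemma coord_indep: "P.indep_vars (\<lambda>_. borel) (\<lambda>i w. w i) UNIV"
proof -
  have "distr W seq_borel (\<lambda>w. \<lambda>i\<in>UNIV. w i) = distr W W (\<lambda>w. w)"
    by (rule distr_cong) (simp_all add: sets_W restrict_def)
  also have "\<dots> = Pi\<^sub>M UNIV (\<lambda>i. distr W borel (\<lambda>w. w i))"
    by (simp add: coord_distr distr_id2)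
  finally show ?thesis
    by (subst P.indep_vars_iff_distr_eq_PiM) (auto intro: coord_measurable)
qed

lemma char_psum: "char (distr W borel (\<lambda>w. psum w n)) t = char \<nu> t ^ n"
proof -
  have "P.indep_vars (\<lambda>_. borel) (\<lambda>i w. w i) {..<n}"
    using coord_indep by (rule P.indep_vars_subset) simp
  then show ?thesis
    unfolding psum_def by (subst P.char_distr_sum) (simp_all add: coord_distr)
qed

lemma clt: "weak_conv_m (\<lambda>n. distr W borel (\<lambda>w. psum w n / sqrt (n * \<sigma>\<^sup>2))) std_normal_distribution"
  unfolding psum_def
proof (rule P.central_limit_theorem_zero_mean[where \<mu> = \<nu>])
  show "P.indep_vars (\<lambda>i. borel) (\<lambda>i w. w i) UNIV" by (rule coord_indep)
  show "P.variance (\<lambda>w. w n) = \<sigma>\<^sup>2" for n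
    by (simp add: coord_mean coord_square)
qed (auto simp: coord_mean sigma_pos coord_square_integrable coord_distr)

lemma char_power_tendsto: "(\<lambda>n. char \<nu> (s / sqrt (real n)) ^ n) \<longlonglongrightarrow> complex_of_real (exp (- ((\<sigma> * s)\<^sup>2) / 2))"
proof -
  have "(\<lambda>n. char (distr W borel (\<lambda>w. psum w n / sqrt (n * \<sigma>\<^sup>2))) (\<sigma> * s)) \<longlonglongrightarrow> char std_normal_distribution (\<sigma> * s)"
    by (rule levy_continuity1[OF _ real_dist_normal_dist clt]) simp
  moreover have "char (distr W borel (\<lambda>w. psum w n / sqrt (n * \<sigma>\<^sup>2))) (\<sigma> * s) = char \<nu> (s / sqrt (real n)) ^ n" for n
  proof -
    have e: "\<sigma> * s * (y / sqrt (n * \<sigma>\<^sup>2)) = s / sqrt (real n) * y" for y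
      using sigma_pos by (simp add: real_sqrt_mult)
    have ch: "char (distr W borel f) t = (CLINT w|W. iexp (t * f w))"
      if "f \<in> borel_measurable W" for f :: "(nat \<Rightarrow> real) \<Rightarrow> real" and t
      unfolding char_def by (rule integral_distr[OF that]) simp
    have l: "char (distr W borel (\<lambda>w. psum w n / sqrt (n * \<sigma>\<^sup>2))) (\<sigma> * s)
        = (CLINT w|W. iexp (\<sigma> * s * (psum w n / sqrt (n * \<sigma>\<^sup>2))))"
      by (rule ch) measurable
    have r: "char (distr W borel (\<lambda>w. psum w n)) (s / sqrt n) = (CLINT w|W. iexp (s / sqrt n * psum w n))"
      by (rule ch) measurable
    show ?thesis unfolding char_psum[symmetric] l r e ..
  qed
  ultimately show ?thesis by (simp add: char_std_normal_distribution)
qed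

text \<open>The second-order expansion has an error o(t^2) by dominated convergence. Settling for
  \<sigma>^2 / 4 in place of \<sigma>^2 / 2 leaves room for it.\<close>

lemma char_near_zero: "\<exists>d>0. \<forall>t. \<bar>t\<bar> \<le> d \<longrightarrow> cmod (char \<nu> t) \<le> exp (- (\<sigma>\<^sup>2 / 4 * t\<^sup>2))"
proof -
  interpret R: real_distribution \<nu> by (rule real_distribution_nu)
  let ?e = "\<lambda>t. \<integral>x. min (6 * x\<^sup>2) (\<bar>t\<bar> * \<bar>x\<bar> ^ 3) \<partial>\<nu>"
  have ap: "cmod (char \<nu> t - (1 - t\<^sup>2 * \<sigma>\<^sup>2 / 2)) \<le> t\<^sup>2 / 6 * ?e t" for t
    by (rule R.char_approx3) (simp_all add: integrable_id mean_zero square_integrable second_moment)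
  have "(?e \<longlongrightarrow> (\<integral>x. 0 \<partial>\<nu>)) (at 0)"
    unfolding tendsto_at_iff_sequentially
  proof (intro allI impI)
    fix X :: "nat \<Rightarrow> real" assume X: "X \<longlonglongrightarrow> 0"
    have "(\<lambda>i. ?e (X i)) \<longlonglongrightarrow> (\<integral>x. 0 \<partial>\<nu>)"
    proof (rule integral_dominated_convergence[where w = "\<lambda>x. 6 * x\<^sup>2"])
      show "integrable \<nu> (\<lambda>x. 6 * x\<^sup>2)" using square_integrable by simp
      show "AE x in \<nu>. (\<lambda>i. min (6 * x\<^sup>2) (\<bar>X i\<bar> * \<bar>x\<bar> ^ 3)) \<longlonglongrightarrow> 0"
      proof (rule AE_I2)
        fix x :: real
        have "(\<lambda>i. min (6 * x\<^sup>2) (\<bar>X i\<bar> * \<bar>x\<bar> ^ 3)) \<longlonglongrightarrow> min (6 * x\<^sup>2) (\<bar>0\<bar> * \<bar>x\<bar> ^ 3)"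
          by (intro tendsto_intros X)
        then show "(\<lambda>i. min (6 * x\<^sup>2) (\<bar>X i\<bar> * \<bar>x\<bar> ^ 3)) \<longlonglongrightarrow> 0" by simp
      qed
      show "AE x in \<nu>. norm (min (6 * x\<^sup>2) (\<bar>X i\<bar> * \<bar>x\<bar> ^ 3)) \<le> 6 * x\<^sup>2" for i
        by (intro AE_I2) auto
    qed simp_all
    then show "(?e \<circ> X) \<longlonglongrightarrow> (\<integral>x. 0 \<partial>\<nu>)" by (simp add: comp_def)
  qed
  then have "(?e \<longlongrightarrow> 0) (at 0)" by simp
  then have "\<forall>\<^sub>F t in at 0. ?e t < \<sigma>\<^sup>2"
    by (rule order_tendstoD) (use sigma_pos in simp)
  then obtain d where d: "d > 0" "\<And>t. t \<noteq> 0 \<Longrightarrow> \<bar>t\<bar> < d \<Longrightarrow> ?e t < \<sigma>\<^sup>2"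
    unfolding eventually_at by (auto simp: dist_real_def)
  \<comment> \<open>The bound 1 / \<sigma> keeps \<open>1 - t\<^sup>2 * \<sigma>\<^sup>2 / 2\<close>
    nonnegative, so that it equals its modulus.\<close>
  define d' where "d' = min (d / 2) (1 / \<sigma>)"
  have d': "d' > 0" "d' < d" using d(1) sigma_pos by (auto simp: d'_def)
  show ?thesis
  proof (intro exI[of _ d'] conjI allI impI d')
    fix t assume t: "\<bar>t\<bar> \<le> d'"
    show "cmod (char \<nu> t) \<le> exp (- (\<sigma>\<^sup>2 / 4 * t\<^sup>2))"
    proof (cases "t = 0")
      case False
      have "\<bar>t\<bar> * \<sigma> \<le> 1 / \<sigma> * \<sigma>" using t sigma_pos by (intro mult_right_mono) (auto simp: d'_def)
      then have "(\<bar>t\<bar> * \<sigma>)\<^sup>2 \<le> 1\<^sup>2" using sigma_pos by (intro power_mono) auto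
      then have s: "0 \<le> 1 - t\<^sup>2 * \<sigma>\<^sup>2 / 2" by (simp add: power_mult_distrib)
      have "cmod (char \<nu> t) \<le> cmod (char \<nu> t - (1 - t\<^sup>2 * \<sigma>\<^sup>2 / 2)) + cmod (1 - t\<^sup>2 * \<sigma>\<^sup>2 / 2)"
        using norm_triangle_ineq[of "char \<nu> t - (1 - t\<^sup>2 * \<sigma>\<^sup>2 / 2)" "1 - t\<^sup>2 * \<sigma>\<^sup>2 / 2"] by simp
      also have "cmod (1 - t\<^sup>2 * \<sigma>\<^sup>2 / 2) = 1 - t\<^sup>2 * \<sigma>\<^sup>2 / 2"
      proof -
        have "(1 - t\<^sup>2 * \<sigma>\<^sup>2 / 2 :: complex) = complex_of_real (1 - t\<^sup>2 * \<sigma>\<^sup>2 / 2)" by simp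
        then show ?thesis using s by (metis norm_of_real abs_of_nonneg)
      qed
      also have "cmod (char \<nu> t - (1 - t\<^sup>2 * \<sigma>\<^sup>2 / 2)) \<le> t\<^sup>2 / 6 * \<sigma>\<^sup>2"
        using d(2)[OF False] t d' by (intro order_trans[OF ap] mult_left_mono) auto
      finally have "cmod (char \<nu> t) \<le> 1 + (- (\<sigma>\<^sup>2 / 4 * t\<^sup>2)) - t\<^sup>2 * \<sigma>\<^sup>2 * (1 / 12)" by simp
      moreover have "0 \<le> t\<^sup>2 * \<sigma>\<^sup>2 * (1 / 12)" by simp
      ultimately have "cmod (char \<nu> t) \<le> 1 + (- (\<sigma>\<^sup>2 / 4 * t\<^sup>2))" by linarith
      also have "\<dots> \<le> exp (- (\<sigma>\<^sup>2 / 4 * t\<^sup>2))" by (rule exp_ge_add_one_self)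
      finally show ?thesis .
    qed (simp add: R.char_zero)
  qed
qed

end

text \<open>The non-lattice condition in the form that the Fourier argument consumes;
  \<open>lattice_if_char_eq_1\<close> derives it from \<open>non_lattice\<close>.\<close>

locale nonlattice_walk = iid_walk +
  assumes char_less_1: "t \<noteq> 0 \<Longrightarrow> cmod (char \<nu> t) < 1"
begin

text \<open>Near 0 the quadratic expansion gives the bound; on the compact remainder of [-a, a] the
  modulus is continuous and below 1, hence bounded by some \<rho> < 1.\<close>

lemma char_gaussian_bound:
  assumes "0 < a"
  shows "\<exists>\<kappa>>0. \<forall>t. \<bar>t\<bar> \<le> a \<longrightarrow> cmod (char \<nu> t) \<le> exp (- (\<kappa> * t\<^sup>2))"
proof -
  interpret R: real_distribution \<nu> by (rule real_distribution_nu)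
  obtain d where d: "d > 0" "\<And>t. \<bar>t\<bar> \<le> d \<Longrightarrow> cmod (char \<nu> t) \<le> exp (- (\<sigma>\<^sup>2 / 4 * t\<^sup>2))"
    using char_near_zero by blast
  let ?K = "{t. d \<le> \<bar>t\<bar> \<and> \<bar>t\<bar> \<le> a}"
  have K: "compact ?K"
  proof -
    have "?K = {-a..-d} \<union> {d..a}" using d(1) assms by auto
    then show ?thesis by (simp add: compact_Un)
  qed
  have "\<exists>\<rho>. 0 < \<rho> \<and> \<rho> < 1 \<and> (\<forall>t\<in>?K. cmod (char \<nu> t) \<le> \<rho>)"
  proof (cases "?K = {}")
    case False
    have "continuous_on ?K (\<lambda>t. cmod (char \<nu> t))"
      by (intro continuous_at_imp_continuous_on ballI continuous_intros R.isCont_char)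
    then obtain t0 where t0: "t0 \<in> ?K" "\<And>t. t \<in> ?K \<Longrightarrow> cmod (char \<nu> t) \<le> cmod (char \<nu> t0)"
      using continuous_attains_sup[OF K False] by blast
    have "cmod (char \<nu> t0) < 1" using t0(1) d(1) by (intro char_less_1) auto
    then show ?thesis using t0(2)
      by (intro exI[of _ "max (1 / 2) (cmod (char \<nu> t0))"]) (auto simp: le_max_iff_disj)
  next
    case True
    then have "\<forall>t\<in>?K. cmod (char \<nu> t) \<le> 1 / 2" by blast
    then show ?thesis by (intro exI[of _ "1 / 2"]) simp
  qed
  then obtain \<rho> where r: "0 < \<rho>" "\<rho> < 1" "\<And>t. t \<in> ?K \<Longrightarrow> cmod (char \<nu> t) \<le> \<rho>" by blast
  \<comment> \<open>The first term serves the neighbourhood of 0; the second keeps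
    \<open>exp (- (\<kappa> * t\<^sup>2))\<close> above \<rho> up to
    \<open>\<bar>t\<bar> = a\<close>.\<close>
  define \<kappa> where "\<kappa> = min (\<sigma>\<^sup>2 / 4) (- ln \<rho> / a\<^sup>2)"
  have k: "\<kappa> > 0" using r assms sigma_pos by (auto simp: \<kappa>_def ln_less_zero divide_neg_pos)
  have k1: "\<kappa> \<le> \<sigma>\<^sup>2 / 4" unfolding \<kappa>_def by (rule min.cobounded1)
  have k2: "\<kappa> \<le> - ln \<rho> / a\<^sup>2" unfolding \<kappa>_def by (rule min.cobounded2)
  show ?thesis
  proof (intro exI[of _ \<kappa>] conjI allI impI k)
    fix t assume t: "\<bar>t\<bar> \<le> a"
    show "cmod (char \<nu> t) \<le> exp (- (\<kappa> * t\<^sup>2))"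
    proof (cases "\<bar>t\<bar> \<le> d")
      case True
      have "\<kappa> * t\<^sup>2 \<le> \<sigma>\<^sup>2 / 4 * t\<^sup>2" by (intro mult_right_mono k1) simp
      then show ?thesis using d(2)[OF True] by (smt (verit) exp_le_cancel_iff)
    next
      case False
      have "\<kappa> * t\<^sup>2 \<le> - ln \<rho> / a\<^sup>2 * a\<^sup>2"
      proof (intro mult_mono)
        show "t\<^sup>2 \<le> a\<^sup>2" using t power_mono[of "\<bar>t\<bar>" a 2] by simp
        show "0 \<le> - ln \<rho> / a\<^sup>2" using r by (simp add: divide_nonpos_nonneg)
      qed (use k2 in auto)
      then have "ln \<rho> \<le> - (\<kappa> * t\<^sup>2)" using assms by simp
      then have "exp (ln \<rho>) \<le> exp (- (\<kappa> * t\<^sup>2))" by simp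
      then have "\<rho> \<le> exp (- (\<kappa> * t\<^sup>2))" using r(1) by simp
      then show ?thesis using r(3)[of t] False t by force
    qed
  qed
qed

text \<open>The substitution u = sqrt n * \<theta> absorbs the prefactor. The integrand then tends
  to 0 by the central limit theorem, and the Gaussian bound, valid on the full range of frequencies,
  provides the majorant.\<close>

lemma char_distance_tendsto:
  assumes a: "0 < a"
  shows "(\<lambda>n. sqrt n * (\<integral>\<theta>. indicator {0..1} \<theta> *
      cmod (char \<nu> (a * \<theta>) ^ n - exp (- (\<sigma> * sqrt n * (a * \<theta>))\<^sup>2 / 2)) \<partial>lborel)) \<longlonglongrightarrow> 0"
proof -
  interpret R: real_distribution \<nu> by (rule real_distribution_nu)
  note [measurable] = R.char_measurable
  obtain \<kappa> where k: "\<kappa> > 0" "\<And>t. \<bar>t\<bar> \<le> a \<Longrightarrow> cmod (char \<nu> t) \<le> exp (- (\<kappa> * t\<^sup>2))"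
    using char_gaussian_bound[OF a] by blast
  let ?f = "\<lambda>n u. indicator {0..sqrt n} u *
      cmod (char \<nu> (a * u / sqrt n) ^ n - exp (- (\<sigma> * (a * u))\<^sup>2 / 2))"
  let ?w = "\<lambda>u. exp (- (\<kappa> * a\<^sup>2 * u\<^sup>2)) + exp (- (\<sigma>\<^sup>2 * a\<^sup>2 / 2 * u\<^sup>2))"
  have e: "sqrt n * (\<integral>\<theta>. indicator {0..1} \<theta> *
      cmod (char \<nu> (a * \<theta>) ^ n - exp (- (\<sigma> * sqrt n * (a * \<theta>))\<^sup>2 / 2)) \<partial>lborel) = (\<integral>u. ?f n u \<partial>lborel)"
    if n: "1 \<le> n" for n :: nat
  proof -
    have "(\<integral>u. ?f n u \<partial>lborel) = \<bar>sqrt n\<bar> *\<^sub>R (\<integral>\<theta>. ?f n (0 + sqrt n * \<theta>) \<partial>lborel)"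
      using n by (intro lborel_integral_real_affine) simp
    also have "(\<lambda>\<theta>. ?f n (0 + sqrt n * \<theta>)) = (\<lambda>\<theta>. indicator {0..1} \<theta> *
      cmod (char \<nu> (a * \<theta>) ^ n - exp (- (\<sigma> * sqrt n * (a * \<theta>))\<^sup>2 / 2)))"
    proof (rule ext)
      fix \<theta>
      have "sqrt n * \<theta> \<le> sqrt n \<longleftrightarrow> \<theta> \<le> 1" "0 \<le> sqrt n * \<theta> \<longleftrightarrow> 0 \<le> \<theta>"
        using n by (simp_all add: zero_le_mult_iff)
      then have "indicator {0..sqrt n} (0 + sqrt n * \<theta>) = (indicator {0..1} \<theta> :: real)"
        by (simp add: indicator_def)
      moreover have "a * (0 + sqrt n * \<theta>) / sqrt n = a * \<theta>" using n by simp
      moreover have "\<sigma> * (a * (0 + sqrt n * \<theta>)) = \<sigma> * sqrt n * (a * \<theta>)" by simp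
      ultimately show "?f n (0 + sqrt n * \<theta>) = indicator {0..1} \<theta> *
        cmod (char \<nu> (a * \<theta>) ^ n - exp (- (\<sigma> * sqrt n * (a * \<theta>))\<^sup>2 / 2))" by (simp only:)
    qed
    finally show ?thesis by simp
  qed
  have "(\<lambda>n. \<integral>u. ?f n u \<partial>lborel) \<longlonglongrightarrow> (\<integral>u. 0 \<partial>(lborel::real measure))"
  proof (rule integral_dominated_convergence[where w = ?w])
    show "integrable lborel ?w"
      using k a sigma_pos by (intro Bochner_Integration.integrable_add gaussian_integrable) auto
    show "AE u in lborel. (\<lambda>n. ?f n u) \<longlonglongrightarrow> 0"
    proof (rule AE_I2)
      fix u :: real
      have "(\<lambda>n. cmod (char \<nu> (a * u / sqrt n) ^ n - exp (- (\<sigma> * (a * u))\<^sup>2 / 2))) \<longlonglongrightarrow> 0"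
        using char_power_tendsto[of "a * u"] by (simp add: LIM_zero tendsto_norm_zero)
      then show "(\<lambda>n. ?f n u) \<longlonglongrightarrow> 0"
        by (rule Lim_null_comparison[rotated]) (auto intro!: always_eventually simp: indicator_def)
    qed
    show "AE u in lborel. norm (?f n u) \<le> ?w u" for n
    proof (rule AE_I2)
      fix u :: real
      show "norm (?f n u) \<le> ?w u"
      proof (cases "u \<in> {0..sqrt n}")
        case u: True
        have "cmod (char \<nu> (a * u / sqrt n) ^ n) \<le> exp (- (\<kappa> * a\<^sup>2 * u\<^sup>2))"
        proof (cases "n = 0")
          case True
          then show ?thesis using u by simp
        next
          case False
          then have n: "0 < sqrt n" by simp
          have "u / sqrt n \<le> 1" using u n by simp
          then have "\<bar>a * u / sqrt n\<bar> \<le> a" using u a n mult_left_mono[of "u / sqrt n" 1 a] by (simp add: abs_mult)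
          then have "cmod (char \<nu> (a * u / sqrt n)) ^ n \<le> exp (- (\<kappa> * (a * u / sqrt n)\<^sup>2)) ^ n"
            by (intro power_mono k) auto
          also have "\<dots> = exp (- (\<kappa> * a\<^sup>2 * u\<^sup>2))"
            using n by (simp add: power_divide power_mult_distrib flip: exp_of_nat_mult)
          finally show ?thesis by (simp add: norm_power)
        qed
        moreover have "cmod (complex_of_real (exp (- (\<sigma> * (a * u))\<^sup>2 / 2))) = exp (- (\<sigma>\<^sup>2 * a\<^sup>2 / 2 * u\<^sup>2))"
          unfolding norm_of_real by (simp add: power_mult_distrib)
        ultimately show ?thesis
          using u norm_triangle_ineq4[of "char \<nu> (a * u / sqrt n) ^ n" "complex_of_real (exp (- (\<sigma> * (a * u))\<^sup>2 / 2))"]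
          by simp
      qed simp
    qed
  qed measurable
  then have "(\<lambda>n. \<integral>u. ?f n u \<partial>lborel) \<longlonglongrightarrow> 0" by simp
  then show ?thesis
  proof (rule Lim_transform_eventually)
    show "\<forall>\<^sub>F n in sequentially. (\<integral>u. ?f n u \<partial>lborel) = sqrt n * (\<integral>\<theta>. indicator {0..1} \<theta> *
      cmod (char \<nu> (a * \<theta>) ^ n - exp (- (\<sigma> * sqrt n * (a * \<theta>))\<^sup>2 / 2)) \<partial>lborel)"
      using eventually_ge_at_top[of 1] by eventually_elim (rule e[symmetric])
  qed
qed

end

section \<open>From smoothed to pointwise asymptotics of \<open>G\<close>\<close>

lemma smoothed_scale: "smoothed a (\<lambda>x. c * f x) x = c * smoothed a f x"
  unfolding smoothed_def by (simp add: mult.left_commute)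

lemma char_scaled_normal:
  "char (distr std_normal_distribution borel (\<lambda>y. b * y)) t = exp (- (b * t)\<^sup>2 / 2)"
proof -
  have "char (distr std_normal_distribution borel (\<lambda>y. b * y)) t = (CLINT y|std_normal_distribution. iexp (t * (b * y)))"
    unfolding char_def by (rule integral_distr) auto
  also have "\<dots> = char std_normal_distribution (b * t)"
    unfolding char_def by (simp add: mult_ac)
  finally show ?thesis by (simp add: char_std_normal_distribution)
qed

context nonlattice_walk begin

lemma G_eq_distr: "G l n x = (\<integral>y. gexp l (x + y) \<partial>distr W borel (\<lambda>w. psum w n))"
  unfolding G_def by (rule integral_distr[symmetric]) auto

lemma smoothed_G_gauss:
  assumes "0 < l" "0 < a"
  shows "\<exists>\<epsilon>. \<epsilon> \<longlonglongrightarrow> 0 \<and> (\<forall>n x.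
    \<bar>smoothed a (\<lambda>x. sqrt n * G l n x) x - smoothed a (\<lambda>x. sqrt n * gauss l (\<sigma> * sqrt n) x) x\<bar> \<le> \<epsilon> n)"
proof (intro exI conjI allI)
  let ?d = "\<lambda>n. (\<integral>\<theta>. indicator {0..1} \<theta> *
      cmod (char \<nu> (a * \<theta>) ^ n - exp (- (\<sigma> * sqrt n * (a * \<theta>))\<^sup>2 / 2)) \<partial>lborel)"
  show "(\<lambda>n. a / l * (sqrt n * ?d n)) \<longlonglongrightarrow> 0"
    by (intro tendsto_mult_right_zero char_distance_tendsto assms)
  fix n :: nat and x :: real
  have "\<bar>smoothed a (G l n) x - smoothed a (gauss l (\<sigma> * sqrt n)) x\<bar> \<le> a / l * ?d n"
    using smoothed_comparison[OF real_distribution_psum _ assms, of "distr std_normal_distribution borel (\<lambda>y. \<sigma> * sqrt n * y)" n x]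
    unfolding char_psum char_scaled_normal G_eq_distr[symmetric] gauss_def[symmetric]
    using real_distribution.axioms(1)[OF real_dist_normal_dist]
    by (simp add: prob_space.real_distribution_distr)
  then have "sqrt n * \<bar>smoothed a (G l n) x - smoothed a (gauss l (\<sigma> * sqrt n)) x\<bar> \<le> sqrt n * (a / l * ?d n)"
    by (rule mult_left_mono) simp
  then show "\<bar>smoothed a (\<lambda>x. sqrt n * G l n x) x - smoothed a (\<lambda>x. sqrt n * gauss l (\<sigma> * sqrt n) x) x\<bar>
      \<le> a / l * (sqrt n * ?d n)"
    unfolding smoothed_scale right_diff_distrib[symmetric] abs_mult by (simp add: mult_ac)
qed

lemma G_slowly_decreasing: "0 \<le> l \<Longrightarrow> 0 \<le> h \<Longrightarrow> exp (- (l * h)) * G l n x \<le> G l n (x + h)"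
proof -
  assume l: "0 \<le> l" and h: "0 \<le> h"
  have "exp (- (l * h)) * G l n x = (\<integral>w. exp (- (l * h)) * gexp l (x + psum w n) \<partial>W)"
    by (simp add: G_def)
  also have "\<dots> \<le> G l n (x + h)"
    unfolding G_def
  proof (intro integral_mono G_integrable l integrable_mult_right)
    fix w show "exp (- (l * h)) * gexp l (x + psum w n) \<le> gexp l (x + h + psum w n)"
      using gexp_shift_ge[OF l h, of "x + psum w n"] by (simp add: algebra_simps)
  qed
  finally show ?thesis .
qed

lemma G_le_1: "0 \<le> l \<Longrightarrow> G l n x \<le> 1"
proof -
  assume l: "0 \<le> l"
  have "G l n x \<le> (\<integral>w. 1 \<partial>W)" unfolding G_def
    using l by (intro integral_mono G_integrable) (auto simp: gexp_le_1)
  then show ?thesis using P.prob_space by simp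
qed

text \<open>The halves are separate because the lower estimate takes a uniform bound M' on
  \<open>sqrt n * G l n x\<close> as input, and such a bound comes out of the upper estimate in
  \<open>G_eventually_bounded\<close>.\<close>

lemma G_sandwich:
  assumes l: "0 < l" and h: "0 < h" and R: "0 < R" "0 < fejer_mass R"
  defines "M \<equiv> 1 / (l * \<sigma>)"
  shows "\<forall>\<^sub>F n in sequentially. \<forall>x.
      sqrt n * G l n x \<le> exp (2 * l * h) / fejer_mass R *
        (fejer_total * (sqrt n * gauss l (\<sigma> * sqrt n) x) + (M * (fejer_total - fejer_mass R) + h))"
    and "\<forall>\<^sub>F n in sequentially. \<forall>M'. (\<forall>x. sqrt n * G l n x \<le> M') \<longrightarrow> (\<forall>x.
      exp (- (2 * l * h)) / fejer_mass R *
        (fejer_total * (sqrt n * gauss l (\<sigma> * sqrt n) x) - (M * (fejer_total - fejer_mass R) + h)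
          - M' * (fejer_total - fejer_mass R)) \<le> sqrt n * G l n x)"
proof -
  have a: "0 < R / h" using h R by simp
  obtain \<epsilon> where eps: "\<epsilon> \<longlonglongrightarrow> 0" and close: "\<And>n x.
      \<bar>smoothed (R / h) (\<lambda>x. sqrt n * G l n x) x - smoothed (R / h) (\<lambda>x. sqrt n * gauss l (\<sigma> * sqrt n) x) x\<bar> \<le> \<epsilon> n"
    using smoothed_G_gauss[OF l a] by blast
  have "(\<lambda>n. 2 * h * (1 / (l * \<sigma>\<^sup>2) * inverse (sqrt (real n))) * fejer_total + \<epsilon> n) \<longlonglongrightarrow> 2 * h * (1 / (l * \<sigma>\<^sup>2) * 0) * fejer_total + 0"
    by (intro tendsto_intros eps tendsto_inverse_0_at_top filterlim_compose[OF sqrt_at_top filterlim_real_sequentially])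
  then have small: "\<forall>\<^sub>F n in sequentially. 2 * h * (1 / (l * \<sigma>\<^sup>2) * inverse (sqrt (real n))) * fejer_total + \<epsilon> n < h"
    by (rule order_tendstoD) (use h in simp)
  have main: "sqrt n * G l n x \<le> exp (2 * l * h) / fejer_mass R *
        (fejer_total * (sqrt n * gauss l (\<sigma> * sqrt n) x) + (M * (fejer_total - fejer_mass R) + h)) \<and>
      ((\<forall>x. sqrt n * G l n x \<le> M') \<longrightarrow> exp (- (2 * l * h)) / fejer_mass R *
        (fejer_total * (sqrt n * gauss l (\<sigma> * sqrt n) x) - (M * (fejer_total - fejer_mass R) + h)
          - M' * (fejer_total - fejer_mass R)) \<le> sqrt n * G l n x)"
    if n: "1 \<le> n" and sm: "2 * h * (1 / (l * \<sigma>\<^sup>2) * inverse (sqrt (real n))) * fejer_total + \<epsilon> n < h" for n x M'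
  proof -
    let ?b = "\<sigma> * sqrt n" and ?L = "1 / (l * \<sigma>\<^sup>2) * inverse (sqrt (real n))"
    have sn: "0 < sqrt n" using n by simp
    have b: "0 < ?b" using n sigma_pos by simp
    note gb = gauss_bounds[OF b l]
    have [measurable]: "gauss l ?b \<in> borel_measurable borel"
    proof -
      have "(\<lambda>x. \<integral>s. gexp l s * (std_normal_density ((s - x) / ?b) / ?b) \<partial>lborel) \<in> borel_measurable borel"
        by measurable
      then show ?thesis using gauss_eq[OF b] by (simp add: fun_eq_iff cong: measurable_cong)
    qed
    have g1: "sqrt n * gauss l ?b x \<le> M" for x
    proof -
      have "sqrt n * gauss l ?b x \<le> sqrt n * (1 / (l * ?b))" by (intro mult_left_mono gb(2)) simp
      also have "\<dots> = M" using sn by (simp add: M_def)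
      finally show ?thesis .
    qed
    have lip: "\<bar>sqrt n * gauss l ?b x - sqrt n * gauss l ?b y\<bar> \<le> ?L * \<bar>x - y\<bar>" for x y
    proof -
      have "\<bar>sqrt n * gauss l ?b x - sqrt n * gauss l ?b y\<bar> = sqrt n * \<bar>gauss l ?b x - gauss l ?b y\<bar>"
        by (simp add: abs_mult flip: right_diff_distrib)
      also have "\<dots> \<le> sqrt n * (1 / (l * ?b\<^sup>2) * \<bar>x - y\<bar>)" by (intro mult_left_mono gb(3)) simp
      also have "sqrt n * (1 / (l * ?b\<^sup>2)) = ?L"
        using sn by (simp add: power_mult_distrib divide_simps)
      then have "sqrt n * (1 / (l * ?b\<^sup>2) * \<bar>x - y\<bar>) = ?L * \<bar>x - y\<bar>" by (simp only: mult.assoc[symmetric])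
      finally show ?thesis .
    qed
    have f1: "sqrt n * G l n x \<le> M' \<Longrightarrow> True" for x M' by simp
    have f0: "0 \<le> sqrt n * G l n x" for x by (simp add: G_nonneg)
    have g0: "0 \<le> sqrt n * gauss l ?b x" for x using gb(1) by simp
    have slow: "exp (- (l * d)) * (sqrt n * G l n x) \<le> sqrt n * G l n (x + d)" if "0 \<le> d" for x d
      using mult_left_mono[OF G_slowly_decreasing[of l d n x], of "sqrt n"] l that by (simp add: mult_ac)
    have fs: "sqrt n * G l n x \<le> sqrt n" for x
      using mult_left_mono[OF G_le_1, of l "sqrt n" n x] l by simp
    have L0: "0 \<le> ?L" using l by simp
    have c0: "0 \<le> fejer_total - fejer_mass R" using fejer_mass_le by simp
    note S = slowly_decreasing_sandwich[where f = "\<lambda>x. sqrt n * G l n x" and g = "\<lambda>x. sqrt n * gauss l ?b x"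
        and L = ?L and M = M and R = R and h = h and l = l and \<epsilon> = "\<epsilon> n", OF _ _ f0 _ g0 g1 slow lip close l h R L0]
    have "sqrt n * G l n x \<le> exp (2 * l * h) / fejer_mass R *
        (fejer_total * (sqrt n * gauss l ?b x) + (2 * h * ?L * fejer_total + M * (fejer_total - fejer_mass R) + \<epsilon> n))"
      by (rule S(1)[where M' = "sqrt n"]) (use fs in auto)
    also have "\<dots> \<le> exp (2 * l * h) / fejer_mass R *
        (fejer_total * (sqrt n * gauss l ?b x) + (M * (fejer_total - fejer_mass R) + h))"
      using sm R by (intro mult_left_mono) auto
    finally have 1: "sqrt n * G l n x \<le> exp (2 * l * h) / fejer_mass R *
        (fejer_total * (sqrt n * gauss l ?b x) + (M * (fejer_total - fejer_mass R) + h))" .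
    have 2: "exp (- (2 * l * h)) / fejer_mass R *
        (fejer_total * (sqrt n * gauss l ?b x) - (M * (fejer_total - fejer_mass R) + h)
          - M' * (fejer_total - fejer_mass R)) \<le> sqrt n * G l n x" if M': "\<forall>x. sqrt n * G l n x \<le> M'"
    proof -
      have "exp (- (2 * l * h)) / fejer_mass R *
        (fejer_total * (sqrt n * gauss l ?b x) - (M * (fejer_total - fejer_mass R) + h)
          - M' * (fejer_total - fejer_mass R)) \<le> exp (- (2 * l * h)) / fejer_mass R *
        (fejer_total * (sqrt n * gauss l ?b x) - (2 * h * ?L * fejer_total + M * (fejer_total - fejer_mass R) + \<epsilon> n)
          - M' * (fejer_total - fejer_mass R))"
        using sm R by (intro mult_left_mono) auto
      also have "\<dots> \<le> sqrt n * G l n x"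
        by (rule S(2)) (use M' in auto)
      finally show ?thesis .
    qed
    show ?thesis using 1 2 by blast
  qed
  show "\<forall>\<^sub>F n in sequentially. \<forall>x.
      sqrt n * G l n x \<le> exp (2 * l * h) / fejer_mass R *
        (fejer_total * (sqrt n * gauss l (\<sigma> * sqrt n) x) + (M * (fejer_total - fejer_mass R) + h))"
    using small eventually_ge_at_top[of 1] by eventually_elim (use main in blast)
  show "\<forall>\<^sub>F n in sequentially. \<forall>M'. (\<forall>x. sqrt n * G l n x \<le> M') \<longrightarrow> (\<forall>x.
      exp (- (2 * l * h)) / fejer_mass R *
        (fejer_total * (sqrt n * gauss l (\<sigma> * sqrt n) x) - (M * (fejer_total - fejer_mass R) + h)
          - M' * (fejer_total - fejer_mass R)) \<le> sqrt n * G l n x)"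
    using small eventually_ge_at_top[of 1] by eventually_elim (use main in blast)
qed

lemma gauss_scaled_le:
  assumes "0 < l" "1 \<le> (n::nat)"
  shows "sqrt n * gauss l (\<sigma> * sqrt n) x \<le> 1 / (l * \<sigma>)"
proof -
  have "sqrt n * gauss l (\<sigma> * sqrt n) x \<le> sqrt n * (1 / (l * (\<sigma> * sqrt n)))"
    using assms sigma_pos by (intro mult_left_mono gauss_bounds(2)) auto
  also have "\<dots> = 1 / (l * \<sigma>)" using assms by simp
  finally show ?thesis .
qed

lemma G_eventually_bounded:
  assumes l: "0 < l"
  shows "\<exists>M'>0. \<forall>\<^sub>F n in sequentially. \<forall>x. sqrt n * G l n x \<le> M'"
proof -
  have "\<forall>\<^sub>F k in sequentially. 0 < fejer_mass (real (Suc k))"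
    by (rule order_tendstoD(1)[OF fejer_mass_tendsto]) (rule fejer_integral_pos)
  then obtain k where k: "0 < fejer_mass (real (Suc k))" unfolding eventually_sequentially by blast
  let ?R = "real (Suc k)" and ?M = "1 / (l * \<sigma>)"
  have Rp: "0 < ?R" by simp
  let ?B = "exp (2 * l * 1) / fejer_mass ?R * (fejer_total * ?M + (?M * (fejer_total - fejer_mass ?R) + 1))"
  have "\<forall>\<^sub>F n in sequentially. \<forall>x. sqrt n * G l n x \<le> ?B"
    using G_sandwich(1)[OF l zero_less_one Rp k] eventually_ge_at_top[of 1]
  proof eventually_elim
    case (elim n)
    show ?case
    proof
      fix x
      have "sqrt n * G l n x \<le> exp (2 * l * 1) / fejer_mass ?R *
        (fejer_total * (sqrt n * gauss l (\<sigma> * sqrt n) x) + (?M * (fejer_total - fejer_mass ?R) + 1))"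
        using elim by auto
      also have "\<dots> \<le> ?B"
        using gauss_scaled_le[OF l elim(2), of x] k fejer_integral_pos
        by (intro mult_left_mono add_right_mono) auto
      finally show "sqrt n * G l n x \<le> ?B" .
    qed
  qed
  then show ?thesis
    by (intro exI[of _ "max 1 ?B"]) (auto elim!: eventually_mono simp: le_max_iff_disj)
qed

lemma G_gauss_close:
  assumes l: "0 < l" and e: "0 < e"
  shows "\<forall>\<^sub>F n in sequentially. \<forall>x. \<bar>sqrt n * G l n x - sqrt n * gauss l (\<sigma> * sqrt n) x\<bar> \<le> e"
proof -
  obtain M' where M': "M' > 0" "\<forall>\<^sub>F n in sequentially. \<forall>x. sqrt n * G l n x \<le> M'"
    using G_eventually_bounded[OF l] by blast
  \<comment> \<open>One index k governs both parameters: window width h = 1 / (k + 1) and kernel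
    cut-off R = k + 1. \<open>?U\<close> and \<open>?L\<close> bound the two one-sided errors and
    vanish as k grows, so k is fixed first and n is sent to infinity afterwards.\<close>
  let ?c = fejer_total and ?m = "\<lambda>k. fejer_mass (real (Suc k))" and ?h = "\<lambda>k. inverse (real (Suc k))"
  let ?M = "1 / (l * \<sigma>)"
  let ?E = "\<lambda>k. exp (2 * l * ?h k) / ?m k" and ?F = "\<lambda>k. exp (- (2 * l * ?h k)) / ?m k"
  let ?U = "\<lambda>k. (?E k * ?c - 1) * ?M + ?E k * (?M * (?c - ?m k) + ?h k)"
  let ?L = "\<lambda>k. \<bar>?F k * ?c - 1\<bar> * ?M + ?F k * (?M * (?c - ?m k) + ?h k + M' * (?c - ?m k))"
  have c: "?c > 0" by (rule fejer_integral_pos)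
  have h: "?h \<longlonglongrightarrow> 0" by (rule LIMSEQ_inverse_real_of_nat)
  have m: "?m \<longlonglongrightarrow> ?c" by (rule fejer_mass_tendsto)
  have "?U \<longlonglongrightarrow> (exp (2 * l * 0) / ?c * ?c - 1) * ?M + exp (2 * l * 0) / ?c * (?M * (?c - ?c) + 0)"
    by (intro tendsto_intros h m) (use c in auto)
  then have "?U \<longlonglongrightarrow> 0" using c by simp
  then have U: "\<forall>\<^sub>F k in sequentially. ?U k < e" by (rule order_tendstoD) (rule e)
  have "?L \<longlonglongrightarrow> \<bar>exp (- (2 * l * 0)) / ?c * ?c - 1\<bar> * ?M + exp (- (2 * l * 0)) / ?c * (?M * (?c - ?c) + 0 + M' * (?c - ?c))"
    by (intro tendsto_intros h m) (use c in auto)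
  then have "?L \<longlonglongrightarrow> 0" using c by simp
  then have L: "\<forall>\<^sub>F k in sequentially. ?L k < e" by (rule order_tendstoD) (rule e)
  have mp: "\<forall>\<^sub>F k in sequentially. 0 < ?m k" by (rule order_tendstoD(1)[OF m c])
  obtain k where k: "?U k < e" "?L k < e" "0 < ?m k"
    using eventually_conj[OF U eventually_conj[OF L mp]] unfolding eventually_sequentially by blast
  have hp: "0 < ?h k" and Rp: "0 < real (Suc k)" by simp_all
  show ?thesis
    using M'(2) G_sandwich(1)[OF l hp Rp k(3)] G_sandwich(2)[OF l hp Rp k(3)] eventually_ge_at_top[of 1]
  proof eventually_elim
    case (elim n)
    show ?case
    proof
      fix x
      let ?f = "sqrt n * G l n x" and ?g = "sqrt n * gauss l (\<sigma> * sqrt n) x"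
      have g: "0 \<le> ?g" "?g \<le> ?M"
        using gauss_bounds(1)[of "\<sigma> * sqrt n" l x] sigma_pos elim l gauss_scaled_le[OF l, of n x] by auto
      have cm: "?m k \<le> ?c" by (rule fejer_mass_le)
      have "1 * 1 \<le> exp (2 * l * ?h k) * (?c / ?m k)"
        using l k(3) cm by (intro mult_mono) (auto simp: pos_le_divide_eq)
      then have E1: "0 \<le> ?E k * ?c - 1" by simp
      have "?f - ?g \<le> (?E k * ?c - 1) * ?g + ?E k * (?M * (?c - ?m k) + ?h k)"
        using elim(2)[rule_format, of x] by (simp only: algebra_simps)
      also have "\<dots> \<le> ?U k" using g E1 by (intro add_right_mono mult_left_mono) auto
      finally have 1: "?f - ?g \<le> e" using k(1) by linarith
      have "?F k * (?c * ?g - (?M * (?c - ?m k) + ?h k) - M' * (?c - ?m k)) \<le> ?f"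
        using elim(1,3) by blast
      then have "?g - ?f \<le> - ((?F k * ?c - 1) * ?g) + ?F k * (?M * (?c - ?m k) + ?h k + M' * (?c - ?m k))"
        by (simp only: algebra_simps)
      also have "- ((?F k * ?c - 1) * ?g) \<le> \<bar>?F k * ?c - 1\<bar> * ?g"
        unfolding mult_minus_left[symmetric] using g by (intro mult_right_mono) auto
      also have "\<bar>?F k * ?c - 1\<bar> * ?g \<le> \<bar>?F k * ?c - 1\<bar> * ?M" using g by (intro mult_left_mono) auto
      finally have "?g - ?f \<le> ?L k" by simp
      then show "\<bar>?f - ?g\<bar> \<le> e" using 1 k(2) by linarith
    qed
  qed
qed

theorem local_limit:
  assumes l: "0 < l" and e: "0 < e"
  shows "\<forall>\<^sub>F n in sequentially. \<forall>x. \<bar>sqrt n * G l n x - std_normal_density (x / (\<sigma> * sqrt n)) / (\<sigma> * l)\<bar> \<le> e"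
proof -
  have "(\<lambda>n. 4 / (l\<^sup>2 * \<sigma>\<^sup>2) * inverse (sqrt (real n))) \<longlonglongrightarrow> 4 / (l\<^sup>2 * \<sigma>\<^sup>2) * 0"
    by (intro tendsto_intros tendsto_inverse_0_at_top filterlim_compose[OF sqrt_at_top filterlim_real_sequentially])
  then have "(\<lambda>n. 4 / (l\<^sup>2 * \<sigma>\<^sup>2) * inverse (sqrt (real n))) \<longlonglongrightarrow> 0" by simp
  then have "\<forall>\<^sub>F n in sequentially. 4 / (l\<^sup>2 * \<sigma>\<^sup>2) * inverse (sqrt (real n)) < e / 2"
    by (rule order_tendstoD) (use e in simp)
  moreover have "0 < e / 2" using e by simp
  note G_gauss_close[OF l this]
  ultimately show ?thesis
    using eventually_ge_at_top[of 1]
  proof eventually_elim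
    case (elim n)
    show ?case
    proof
      fix x
      have sn: "0 < sqrt n" using elim by simp
      have b: "0 < \<sigma> * sqrt n" using sn sigma_pos by simp
      have "\<bar>sqrt n * gauss l (\<sigma> * sqrt n) x - std_normal_density (x / (\<sigma> * sqrt n)) / (\<sigma> * l)\<bar>
        = sqrt n * \<bar>gauss l (\<sigma> * sqrt n) x - std_normal_density (x / (\<sigma> * sqrt n)) / (\<sigma> * sqrt n * l)\<bar>"
      proof -
        have "std_normal_density (x / (\<sigma> * sqrt n)) / (\<sigma> * l) = sqrt n * (std_normal_density (x / (\<sigma> * sqrt n)) / (\<sigma> * sqrt n * l))"
          using sn by simp
        then show ?thesis using sn by (simp only: right_diff_distrib[symmetric] abs_mult)
      qed
      also have "\<dots> \<le> sqrt n * (4 / (l\<^sup>2 * (\<sigma> * sqrt n)\<^sup>2))"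
        using sn by (intro mult_left_mono gauss_bounds(4)[OF b l]) simp
      also have "\<dots> = 4 / (l\<^sup>2 * \<sigma>\<^sup>2) * inverse (sqrt (real n))"
        using sn by (simp add: power_mult_distrib divide_simps)
      finally have 1: "\<bar>sqrt n * gauss l (\<sigma> * sqrt n) x - std_normal_density (x / (\<sigma> * sqrt n)) / (\<sigma> * l)\<bar>
        \<le> 4 / (l\<^sup>2 * \<sigma>\<^sup>2) * inverse (sqrt (real n))" .
      have "4 / (l\<^sup>2 * \<sigma>\<^sup>2) * inverse (sqrt (real n)) < e / 2" using elim by (simp add: field_simps)
      moreover have "\<bar>sqrt n * G l n x - sqrt n * gauss l (\<sigma> * sqrt n) x\<bar> \<le> e / 2" using elim by auto
      ultimately show "\<bar>sqrt n * G l n x - std_normal_density (x / (\<sigma> * sqrt n)) / (\<sigma> * l)\<bar> \<le> e"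
        using 1 by linarith
    qed
  qed
qed

lemma G_bound:
  assumes l: "0 < l"
  shows "\<exists>C>0. \<forall>n\<ge>1. \<forall>x. G l n x \<le> C / sqrt n"
proof -
  obtain M' where M': "M' > 0" "\<forall>\<^sub>F n in sequentially. \<forall>x. sqrt n * G l n x \<le> M'"
    using G_eventually_bounded[OF l] by blast
  obtain N where N: "\<And>n x. N \<le> n \<Longrightarrow> sqrt n * G l n x \<le> M'"
    using M'(2) unfolding eventually_sequentially by blast
  have G1: "G l n x \<le> 1" for n x
    using l by (intro G_le_1) simp
  have "sqrt n * G l n x \<le> max M' (sqrt N)" for n x
  proof (cases "N \<le> n")
    case False
    then have "sqrt n * G l n x \<le> sqrt N * 1" using G1 G_nonneg by (intro mult_mono) auto
    then show ?thesis by simp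
  qed (use N in \<open>auto simp: le_max_iff_disj\<close>)
  then show ?thesis
    using M'(1) by (intro exI[of _ "max M' (sqrt N)"]) (auto simp: pos_le_divide_eq mult.commute less_max_iff_disj)
qed

end

section \<open>Walks on a half-line\<close>

lemma (in prob_space) distr_sequence_eq_PiM:
  fixes X :: "nat \<Rightarrow> 'a \<Rightarrow> real"
  assumes "indep_vars (\<lambda>_::nat. borel) X UNIV" "\<And>i. distr M borel (X i) = \<nu>"
  shows "distr M seq_borel (\<lambda>\<omega> i. X i \<omega>) = Pi\<^sub>M UNIV (\<lambda>_. \<nu>)"
proof -
  have "\<And>i. random_variable borel (X i)" using assms(1) by (simp add: indep_vars_def2)
  then have "distr M seq_borel (\<lambda>\<omega>. \<lambda>i\<in>UNIV. X i \<omega>) = Pi\<^sub>M UNIV (\<lambda>i. distr M borel (X i))"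
    using indep_vars_iff_distr_eq_PiM[where I = UNIV and M' = "\<lambda>_. borel" and X = X] assms(1) by simp
  then show ?thesis by (simp add: restrict_def assms(2))
qed

lemma psum_reversal_self: "psum (reversal n w) n = psum w n"
  by (simp add: psum_reversal)

text \<open>The mirror image of \<open>stays\<close> under reflection (\<open>below_uminus\<close>);
  under time reversal, the event of ending close to the running minimum
  (\<open>below_reversal\<close>).\<close>

definition below :: "real \<Rightarrow> (nat \<Rightarrow> real) \<Rightarrow> nat \<Rightarrow> bool" where
  "below t w n \<longleftrightarrow> (\<forall>j\<le>n. psum w j \<le> t)"

lemma measurable_below [measurable (raw)]:
  assumes [measurable]: "t \<in> borel_measurable M" "f \<in> measurable M seq_borel"
  shows "Measurable.pred M (\<lambda>x. below (t x) (f x) n)"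
  unfolding below_def by measurable

lemma psum_uminus: "psum (\<lambda>i. - w i) n = - psum w n"
  by (simp add: psum_def sum_negf)

lemma below_uminus: "below t (\<lambda>i. - w i) n \<longleftrightarrow> stays t w n"
  by (auto simp: below_def stays_def psum_uminus minus_le_iff add.commute)

lemma below_comb_seq [simp]: "j \<le> k \<Longrightarrow> below t (comb_seq k w w') j = below t w j"
  by (simp add: below_def)

lemma below_antimono: "m \<le> n \<Longrightarrow> below t w n \<Longrightarrow> below t w m"
  by (simp add: below_def)

lemma below_reversal: "below t (reversal n w) n \<longleftrightarrow> psum w n - runmin w n \<le> t"
proof -
  have "below t (reversal n w) n \<longleftrightarrow> (\<forall>j\<le>n. psum w n - psum w (n - j) \<le> t)"
    unfolding below_def by (intro all_cong) (simp add: psum_reversal)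
  also have "\<dots> \<longleftrightarrow> (\<forall>j\<le>n. psum w n - psum w j \<le> t)"
    by (metis diff_diff_cancel diff_le_self)
  also have "\<dots> \<longleftrightarrow> psum w n - t \<le> runmin w n"
    unfolding runmin_ge_iff by (auto simp: algebra_simps)
  finally show ?thesis by (auto simp: algebra_simps)
qed

lemma ladder_reversal_below: "ladder (reversal n w) n \<Longrightarrow> below 0 w n"
  unfolding below_def
proof (intro allI impI)
  fix j assume L: "ladder (reversal n w) n" and j: "j \<le> n"
  show "psum w j \<le> 0"
  proof (cases "j = 0")
    case False
    then have "psum (reversal n w) n < psum (reversal n w) (n - j)"
      using L j by (simp add: ladder_def)
    then show ?thesis using j by (simp add: psum_reversal)
  qed simp
qed

lemma sum_inverse_sqrt_le: "(\<Sum>k=1..n. 1 / sqrt (real k)) \<le> 2 * sqrt n"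
proof (induction n)
  case (Suc n)
  have "1 / sqrt (real (Suc n)) \<le> 2 * (sqrt (Suc n) - sqrt n)"
  proof -
    have pos: "0 < sqrt (Suc n) + sqrt n" by (simp add: add_pos_nonneg)
    have "(sqrt (Suc n) - sqrt n) * (sqrt (Suc n) + sqrt n) = 1"
      by (simp add: algebra_simps flip: power2_eq_square)
    then have "sqrt (Suc n) - sqrt n = 1 / (sqrt (Suc n) + sqrt n)"
      using pos by (simp add: nonzero_eq_divide_eq)
    moreover have "1 / (2 * sqrt (Suc n)) \<le> 1 / (sqrt (Suc n) + sqrt n)"
      using pos by (intro divide_left_mono) auto
    ultimately show ?thesis by simp
  qed
  then show ?case using Suc by simp
qed simp

context iid_walk begin

lemma reflected_distr: "distr W seq_borel (\<lambda>w i. - w i) = Pi\<^sub>M UNIV (\<lambda>_. distr \<nu> borel uminus)"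
proof (rule P.distr_sequence_eq_PiM)
  show "P.indep_vars (\<lambda>_. borel) (\<lambda>i w. - w i) UNIV"
    using P.indep_vars_compose2[OF coord_indep, of "\<lambda>_ y. - y" "\<lambda>_. borel"] by simp
  fix i
  have "distr (distr W borel (\<lambda>w. w i)) borel uminus = distr W borel (uminus \<circ> (\<lambda>w. w i))"
    by (rule distr_distr) (auto intro: coord_measurable)
  then show "distr W borel (\<lambda>w. - w i) = distr \<nu> borel uminus"
    by (simp add: coord_distr comp_def)
qed

lemma reflected_walk: "iid_walk (distr \<nu> borel uminus) \<sigma>"
proof (rule iid_walk.intro)
  have m: "uminus \<in> measurable \<nu> borel" by measurable
  show "prob_space (distr \<nu> borel uminus)" by (rule nu.prob_space_distr[OF m])
  show "sets (distr \<nu> borel uminus) = sets borel" by simp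
  show "(\<integral>y. y \<partial>distr \<nu> borel uminus) = 0" by (simp add: integral_distr[OF m] mean_zero)
  show "integrable (distr \<nu> borel uminus) (\<lambda>y. y\<^sup>2)"
    by (simp add: integrable_distr_eq[OF m] square_integrable)
  show "(\<integral>y. y\<^sup>2 \<partial>distr \<nu> borel uminus) = \<sigma>\<^sup>2" by (simp add: integral_distr[OF m] second_moment)
qed (rule sigma_pos)

lemma integral_reflected:
  fixes F :: "(nat \<Rightarrow> real) \<Rightarrow> real"
  assumes "F \<in> borel_measurable seq_borel"
  shows "(\<integral>w. F (\<lambda>i. - w i) \<partial>W) = (\<integral>w. F w \<partial>Pi\<^sub>M UNIV (\<lambda>_. distr \<nu> borel uminus))"
proof -
  have "(\<lambda>w i. - w i) \<in> measurable W seq_borel"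
    by (rule measurable_PiM_single') (auto intro: coord_measurable)
  then show ?thesis unfolding reflected_distr[symmetric] using integral_distr[of _ W seq_borel F] assms by simp
qed

section \<open>Survival probabilities of order 1 / sqrt n\<close>

lemma expected_negative_part: "(\<integral>w. max 0 (- psum w n) \<partial>W) \<le> \<sigma> * sqrt n"
proof (cases "n = 0")
  case False
  let ?a = "\<sigma> * sqrt n"
  have a: "0 < ?a" using False sigma_pos by simp
  have "(\<integral>w. max 0 (- psum w n) \<partial>W) \<le> (\<integral>w. (psum w n)\<^sup>2 / (2 * ?a) + ?a / 2 \<partial>W)"
  proof (rule integral_mono)
    show "integrable W (\<lambda>w. max 0 (- psum w n))" by (intro integrable_max) simp_all
    show "integrable W (\<lambda>w. (psum w n)\<^sup>2 / (2 * ?a) + ?a / 2)" using psum_square[of n] by simp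
    fix w
    have "2 * ?a * max 0 (- psum w n) \<le> (psum w n)\<^sup>2 + ?a\<^sup>2"
      using sum_squares_bound[of "max 0 (- psum w n)" ?a] by (auto simp: max_def mult_ac split: if_splits)
    then have "max 0 (- psum w n) \<le> ((psum w n)\<^sup>2 + ?a\<^sup>2) / (2 * ?a)"
      using a by (subst pos_le_divide_eq) (simp_all add: mult_ac)
    also have "\<dots> = (psum w n)\<^sup>2 / (2 * ?a) + ?a / 2"
      using a by (simp add: add_divide_distrib power2_eq_square)
    finally show "max 0 (- psum w n) \<le> (psum w n)\<^sup>2 / (2 * ?a) + ?a / 2" .
  qed
  also have "\<dots> = n * \<sigma>\<^sup>2 / (2 * ?a) + ?a / 2"
    using psum_square[of n] P.prob_space by (subst Bochner_Integration.integral_add) auto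
  also have "\<dots> = ?a"
  proof -
    have "n * \<sigma>\<^sup>2 = ?a * ?a" by (simp add: power2_eq_square)
    then show ?thesis using a by simp
  qed
  finally show ?thesis .
qed simp

lemma runmin_integrable: "integrable W (\<lambda>w. runmin w n)"
  by (induction n) (auto intro!: integrable_min)

definition exp_min :: "nat \<Rightarrow> real" where
  "exp_min n = (\<integral>w. - runmin w n \<partial>W)"

text \<open>A form of Spitzer's identity: by the rotation argument the expected drop at time k is
  the mean negative part of the k-th sum divided by k, at most \<sigma> / sqrt k, and the drops add
  up to the depth of the minimum.\<close>

lemma exp_min_le: "exp_min n \<le> 2 * \<sigma> * sqrt n"
proof -
  have i: "integrable W (\<lambda>w. drop_at w k)" and e: "(\<integral>w. drop_at w k \<partial>W) = (\<integral>w. max 0 (- psum w k) \<partial>W) / k"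
    if "1 \<le> k" for k
    using drop_identity[of k "\<lambda>_. 1" 1] that by simp_all
  have "exp_min n = (\<Sum>k=1..n. \<integral>w. drop_at w k \<partial>W)"
    unfolding exp_min_def sum_drop_at[symmetric] using i by (intro Bochner_Integration.integral_sum) auto
  also have "\<dots> \<le> (\<Sum>k=1..n. \<sigma> * (1 / sqrt k))"
  proof (rule sum_mono)
    fix k assume k: "k \<in> {1..n}"
    have "(\<integral>w. drop_at w k \<partial>W) \<le> \<sigma> * sqrt k / k"
      using e k expected_negative_part[of k] by (simp add: divide_right_mono)
    also have "\<dots> = \<sigma> * (1 / sqrt k)" using k by (simp add: real_div_sqrt field_simps)
    finally show "(\<integral>w. drop_at w k \<partial>W) \<le> \<sigma> * (1 / sqrt k)" .
  qed
  also have "\<dots> \<le> \<sigma> * (2 * sqrt n)"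
    unfolding sum_distrib_left[symmetric] using sigma_pos sum_inverse_sqrt_le by (intro mult_left_mono) auto
  finally show ?thesis by simp
qed

lemma exp_min_mono: "m \<le> n \<Longrightarrow> exp_min m \<le> exp_min n"
  unfolding exp_min_def using runmin_integrable
  by (intro integral_mono integrable_minus) (auto simp: runmin_antimono)

lemma exp_min_nonneg: "0 \<le> exp_min n"
  using exp_min_mono[of 0 n] by (simp add: exp_min_def)

text \<open>The event is that the normalised sum is at most - 1 / \<sigma>. By the central limit
  theorem its probability eventually exceeds half of the corresponding normal probability, which is
  positive.\<close>

lemma lower_tail_bound: "\<exists>c>0. \<exists>N0. \<forall>N\<ge>N0. c \<le> measure W {w. psum w N \<le> - sqrt N}"
proof -
  interpret S: real_distribution std_normal_distribution by (rule real_dist_normal_dist)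
  let ?x = "- 1 / \<sigma>" and ?F = "cdf std_normal_distribution"
  have z: "measure std_normal_distribution {?x} = 0"
  proof -
    have "emeasure std_normal_distribution {?x} = (\<integral>\<^sup>+y. ennreal (std_normal_density y) * indicator {?x} y \<partial>lborel)"
      by (subst emeasure_density) auto
    also have "\<dots> = 0"
      by (subst nn_integral_0_iff_AE) (auto intro!: AE_I[of _ _ "{?x}"] simp: indicator_def)
    finally show ?thesis by (simp add: measure_def)
  qed
  have pos: "0 < ?F ?x"
  proof (rule ccontr)
    assume "\<not> 0 < ?F ?x"
    then have "measure std_normal_distribution {..?x} = 0"
      using S.cdf_nonneg[of ?x] unfolding cdf_def by linarith
    then have "emeasure std_normal_distribution {..?x} = 0"
      unfolding S.emeasure_eq_measure by simp
    then have "(\<integral>\<^sup>+y. ennreal (std_normal_density y) * indicator {..?x} y \<partial>lborel) = 0"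
      by (subst (asm) emeasure_density) auto
    then have "AE y in lborel. ennreal (std_normal_density y) * indicator {..?x} y = 0"
      by (subst (asm) nn_integral_0_iff_AE) auto
    then have "AE y in lborel. y \<notin> {..?x}"
    proof eventually_elim
      case (elim y)
      have "0 < std_normal_density y" by (rule normal_density_pos) simp
      then show ?case using elim by (auto simp: indicator_def ennreal_eq_0_iff split: if_splits)
    qed
    then have "emeasure lborel {..?x} = 0"
      using AE_iff_null[where P = "\<lambda>y. y \<notin> {..?x}" and M = lborel] by (simp add: null_sets_def atMost_def)
    moreover have "emeasure lborel {?x - 1..?x} \<le> emeasure lborel {..?x}"
      by (intro emeasure_mono) auto
    ultimately show False by simp
  qed
  have "(\<lambda>n. cdf (distr W borel (\<lambda>w. psum w n / sqrt (n * \<sigma>\<^sup>2))) ?x) \<longlonglongrightarrow> ?F ?x"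
    using clt S.isCont_cdf[of ?x] z by (simp add: weak_conv_m_def weak_conv_def)
  then have "\<forall>\<^sub>F n in sequentially. ?F ?x / 2 < cdf (distr W borel (\<lambda>w. psum w n / sqrt (n * \<sigma>\<^sup>2))) ?x"
    by (rule order_tendstoD(1)) (use pos in simp)
  then obtain N0 where N0: "\<And>n. N0 \<le> n \<Longrightarrow> ?F ?x / 2 < cdf (distr W borel (\<lambda>w. psum w n / sqrt (n * \<sigma>\<^sup>2))) ?x"
    unfolding eventually_sequentially by blast
  have "?F ?x / 2 \<le> measure W {w. psum w N \<le> - sqrt N}" if N: "max 1 N0 \<le> N" for N
  proof -
    have "cdf (distr W borel (\<lambda>w. psum w N / sqrt (N * \<sigma>\<^sup>2))) ?x = measure W {w. psum w N / sqrt (N * \<sigma>\<^sup>2) \<le> ?x}"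
      unfolding cdf_def by (subst measure_distr) (auto intro!: arg_cong[of _ _ "measure W"])
    also have "{w. psum w N / sqrt (N * \<sigma>\<^sup>2) \<le> ?x} = {w. psum w N \<le> - sqrt N}"
    proof -
      have "y / sqrt (N * \<sigma>\<^sup>2) \<le> ?x \<longleftrightarrow> y \<le> - sqrt N" for y
      proof -
        have s: "0 < sqrt (N * \<sigma>\<^sup>2)" using N sigma_pos by simp
        have "y / sqrt (N * \<sigma>\<^sup>2) \<le> ?x \<longleftrightarrow> y \<le> ?x * sqrt (N * \<sigma>\<^sup>2)" by (rule pos_divide_le_eq[OF s])
        also have "?x * sqrt (N * \<sigma>\<^sup>2) = - sqrt N" using sigma_pos by (simp add: real_sqrt_mult)
        finally show ?thesis .
      qed
      then show ?thesis by simp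
    qed
    finally show ?thesis using N0[of N] N by simp
  qed
  then show ?thesis using pos by (intro exI[of _ "?F ?x / 2"] conjI exI[of _ "max 1 N0"]) auto
qed

text \<open>By reversal, staying below \<open>t\<close> means ending within \<open>t\<close> of the running minimum; from there
  the minimum drops by at least 1 within order \<open>t\<^sup>2\<close> further steps with a probability bounded
  away from 0, so that such times cannot be more frequent than the minimum allows.\<close>

lemma below_bound: "\<exists>C>0. \<forall>n. \<forall>t\<ge>0. (\<integral>w. of_bool (below t w n) \<partial>W) \<le> C * (1 + t) ^ 4 / sqrt (real n + 1)"
proof -
  obtain c N0 where c: "c > 0" "\<And>N. N0 \<le> N \<Longrightarrow> c \<le> measure W {w. psum w N \<le> - sqrt N}"
    using lower_tail_bound by blast
  \<comment> \<open>Chosen so that \<open>real N + 1 \<le> K * (1 + t)\<^sup>2\<close> for the N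
    introduced below: N0 from the central limit theorem, 1 from the square and 2 from rounding and
    the extra summand.\<close>
  define K where "K = real N0 + 3"
  let ?C = "max 1 (sqrt 2 * (2 * \<sigma> * K\<^sup>2 / c))"
  let ?p = "\<lambda>t n. (\<integral>w. of_bool (below t w n) \<partial>W) :: real"
  have ib: "integrable W (\<lambda>w. of_bool (below t w n) :: real)" for t n
    by (rule integrable_bounded[where c = 1]) auto
  have main: "?p t n \<le> ?C * (1 + t) ^ 4 / sqrt (real n + 1)" if t: "0 \<le> t" for t n
  proof (cases "n = 0")
    case True
    have "?p t n \<le> (\<integral>w. 1 \<partial>W)" by (intro integral_mono ib) auto
    also have "\<dots> = 1 * 1" using P.prob_space by simp
    also have "\<dots> \<le> ?C * (1 + t) ^ 4" using t by (intro mult_mono one_le_power) auto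
    finally show ?thesis using True by simp
  next
    case False
    \<comment> \<open>Large enough for \<open>lower_tail_bound\<close> and for sqrt N to reach t +
      1, so that a descent of t + 1 within N steps has probability at least c.\<close>
    define N where "N = N0 + nat \<lceil>(t + 1)\<^sup>2\<rceil>"
    have N1: "(t + 1)\<^sup>2 \<le> N" unfolding N_def by linarith
    have ceil: "real (nat \<lceil>x\<rceil>) \<le> x + 1" if "0 \<le> x" for x :: real
      using that by linarith
    have N2: "real N + 1 \<le> K * (1 + t)\<^sup>2"
    proof -
      have "1 * 1 \<le> (1 + t) * (1 + t)" using t by (intro mult_mono) auto
      then have o: "1 \<le> (1 + t)\<^sup>2" by (simp add: power2_eq_square)
      have "real N + 1 \<le> real N0 + (t + 1)\<^sup>2 + 2"
        using ceil[of "(t + 1)\<^sup>2"] zero_le_power2[of "t + 1"] unfolding N_def of_nat_add by linarith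
      also have "\<dots> \<le> real N0 * (1 + t)\<^sup>2 + (1 + t)\<^sup>2 + 2 * (1 + t)\<^sup>2"
        using o mult_left_mono[OF o, of "real N0"] by (simp add: add.commute)
      finally show ?thesis by (simp add: K_def algebra_simps)
    qed
    have cN: "c \<le> (\<integral>w. of_bool (psum w N \<le> - (t + 1)) \<partial>W)"
    proof -
      have "t + 1 \<le> sqrt N" using N1 t by (intro real_le_rsqrt) auto
      then have "measure W {w. psum w N \<le> - sqrt N} \<le> measure W {w. psum w N \<le> - (t + 1)}"
      proof (intro P.finite_measure_mono)
        have "{w \<in> space W. psum w N \<le> - (t + 1)} \<in> sets W" by measurable
        then show "{w. psum w N \<le> - (t + 1)} \<in> sets W" by simp
      qed auto
      also have "\<dots> = (\<integral>w. indicator {w. psum w N \<le> - (t + 1)} w \<partial>W)" by simp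
      also have "\<dots> = (\<integral>w. of_bool (psum w N \<le> - (t + 1)) \<partial>W)"
        by (intro Bochner_Integration.integral_cong refl) (simp add: indicator_def)
      finally show ?thesis using c(2)[of N] by (simp add: N_def)
    qed
    have step: "c * ?p t k \<le> exp_min (k + N) - exp_min k" for k
    proof -
      let ?r = "\<lambda>w. of_bool (psum w k - runmin w k \<le> t) :: real"
      let ?s = "\<lambda>w. of_bool (psum w N \<le> - (t + 1)) :: real"
      have ir: "integrable W ?r" and is': "integrable W ?s"
        by (rule integrable_bounded[where c = 1]; auto)+
      have "?p t k = (\<integral>w. of_bool (below t (reversal k w) k) \<partial>W)"
        by (rule integral_reversal[symmetric]) measurable
      then have "?p t k = (\<integral>w. ?r w \<partial>W)" by (simp only: below_reversal)
      then have "c * ?p t k \<le> (\<integral>w. ?r w \<partial>W) * (\<integral>w. ?s w \<partial>W)"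
        using cN by (simp add: mult.commute[of c] mult_left_mono)
      also have "\<dots> = (\<integral>w. ?r w * ?s (shifted k w) \<partial>W)"
        by (rule indep_product(2)[OF ir is', symmetric]) simp
      also have "\<dots> \<le> (\<integral>w. - runmin w (k + N) - (- runmin w k) \<partial>W)"
      proof (rule integral_mono[OF indep_product(1)[OF ir is']])
        show "integrable W (\<lambda>w. - runmin w (k + N) - (- runmin w k))" using runmin_integrable by simp
        fix w
        show "?r w * ?s (shifted k w) \<le> - runmin w (k + N) - (- runmin w k)"
          using runmin_antimono[of k "k + N" w] runmin_le[of "k + N" "k + N" w] psum_add[of w k N] by auto
      qed simp
      also have "\<dots> = exp_min (k + N) - exp_min k"
        unfolding exp_min_def using runmin_integrable by (subst Bochner_Integration.integral_diff) auto
      finally show ?thesis .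
    qed
    \<comment> \<open>Increments over the lag N' regroup into N' telescoping sums, each at most the
      last value of \<open>exp_min\<close>.\<close>
    have tele: "(\<Sum>k<n. exp_min (k + N') - exp_min k) \<le> N' * exp_min (n + N')" for N'
    proof (induction N')
      case (Suc N')
      have e: "(\<Sum>k<n. exp_min (k + Suc N') - exp_min k)
        = (\<Sum>k<n. exp_min (k + N') - exp_min k) + (\<Sum>k<n. exp_min (Suc k + N') - exp_min (k + N'))"
        unfolding sum.distrib[symmetric] by (intro sum.cong) simp_all
      have "(\<Sum>k<n. exp_min (Suc k + N') - exp_min (k + N')) = exp_min (n + N') - exp_min N'"
        using sum_lessThan_telescope[of "\<lambda>k. exp_min (k + N')" n] by simp
      moreover have m: "exp_min (n + N') \<le> exp_min (n + Suc N')" by (intro exp_min_mono) simp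
      moreover have "N' * exp_min (n + N') \<le> N' * exp_min (n + Suc N')" by (intro mult_left_mono m) simp
      ultimately have "(\<Sum>k<n. exp_min (k + Suc N') - exp_min k) \<le> N' * exp_min (n + Suc N') + exp_min (n + Suc N')"
        unfolding e using Suc exp_min_nonneg[of N'] by linarith
      then show ?case by (simp add: distrib_right)
    qed simp
    have pm: "?p t n \<le> ?p t k" if "k < n" for k
      using that below_antimono[of k n t] by (intro integral_mono ib) auto
    \<comment> \<open>The probability decreases in time, so n copies of its value at n are at most
      the sum over earlier times. The exponent 4 stems from N as a factor and from N under the
      square root, each estimated by a multiple of (1 + t)^2.\<close>
    have "c * (real n * ?p t n) = (\<Sum>k<n. c * ?p t n)" by simp
    also have "\<dots> \<le> (\<Sum>k<n. c * ?p t k)" using pm c by (intro sum_mono mult_left_mono) auto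
    also have "\<dots> \<le> (\<Sum>k<n. exp_min (k + N) - exp_min k)" by (intro sum_mono step)
    also have "\<dots> \<le> N * (2 * \<sigma> * sqrt (n + N))"
      by (rule order_trans[OF tele]) (use exp_min_le[of "n + N"] in \<open>auto intro!: mult_left_mono\<close>)
    also have "\<dots> \<le> (K * (1 + t)\<^sup>2) * (2 * \<sigma> * (sqrt n * (K * (1 + t)\<^sup>2)))"
    proof (intro mult_mono)
      have "real (n + N) \<le> real n * (real N + 1)\<^sup>2"
      proof -
        have "real (n + N) \<le> real n * (1 + real N)" using False by (cases n) (auto simp: algebra_simps)
        also have "\<dots> \<le> real n * (real N + 1)\<^sup>2"
          by (intro mult_left_mono) (auto simp: power2_eq_square algebra_simps)
        finally show ?thesis .
      qed
      then have "sqrt (n + N) \<le> sqrt (real n * (real N + 1)\<^sup>2)" by (rule real_sqrt_le_mono)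
      also have "\<dots> = sqrt n * (real N + 1)" by (simp add: real_sqrt_mult)
      also have "\<dots> \<le> sqrt n * (K * (1 + t)\<^sup>2)" using N2 by (intro mult_left_mono) auto
      finally show "sqrt (n + N) \<le> sqrt n * (K * (1 + t)\<^sup>2)" .
      show "N \<le> K * (1 + t)\<^sup>2" using N2 by simp
    qed (use sigma_pos in \<open>auto simp: K_def\<close>)
    also have "\<dots> = c * (real n * (2 * \<sigma> * K\<^sup>2 / c * (1 + t) ^ 4 / sqrt n))"
    proof -
      have "c * (real n * (2 * \<sigma> * K\<^sup>2 / c * (1 + t) ^ 4 / sqrt n))
          = 2 * \<sigma> * K\<^sup>2 * (1 + t) ^ 4 * (real n / sqrt n)"
        using c(1) by simp
      also have "real n / sqrt n = sqrt n" by (simp add: real_div_sqrt)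
      finally have "c * (real n * (2 * \<sigma> * K\<^sup>2 / c * (1 + t) ^ 4 / sqrt n)) = 2 * \<sigma> * K\<^sup>2 * (1 + t) ^ 4 * sqrt n" .
      then show ?thesis by (simp add: power2_eq_square power4_eq_xxxx mult_ac)
    qed
    finally have "real n * ?p t n \<le> real n * (2 * \<sigma> * K\<^sup>2 / c * (1 + t) ^ 4 / sqrt n)"
      by (rule mult_left_le_imp_le) (rule c(1))
    then have "?p t n \<le> 2 * \<sigma> * K\<^sup>2 / c * (1 + t) ^ 4 / sqrt n"
      by (rule mult_left_le_imp_le) (use False in simp)
    also have "\<dots> \<le> 2 * \<sigma> * K\<^sup>2 / c * (1 + t) ^ 4 * (sqrt 2 / sqrt (real n + 1))"
    proof -
      have "sqrt (real n + 1) \<le> sqrt (2 * real n)" using False by (intro real_sqrt_le_mono) simp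
      then have "1 / sqrt n \<le> sqrt 2 / sqrt (real n + 1)"
        using False by (simp add: field_simps real_sqrt_mult)
      then show ?thesis
        using mult_left_mono[of "1 / sqrt n" "sqrt 2 / sqrt (real n + 1)" "2 * \<sigma> * K\<^sup>2 / c * (1 + t) ^ 4"] sigma_pos c t
        by simp
    qed
    also have "\<dots> = (sqrt 2 * (2 * \<sigma> * K\<^sup>2 / c)) * (1 + t) ^ 4 / sqrt (real n + 1)" by simp
    also have "\<dots> \<le> ?C * (1 + t) ^ 4 / sqrt (real n + 1)"
      using t by (intro divide_right_mono mult_right_mono) auto
    finally show ?thesis .
  qed
  show ?thesis by (intro exI[of _ ?C]) (use main in auto)
qed

lemma stays_bound: "\<exists>C>0. \<forall>n. \<forall>t\<ge>0. (\<integral>w. of_bool (stays t w n) \<partial>W) \<le> C * (1 + t) ^ 4 / sqrt (real n + 1)"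
proof -
  interpret R: iid_walk "distr \<nu> borel uminus" \<sigma> by (rule reflected_walk)
  have "(\<integral>w. of_bool (stays t w n) \<partial>W) = (\<integral>w. of_bool (below t w n) \<partial>R.W :: real)" for t n
    using integral_reflected[of "\<lambda>w. of_bool (below t w n)"] by (simp add: below_uminus)
  then show ?thesis using R.below_bound by simp
qed

lemma stays_integrable: "integrable W (\<lambda>w. of_bool (stays t w n) :: real)"
  and below_integrable: "integrable W (\<lambda>w. of_bool (below t w n) :: real)"
  and ladder_integrable: "integrable W (\<lambda>w. of_bool (ladder w n) :: real)"
  by (rule integrable_bounded[where c = 1]; auto)+

lemma ladder_prob_le_below: "(\<integral>w. of_bool (ladder w n) \<partial>W) \<le> (\<integral>w. of_bool (below 0 w n) \<partial>W :: real)"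
proof -
  have "(\<integral>w. of_bool (ladder w n) \<partial>W :: real) = (\<integral>w. of_bool (ladder (reversal n w) n) \<partial>W)"
    by (rule integral_reversal[symmetric]) measurable
  also have "\<dots> \<le> (\<integral>w. of_bool (below 0 w n) \<partial>W)"
  proof (rule integral_mono[OF _ below_integrable])
    have "(\<lambda>w. reversal n w) = (\<lambda>w i. w (if i < n then n - 1 - i else i))"
      by (auto simp: reversal_def fun_eq_iff)
    then have [measurable]: "(\<lambda>w. reversal n w) \<in> measurable W seq_borel"
      using measurable_reindex[of "\<lambda>w. w" W] by (simp add: measurable_W_eq)
    show "integrable W (\<lambda>w. of_bool (ladder (reversal n w) n) :: real)"
      by (rule integrable_bounded[where c = 1]) auto
  qed (use ladder_reversal_below in auto)
  finally show ?thesis .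
qed

section \<open>The martingale killed below zero\<close>

definition potential :: "real \<Rightarrow> nat \<Rightarrow> real" where
  "potential t n = (\<integral>w. of_bool (stays t w n) * (t + psum w n) \<partial>W)"

lemma psum_shift_square_integrable: "integrable W (\<lambda>w. (t + psum w n)\<^sup>2)"
  using psum_square[of n] by (simp add: power2_sum mult.assoc)

lemma killed_square_integrable: "integrable W (\<lambda>w. of_bool (stays t w n) * (t + psum w n)\<^sup>2)"
  by (rule integrable_dom[OF psum_shift_square_integrable[of t n]]) (auto simp: abs_mult)

lemma killed_integrable: "integrable W (\<lambda>w. of_bool (stays t w n) * (t + psum w n))"
proof (rule integrable_dom[where g = "\<lambda>w. \<bar>t\<bar> + \<bar>psum w n\<bar>"])
  show "\<bar>of_bool (stays t w n) * (t + psum w n)\<bar> \<le> \<bar>t\<bar> + \<bar>psum w n\<bar>" for w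
    by (auto simp: abs_mult)
qed auto

lemma overshoot_integrable: "integrable W (\<lambda>w. of_bool (stays t w n) * max 0 (- (t + psum w m)))"
proof (rule integrable_dom[where g = "\<lambda>w. \<bar>t\<bar> + \<bar>psum w m\<bar>"])
  show "\<bar>of_bool (stays t w n) * max 0 (- (t + psum w m))\<bar> \<le> \<bar>t\<bar> + \<bar>psum w m\<bar>" for w
    by (auto simp: abs_mult)
qed auto

text \<open>\<open>t + psum w n\<close> is a martingale, so discarding the paths that have just
  become negative adds their overshoot to the expectation. In particular the sequence
  increases.\<close>

lemma potential_Suc:
  "potential t (Suc n) = potential t n + (\<integral>w. of_bool (stays t w n) * max 0 (- (t + psum w (Suc n))) \<partial>W)"
proof -
  let ?k = "\<lambda>w. of_bool (stays t w n) :: real"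
  have ip: "integrable W (\<lambda>w. ?k w * (\<lambda>w. w 0) (shifted n w))" "(\<integral>w. ?k w * (\<lambda>w. w 0) (shifted n w) \<partial>W) = 0"
    using indep_product[OF stays_integrable[of t n] coord_integrable[of 0], of n] coord_mean[of 0] by simp_all
  have e: "of_bool (stays t w (Suc n)) * (t + psum w (Suc n))
      = (?k w * (t + psum w n) + ?k w * (\<lambda>w. w 0) (shifted n w)) + ?k w * max 0 (- (t + psum w (Suc n)))" for w
    by (auto simp: stays_Suc psum_Suc shifted_def)
  show ?thesis
    unfolding potential_def e
    using killed_integrable[of t n] ip overshoot_integrable[of t n "Suc n"]
    by (subst Bochner_Integration.integral_add) (auto intro: Bochner_Integration.integrable_add)
qed

lemma killed_square_le:
  "(\<integral>w. of_bool (stays t w n) * (t + psum w n)\<^sup>2 \<partial>W) \<le> t\<^sup>2 + \<sigma>\<^sup>2 * (\<Sum>k<n. \<integral>w. of_bool (stays t w k) \<partial>W)"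
proof (induction n)
  case 0
  have "(\<integral>w. of_bool (stays t w 0) * (t + psum w 0)\<^sup>2 \<partial>W) \<le> (\<integral>w. t\<^sup>2 \<partial>W)"
    by (intro integral_mono killed_square_integrable) auto
  then show ?case using P.prob_space by simp
next
  case (Suc n)
  let ?k = "\<lambda>w. of_bool (stays t w n) :: real"
  have ip: "integrable W (\<lambda>w. (?k w * (t + psum w n)) * (\<lambda>w. w 0) (shifted n w))"
     "(\<integral>w. (?k w * (t + psum w n)) * (\<lambda>w. w 0) (shifted n w) \<partial>W) = 0"
    using indep_product[OF killed_integrable[of t n] coord_integrable[of 0], of n] coord_mean[of 0] by simp_all
  have iq: "integrable W (\<lambda>w. ?k w * (\<lambda>w. (w 0)\<^sup>2) (shifted n w))"
     "(\<integral>w. ?k w * (\<lambda>w. (w 0)\<^sup>2) (shifted n w) \<partial>W) = (\<integral>w. ?k w \<partial>W) * \<sigma>\<^sup>2"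
    using indep_product[OF stays_integrable[of t n] coord_square_integrable[of 0], of n] coord_square[of 0] by simp_all
  let ?R = "\<lambda>w. ?k w * (t + psum w n)\<^sup>2 + (2 * ((?k w * (t + psum w n)) * (\<lambda>w. w 0) (shifted n w)) + ?k w * (\<lambda>w. (w 0)\<^sup>2) (shifted n w))"
  have iR: "integrable W ?R"
    using killed_square_integrable ip iq by (intro Bochner_Integration.integrable_add integrable_mult_right) auto
  have "(\<integral>w. of_bool (stays t w (Suc n)) * (t + psum w (Suc n))\<^sup>2 \<partial>W) \<le> (\<integral>w. ?R w \<partial>W)"
  proof (rule integral_mono[OF killed_square_integrable iR])
    fix w
    have "of_bool (stays t w (Suc n)) * (t + psum w (Suc n))\<^sup>2 \<le> ?k w * (t + psum w (Suc n))\<^sup>2"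
      by (auto simp: stays_Suc)
    also have "\<dots> = ?R w" by (simp add: psum_Suc shifted_def power2_eq_square algebra_simps)
    finally show "of_bool (stays t w (Suc n)) * (t + psum w (Suc n))\<^sup>2 \<le> ?R w" .
  qed
  also have "\<dots> = (\<integral>w. ?k w * (t + psum w n)\<^sup>2 \<partial>W) + \<sigma>\<^sup>2 * (\<integral>w. ?k w \<partial>W)"
  proof -
    have i2: "integrable W (\<lambda>w. 2 * ((?k w * (t + psum w n)) * (\<lambda>w. w 0) (shifted n w)))" using ip by simp
    have "(\<integral>w. ?R w \<partial>W) = (\<integral>w. ?k w * (t + psum w n)\<^sup>2 \<partial>W) +
        ((\<integral>w. 2 * ((?k w * (t + psum w n)) * (\<lambda>w. w 0) (shifted n w)) \<partial>W) + (\<integral>w. ?k w * (\<lambda>w. (w 0)\<^sup>2) (shifted n w) \<partial>W))"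
      by (subst Bochner_Integration.integral_add[OF killed_square_integrable Bochner_Integration.integrable_add[OF i2 iq(1)]],
          subst Bochner_Integration.integral_add[OF i2 iq(1)]) simp
    then show ?thesis using ip iq by (simp add: mult.commute)
  qed
  finally show ?case using Suc by (simp add: distrib_left)
qed

lemma killed_square_bound:
  "\<exists>C>0. \<forall>n. \<forall>t\<ge>0. (\<integral>w. of_bool (stays t w n) * (t + psum w n)\<^sup>2 \<partial>W) \<le> C * (1 + t) ^ 4 * sqrt (real n + 1)"
proof -
  obtain C where C: "C > 0" "\<And>n t. 0 \<le> t \<Longrightarrow> (\<integral>w. of_bool (stays t w n) \<partial>W) \<le> C * (1 + t) ^ 4 / sqrt (real n + 1)"
    using stays_bound by blast
  have main: "(\<integral>w. of_bool (stays t w n) * (t + psum w n)\<^sup>2 \<partial>W) \<le> (1 + \<sigma>\<^sup>2 * (C * 2)) * (1 + t) ^ 4 * sqrt (real n + 1)"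
    if t: "0 \<le> t" for t n
  proof -
    have s: "(\<Sum>k<n. \<integral>w. of_bool (stays t w k) \<partial>W) \<le> C * (1 + t) ^ 4 * (2 * sqrt n)"
    proof -
      have "(\<Sum>k<n. \<integral>w. of_bool (stays t w k) \<partial>W) \<le> (\<Sum>k<n. C * (1 + t) ^ 4 * (1 / sqrt (real (Suc k))))"
        using C(2)[OF t] by (intro sum_mono) (simp add: add.commute)
      also have "\<dots> = C * (1 + t) ^ 4 * (\<Sum>k=1..n. 1 / sqrt (real k))"
        by (simp add: sum_distrib_left sum.lessThan_Suc_shift sum.atLeast1_atMost_eq)
      also have "\<dots> \<le> C * (1 + t) ^ 4 * (2 * sqrt n)"
        using C t sum_inverse_sqrt_le by (intro mult_left_mono) auto
      finally show ?thesis .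
    qed
    have t4: "t\<^sup>2 \<le> (1 + t) ^ 4"
    proof -
      have "t\<^sup>2 \<le> (1 + t)\<^sup>2" using t by (intro power_mono) auto
      also have "\<dots> \<le> (1 + t) ^ 4" using t by (intro power_increasing) auto
      finally show ?thesis .
    qed
    have "(\<integral>w. of_bool (stays t w n) * (t + psum w n)\<^sup>2 \<partial>W) \<le> t\<^sup>2 + \<sigma>\<^sup>2 * (C * (1 + t) ^ 4 * (2 * sqrt n))"
      using killed_square_le[of t n] mult_left_mono[OF s, of "\<sigma>\<^sup>2"] by simp
    also have "\<dots> \<le> (1 + t) ^ 4 * sqrt (real n + 1) + \<sigma>\<^sup>2 * (C * (1 + t) ^ 4 * (2 * sqrt (real n + 1)))"
    proof (intro add_mono mult_left_mono)
      show "t\<^sup>2 \<le> (1 + t) ^ 4 * sqrt (real n + 1)"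
      proof -
        have "(1 + t) ^ 4 * 1 \<le> (1 + t) ^ 4 * sqrt (real n + 1)" using t by (intro mult_left_mono) auto
        then show ?thesis using t4 by linarith
      qed
    qed (use C t in auto)
    also have "\<dots> = (1 + \<sigma>\<^sup>2 * (C * 2)) * (1 + t) ^ 4 * sqrt (real n + 1)" by (simp add: algebra_simps)
    finally show ?thesis .
  qed
  show ?thesis
    using C(1) main by (intro exI[of _ "1 + \<sigma>\<^sup>2 * (C * 2)"]) (auto intro: add_pos_nonneg)
qed

lemma potential_mono: "incseq (potential t)"
  unfolding potential_Suc by (intro incseq_SucI) (simp add: potential_Suc Bochner_Integration.integral_nonneg)

text \<open>The inequality y <= y^2 / a + a with a = sqrt (n + 1) balances the killed second moment,
  of order sqrt n, against the survival probability, of order 1 / sqrt n.\<close>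

lemma potential_bound: "\<exists>C>0. \<forall>n. \<forall>t\<ge>0. potential t n \<le> C * (1 + t) ^ 4"
proof -
  obtain C where C: "C > 0" "\<And>n t. 0 \<le> t \<Longrightarrow> (\<integral>w. of_bool (stays t w n) \<partial>W) \<le> C * (1 + t) ^ 4 / sqrt (real n + 1)"
    using stays_bound by blast
  obtain D where D: "D > 0" "\<And>n t. 0 \<le> t \<Longrightarrow> (\<integral>w. of_bool (stays t w n) * (t + psum w n)\<^sup>2 \<partial>W) \<le> D * (1 + t) ^ 4 * sqrt (real n + 1)"
    using killed_square_bound by blast
  have main: "potential t n \<le> (C + D) * (1 + t) ^ 4" if t: "0 \<le> t" for t n
  proof -
    let ?a = "sqrt (real n + 1)"
    have a: "0 < ?a" by simp
    have "potential t n \<le> (\<integral>w. of_bool (stays t w n) * (t + psum w n)\<^sup>2 / ?a + ?a * of_bool (stays t w n) \<partial>W)"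
      unfolding potential_def
    proof (rule integral_mono[OF killed_integrable])
      show "integrable W (\<lambda>w. of_bool (stays t w n) * (t + psum w n)\<^sup>2 / ?a + ?a * of_bool (stays t w n))"
        using killed_square_integrable stays_integrable by (intro Bochner_Integration.integrable_add) auto
      fix w
      have "y \<le> y\<^sup>2 / ?a + ?a" for y
      proof (cases "y \<le> ?a")
        case True
        then show ?thesis using a by (simp add: add_increasing)
      next
        case False
        then have "?a * y \<le> y * y" using a by (intro mult_right_mono) linarith+
        then have "y \<le> y\<^sup>2 / ?a" using a by (simp add: pos_le_divide_eq power2_eq_square mult.commute)
        then show ?thesis using a by linarith
      qed
      then show "of_bool (stays t w n) * (t + psum w n) \<le> of_bool (stays t w n) * (t + psum w n)\<^sup>2 / ?a + ?a * of_bool (stays t w n)"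
        by simp
    qed
    also have "\<dots> = (\<integral>w. of_bool (stays t w n) * (t + psum w n)\<^sup>2 \<partial>W) / ?a + ?a * (\<integral>w. of_bool (stays t w n) \<partial>W)"
      using killed_square_integrable stays_integrable by (subst Bochner_Integration.integral_add) auto
    also have "\<dots> \<le> (D * (1 + t) ^ 4 * ?a) / ?a + ?a * (C * (1 + t) ^ 4 / ?a)"
      using D(2)[OF t, of n] C(2)[OF t, of n] by (intro add_mono divide_right_mono mult_left_mono) auto
    also have "\<dots> = (C + D) * (1 + t) ^ 4" using a by (simp add: algebra_simps)
    finally show ?thesis .
  qed
  show ?thesis by (intro exI[of _ "C + D"]) (use C(1) D(1) main in auto)
qed

section \<open>Total exponential weight of the ladder points\<close>

lemma exists_negative_step: "\<exists>\<epsilon>>0. 0 < measure \<nu> {..- \<epsilon>}"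
proof (rule ccontr)
  assume "\<not> ?thesis"
  then have z: "measure \<nu> {..- \<epsilon>} = 0" if "\<epsilon> > 0" for \<epsilon>
    using that by (meson linorder_not_less measure_nonneg order_antisym)
  have "AE y in \<nu>. \<forall>k::nat. - (1 / real (Suc k)) < y"
  proof (subst AE_all_countable, intro allI)
    fix k :: nat
    have "{y \<in> space \<nu>. \<not> - (1 / real (Suc k)) < y} = {..- (1 / real (Suc k))}" by auto
    moreover have "{..- (1 / real (Suc k))} \<in> null_sets \<nu>"
      using z[of "1 / real (Suc k)"] by (simp add: null_sets_def nu.emeasure_eq_measure sets_nu)
    ultimately show "AE y in \<nu>. - (1 / real (Suc k)) < y" by (intro AE_I'[of "{..- (1 / real (Suc k))}"]) auto
  qed
  then have nn: "AE y in \<nu>. 0 \<le> y"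
  proof eventually_elim
    case (elim y)
    show ?case
    proof (rule ccontr)
      assume "\<not> 0 \<le> y"
      then obtain k where "inverse (real (Suc k)) < - y" using reals_Archimedean[of "- y"] by auto
      then show False using elim[rule_format, of k] by (simp add: inverse_eq_divide)
    qed
  qed
  then have "AE y in \<nu>. y = 0"
    using integral_nonneg_eq_0_iff_AE[OF integrable_id nn] mean_zero by simp
  then have "(\<integral>y. y\<^sup>2 \<partial>\<nu>) = (\<integral>y. 0 \<partial>\<nu>)" by (intro integral_cong_AE) (auto simp: measurable_cong_sets[OF sets_nu refl])
  then show False using second_moment sigma_pos by simp
qed

text \<open>A Lyapunov argument: H is bounded, monotone and satisfies
  \<open>gexp l y \<le> H y - H (y - \<epsilon>)\<close>. If j is a ladder time and the next step is
  at most - \<epsilon>, which has probability p independently of the past, the minimum falls by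
  \<epsilon>. Thus \<open>H (x + runmin w j)\<close> loses at least \<open>p * A l j x\<close> in
  mean at each step, and the total loss is at most the range of H.\<close>

lemma A_sum_bound:
  assumes l: "0 < l"
  shows "\<exists>C>0. \<forall>n x. (\<Sum>j<n. A l j x) \<le> C"
proof -
  obtain \<epsilon> where eps: "\<epsilon> > 0" "0 < measure \<nu> {..- \<epsilon>}"
    using exists_negative_step by blast
  define p where "p = measure \<nu> {..- \<epsilon>}"
  \<comment> \<open>The value for which \<open>H y - H (y - \<epsilon>)\<close> equals
    \<open>gexp l y\<close> exactly once y is at least \<epsilon>.\<close>
  define B where "B = 1 / (exp (l * \<epsilon>) - 1)"
  have B0: "0 < B" using l eps by (simp add: B_def)
  define H where "H y = (if 0 \<le> y then B + 1 - B * exp (- (l * y)) else 0)" for y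
  have H_mono: "H y \<le> H z" if "y \<le> z" for y z
  proof (cases "0 \<le> y")
    case True
    then have "B * exp (- (l * z)) \<le> B * exp (- (l * y))" using that l B0 by (intro mult_left_mono) auto
    then show ?thesis using True that by (simp add: H_def)
  next
    case False
    have "0 \<le> H z"
    proof (cases "0 \<le> z")
      case True
      then have "B * exp (- (l * z)) \<le> B * 1" using l B0 by (intro mult_left_mono) auto
      then show ?thesis by (simp add: H_def)
    qed (simp add: H_def)
    then show ?thesis using False by (simp add: H_def)
  qed
  have H_bd: "0 \<le> H y" "H y \<le> B + 1" for y
    using H_mono[of "min y (-1)" y] B0 by (auto simp: H_def)
  have H_gap: "gexp l y \<le> H y - H (y - \<epsilon>)" for y
  proof (cases "0 \<le> y")
    case True
    show ?thesis
    proof (cases "\<epsilon> \<le> y")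
      case ge: True
      have "exp (- (l * (y - \<epsilon>))) = exp (- (l * y)) * exp (l * \<epsilon>)" by (simp add: algebra_simps flip: exp_add)
      then have "H y - H (y - \<epsilon>) = exp (- (l * y)) * (B * (exp (l * \<epsilon>) - 1))"
        using True ge by (simp add: H_def algebra_simps)
      also have "B * (exp (l * \<epsilon>) - 1) = 1" using l eps by (simp add: B_def)
      finally show ?thesis using True by (simp add: gexp_def)
    next
      case False
      have "(B + 1) * exp (- (l * y)) \<le> (B + 1) * 1" using True l B0 by (intro mult_left_mono) auto
      then show ?thesis using True False by (simp add: H_def gexp_def algebra_simps)
    qed
  next
    case False
    then show ?thesis using H_mono[of "y - \<epsilon>" y] eps by (simp add: gexp_def)
  qed
  have [measurable]: "H \<in> borel_measurable borel" unfolding H_def[abs_def] by measurable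
  have ih: "integrable W (\<lambda>w. H (x + runmin w j))" for x j
    by (rule integrable_bounded[where c = "B + 1"]) (use H_bd in auto)
  have step: "p * A l j x \<le> (\<integral>w. H (x + runmin w j) \<partial>W) - (\<integral>w. H (x + runmin w (Suc j)) \<partial>W)" for x j
  proof -
    let ?a = "\<lambda>w. of_bool (ladder w j) * gexp l (x + psum w j)"
    let ?b = "\<lambda>w. indicator {..- \<epsilon>} (w 0) :: real"
    have ia: "integrable W ?a" using A_integrable[of l] l by simp
    have ib: "integrable W ?b" by (rule integrable_bounded[where c = 1]) (auto simp: coord_measurable)
    have "(\<integral>w. ?b w \<partial>W) = p"
      using component_integral(1)[of "indicator {..- \<epsilon>}" 0] by (simp add: p_def sets_nu)
    then have "p * A l j x = (\<integral>w. ?a w * ?b (shifted j w) \<partial>W)"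
      using indep_product(2)[OF ia ib, of j] by (simp add: A_def mult.commute)
    also have "\<dots> \<le> (\<integral>w. H (x + runmin w j) - H (x + runmin w (Suc j)) \<partial>W)"
    proof (rule integral_mono)
      show "integrable W (\<lambda>w. ?a w * ?b (shifted j w))" by (rule indep_product(1)[OF ia ib]) simp
      show "integrable W (\<lambda>w. H (x + runmin w j) - H (x + runmin w (Suc j)))"
        by (rule Bochner_Integration.integrable_diff[OF ih ih])
      fix w
      show "?a w * ?b (shifted j w) \<le> H (x + runmin w j) - H (x + runmin w (Suc j))"
      proof (cases "ladder w j \<and> w j \<le> - \<epsilon>")
        case True
        then have "runmin w j = psum w j" by (simp add: ladder_imp_runmin)
        moreover have "runmin w (Suc j) \<le> psum w j - \<epsilon>"
          using True runmin_le[of "Suc j" "Suc j" w] by (simp add: psum_Suc del: runmin.simps)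
        ultimately have "H (x + runmin w (Suc j)) \<le> H (x + psum w j - \<epsilon>)" by (intro H_mono) simp
        then show ?thesis
          using True H_gap[of "x + psum w j"] \<open>runmin w j = psum w j\<close> by (simp add: shifted_def)
      next
        case False
        have "H (x + runmin w (Suc j)) \<le> H (x + runmin w j)" by (intro H_mono) simp
        then show ?thesis using False by (auto simp: shifted_def indicator_def)
      qed
    qed
    also have "\<dots> = (\<integral>w. H (x + runmin w j) \<partial>W) - (\<integral>w. H (x + runmin w (Suc j)) \<partial>W)"
      by (rule Bochner_Integration.integral_diff[OF ih ih])
    finally show ?thesis .
  qed
  have main: "(\<Sum>j<n. A l j x) \<le> (B + 1) / p" for n x
  proof -
    have "p * (\<Sum>j<n. A l j x) \<le> (\<Sum>j<n. (\<integral>w. H (x + runmin w j) \<partial>W) - (\<integral>w. H (x + runmin w (Suc j)) \<partial>W))"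
      unfolding sum_distrib_left by (intro sum_mono step)
    also have "\<dots> = (\<integral>w. H (x + runmin w 0) \<partial>W) - (\<integral>w. H (x + runmin w n) \<partial>W)"
      by (rule sum_lessThan_telescope')
    also have "\<dots> \<le> (\<integral>w. B + 1 \<partial>W) - 0"
      using H_bd ih by (intro diff_mono integral_mono Bochner_Integration.integral_nonneg) auto
    finally show ?thesis using eps P.prob_space by (simp add: p_def pos_le_divide_eq mult.commute)
  qed
  show ?thesis using B0 eps main by (intro exI[of _ "(B + 1) / p"]) (auto simp: p_def)
qed

end

section \<open>Survival combined with a localised endpoint\<close>

context nonlattice_walk begin

lemma G_bound': assumes l: "0 < l" shows "\<exists>C>0. \<forall>n x. G l n x \<le> C / sqrt (real n + 1)"
proof -
  obtain C where C: "C > 0" "\<And>n x. 1 \<le> n \<Longrightarrow> G l n x \<le> C / sqrt n"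
    using G_bound[OF l] by blast
  have "G l n x \<le> max 1 (sqrt 2 * C) / sqrt (real n + 1)" for n x
  proof (cases "n = 0")
    case True
    then show ?thesis using G_le_1[of l n x] l by simp
  next
    case False
    have "sqrt (real n + 1) \<le> sqrt (2 * real n)" using False by (intro real_sqrt_le_mono) simp
    then have "1 / sqrt n \<le> sqrt 2 / sqrt (real n + 1)"
      using False by (simp add: field_simps real_sqrt_mult)
    then have "C * (1 / sqrt n) \<le> C * (sqrt 2 / sqrt (real n + 1))" using C by (intro mult_left_mono) auto
    then have "G l n x \<le> sqrt 2 * C / sqrt (real n + 1)"
      using C(2)[of n x] False by (simp add: mult.commute)
    also have "\<dots> \<le> max 1 (sqrt 2 * C) / sqrt (real n + 1)" by (intro divide_right_mono) auto
    finally show ?thesis .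
  qed
  then show ?thesis by (intro exI[of _ "max 1 (sqrt 2 * C)"]) auto
qed

lemma event_product_bound:
  fixes E F :: "(nat \<Rightarrow> real) \<Rightarrow> bool"
  assumes l: "0 < l" and [measurable]: "Measurable.pred seq_borel E" "Measurable.pred seq_borel F"
    and dep: "\<And>w w'. E (comb_seq k w w') = E w"
    and c: "\<And>z. (\<integral>w. of_bool (F w) * gexp l (z + psum w m) \<partial>W) \<le> c"
  shows "(\<integral>w. of_bool (E w \<and> F (shifted k w)) * gexp l (x + psum w (k + m)) \<partial>W)
    \<le> (\<integral>w. of_bool (E w) \<partial>W) * c"
proof -
  have mE[measurable]: "Measurable.pred W E" "Measurable.pred W F" by (simp_all add: measurable_W_eq)
  let ?f = "\<lambda>w. of_bool (E w \<and> F (shifted k w)) * gexp l (x + psum w (k + m))"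
  have l0: "0 \<le> l" using l by simp
  have i: "integrable W ?f"
  proof (rule integrable_bounded[where c = 1])
    have [measurable]: "(\<lambda>w. shifted k w) \<in> measurable W seq_borel"
      by (rule measurable_shifted) (simp add: measurable_W_eq)
    show "?f \<in> borel_measurable W" by measurable
  qed (auto simp: abs_mult gexp_le_1[OF l0])
  have e: "(\<integral>w'. ?f (comb_seq k w w') \<partial>W) = of_bool (E w) * (\<integral>w'. of_bool (F w') * gexp l ((x + psum w k) + psum w' m) \<partial>W)" for w
    by (simp add: dep psum_comb_seq_ge add.assoc of_bool_conj mult.assoc)
  have "(\<integral>w. ?f w \<partial>W) = (\<integral>w. of_bool (E w) * (\<integral>w'. of_bool (F w') * gexp l ((x + psum w k) + psum w' m) \<partial>W) \<partial>W)"
    by (subst split_integral(1)[OF i, of k]) (simp only: e)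
  also have "\<dots> \<le> (\<integral>w. of_bool (E w) * c \<partial>W)"
  proof (rule integral_mono)
    show "integrable W (\<lambda>w. of_bool (E w) * (\<integral>w'. of_bool (F w') * gexp l ((x + psum w k) + psum w' m) \<partial>W))"
      using split_integral(2)[OF i, of k] by (simp only: e)
    show "integrable W (\<lambda>w. of_bool (E w) * c)"
      by (intro integrable_mult_left integrable_bounded[where c = 1]) auto
  qed (intro mult_left_mono c, simp)
  finally show ?thesis by simp
qed

lemma gexp_of_bool_integrable:
  assumes "0 \<le> l" "Measurable.pred W E"
  shows "integrable W (\<lambda>w. of_bool (E w) * gexp l (x + psum w n))"
  by (rule integrable_bounded[where c = 1]) (use assms in \<open>auto simp: abs_mult gexp_le_1\<close>)

lemma half_sqrt_product: "(real n + 1) / 2 \<le> sqrt (real (n div 2) + 1) * sqrt (real (n - n div 2) + 1)"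
proof -
  have 1: "(real n + 1) / 2 \<le> real (n div 2) + 1" by (simp add: field_simps; linarith?)
  have 2: "(real n + 1) / 2 \<le> real (n - n div 2) + 1" by (simp add: field_simps; linarith?)
  have "(real n + 1) / 2 = sqrt ((real n + 1) / 2) * sqrt ((real n + 1) / 2)" by simp
  also have "\<dots> \<le> sqrt (real (n div 2) + 1) * sqrt (real (n - n div 2) + 1)"
    using 1 2 by (intro mult_mono real_sqrt_le_mono) auto
  finally show ?thesis .
qed

text \<open>The first half of the path pays for the event and the second half, through the uniform
  bound on \<open>G\<close>, for the endpoint; each contributes a factor of order 1 / sqrt n. The
  hypothesis \<open>anti\<close> relaxes the event to its first half.\<close>

lemma halving_bound:
  fixes E :: "real \<Rightarrow> (nat \<Rightarrow> real) \<Rightarrow> nat \<Rightarrow> bool"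
  assumes l: "0 < l"
    and prob: "\<exists>C>0. \<forall>n. \<forall>t\<ge>0. (\<integral>w. of_bool (E t w n) \<partial>W) \<le> C * (1 + t) ^ 4 / sqrt (real n + 1)"
    and mE: "\<And>t n. Measurable.pred seq_borel (\<lambda>w. E t w n)"
    and dep: "\<And>t w w' k. E t (comb_seq k w w') k = E t w k"
    and anti: "\<And>t w k n. k \<le> n \<Longrightarrow> E t w n \<Longrightarrow> E t w k"
  shows "\<exists>C>0. \<forall>n x. \<forall>t\<ge>0. (\<integral>w. of_bool (E t w n) * gexp l (x + psum w n) \<partial>W) \<le> C * (1 + t) ^ 4 / (real n + 1)"
proof -
  obtain Cg where Cg: "Cg > 0" "\<And>n x. G l n x \<le> Cg / sqrt (real n + 1)" using G_bound'[OF l] by blast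
  obtain C where C: "C > 0" "\<And>n t. 0 \<le> t \<Longrightarrow> (\<integral>w. of_bool (E t w n) \<partial>W) \<le> C * (1 + t) ^ 4 / sqrt (real n + 1)"
    using prob by blast
  have "(\<integral>w. of_bool (E t w n) * gexp l (x + psum w n) \<partial>W) \<le> (2 * C * Cg) * (1 + t) ^ 4 / (real n + 1)"
    if t: "0 \<le> t" for n x t
  proof -
    let ?k = "n div 2" and ?m = "n - n div 2"
    have km: "?k + ?m = n" by simp
    have mW: "Measurable.pred W (\<lambda>w. E t w n)" for n using mE by (simp add: measurable_W_eq)
    have l0: "0 \<le> l" using l by simp
    have cg: "(\<integral>w. of_bool True * gexp l (z + psum w ?m) \<partial>W) \<le> Cg / sqrt (real ?m + 1)" for z
      using Cg(2)[of ?m z] by (simp only: G_def of_bool_eq mult_1_left)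
    have "(\<integral>w. of_bool (E t w n) * gexp l (x + psum w n) \<partial>W) \<le> (\<integral>w. of_bool (E t w ?k \<and> True) * gexp l (x + psum w (?k + ?m)) \<partial>W)"
      unfolding km using anti[of ?k n t] mW
      by (intro integral_mono gexp_of_bool_integrable l0) (auto intro!: mult_right_mono)
    also have "\<dots> \<le> (\<integral>w. of_bool (E t w ?k) \<partial>W) * (Cg / sqrt (real ?m + 1))"
      by (rule event_product_bound[OF l mE _ dep cg]) simp
    also have "\<dots> \<le> (C * (1 + t) ^ 4 / sqrt (real ?k + 1)) * (Cg / sqrt (real ?m + 1))"
      using C(2)[OF t] Cg(1) by (intro mult_right_mono) auto
    also have "\<dots> = C * Cg * (1 + t) ^ 4 * (1 / (sqrt (real ?k + 1) * sqrt (real ?m + 1)))" by simp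
    also have "\<dots> \<le> C * Cg * (1 + t) ^ 4 * (1 / ((real n + 1) / 2))"
      using half_sqrt_product[of n] C Cg t by (intro mult_left_mono divide_left_mono) auto
    also have "\<dots> = (2 * C * Cg) * (1 + t) ^ 4 / (real n + 1)" by simp
    finally show ?thesis .
  qed
  then show ?thesis using C(1) Cg(1) by (intro exI[of _ "2 * C * Cg"]) auto
qed

lemma below_G_bound:
  assumes l: "0 < l"
  shows "\<exists>C>0. \<forall>n x. \<forall>t\<ge>0. (\<integral>w. of_bool (below t w n) * gexp l (x + psum w n) \<partial>W) \<le> C * (1 + t) ^ 4 / (real n + 1)"
  by (rule halving_bound[OF l below_bound]) (auto intro: below_antimono)

lemma stays_G_bound:
  assumes l: "0 < l"
  shows "\<exists>C>0. \<forall>n x. \<forall>t\<ge>0. (\<integral>w. of_bool (stays t w n) * gexp l (x + psum w n) \<partial>W) \<le> C * (1 + t) ^ 4 / (real n + 1)"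
  by (rule halving_bound[OF l stays_bound]) (auto intro: stays_antimono)

lemma A_bound:
  assumes l: "0 < l" shows "\<exists>C>0. \<forall>n x. A l n x \<le> C / (real n + 1)"
proof -
  obtain C where C: "C > 0" "\<And>n x t. 0 \<le> t \<Longrightarrow> (\<integral>w. of_bool (below t w n) * gexp l (x + psum w n) \<partial>W) \<le> C * (1 + t) ^ 4 / (real n + 1)"
    using below_G_bound[OF l] by blast
  have "A l n x \<le> C / (real n + 1)" for n x
  proof -
    have l0: "0 \<le> l" using l by simp
    have "A l n x = (\<integral>w. of_bool (ladder (reversal n w) n) * gexp l (x + psum (reversal n w) n) \<partial>W)"
      unfolding A_def by (rule integral_reversal[symmetric]) measurable
    also have "\<dots> \<le> (\<integral>w. of_bool (below 0 w n) * gexp l (x + psum w n) \<partial>W)"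
      unfolding psum_reversal_self using ladder_reversal_below[of n]
      by (intro integral_mono gexp_of_bool_integrable l0) auto
    also have "\<dots> \<le> C / (real n + 1)" using C(2)[of 0 n x] by simp
    finally show ?thesis .
  qed
  then show ?thesis using C(1) by blast
qed

lemma near_min_bound:
  assumes l: "0 < l"
  shows "\<exists>C>0. \<forall>n x. \<forall>y\<ge>0. (\<integral>w. of_bool (psum w n - runmin w n \<le> y) * gexp l (x + psum w n) \<partial>W)
    \<le> C * (1 + y) ^ 4 / (real n + 1)"
proof -
  obtain C where C: "C > 0" "\<And>n x t. 0 \<le> t \<Longrightarrow> (\<integral>w. of_bool (below t w n) * gexp l (x + psum w n) \<partial>W) \<le> C * (1 + t) ^ 4 / (real n + 1)"
    using below_G_bound[OF l] by blast
  have "(\<integral>w. of_bool (psum w n - runmin w n \<le> y) * gexp l (x + psum w n) \<partial>W)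
    = (\<integral>w. of_bool (below y w n) * gexp l (x + psum w n) \<partial>W)" for n x y
  proof -
    have "(\<integral>w. of_bool (below y (reversal n w) n) * gexp l (x + psum (reversal n w) n) \<partial>W)
      = (\<integral>w. of_bool (below y w n) * gexp l (x + psum w n) \<partial>W)"
      by (rule integral_reversal) measurable
    then show ?thesis by (simp only: psum_reversal_self below_reversal)
  qed
  then show ?thesis using C by auto
qed

text \<open>A nonnegative path that ends at height at most y has a second half that ends within y of
  its own minimum. Survival of the first half gives n^(-1/2), and \<open>near_min_bound\<close>
  gives n^(-1) for the second.\<close>

lemma stays_window_bound:
  assumes l: "0 < l"
  shows "\<exists>C>0. \<forall>n x. \<forall>y\<ge>0. (\<integral>w. of_bool (stays 0 w n \<and> psum w n \<le> y) * gexp l (x + psum w n) \<partial>W)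
    \<le> C * (1 + y) ^ 4 / ((real n + 1) * sqrt (real n + 1))"
proof -
  obtain C where C: "C > 0" "\<And>n x y. 0 \<le> y \<Longrightarrow> (\<integral>w. of_bool (psum w n - runmin w n \<le> y) * gexp l (x + psum w n) \<partial>W)
    \<le> C * (1 + y) ^ 4 / (real n + 1)" using near_min_bound[OF l] by blast
  obtain D where D: "D > 0" "\<And>n t. 0 \<le> t \<Longrightarrow> (\<integral>w. of_bool (stays t w n) \<partial>W) \<le> D * (1 + t) ^ 4 / sqrt (real n + 1)"
    using stays_bound by blast
  have "(\<integral>w. of_bool (stays 0 w n \<and> psum w n \<le> y) * gexp l (x + psum w n) \<partial>W)
    \<le> (4 * D * C) * (1 + y) ^ 4 / ((real n + 1) * sqrt (real n + 1))" if y: "0 \<le> y" for n x y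
  proof -
    let ?k = "n div 2" and ?m = "n - n div 2"
    let ?F = "\<lambda>w. psum w ?m - runmin w ?m \<le> y"
    have l0: "0 \<le> l" using l by simp
    have km: "?k + ?m = n" by simp
    have imp: "stays 0 w ?k \<and> ?F (shifted ?k w)" if "stays 0 w n \<and> psum w n \<le> y" for w
    proof -
      obtain j where j: "j \<le> ?m" "runmin (shifted ?k w) ?m = psum (shifted ?k w) j" using runmin_attained by blast
      have "psum (shifted ?k w) ?m - psum (shifted ?k w) j = psum w n - psum w (?k + j)"
        using psum_add[of w ?k ?m] psum_add[of w ?k j] by simp
      also have "\<dots> \<le> y"
      proof -
        have "?k + j \<le> n" using j(1) by linarith
        then have "0 \<le> psum w (?k + j)" using that by (auto simp: stays_def)
        then show ?thesis using that by linarith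
      qed
      finally show ?thesis using that j stays_antimono[of ?k n 0 w] by auto
    qed
    have [measurable]: "(\<lambda>w. shifted k w) \<in> measurable W seq_borel" for k
      by (rule measurable_shifted) (simp add: measurable_W_eq)
    have "(\<integral>w. of_bool (stays 0 w n \<and> psum w n \<le> y) * gexp l (x + psum w n) \<partial>W)
      \<le> (\<integral>w. of_bool (stays 0 w ?k \<and> ?F (shifted ?k w)) * gexp l (x + psum w (?k + ?m)) \<partial>W)"
      unfolding km
    proof (rule integral_mono)
      show "integrable W (\<lambda>w. of_bool (stays 0 w n \<and> psum w n \<le> y) * gexp l (x + psum w n))"
        by (rule gexp_of_bool_integrable[OF l0]) measurable
      show "integrable W (\<lambda>w. of_bool (stays 0 w ?k \<and> ?F (shifted ?k w)) * gexp l (x + psum w n))"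
        by (rule gexp_of_bool_integrable[OF l0]) measurable
      show "of_bool (stays 0 w n \<and> psum w n \<le> y) * gexp l (x + psum w n)
        \<le> of_bool (stays 0 w ?k \<and> ?F (shifted ?k w)) * gexp l (x + psum w n)" for w
        by (intro mult_right_mono) (use imp[of w] in auto)
    qed
    also have "\<dots> \<le> (\<integral>w. of_bool (stays 0 w ?k) \<partial>W) * (C * (1 + y) ^ 4 / (real ?m + 1))"
    proof (rule event_product_bound[OF l])
      show "(\<integral>w. of_bool (?F w) * gexp l (z + psum w ?m) \<partial>W) \<le> C * (1 + y) ^ 4 / (real ?m + 1)" for z
        by (rule C(2)[OF y])
    qed auto
    also have "\<dots> \<le> (D / sqrt (real ?k + 1)) * (C * (1 + y) ^ 4 / (real ?m + 1))"
      using D(2)[of 0 ?k] C(1) y by (intro mult_right_mono) auto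
    also have "\<dots> = D * C * (1 + y) ^ 4 * (1 / (sqrt (real ?k + 1) * (real ?m + 1)))" by simp
    also have "\<dots> \<le> D * C * (1 + y) ^ 4 * (1 / ((sqrt (real n + 1) / 2) * ((real n + 1) / 2)))"
    proof (intro mult_left_mono divide_left_mono mult_mono)
      have "(real n + 1) / 4 \<le> real ?k + 1" by (simp add: field_simps; linarith?)
      then have "sqrt ((real n + 1) / 4) \<le> sqrt (real ?k + 1)" by (rule real_sqrt_le_mono)
      then show "sqrt (real n + 1) / 2 \<le> sqrt (real ?k + 1)" by (simp add: real_sqrt_divide)
      show "(real n + 1) / 2 \<le> real ?m + 1" by (simp add: field_simps; linarith?)
    qed (use C D y in auto)
    also have "\<dots> = (4 * D * C) * (1 + y) ^ 4 / ((real n + 1) * sqrt (real n + 1))" by (simp add: field_simps)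
    finally show ?thesis .
  qed
  then show ?thesis using C(1) D(1) by (intro exI[of _ "4 * D * C"]) auto
qed

lemma summable_poly_exp: "0 < c \<Longrightarrow> summable (\<lambda>i. exp (- (c * real i)) * (2 + real i) ^ 4)"
proof -
  assume c: "0 < c"
  have "(\<lambda>i. exp (- (c * real i)) * (2 + real i) ^ 4) \<in> O(\<lambda>i. 1 / real i ^ 2)"
    using c by real_asymp
  moreover have "summable (\<lambda>i. norm (1 / real i ^ 2))"
    using inverse_power_summable[of 2] by (simp add: inverse_eq_divide)
  ultimately show ?thesis by (rule summable_comparison_test_bigo[rotated])
qed

lemma Q_0_bound:
  assumes l: "0 < l"
  shows "\<exists>C>0. \<forall>n. Q l n 0 \<le> C / ((real n + 1) * sqrt (real n + 1))"
proof -
  have l2: "0 < l / 2" using l by simp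
  obtain C where C: "C > 0" "\<And>n x y. 0 \<le> y \<Longrightarrow> (\<integral>w. of_bool (stays 0 w n \<and> psum w n \<le> y) * gexp (l / 2) (x + psum w n) \<partial>W)
    \<le> C * (1 + y) ^ 4 / ((real n + 1) * sqrt (real n + 1))" using stays_window_bound[OF l2] by blast
  \<comment> \<open>Half of the exponential rate is spent on summing over slices of the endpoint;
    the other half remains as \<open>gexp (l / 2)\<close> for the local bound. The factor (2 + i)^4
    is (1 + y)^4 at y = i + 1.\<close>
  define f where "f i = exp (- (l / 2 * real i)) * (2 + real i) ^ 4" for i :: nat
  define S where "S = (\<Sum>i. f i)"
  have sf: "summable f" unfolding f_def using summable_poly_exp[OF l2] by simp
  have f0: "0 \<le> f i" for i by (simp add: f_def)
  have S: "(\<Sum>i<n. f i) \<le> S" for n unfolding S_def using sf f0 by (intro sum_le_suminf) auto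
  have Sn: "f n \<le> S" for n using S[of "Suc n"] f0 sum_nonneg[of "{..<n}" f] by simp
  have S0: "0 < S" using Sn[of 0] by (simp add: f_def)
  have "Q l n 0 \<le> (C * S + S) / ((real n + 1) * sqrt (real n + 1))" for n
  proof -
    let ?d = "(real n + 1) * sqrt (real n + 1)"
    let ?g = "\<lambda>i w. exp (- (l / 2 * real i)) * (of_bool (stays 0 w n \<and> psum w n \<le> real i + 1) * gexp (l / 2) (0 + psum w n))"
    have d: "0 < ?d" by simp
    have ig: "integrable W (?g i)" for i
      using l2 by (intro integrable_mult_right gexp_of_bool_integrable) auto
    \<comment> \<open>Finitely many slices suffice: heights of at least n carry weight at most
      \<open>exp (- (l / 2 * real n))\<close>, which is smaller than the order sought.\<close>
    have pw: "of_bool (stays 0 w n) * gexp l (0 + psum w n) \<le> (\<Sum>i<n. ?g i w) + exp (- (l / 2 * real n))" for w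
    proof (cases "stays 0 w n")
      case True
      let ?s = "psum w n"
      have s: "0 \<le> ?s" using True by (auto simp: stays_def)
      have sp: "gexp l ?s = exp (- (l / 2 * ?s)) * gexp (l / 2) ?s" using s by (simp add: gexp_def flip: exp_add)
      have g0: "0 \<le> (\<Sum>i<n. ?g i w)" by (intro sum_nonneg) simp
      show ?thesis
      proof (cases "?s < real n")
        case lt: True
        define i where "i = nat \<lfloor>?s\<rfloor>"
        have i: "real i \<le> ?s" "?s \<le> real i + 1" using s unfolding i_def by linarith+
        have "i < n" using lt i(1) by linarith
        have "l / 2 * real i \<le> l / 2 * ?s" using i l by (intro mult_left_mono) auto
        then have "gexp l ?s \<le> exp (- (l / 2 * real i)) * gexp (l / 2) ?s"
          unfolding sp by (intro mult_right_mono) auto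
        also have "\<dots> = ?g i w" using True i by simp
        also have "\<dots> \<le> (\<Sum>i<n. ?g i w)" using \<open>i < n\<close> by (intro member_le_sum) auto
        finally show ?thesis using True by (simp add: add_increasing2)
      next
        case False
        have "l / 2 * real n \<le> l / 2 * ?s" using False l by (intro mult_left_mono) auto
        then have "gexp l ?s \<le> exp (- (l / 2 * real n)) * 1"
          unfolding sp using gexp_le_1[of "l / 2"] l by (intro mult_mono) auto
        then show ?thesis using True g0 by simp
      qed
    qed (simp add: sum_nonneg)
    have c1: "Q l n 0 \<le> (\<integral>w. (\<Sum>i<n. ?g i w) + exp (- (l / 2 * real n)) \<partial>W)"
      unfolding Q_def using l ig pw
      by (intro integral_mono gexp_of_bool_integrable Bochner_Integration.integrable_add Bochner_Integration.integrable_sum) auto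
    have c2: "(\<integral>w. (\<Sum>i<n. ?g i w) + exp (- (l / 2 * real n)) \<partial>W) = (\<Sum>i<n. \<integral>w. ?g i w \<partial>W) + exp (- (l / 2 * real n))"
      using ig P.prob_space
      by (subst Bochner_Integration.integral_add) (auto intro!: Bochner_Integration.integrable_sum Bochner_Integration.integral_sum)
    have "(\<Sum>i<n. \<integral>w. ?g i w \<partial>W) \<le> (\<Sum>i<n. f i * (C / ?d))"
    proof (rule sum_mono)
      fix i
      have "(\<integral>w. ?g i w \<partial>W) \<le> exp (- (l / 2 * real i)) * (C * (1 + (real i + 1)) ^ 4 / ?d)"
        unfolding integral_mult_right_zero by (intro mult_left_mono C(2)) auto
      also have "\<dots> = f i * (C / ?d)" by (simp add: f_def add_ac)
      finally show "(\<integral>w. ?g i w \<partial>W) \<le> f i * (C / ?d)" .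
    qed
    also have "\<dots> \<le> S * (C / ?d)" unfolding sum_distrib_right[symmetric] using S C d by (intro mult_right_mono) auto
    finally have c3: "(\<Sum>i<n. \<integral>w. ?g i w \<partial>W) \<le> S * (C / ?d)" .
    have "exp (- (l / 2 * real n)) \<le> S / ?d"
    proof -
      have "exp (- (l / 2 * real n)) * ?d \<le> exp (- (l / 2 * real n)) * (2 + real n) ^ 4"
      proof (intro mult_left_mono)
        have "sqrt (real n + 1) \<le> sqrt ((real n + 1)\<^sup>2)" by (intro real_sqrt_le_mono) (simp add: power2_eq_square)
        then have "?d \<le> (2 + real n) * (2 + real n)" by (intro mult_mono) auto
        also have "\<dots> = (2 + real n)\<^sup>2" by (simp add: power2_eq_square)
        also have "\<dots> \<le> (2 + real n) ^ 4" by (intro power_increasing) auto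
        finally show "?d \<le> (2 + real n) ^ 4" .
      qed simp
      also have "\<dots> \<le> S" using Sn[of n] by (simp add: f_def)
      finally show ?thesis using d by (simp add: pos_le_divide_eq)
    qed
    then have "Q l n 0 \<le> S * (C / ?d) + S / ?d" using c1 c2 c3 by linarith
    also have "\<dots> = (C * S + S) / ?d" by (simp add: add_divide_distrib mult.commute)
    finally show ?thesis .
  qed
  moreover have "0 < C * S + S" using C(1) S0 by (intro add_pos_pos mult_pos_pos)
  ultimately show ?thesis by blast
qed

end

section \<open>Ladder times\<close>

lemma mult_gexp_le: "0 < l \<Longrightarrow> \<bar>y\<bar> * gexp l y \<le> 2 / l * gexp (l / 2) y"
proof (cases "0 \<le> y")
  case True
  assume l: "0 < l"
  have "l * y / 2 \<le> exp (l * y / 2)" using exp_ge_add_one_self[of "l * y / 2"] by linarith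
  then have "y \<le> 2 / l * exp (l * y / 2)" using l by (simp add: field_simps)
  then have "y * exp (- (l * y)) \<le> 2 / l * exp (l * y / 2) * exp (- (l * y))"
    by (rule mult_right_mono) simp
  also have "\<dots> = 2 / l * exp (- (l / 2 * y))" by (simp flip: exp_add)
  finally show ?thesis using True by (simp add: gexp_def)
qed (simp add: gexp_def)

lemma phi_plus_nonneg: "0 \<le> phi_plus s"
  by (simp add: phi_plus_def indicator_def)

lemma phi_plus_le: "phi_plus s \<le> max 0 s" and phi_plus_le_1: "phi_plus s \<le> 1"
proof -
  show "phi_plus s \<le> max 0 s" by (auto simp: phi_plus_def indicator_def intro!: mult_left_le)
  show "phi_plus s \<le> 1" using abs_mult_exp_le_1[of s] by (auto simp: phi_plus_def indicator_def)
qed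

lemma phi_plus_lipschitz: "\<bar>phi_plus s - phi_plus t\<bar> \<le> 2 * \<bar>s - t\<bar>"
proof -
  have main: "\<bar>phi_plus s - phi_plus t\<bar> \<le> 2 * \<bar>s - t\<bar>" if "0 \<le> s" "0 \<le> t" for s t
  proof -
    let ?f = "\<lambda>s::real. s * exp (- s\<^sup>2 / 2)"
    have d: "(?f has_field_derivative ((1 - u\<^sup>2) * exp (- u\<^sup>2 / 2))) (at u within UNIV)" for u
      by (auto intro!: derivative_eq_intros simp: field_simps power2_eq_square)
    have b: "norm ((1 - u\<^sup>2) * exp (- u\<^sup>2 / 2)) \<le> 2" for u :: real
    proof -
      have "\<bar>1 - u\<^sup>2\<bar> \<le> 1 + u\<^sup>2" by (simp add: abs_le_iff)
      also have "\<dots> \<le> 2 * (1 + u\<^sup>2 / 2)" by simp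
      also have "\<dots> \<le> 2 * exp (u\<^sup>2 / 2)" by (intro mult_left_mono exp_ge_add_one_self) simp
      finally have "\<bar>1 - u\<^sup>2\<bar> * exp (- u\<^sup>2 / 2) \<le> 2 * exp (u\<^sup>2 / 2) * exp (- u\<^sup>2 / 2)"
        by (rule mult_right_mono) simp
      also have "\<dots> = 2" by (simp flip: exp_add)
      finally show ?thesis by (simp add: abs_mult)
    qed
    have "\<bar>?f s - ?f t\<bar> \<le> 2 * \<bar>s - t\<bar>"
      using field_differentiable_bound[OF convex_UNIV d b, of s t] by simp
    then show ?thesis using that by (simp add: phi_plus_def)
  qed
  have neg: "phi_plus s = 0" if "s < 0" for s using that by (simp add: phi_plus_def)
  consider "0 \<le> s" "0 \<le> t" | "s < 0" "t < 0" | "s < 0" "0 \<le> t" | "0 \<le> s" "t < 0" by linarith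
  then show ?thesis
  proof cases
    case 3
    then show ?thesis using phi_plus_le[of t] phi_plus_nonneg[of t] neg[of s] by simp
  next
    case 4
    then show ?thesis using phi_plus_le[of s] phi_plus_nonneg[of s] neg[of t] by simp
  qed (use main neg in auto)
qed

section \<open>The limit profile of \<open>Gneg\<close>\<close>

context nonlattice_walk begin

text \<open>The limit of \<open>Gneg l n x\<close> with s = x / (\<sigma> * sqrt n): the local limit
  of \<open>G l n x\<close> multiplied by x. Up to the constant it is the Rayleigh density.\<close>

definition rayleigh :: "real \<Rightarrow> real \<Rightarrow> real" where
  "rayleigh l s = phi_plus s / (l * sqrt (2 * pi))"

lemma rayleigh_bounds:
  assumes "0 < l"
  shows "0 \<le> rayleigh l s" "rayleigh l s \<le> 1 / l" "\<bar>rayleigh l s - rayleigh l t\<bar> \<le> 2 / l * \<bar>s - t\<bar>"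
proof -
  have p: "1 \<le> sqrt (2 * pi)" using pi_gt3 by (intro real_le_rsqrt) simp
  have d: "0 < l * sqrt (2 * pi)" "l \<le> l * sqrt (2 * pi)" using assms p by auto
  show "0 \<le> rayleigh l s" using phi_plus_nonneg[of s] assms by (simp add: rayleigh_def)
  show "rayleigh l s \<le> 1 / l"
    unfolding rayleigh_def using phi_plus_le_1[of s] d assms by (intro frac_le) auto
  have "\<bar>rayleigh l s - rayleigh l t\<bar> = \<bar>phi_plus s - phi_plus t\<bar> / (l * sqrt (2 * pi))"
    using d by (simp add: rayleigh_def flip: diff_divide_distrib)
  also have "\<dots> \<le> 2 * \<bar>s - t\<bar> / l"
    using phi_plus_lipschitz[of s t] d assms by (intro frac_le) auto
  finally show "\<bar>rayleigh l s - rayleigh l t\<bar> \<le> 2 / l * \<bar>s - t\<bar>" by simp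
qed

lemma Gneg_neg: "x < 0 \<Longrightarrow> Gneg l n x = 0"
proof -
  assume x: "x < 0"
  have "max 0 (- psum w n) * gexp l (x + psum w n) = 0" for w using x by (auto simp: gexp_def max_def)
  then show ?thesis by (simp only: Gneg_def Bochner_Integration.integral_zero)
qed

text \<open>Where the weight counts, \<open>- psum w n\<close> is close to x. The difference is at
  most \<open>x + psum w n\<close> in modulus, which the exponential absorbs at half its
  rate.\<close>

lemma Gneg_close_to_G:
  assumes l: "0 < l" and x: "0 \<le> x"
  shows "\<bar>Gneg l n x - x * G l n x\<bar> \<le> 2 / l * G (l / 2) n x"
proof -
  have l0: "0 \<le> l" "0 \<le> l / 2" using l by auto
  note i1 = Gneg_integrable[OF l0(1), of n x] and i2 = G_integrable[OF l0(1), of x n]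
    and i3 = G_integrable[OF l0(2), of x n]
  have "\<bar>Gneg l n x - x * G l n x\<bar> = \<bar>\<integral>w. max 0 (- psum w n) * gexp l (x + psum w n) - x * gexp l (x + psum w n) \<partial>W\<bar>"
    unfolding Gneg_def G_def using i1 i2 by (subst Bochner_Integration.integral_diff) auto
  also have "\<dots> \<le> (\<integral>w. 2 / l * gexp (l / 2) (x + psum w n) \<partial>W)"
  proof (rule order_trans[OF integral_abs_bound], rule integral_mono)
    show "integrable W (\<lambda>w. \<bar>max 0 (- psum w n) * gexp l (x + psum w n) - x * gexp l (x + psum w n)\<bar>)"
      using i1 i2 by (intro integrable_abs Bochner_Integration.integrable_diff) auto
    show "integrable W (\<lambda>w. 2 / l * gexp (l / 2) (x + psum w n))" using i3 by simp
    fix w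
    have "\<bar>max 0 (- psum w n) - x\<bar> * gexp l (x + psum w n) \<le> \<bar>x + psum w n\<bar> * gexp l (x + psum w n)"
      using x by (intro mult_right_mono) auto
    also have "\<dots> \<le> 2 / l * gexp (l / 2) (x + psum w n)" by (rule mult_gexp_le[OF l])
    finally show "\<bar>max 0 (- psum w n) * gexp l (x + psum w n) - x * gexp l (x + psum w n)\<bar>
        \<le> 2 / l * gexp (l / 2) (x + psum w n)"
      by (simp add: abs_mult flip: left_diff_distrib)
  qed
  also have "\<dots> = 2 / l * G (l / 2) n x" by (simp add: G_def)
  finally show ?thesis .
qed

text \<open>The range of x is unbounded below, since the lemma is applied at x plus the value at a
  ladder time. For negative x both terms vanish.\<close>

lemma Gneg_limit:
  assumes l: "0 < l" and K: "0 < K" and e: "0 < e"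
  shows "\<forall>\<^sub>F n in sequentially. \<forall>x \<le> K * sqrt n. \<bar>Gneg l n x - rayleigh l (x / (\<sigma> * sqrt n))\<bar> \<le> e"
proof -
  have l2: "0 < l / 2" using l by simp
  obtain C where C: "C > 0" "\<And>n x. G (l / 2) n x \<le> C / sqrt (real n + 1)" using G_bound'[OF l2] by blast
  have "(\<lambda>n. 2 / l * (C / sqrt (real n + 1))) \<longlonglongrightarrow> 0" by real_asymp
  then have 1: "\<forall>\<^sub>F n in sequentially. 2 / l * (C / sqrt (real n + 1)) < e / 2"
    by (rule order_tendstoD) (use e in simp)
  have 2: "\<forall>\<^sub>F n in sequentially. \<forall>x. \<bar>sqrt n * G l n x - std_normal_density (x / (\<sigma> * sqrt n)) / (\<sigma> * l)\<bar> \<le> e / (2 * K)"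
    by (rule local_limit[OF l]) (use e K in simp)
  show ?thesis
    using 1 2 eventually_ge_at_top[of 1]
  proof eventually_elim
    case (elim n)
    have sn: "0 < sqrt n" using elim by simp
    show ?case
    proof (intro allI impI)
      fix x assume x: "x \<le> K * sqrt n"
      show "\<bar>Gneg l n x - rayleigh l (x / (\<sigma> * sqrt n))\<bar> \<le> e"
      proof (cases "x < 0")
        case True
        then have "x / (\<sigma> * sqrt n) < 0" using sn sigma_pos by (simp add: divide_neg_pos)
        then have "rayleigh l (x / (\<sigma> * sqrt n)) = 0" by (simp add: rayleigh_def phi_plus_def)
        then show ?thesis using True e by (simp add: Gneg_neg)
      next
        case False
        let ?s = "x / (\<sigma> * sqrt n)"
        have s: "0 \<le> ?s" using False sn sigma_pos by simp
        have r: "rayleigh l ?s = x / sqrt n * (std_normal_density ?s / (\<sigma> * l))"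
          using s sigma_pos by (simp add: rayleigh_def phi_plus_def std_normal_density_def)
        have xg: "x * G l n x = x / sqrt n * (sqrt n * G l n x)" using sn by simp
        have "\<bar>x * G l n x - rayleigh l ?s\<bar> = x / sqrt n * \<bar>sqrt n * G l n x - std_normal_density ?s / (\<sigma> * l)\<bar>"
          unfolding r xg by (simp only: right_diff_distrib[symmetric] abs_mult) (use False sn in simp)
        also have "\<dots> \<le> K * (e / (2 * K))"
          using x False sn elim K by (intro mult_mono) (auto simp: pos_divide_le_eq)
        also have "\<dots> = e / 2" using K by simp
        finally have a: "\<bar>x * G l n x - rayleigh l ?s\<bar> \<le> e / 2" .
        have "\<bar>Gneg l n x - x * G l n x\<bar> \<le> 2 / l * G (l / 2) n x"
          using Gneg_close_to_G[OF l] False by simp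
        also have "\<dots> \<le> 2 / l * (C / sqrt (real n + 1))" using C(2) l by (intro mult_left_mono) auto
        finally show ?thesis using a elim(1) by linarith
      qed
    qed
  qed
qed

text \<open>A fixed lag k and a fixed shift z disappear in the limit, because
  \<open>rayleigh\<close> is bounded and Lipschitz and its argument moves by an amount that vanishes
  uniformly on the range considered.\<close>

lemma Gneg_limit_perturbed:
  assumes l: "0 < l" and K: "0 < K" and e: "0 < e" and z: "0 \<le> z"
  shows "\<forall>\<^sub>F i in sequentially. \<forall>w \<le> K * sqrt i.
    \<bar>Gneg l (i - k) (w - z) / real (i - k) - rayleigh l (w / (\<sigma> * sqrt i)) / i\<bar> \<le> e / i"
proof -
  \<comment> \<open>The 1 yields the bound 1 / l + 1 on \<open>Gneg\<close>; e / 6 is this term's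
    share of the error, next to e / 3 for each of the other two.\<close>
  define e' where "e' = min 1 (e / 6)"
  have e': "0 < e'" using e by (simp add: e'_def)
  have e6: "e' \<le> e / 6" unfolding e'_def by (rule min.cobounded2)
  \<comment> \<open>Eventually i <= 4 * (i - k), so sqrt i is at most twice sqrt (i - k); this is
    why the limit is taken on the range with constant 2 * K.\<close>
  have K2: "0 < 2 * K" using K by simp
  let ?B = "1 / l + 1"
  have "\<forall>\<^sub>F i in sequentially. \<forall>x \<le> 2 * K * sqrt (i - k). \<bar>Gneg l (i - k) x - rayleigh l (x / (\<sigma> * sqrt (i - k)))\<bar> \<le> e'"
    using eventually_compose_filterlim[OF Gneg_limit[OF l K2 e'] filterlim_minus_const_nat_at_top[of k]] .
  moreover have "\<forall>\<^sub>F i in sequentially. i \<ge> 2 * k + 1" by (rule eventually_ge_at_top)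
  moreover have "\<forall>\<^sub>F i::nat in sequentially. ?B * (real i / (real i - real k) - 1) < e / 3"
  proof -
    have "(\<lambda>i::nat. ?B * (real i / (real i - real k) - 1)) \<longlonglongrightarrow> 0" using l by real_asymp
    then show ?thesis by (rule order_tendstoD) (use e in simp)
  qed
  moreover have "\<forall>\<^sub>F i::nat in sequentially. 2 / l * (K / \<sigma> * (sqrt (real i) / sqrt (real i - real k) - 1) + z / (\<sigma> * sqrt (real i - real k))) < e / 3"
  proof -
    have "(\<lambda>i::nat. 2 / l * (K / \<sigma> * (sqrt (real i) / sqrt (real i - real k) - 1) + z / (\<sigma> * sqrt (real i - real k)))) \<longlonglongrightarrow> 0"
      using l sigma_pos by real_asymp
    then show ?thesis by (rule order_tendstoD) (use e in simp)
  qed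
  ultimately show ?thesis
  proof eventually_elim
    case (elim i)
    have ik: "real (i - k) = real i - real k" "0 < real i - real k" "0 < real i" using elim(2) by auto
    have "real (2 * k + 1) \<le> real i" using elim(2) by (simp only: of_nat_le_iff)
    then have ik2: "real i \<le> 4 * (real i - real k)" by simp
    let ?q = "sqrt (real i - real k)" and ?p = "sqrt (real i)"
    have q: "0 < ?q" "?q \<le> ?p" "0 < ?p" using ik by auto
    have p2q: "?p \<le> 2 * ?q"
      using real_sqrt_le_mono[OF ik2] by (simp only: real_sqrt_mult real_sqrt_four)
    show ?case
    proof (intro allI impI)
      fix w assume w: "w \<le> K * sqrt i"
      have wz: "w - z \<le> 2 * K * sqrt (i - k)"
      proof (cases "0 \<le> w")
        case True
        have "K * ?p \<le> K * (2 * ?q)" using p2q K by (intro mult_left_mono) auto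
        then show ?thesis using w z by (simp add: ik)
      next
        case False
        moreover have "0 \<le> 2 * K * sqrt (i - k)" using K by simp
        ultimately show ?thesis using z by linarith
      qed
      let ?a = "Gneg l (i - k) (w - z)" and ?r1 = "rayleigh l ((w - z) / (\<sigma> * ?q))" and ?r = "rayleigh l (w / (\<sigma> * ?p))"
      have a1: "\<bar>?a - ?r1\<bar> \<le> e'" using elim(1) wz by (simp add: ik)
      have a2: "?a \<le> ?B" using a1 rayleigh_bounds(2)[OF l, of "(w - z) / (\<sigma> * ?q)"] by (simp add: e'_def abs_le_iff)
      have r1: "\<bar>?r1 - ?r\<bar> \<le> e / 3"
      proof (cases "0 \<le> w")
        case True
        have "\<bar>(w - z) / (\<sigma> * ?q) - w / (\<sigma> * ?p)\<bar> = \<bar>w / \<sigma> * (1 / ?q - 1 / ?p) - z / (\<sigma> * ?q)\<bar>"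
          by (rule arg_cong[of _ _ abs]) (simp add: diff_divide_distrib right_diff_distrib)
        also have "\<dots> \<le> w / \<sigma> * (1 / ?q - 1 / ?p) + z / (\<sigma> * ?q)"
        proof -
          have "0 \<le> w / \<sigma> * (1 / ?q - 1 / ?p)" using True sigma_pos q by (simp add: frac_le)
          moreover have "0 \<le> z / (\<sigma> * ?q)" using z sigma_pos q by simp
          ultimately show ?thesis by linarith
        qed
        also have "w / \<sigma> * (1 / ?q - 1 / ?p) \<le> K * ?p / \<sigma> * (1 / ?q - 1 / ?p)"
          using w sigma_pos q by (intro mult_right_mono divide_right_mono) (auto simp: frac_le)
        also have "K * ?p / \<sigma> * (1 / ?q - 1 / ?p) = K / \<sigma> * (?p / ?q - 1)"
          using sigma_pos q by (simp add: field_simps)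
        finally have "\<bar>(w - z) / (\<sigma> * ?q) - w / (\<sigma> * ?p)\<bar> \<le> K / \<sigma> * (?p / ?q - 1) + z / (\<sigma> * ?q)" by simp
        then have "2 / l * \<bar>(w - z) / (\<sigma> * ?q) - w / (\<sigma> * ?p)\<bar> \<le> 2 / l * (K / \<sigma> * (?p / ?q - 1) + z / (\<sigma> * ?q))"
          using l by (intro mult_left_mono) auto
        then show ?thesis using rayleigh_bounds(3)[OF l, of "(w - z) / (\<sigma> * ?q)" "w / (\<sigma> * ?p)"] elim(4) by linarith
      next
        case False
        then have "(w - z) / (\<sigma> * ?q) < 0" "w / (\<sigma> * ?p) < 0" using z q sigma_pos by (auto intro!: divide_neg_pos)
        then have "?r1 = 0" "?r = 0" by (simp_all add: rayleigh_def phi_plus_def)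
        then show ?thesis using e by simp
      qed
      have a3: "\<bar>real i / (real i - real k) * ?a - ?a\<bar> \<le> e / 3"
      proof -
        have f: "0 \<le> real i / (real i - real k) - 1" using ik by (simp add: field_simps)
        have "real i / (real i - real k) * ?a - ?a = (real i / (real i - real k) - 1) * ?a"
          by (simp add: left_diff_distrib)
        then have "\<bar>real i / (real i - real k) * ?a - ?a\<bar> = (real i / (real i - real k) - 1) * ?a"
          using abs_of_nonneg[OF mult_nonneg_nonneg[OF f Gneg_nonneg[of l "i - k" "w - z"]]] by simp
        also have "\<dots> \<le> (real i / (real i - real k) - 1) * ?B" using f a2 by (intro mult_left_mono) auto
        also have "\<dots> \<le> e / 3" using elim(3) by (simp add: mult.commute)
        finally show ?thesis .
      qed
      have "\<bar>real i / (real i - real k) * ?a - ?r\<bar> \<le> e"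
        using a1 a3 r1 e6 e by linarith
      then have "\<bar>real i / (real i - real k) * ?a - ?r\<bar> / i \<le> e / i" using ik by (intro divide_right_mono) auto
      moreover have "\<bar>real i / (real i - real k) * ?a - ?r\<bar> / i = \<bar>?a / real (i - k) - ?r / i\<bar>"
      proof -
        have "\<bar>real i / (real i - real k) * ?a - ?r\<bar> / i = \<bar>(real i / (real i - real k) * ?a - ?r) / i\<bar>" by simp
        also have "(real i / (real i - real k) * ?a - ?r) / i = ?a / real (i - k) - ?r / i"
          using ik by (simp add: diff_divide_distrib)
        finally show ?thesis .
      qed
      ultimately show "\<bar>?a / real (i - k) - ?r / i\<bar> \<le> e / i" by simp
    qed
  qed
qed

section \<open>Ladder points weighted by their depth\<close>

lemma ladder_prob_sum: "\<exists>C>0. \<forall>n. (\<Sum>j<n. \<integral>w. of_bool (ladder w j) \<partial>W) \<le> C * sqrt n"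
proof -
  obtain C where C: "C > 0" "\<And>n t. 0 \<le> t \<Longrightarrow> (\<integral>w. of_bool (below t w n) \<partial>W) \<le> C * (1 + t) ^ 4 / sqrt (real n + 1)"
    using below_bound by blast
  have "(\<Sum>j<n. \<integral>w. of_bool (ladder w j) \<partial>W) \<le> C * 2 * sqrt n" for n
  proof -
    have "(\<Sum>j<n. \<integral>w. of_bool (ladder w j) \<partial>W) \<le> (\<Sum>j<n. C * (1 / sqrt (real (Suc j))))"
      using C(2)[of 0] ladder_prob_le_below by (intro sum_mono) (force intro: order_trans simp: add.commute)
    also have "\<dots> = C * (\<Sum>k=1..n. 1 / sqrt (real k))"
      by (simp add: sum_distrib_left sum.lessThan_Suc_shift sum.atLeast1_atMost_eq)
    also have "\<dots> \<le> C * (2 * sqrt n)" using C sum_inverse_sqrt_le by (intro mult_left_mono) auto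
    finally show ?thesis by simp
  qed
  then show ?thesis using C(1) by (intro exI[of _ "C * 2"]) auto
qed

text \<open>A substitute for \<open>x * A l n x\<close>: the two differ by lower order because the
  ladder point is near - x where the weight counts, but \<open>B\<close> has the additive
  decomposition \<open>ladder_weighted_decomp\<close> with terms in \<open>Gneg\<close>.\<close>

definition B :: "real \<Rightarrow> nat \<Rightarrow> real \<Rightarrow> real" where
  "B l n x = (\<integral>w. of_bool (ladder w n) * (- psum w n) * gexp l (x + psum w n) \<partial>W)"

lemma B_eq_sum:
  assumes "0 \<le> l"
  shows "B l n x = (\<Sum>j<n. (\<integral>w. of_bool (ladder w j) * Gneg l (n - j) (x + psum w j) \<partial>W) / real (n - j))"
  unfolding B_def ladder_weighted_decomp[OF assms]
  by (rule sum.reindex_bij_witness[of _ "\<lambda>j. n - j" "\<lambda>k. n - k"]) auto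

lemma B_close_to_A:
  assumes l: "0 < l"
  shows "\<bar>x * A l n x - B l n x\<bar> \<le> 2 / l * A (l / 2) n x"
proof -
  have l0: "0 \<le> l" "0 \<le> l / 2" using l by auto
  note i1 = A_integrable[OF l0(1), of n x] and i2 = A_integrable[OF l0(2), of n x]
  have i3: "integrable W (\<lambda>w. of_bool (ladder w n) * (- psum w n) * gexp l (x + psum w n))"
  proof (rule dominated_by_psum[where c = 1])
    fix w
    have "\<bar>- psum w n\<bar> * gexp l (x + psum w n) \<le> \<bar>psum w n\<bar> * 1" using gexp_le_1[OF l0(1)] by (intro mult_mono) auto
    then show "\<bar>of_bool (ladder w n) * (- psum w n) * gexp l (x + psum w n)\<bar> \<le> 1 * \<bar>psum w n\<bar>"
      by (auto simp: abs_mult)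
  qed measurable
  have "\<bar>x * A l n x - B l n x\<bar> = \<bar>\<integral>w. x * (of_bool (ladder w n) * gexp l (x + psum w n)) - of_bool (ladder w n) * (- psum w n) * gexp l (x + psum w n) \<partial>W\<bar>"
    unfolding A_def B_def using i1 i3 by (subst Bochner_Integration.integral_diff) auto
  also have "\<dots> \<le> (\<integral>w. 2 / l * (of_bool (ladder w n) * gexp (l / 2) (x + psum w n)) \<partial>W)"
  proof (rule order_trans[OF integral_abs_bound], rule integral_mono)
    show "integrable W (\<lambda>w. \<bar>x * (of_bool (ladder w n) * gexp l (x + psum w n)) - of_bool (ladder w n) * (- psum w n) * gexp l (x + psum w n)\<bar>)"
      using i1 i3 by (intro integrable_abs Bochner_Integration.integrable_diff) auto
    show "integrable W (\<lambda>w. 2 / l * (of_bool (ladder w n) * gexp (l / 2) (x + psum w n)))" using i2 by simp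
    fix w
    have "x * (of_bool (ladder w n) * gexp l (x + psum w n)) - of_bool (ladder w n) * (- psum w n) * gexp l (x + psum w n)
        = of_bool (ladder w n) * ((x + psum w n) * gexp l (x + psum w n))" by (simp add: algebra_simps)
    then show "\<bar>x * (of_bool (ladder w n) * gexp l (x + psum w n)) - of_bool (ladder w n) * (- psum w n) * gexp l (x + psum w n)\<bar>
      \<le> 2 / l * (of_bool (ladder w n) * gexp (l / 2) (x + psum w n))"
      using mult_gexp_le[OF l, of "x + psum w n"] by (simp add: abs_mult)
  qed
  also have "\<dots> = 2 / l * A (l / 2) n x" by (simp add: A_def)
  finally show ?thesis .
qed

lemma ladder_Gneg_integrable:
  assumes l: "0 \<le> l"
  shows "integrable W (\<lambda>w. of_bool (ladder w j) * Gneg l i (x + psum w j))"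
proof (rule integrable_bounded[where c = "\<sigma> * sqrt i"])
  fix w
  have "Gneg l i y \<le> \<sigma> * sqrt i" for y
  proof -
    have "Gneg l i y \<le> (\<integral>w. max 0 (- psum w i) \<partial>W)"
      unfolding Gneg_def
    proof (rule integral_mono[OF Gneg_integrable[OF l]])
      show "integrable W (\<lambda>w. max 0 (- psum w i))" by (intro integrable_max) simp_all
      show "max 0 (- psum w i) * gexp l (y + psum w i) \<le> max 0 (- psum w i)" for w
        using mult_left_mono[OF gexp_le_1[OF l, of "y + psum w i"], of "max 0 (- psum w i)"] by simp
    qed
    also have "\<dots> \<le> \<sigma> * sqrt i" by (rule expected_negative_part)
    finally show ?thesis .
  qed
  then show "\<bar>of_bool (ladder w j) * Gneg l i (x + psum w j)\<bar> \<le> \<sigma> * sqrt i"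
    using sigma_pos Gneg_nonneg[of l i "x + psum w j"] by (auto simp: abs_mult)
qed measurable

text \<open>For j close to n the long block is the one ending at the ladder time. Exchanging the
  blocks lets the uniform bound on \<open>A\<close> act on it, while the short block of length i
  contributes at most \<sigma> * sqrt i.\<close>

lemma ladder_Gneg_swap:
  assumes l: "0 \<le> l"
  shows "(\<integral>w. of_bool (ladder w j) * Gneg l i (x + psum w j) \<partial>W)
    = (\<integral>w. max 0 (- psum w i) * A l j (x + psum w i) \<partial>W)"
proof -
  let ?F = "\<lambda>w. of_bool (ladder w j) * (max 0 (- psum (shifted j w) i) * gexp l (x + psum w j + psum (shifted j w) i))"
  have [measurable]: "(\<lambda>w. shifted j w) \<in> measurable W seq_borel"
    by (rule measurable_shifted) (simp add: measurable_W_eq)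
  have i: "integrable W ?F"
  proof (rule integrable_dom[where g = "\<lambda>w. \<bar>psum w j\<bar> + \<bar>psum w (j + i)\<bar>"])
    fix w
    have "max 0 (- psum (shifted j w) i) * gexp l (x + psum w j + psum (shifted j w) i) \<le> \<bar>psum (shifted j w) i\<bar> * 1"
      using gexp_le_1[OF l] by (intro mult_mono) auto
    moreover have "\<bar>psum (shifted j w) i\<bar> \<le> \<bar>psum w j\<bar> + \<bar>psum w (j + i)\<bar>" using psum_add[of w j i] by simp
    ultimately show "\<bar>?F w\<bar> \<le> \<bar>psum w j\<bar> + \<bar>psum w (j + i)\<bar>" by (auto simp: abs_mult)
  qed (simp, measurable)
  have "(\<integral>w. ?F w \<partial>W) = (\<integral>w. of_bool (ladder w j) * Gneg l i (x + psum w j) \<partial>W)"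
    by (subst split_integral(1)[OF i, of j]) (simp add: Gneg_def)
  moreover have "(\<integral>w. ?F w \<partial>W) = (\<integral>w. max 0 (- psum w i) * A l j (x + psum w i) \<partial>W)"
  proof (subst integral_split_swap[OF i, of j], rule Bochner_Integration.integral_cong[OF refl])
    fix w'
    have "(\<integral>w. ?F (comb_seq j w w') \<partial>W) = (\<integral>w. max 0 (- psum w' i) * (of_bool (ladder w j) * gexp l (x + psum w' i + psum w j)) \<partial>W)"
      by (intro Bochner_Integration.integral_cong refl) (simp add: algebra_simps)
    then show "(\<integral>w. ?F (comb_seq j w w') \<partial>W) = max 0 (- psum w' i) * A l j (x + psum w' i)"
      by (simp add: A_def)
  qed
  ultimately show ?thesis by simp
qed

end

lemma phi_plus_measurable [measurable]: "phi_plus \<in> borel_measurable borel"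
  unfolding phi_plus_def[abs_def] by measurable

context nonlattice_walk begin

lemma rayleigh_measurable [measurable]: "rayleigh l \<in> borel_measurable borel"
  unfolding rayleigh_def[abs_def] by measurable

section \<open>Insensitivity of \<open>A\<close> to fixed lags and shifts\<close>

definition early :: "real \<Rightarrow> nat \<Rightarrow> nat set" where
  "early \<epsilon> n = {j. j < n \<and> real j \<le> (1 - \<epsilon>) * real n}"

text \<open>An intermediate quantity in which the lag k and the shift z of \<open>B_approx\<close>
  no longer occur; two values of \<open>B\<close> are compared through it.\<close>

definition B_limit :: "real \<Rightarrow> real \<Rightarrow> nat \<Rightarrow> real \<Rightarrow> real" where
  "B_limit l \<epsilon> n x = (\<Sum>j\<in>early \<epsilon> n. (\<integral>w. of_bool (ladder w j) *
     rayleigh l ((x + psum w j) / (\<sigma> * sqrt (n - j))) \<partial>W) / real (n - j))"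

text \<open>Up to the time (1 - \<epsilon>) * n the remaining block is long and \<open>Gneg\<close>
  is replaced by its limit with an error \<epsilon> / n for each ladder time, of which there are
  O(sqrt n) in mean. The later terms are O(1 / (n * sqrt i)) with i at most \<epsilon> * n, in total
  O(sqrt (\<epsilon> / n)). The constant C comes before \<epsilon>, so that \<epsilon> may be chosen
  in terms of it.\<close>

lemma B_approx:
  assumes l: "0 < l"
  shows "\<exists>C>0. \<forall>K>0. \<forall>\<epsilon>. 0 < \<epsilon> \<and> \<epsilon> \<le> 1 / 2 \<longrightarrow> (\<forall>k. \<forall>z\<ge>0. \<forall>\<^sub>F n in sequentially. \<forall>x \<le> K * sqrt n.
    sqrt n * \<bar>B l (n - k) (x - z) - B_limit l \<epsilon> n x\<bar> \<le> C * sqrt \<epsilon>)"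
proof -
  obtain Ca where Ca: "Ca > 0" "\<And>n. (\<Sum>j<n. \<integral>w. of_bool (ladder w j) \<partial>W) \<le> Ca * sqrt n"
    using ladder_prob_sum by blast
  obtain CA where CA: "CA > 0" "\<And>n x. A l n x \<le> CA / (real n + 1)" using A_bound[OF l] by blast
  have l0: "0 \<le> l" using l by simp
  have main: "\<forall>\<^sub>F n in sequentially. \<forall>x \<le> K * sqrt n.
    sqrt n * \<bar>B l (n - k) (x - z) - B_limit l \<epsilon> n x\<bar> \<le> (Ca + 4 * CA * \<sigma>) * sqrt \<epsilon>"
    if K: "0 < K" and eps: "0 < \<epsilon>" "\<epsilon> \<le> 1 / 2" and z: "0 \<le> z" for K \<epsilon> k z
  proof -
    \<comment> \<open>On the early range n - j is at least \<epsilon> * n. Therefore K * sqrt n is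
      at most K / sqrt \<epsilon> times sqrt (n - j), and the precision \<epsilon>^2 / (n - j) is at
      most \<epsilon> / n.\<close>
    have K': "0 < K / sqrt \<epsilon>" and e2: "0 < \<epsilon>\<^sup>2" using K eps by auto
    obtain N where N: "\<And>i w. N \<le> i \<Longrightarrow> w \<le> K / sqrt \<epsilon> * sqrt i \<Longrightarrow>
        \<bar>Gneg l (i - k) (w - z) / real (i - k) - rayleigh l (w / (\<sigma> * sqrt i)) / i\<bar> \<le> \<epsilon>\<^sup>2 / i"
      using Gneg_limit_perturbed[OF l K' e2 z, of k] unfolding eventually_sequentially by blast
    have "\<forall>\<^sub>F n in sequentially. real N + real k + 1 < \<epsilon> * real n"
    proof -
      have "filterlim (\<lambda>n. \<epsilon> * real n) at_top sequentially" using eps by real_asymp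
      then show ?thesis by (simp add: filterlim_at_top_dense)
    qed
    then show ?thesis
      using eventually_ge_at_top[of 1]
    proof eventually_elim
      case (elim n)
      have n: "0 < real n" "0 < sqrt n" using elim(2) by auto
      have J: "early \<epsilon> n \<subseteq> {..<n - k}" and Jf: "finite (early \<epsilon> n)"
      proof -
        show "finite (early \<epsilon> n)" by (rule finite_subset[of _ "{..<n}"]) (auto simp: early_def)
        show "early \<epsilon> n \<subseteq> {..<n - k}"
        proof
          fix j assume "j \<in> early \<epsilon> n"
          then have "real j \<le> real n - \<epsilon> * real n" by (simp add: early_def algebra_simps)
          then have "real (j + k) < real n" using elim by simp
          then have "j + k < n" by (simp only: of_nat_less_iff)
          then show "j \<in> {..<n - k}" by simp
        qed
      qed
      show ?case
      proof (intro allI impI)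
        fix x assume x: "x \<le> K * sqrt n"
        let ?b = "\<lambda>j. (\<integral>w. of_bool (ladder w j) * Gneg l (n - k - j) (x - z + psum w j) \<partial>W) / real (n - k - j)"
        let ?r = "\<lambda>j. (\<integral>w. of_bool (ladder w j) * rayleigh l ((x + psum w j) / (\<sigma> * sqrt (n - j))) \<partial>W) / real (n - j)"
        have split: "B l (n - k) (x - z) - B_limit l \<epsilon> n x = (\<Sum>j\<in>early \<epsilon> n. ?b j - ?r j) + (\<Sum>j\<in>{..<n - k} - early \<epsilon> n. ?b j)"
        proof -
          have "(\<Sum>j<n - k. ?b j) = (\<Sum>j\<in>{..<n - k} - early \<epsilon> n. ?b j) + (\<Sum>j\<in>early \<epsilon> n. ?b j)"
            by (rule sum.subset_diff[OF J]) simp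
          then show ?thesis unfolding B_eq_sum[OF l0] B_limit_def sum_subtractf by linarith
        qed
        have part1: "\<bar>\<Sum>j\<in>early \<epsilon> n. ?b j - ?r j\<bar> \<le> \<epsilon> / n * (Ca * sqrt n)"
        proof -
          have "\<bar>?b j - ?r j\<bar> \<le> \<epsilon> / n * (\<integral>w. of_bool (ladder w j) \<partial>W)" if j: "j \<in> early \<epsilon> n" for j
          proof -
            have jn: "j < n" "\<epsilon> * real n \<le> real (n - j)" using j by (auto simp: early_def of_nat_diff algebra_simps)
            have i: "N \<le> n - j" using elim jn by linarith
            have ip: "0 < real (n - j)" using jn by simp
            have ie: "n - k - j = (n - j) - k" by simp
            let ?g = "\<lambda>w. of_bool (ladder w j) * Gneg l (n - k - j) (x - z + psum w j) / real (n - k - j)"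
            let ?h = "\<lambda>w. of_bool (ladder w j) * rayleigh l ((x + psum w j) / (\<sigma> * sqrt (n - j))) / real (n - j)"
            have ig: "integrable W ?g" using ladder_Gneg_integrable[OF l0] by simp
            have ih: "integrable W ?h"
            proof (intro integrable_divide integrable_bounded[where c = "1 / l"])
              fix w show "\<bar>of_bool (ladder w j) * rayleigh l ((x + psum w j) / (\<sigma> * sqrt (n - j)))\<bar> \<le> 1 / l"
                using rayleigh_bounds(1,2)[OF l, of "(x + psum w j) / (\<sigma> * sqrt (n - j))"] l by (auto simp: abs_mult)
            qed measurable
            have "\<bar>?b j - ?r j\<bar> = \<bar>\<integral>w. ?g w - ?h w \<partial>W\<bar>"
              using ig ih by (subst Bochner_Integration.integral_diff) auto
            also have "\<dots> \<le> (\<integral>w. \<epsilon> / n * of_bool (ladder w j) \<partial>W)"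
            proof (rule order_trans[OF integral_abs_bound], rule integral_mono)
              show "integrable W (\<lambda>w. \<bar>?g w - ?h w\<bar>)" using ig ih by simp
              show "integrable W (\<lambda>w. \<epsilon> / n * of_bool (ladder w j))" using ladder_integrable by simp
              fix w
              show "\<bar>?g w - ?h w\<bar> \<le> \<epsilon> / n * of_bool (ladder w j)"
              proof (cases "ladder w j")
                case True
                have "x + psum w j \<le> K * sqrt n" using x ladder_nonpos[OF True] by simp
                also have "\<dots> = K / sqrt \<epsilon> * (sqrt \<epsilon> * sqrt n)" using eps by simp
                also have "\<dots> \<le> K / sqrt \<epsilon> * sqrt (n - j)"
                  using K eps real_sqrt_le_mono[OF jn(2)] by (intro mult_left_mono) (auto simp: real_sqrt_mult)
                finally have "\<bar>Gneg l (n - j - k) (x + psum w j - z) / real (n - j - k) - rayleigh l ((x + psum w j) / (\<sigma> * sqrt (n - j))) / real (n - j)\<bar>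
                  \<le> \<epsilon>\<^sup>2 / real (n - j)" by (rule N[OF i])
                also have "\<dots> \<le> \<epsilon>\<^sup>2 / (\<epsilon> * real n)" using jn eps n by (intro divide_left_mono) auto
                also have "\<dots> = \<epsilon> / n" using eps by (simp add: power2_eq_square)
                finally show ?thesis using True by (simp add: ie algebra_simps)
              qed simp
            qed
            finally show ?thesis by simp
          qed
          then have "\<bar>\<Sum>j\<in>early \<epsilon> n. ?b j - ?r j\<bar> \<le> (\<Sum>j\<in>early \<epsilon> n. \<epsilon> / n * (\<integral>w. of_bool (ladder w j) \<partial>W))"
            by (intro order_trans[OF sum_abs] sum_mono)
          also have "\<dots> \<le> (\<Sum>j<n. \<epsilon> / n * (\<integral>w. of_bool (ladder w j) \<partial>W))"
            using eps by (intro sum_mono2) (auto simp: early_def intro!: mult_nonneg_nonneg Bochner_Integration.integral_nonneg)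
          also have "\<dots> \<le> \<epsilon> / n * (Ca * sqrt n)"
            unfolding sum_distrib_left[symmetric] using eps Ca(2) by (intro mult_left_mono) auto
          finally show ?thesis .
        qed
        have part2: "\<bar>\<Sum>j\<in>{..<n - k} - early \<epsilon> n. ?b j\<bar> \<le> 2 * CA * \<sigma> / n * (2 * sqrt (\<epsilon> * n))"
        proof -
          have bj: "\<bar>?b j\<bar> \<le> 2 * CA * \<sigma> / n * (1 / sqrt (n - k - j))" if j: "j \<in> {..<n - k} - early \<epsilon> n" for j
          proof -
            let ?i = "n - k - j"
            have jn: "j < n" "(1 - \<epsilon>) * real n < real j" "0 < ?i" using j by (auto simp: early_def)
            have "1 / 2 * real n \<le> (1 - \<epsilon>) * real n" using eps by (intro mult_right_mono) auto
            then have j2: "real n / 2 \<le> real j + 1" using jn(2) by simp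
            have i0: "0 \<le> (\<integral>w. of_bool (ladder w j) * Gneg l ?i (x - z + psum w j) \<partial>W)"
              by (intro Bochner_Integration.integral_nonneg) (simp add: Gneg_nonneg)
            have i1: "(\<integral>w. of_bool (ladder w j) * Gneg l ?i (x - z + psum w j) \<partial>W) \<le> \<sigma> * sqrt ?i * (2 * CA / n)"
            proof -
              have "(\<integral>w. of_bool (ladder w j) * Gneg l ?i (x - z + psum w j) \<partial>W)
                = (\<integral>w. max 0 (- psum w ?i) * A l j (x - z + psum w ?i) \<partial>W)" by (rule ladder_Gneg_swap[OF l0])
              also have "\<dots> \<le> (\<integral>w. max 0 (- psum w ?i) * (2 * CA / n) \<partial>W)"
              proof (rule integral_mono_AE')
                show "integrable W (\<lambda>w. max 0 (- psum w ?i) * (2 * CA / n))" by (intro integrable_mult_left integrable_max) simp_all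
                have "A l j y \<le> 2 * CA / n" for y
                proof -
                  have "A l j y \<le> CA / (real j + 1)" by (rule CA(2))
                  also have "\<dots> \<le> CA / (real n / 2)" using CA(1) j2 n by (intro divide_left_mono) auto
                  finally show ?thesis by (simp add: mult.commute)
                qed
                then show "AE w in W. max 0 (- psum w ?i) * A l j (x - z + psum w ?i) \<le> max 0 (- psum w ?i) * (2 * CA / n)"
                  by (intro AE_I2 mult_left_mono) auto
                show "AE w in W. 0 \<le> max 0 (- psum w ?i) * (2 * CA / n)" using CA(1) by (intro AE_I2) auto
              qed
              also have "\<dots> \<le> \<sigma> * sqrt ?i * (2 * CA / n)"
                unfolding integral_mult_left_zero
                using expected_negative_part[of ?i] CA(1) n by (intro mult_right_mono) auto
              finally show ?thesis .
            qed
            have "\<bar>?b j\<bar> = (\<integral>w. of_bool (ladder w j) * Gneg l ?i (x - z + psum w j) \<partial>W) / real ?i"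
              using i0 by (simp only: abs_divide abs_of_nonneg of_nat_0_le_iff)
            also have "\<dots> \<le> \<sigma> * sqrt ?i * (2 * CA / n) / real ?i"
              by (intro divide_right_mono i1) simp
            also have "\<dots> = 2 * CA * \<sigma> / n * (sqrt ?i / real ?i)" by simp
            also have "sqrt ?i / real ?i = 1 / sqrt ?i" using jn(3) by (simp add: field_simps)
            finally show ?thesis .
          qed
          have "\<bar>\<Sum>j\<in>{..<n - k} - early \<epsilon> n. ?b j\<bar> \<le> (\<Sum>j\<in>{..<n - k} - early \<epsilon> n. 2 * CA * \<sigma> / n * (1 / sqrt (n - k - j)))"
            by (intro order_trans[OF sum_abs] sum_mono bj)
          also have "\<dots> = 2 * CA * \<sigma> / n * (\<Sum>j\<in>{..<n - k} - early \<epsilon> n. 1 / sqrt (n - k - j))"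
            by (rule sum_distrib_left[symmetric])
          also have "\<dots> \<le> 2 * CA * \<sigma> / n * (2 * sqrt (\<epsilon> * n))"
          proof (intro mult_left_mono)
            let ?m = "nat \<lfloor>\<epsilon> * n\<rfloor>"
            have m: "real ?m \<le> \<epsilon> * n" using eps by simp
            have "(\<Sum>j\<in>{..<n - k} - early \<epsilon> n. 1 / sqrt (n - k - j)) = (\<Sum>i\<in>(\<lambda>j. n - k - j) ` ({..<n - k} - early \<epsilon> n). 1 / sqrt i)"
              by (subst sum.reindex) (auto simp: inj_on_def)
            also have "\<dots> \<le> (\<Sum>i=1..?m. 1 / sqrt i)"
            proof (intro sum_mono2)
              show "(\<lambda>j. n - k - j) ` ({..<n - k} - early \<epsilon> n) \<subseteq> {1..?m}"
              proof (rule image_subsetI)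
                fix j assume j: "j \<in> {..<n - k} - early \<epsilon> n"
                then have "(1 - \<epsilon>) * real n < real j" "j < n - k" by (auto simp: early_def)
                then have "real (n - k - j) \<le> \<epsilon> * n" by (simp add: of_nat_diff algebra_simps)
                then have "n - k - j \<le> ?m" by linarith
                then show "n - k - j \<in> {1..?m}" using j by auto
              qed
            qed auto
            also have "\<dots> \<le> 2 * sqrt ?m" by (rule sum_inverse_sqrt_le)
            also have "\<dots> \<le> 2 * sqrt (\<epsilon> * n)" using m by simp
            finally show "(\<Sum>j\<in>{..<n - k} - early \<epsilon> n. 1 / sqrt (n - k - j)) \<le> 2 * sqrt (\<epsilon> * n)" .
          qed (use CA sigma_pos in auto)
          finally show ?thesis .
        qed
        have ee: "\<epsilon> \<le> sqrt \<epsilon>"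
        proof -
          have "\<epsilon>\<^sup>2 \<le> \<epsilon>" using eps by (simp add: power2_eq_square mult_left_le)
          then show ?thesis by (rule real_le_rsqrt)
        qed
        have "sqrt n * \<bar>B l (n - k) (x - z) - B_limit l \<epsilon> n x\<bar> \<le> sqrt n * (\<epsilon> / n * (Ca * sqrt n) + 2 * CA * \<sigma> / n * (2 * sqrt (\<epsilon> * n)))"
          unfolding split using part1 part2 by (intro mult_left_mono) auto
        also have "\<dots> = (sqrt n * sqrt n / n) * (\<epsilon> * Ca + 4 * CA * \<sigma> * sqrt \<epsilon>)"
        proof -
          have "q * (\<epsilon> / m * (Ca * q) + 2 * CA * \<sigma> / m * (2 * (s * q))) = (q * q / m) * (\<epsilon> * Ca + 4 * CA * \<sigma> * s)"
            for q m s :: real by (cases "m = 0") (auto simp: field_simps)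
          then show ?thesis by (simp only: real_sqrt_mult)
        qed
        also have "sqrt n * sqrt n / n = 1" using n by simp
        also have "1 * (\<epsilon> * Ca + 4 * CA * \<sigma> * sqrt \<epsilon>) \<le> (Ca + 4 * CA * \<sigma>) * sqrt \<epsilon>"
          using ee Ca(1) by (simp add: distrib_right mult.commute[of Ca] mult_right_mono)
        finally show "sqrt n * \<bar>B l (n - k) (x - z) - B_limit l \<epsilon> n x\<bar> \<le> (Ca + 4 * CA * \<sigma>) * sqrt \<epsilon>" .
      qed
    qed
  qed
  show ?thesis
    using Ca(1) CA(1) sigma_pos by (intro exI[of _ "Ca + 4 * CA * \<sigma>"]) (use main in \<open>auto intro!: add_pos_pos\<close>)
qed

text \<open>Both values of \<open>A\<close> are multiplied by x n, of order sqrt n, and replaced by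
  values of \<open>B\<close>, which are close to the same \<open>B_limit\<close>. Dividing by x n
  again turns the factor n into at most \<eta> * sqrt n, the precision that \<open>B_approx\<close>
  offers.\<close>

lemma A_regular:
  assumes l: "0 < l" and eta: "0 < \<eta>" and z: "0 \<le> z"
    and x: "\<forall>\<^sub>F n in sequentially. sqrt n / \<eta> \<le> x n \<and> x n \<le> \<eta> * sqrt n"
  shows "(\<lambda>n. n * (A l (n - k) (x n - z) - A l n (x n))) \<longlonglongrightarrow> 0"
proof (rule tendstoI)
  fix e :: real assume e: "0 < e"
  obtain C where C0: "C > 0" "\<forall>K>0. \<forall>\<epsilon>. 0 < \<epsilon> \<and> \<epsilon> \<le> 1 / 2 \<longrightarrow> (\<forall>k. \<forall>z\<ge>0. \<forall>\<^sub>F n in sequentially. \<forall>x \<le> K * sqrt n.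
    sqrt n * \<bar>B l (n - k) (x - z) - B_limit l \<epsilon> n x\<bar> \<le> C * sqrt \<epsilon>)"
    using B_approx[OF l] by (elim exE conjE) (rule that)
  have C: "0 < C" "\<forall>\<^sub>F n in sequentially. \<forall>x \<le> K * sqrt n. sqrt n * \<bar>B l (n - k) (x - z) - B_limit l \<epsilon> n x\<bar> \<le> C * sqrt \<epsilon>"
    if "0 < K" "0 < \<epsilon>" "\<epsilon> \<le> 1 / 2" "0 \<le> z" for K \<epsilon> k z
    by (rule C0(1)) (use that in \<open>simp add: C0(2)[rule_format]\<close>)
  obtain CA where CA: "CA > 0" "\<And>n x. A l n x \<le> CA / (real n + 1)" using A_bound[OF l] by blast
  have l2: "0 < l / 2" using l by simp
  obtain C2 where C2: "C2 > 0" "\<And>n x. A (l / 2) n x \<le> C2 / (real n + 1)" using A_bound[OF l2] by blast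
  \<comment> \<open>Makes \<eta> * (2 * C * sqrt \<epsilon>) at most e / 4.\<close>
  define \<epsilon> where "\<epsilon> = min (1 / 2) ((e / (8 * \<eta> * C))\<^sup>2)"
  have eps: "0 < \<epsilon>" "\<epsilon> \<le> 1 / 2" using e eta C0(1) by (auto simp: \<epsilon>_def)
  have se: "sqrt \<epsilon> \<le> e / (8 * \<eta> * C)"
  proof -
    have "sqrt \<epsilon> \<le> sqrt ((e / (8 * \<eta> * C))\<^sup>2)" unfolding \<epsilon>_def by (intro real_sqrt_le_mono min.cobounded2)
    then show ?thesis using e eta C0(1) by simp
  qed
  let ?E = "\<lambda>n. \<eta> * sqrt (real n) * (2 / l * (C2 / (real n - real k + 1)) + 2 / l * (C2 / (real n + 1)) + z * (CA / (real n - real k + 1)))"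
  have "?E \<longlonglongrightarrow> 0" using l by real_asymp
  then have 1: "\<forall>\<^sub>F n in sequentially. ?E n < e / 2" by (rule order_tendstoD) (use e in simp)
  show "\<forall>\<^sub>F n in sequentially. dist (n * (A l (n - k) (x n - z) - A l n (x n))) 0 < e"
    using 1 x C(2)[OF eta eps z, of k] C(2)[OF eta eps order_refl, of 0] eventually_ge_at_top[of "k + 1"]
  proof eventually_elim
    case (elim n)
    have n: "0 < real n" "0 < sqrt n" "real (n - k) = real n - real k" "0 < real n - real k" using elim(5) by auto
    have xp: "0 < x n" using elim(2) n eta by (meson divide_pos_pos less_le_trans)
    let ?A' = "A l (n - k) (x n - z)" and ?A = "A l n (x n)" and ?B' = "B l (n - k) (x n - z)" and ?B = "B l n (x n)"
    let ?err = "2 / l * (C2 / (real n - real k + 1)) + 2 / l * (C2 / (real n + 1)) + z * (CA / (real n - real k + 1))"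
    have b1: "\<bar>(x n - z) * ?A' - ?B'\<bar> \<le> 2 / l * (C2 / (real n - real k + 1))"
      using order_trans[OF B_close_to_A[OF l] mult_left_mono[OF C2(2)]] l n by (metis divide_nonneg_nonneg less_eq_real_def zero_le_numeral)
    have b2: "\<bar>x n * ?A - ?B\<bar> \<le> 2 / l * (C2 / (real n + 1))"
      using order_trans[OF B_close_to_A[OF l] mult_left_mono[OF C2(2)]] l by (metis divide_nonneg_nonneg less_eq_real_def zero_le_numeral)
    have "?A' \<le> CA / (real n - real k + 1)" using CA(2)[of "n - k" "x n - z"] n by simp
    then have b3: "0 \<le> z * ?A'" "z * ?A' \<le> z * (CA / (real n - real k + 1))"
      using z A_nonneg[of l "n - k" "x n - z"] by (simp, intro mult_left_mono)
    have b4: "\<bar>x n * ?A' - x n * ?A\<bar> \<le> \<bar>?B' - ?B\<bar> + ?err"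
    proof -
      have "x n * ?A' - x n * ?A = ((x n - z) * ?A' - ?B') - (x n * ?A - ?B) + (?B' - ?B) + z * ?A'"
        by (simp add: algebra_simps)
      then show ?thesis using b1 b2 b3 by linarith
    qed
    have B': "sqrt n * \<bar>?B' - ?B\<bar> \<le> 2 * C * sqrt \<epsilon>"
    proof -
      have "sqrt n * \<bar>?B' - B_limit l \<epsilon> n (x n)\<bar> \<le> C * sqrt \<epsilon>" "sqrt n * \<bar>?B - B_limit l \<epsilon> n (x n)\<bar> \<le> C * sqrt \<epsilon>"
        using elim(2,3,4) by auto
      moreover have "sqrt n * \<bar>?B' - ?B\<bar> \<le> sqrt n * (\<bar>?B' - B_limit l \<epsilon> n (x n)\<bar> + \<bar>?B - B_limit l \<epsilon> n (x n)\<bar>)"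
        using n by (intro mult_left_mono) auto
      ultimately show ?thesis by (simp add: distrib_left)
    qed
    have nx: "n / x n \<le> \<eta> * sqrt n"
    proof -
      have "real n = sqrt n * sqrt n" by simp
      also have "\<dots> \<le> (\<eta> * x n) * sqrt n" using elim(2) eta by (intro mult_right_mono) (auto simp: pos_divide_le_eq mult.commute)
      finally show ?thesis using xp by (simp add: pos_divide_le_eq mult_ac)
    qed
    have "\<bar>n * (?A' - ?A)\<bar> = n / x n * \<bar>x n * ?A' - x n * ?A\<bar>"
      using xp by (simp add: abs_mult flip: right_diff_distrib)
    also have "\<dots> \<le> \<eta> * sqrt n * (\<bar>?B' - ?B\<bar> + ?err)"
      using nx b4 xp eta by (intro mult_mono) auto
    also have "\<dots> = \<eta> * (sqrt n * \<bar>?B' - ?B\<bar>) + ?E n" by (simp add: algebra_simps)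
    also have "\<dots> < \<eta> * (2 * C * sqrt \<epsilon>) + e / 2"
      using B' eta elim(1) by (intro add_le_less_mono mult_left_mono) auto
    also have "\<dots> \<le> \<eta> * (2 * C * (e / (8 * \<eta> * C))) + e / 2"
      using se eta C0(1) by (intro add_right_mono mult_left_mono) auto
    also have "\<dots> \<le> e" using eta C0(1) e by simp
    finally show ?case by simp
  qed
qed

end

section \<open>Asymptotics up to a constant\<close>

lemma filterlim_half: "filterlim (\<lambda>n::nat. n div 2) at_top sequentially"
  unfolding filterlim_at_top
proof
  fix Z :: nat show "\<forall>\<^sub>F n in sequentially. Z \<le> n div 2"
    using eventually_ge_at_top[of "2 * Z"] by eventually_elim linarith
qed

context nonlattice_walk begin

lemma A_slowly_decreasing: "0 \<le> l \<Longrightarrow> 0 \<le> h \<Longrightarrow> exp (- (l * h)) * A l n x \<le> A l n (x + h)"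
proof -
  assume l: "0 \<le> l" and h: "0 \<le> h"
  have "exp (- (l * h)) * A l n x = (\<integral>w. exp (- (l * h)) * (of_bool (ladder w n) * gexp l (x + psum w n)) \<partial>W)"
    by (simp add: A_def)
  also have "\<dots> \<le> A l n (x + h)"
    unfolding A_def
  proof (intro integral_mono A_integrable l integrable_mult_right)
    fix w show "exp (- (l * h)) * (of_bool (ladder w n) * gexp l (x + psum w n)) \<le> of_bool (ladder w n) * gexp l (x + h + psum w n)"
      using gexp_shift_ge[OF l h, of "x + psum w n"] by (simp add: algebra_simps)
  qed
  finally show ?thesis .
qed

lemma scaled_A_bound:
  assumes l: "0 < l"
  shows "\<exists>C>0. \<forall>n k x. 2 * k \<le> n \<longrightarrow> n * A l (n - k) x \<le> C"
proof -
  obtain CA where CA: "CA > 0" "\<And>n x. A l n x \<le> CA / (real n + 1)" using A_bound[OF l] by blast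
  have "n * A l (n - k) x \<le> 2 * CA" if "2 * k \<le> n" for n k x
  proof -
    have "n * A l (n - k) x \<le> n * (CA / (real (n - k) + 1))" using CA(2) by (intro mult_left_mono) auto
    also have "\<dots> \<le> 2 * CA"
    proof -
      have "real (2 * k) \<le> real n" using that by (simp only: of_nat_le_iff)
      then have "real n \<le> 2 * (real (n - k) + 1)" using that by (simp add: of_nat_diff)
      then have "real n * CA \<le> 2 * (real (n - k) + 1) * CA" using CA(1) by (intro mult_right_mono) auto
      moreover have "0 < real (n - k) + 1" by simp
      ultimately show ?thesis by (simp add: pos_divide_le_eq mult_ac)
    qed
    finally show ?thesis .
  qed
  then show ?thesis using CA(1) by (intro exI[of _ "2 * CA"]) auto
qed

section \<open>First ratio: \<open>Q\<close> against \<open>A\<close>\<close>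

lemma Q_0_summable: assumes "0 < l" shows "summable (\<lambda>m. Q l m 0)"
proof -
  obtain C where C: "C > 0" "\<And>n. Q l n 0 \<le> C / ((real n + 1) * sqrt (real n + 1))" using Q_0_bound[OF assms] by blast
  have "summable (\<lambda>n::nat. C / ((real n + 1) * sqrt (real n + 1)))"
  proof (rule summable_comparison_test_bigo)
    show "summable (\<lambda>n. norm (real n powr (- 3 / 2)))" by (simp add: summable_real_powr_iff)
    show "(\<lambda>n. C / ((real n + 1) * sqrt (real n + 1))) \<in> O(\<lambda>n. real n powr (- 3 / 2))" by real_asymp
  qed
  then show ?thesis by (rule summable_comparison_test'[where N = 0]) (use C Q_nonneg in auto)
qed

lemma Q_ratio:
  assumes l: "0 < l" and eta: "0 < \<eta>"
    and x: "\<forall>\<^sub>F n in sequentially. sqrt n / \<eta> \<le> x n \<and> x n \<le> \<eta> * sqrt n"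
  shows "(\<lambda>n. n * Q l n (x n) - (\<Sum>m. Q l m 0) * (n * A l n (x n))) \<longlonglongrightarrow> 0"
proof -
  let ?q = "\<lambda>m. Q l m 0" and ?K = "\<Sum>m. Q l m 0"
  obtain CA where CA: "CA > 0" "\<And>n k x. 2 * k \<le> n \<Longrightarrow> n * A l (n - k) x \<le> CA" using scaled_A_bound[OF l] by blast
  obtain C where C: "C > 0" "\<And>n. ?q n \<le> C / ((real n + 1) * sqrt (real n + 1))" using Q_0_bound[OF l] by blast
  obtain CS where CS: "CS > 0" "\<And>n x. (\<Sum>j<n. A l j x) \<le> CS" using A_sum_bound[OF l] by blast
  note qs = Q_0_summable[OF l]
  let ?D = "\<lambda>n m. n * (A l (n - m) (x n) - A l n (x n))"
  \<comment> \<open>The sum is restricted to indices up to n / 2, where n * A l (n - m) is bounded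
    by \<open>CA\<close>; then \<open>CA * ?q m\<close> is a summable majorant for Tannery's
    theorem.\<close>
  let ?f = "\<lambda>m n. if 2 * m \<le> n then ?D n m * ?q m else 0"
  have "(\<lambda>n. \<Sum>m. ?f m n) \<longlonglongrightarrow> (\<Sum>m. 0)"
  proof (rule tannerys_theorem[THEN conjunct2, THEN conjunct2])
    fix m
    have "(\<lambda>n. ?D n m * ?q m) \<longlonglongrightarrow> 0 * ?q m"
      using A_regular[OF l eta order_refl x, of m] by (intro tendsto_mult tendsto_const) simp
    then have "(\<lambda>n. ?D n m * ?q m) \<longlonglongrightarrow> 0" by simp
    then show "(\<lambda>n. ?f m n) \<longlonglongrightarrow> 0"
      by (rule Lim_transform_eventually) (use eventually_ge_at_top[of "2 * m"] in eventually_elim, simp)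
  next
    show "summable (\<lambda>m. CA * ?q m)" using qs by (rule summable_mult)
    show "\<forall>\<^sub>F (m, n) in sequentially \<times>\<^sub>F sequentially. norm (?f m n) \<le> CA * ?q m"
    proof (rule always_eventually, clarify)
      fix m n :: nat
      show "norm (?f m n) \<le> CA * ?q m"
      proof (cases "2 * m \<le> n")
        case True
        have "0 \<le> n * A l (n - m) (x n)" "0 \<le> n * A l n (x n)" using A_nonneg by auto
        then have "\<bar>?D n m\<bar> \<le> CA" using CA(2)[OF True, of "x n"] CA(2)[of 0 n "x n"] by (simp add: right_diff_distrib abs_le_iff)
        then show ?thesis using True Q_nonneg[of l m 0] by (simp add: abs_mult mult_right_mono)
      qed (use CA Q_nonneg in simp)
    qed
  qed simp
  then have lim1: "(\<lambda>n. \<Sum>m. ?f m n) \<longlonglongrightarrow> 0" by simp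
  have lim2: "(\<lambda>n. 8 * C * CS / sqrt (real n)) \<longlonglongrightarrow> 0" by real_asymp
  have "(\<lambda>n. \<Sum>m<Suc n. ?q m) \<longlonglongrightarrow> ?K" by (rule LIMSEQ_Suc[OF summable_LIMSEQ[OF qs]])
  moreover have "filterlim (\<lambda>n::nat. n div 2) at_top sequentially"
    by (rule filterlim_half)
  ultimately have "(\<lambda>n. \<Sum>m<Suc (n div 2). ?q m) \<longlonglongrightarrow> ?K" by (rule filterlim_compose)
  then have lim3: "(\<lambda>n. CA * (?K - (\<Sum>m<Suc (n div 2). ?q m))) \<longlonglongrightarrow> CA * (?K - ?K)"
    by (intro tendsto_intros)
  have "(\<lambda>n. \<bar>\<Sum>m. ?f m n\<bar> + 8 * C * CS / sqrt (real n) + CA * (?K - (\<Sum>m<Suc (n div 2). ?q m))) \<longlonglongrightarrow> \<bar>0\<bar> + 0 + CA * (?K - ?K)"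
    by (intro tendsto_add tendsto_rabs lim1 lim2 lim3)
  then have lim: "(\<lambda>n. \<bar>\<Sum>m. ?f m n\<bar> + 8 * C * CS / sqrt (real n) + CA * (?K - (\<Sum>m<Suc (n div 2). ?q m))) \<longlonglongrightarrow> 0" by simp
  show ?thesis
  proof (rule Lim_null_comparison[OF _ lim])
    show "\<forall>\<^sub>F n in sequentially. norm (n * Q l n (x n) - ?K * (n * A l n (x n)))
      \<le> \<bar>\<Sum>m. ?f m n\<bar> + 8 * C * CS / sqrt (real n) + CA * (?K - (\<Sum>m<Suc (n div 2). ?q m))"
      using eventually_ge_at_top[of 1]
    proof eventually_elim
      case (elim n)
      let ?I = "{..n div 2}" and ?J = "{Suc (n div 2)..n}"
      have l0: "0 \<le> l" using l by simp
      have s1: "(\<Sum>m. ?f m n) = (\<Sum>m\<in>?I. ?D n m * ?q m)"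
      proof -
        have "(\<Sum>m. ?f m n) = (\<Sum>m\<in>?I. ?f m n)" by (rule suminf_finite) auto
        also have "\<dots> = (\<Sum>m\<in>?I. ?D n m * ?q m)" by (intro sum.cong) auto
        finally show ?thesis .
      qed
      have "n * Q l n (x n) = (\<Sum>k\<le>n. n * A l k (x n) * ?q (n - k))"
        unfolding Q_decomp[OF l0, of n "x n"] by (simp add: sum_distrib_left mult.assoc)
      also have "\<dots> = (\<Sum>m\<le>n. n * A l (n - m) (x n) * ?q m)"
        by (rule sum.reindex_bij_witness[of _ "\<lambda>m. n - m" "\<lambda>k. n - k"]) auto
      also have "{..n} = ?I \<union> ?J" by auto
      also have "(\<Sum>m\<in>?I \<union> ?J. n * A l (n - m) (x n) * ?q m)
          = (\<Sum>m\<in>?I. n * A l (n - m) (x n) * ?q m) + (\<Sum>m\<in>?J. n * A l (n - m) (x n) * ?q m)"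
        by (rule sum.union_disjoint) auto
      also have "(\<Sum>m\<in>?I. n * A l (n - m) (x n) * ?q m) = (\<Sum>m. ?f m n) + n * A l n (x n) * (\<Sum>m\<in>?I. ?q m)"
        unfolding s1 sum_distrib_left sum.distrib[symmetric] by (intro sum.cong) (auto simp: algebra_simps)
      finally have e: "n * Q l n (x n) - ?K * (n * A l n (x n)) = (\<Sum>m. ?f m n)
          + (\<Sum>m\<in>?J. n * A l (n - m) (x n) * ?q m) - n * A l n (x n) * (?K - (\<Sum>m\<in>?I. ?q m))"
        by (simp add: algebra_simps)
      \<comment> \<open>For m beyond n / 2 the factor \<open>?q m\<close> is of order n^(-3/2),
        while the values of A have a bounded sum by \<open>A_sum_bound\<close>; even after
        multiplication by n this vanishes.\<close>
      have b2: "\<bar>\<Sum>m\<in>?J. n * A l (n - m) (x n) * ?q m\<bar> \<le> 8 * C * CS / sqrt n"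
      proof -
        have n0: "0 < real n" using elim by simp
        have qm: "?q m \<le> C / (real n / 2 * (sqrt n / 2))" if "m \<in> ?J" for m
        proof -
          have m: "real n / 2 \<le> real m + 1" using that by auto
          then have "sqrt (real n / 4) \<le> sqrt (real m + 1)" by (intro real_sqrt_le_mono) simp
          then have "sqrt n / 2 \<le> sqrt (real m + 1)" by (simp add: real_sqrt_divide)
          then have "real n / 2 * (sqrt n / 2) \<le> (real m + 1) * sqrt (real m + 1)"
            using m n0 by (intro mult_mono) auto
          then have "C / ((real m + 1) * sqrt (real m + 1)) \<le> C / (real n / 2 * (sqrt n / 2))"
            using C(1) n0 by (intro divide_left_mono) auto
          then show ?thesis using C(2)[of m] by linarith
        qed
        have "\<bar>\<Sum>m\<in>?J. n * A l (n - m) (x n) * ?q m\<bar> = (\<Sum>m\<in>?J. n * A l (n - m) (x n) * ?q m)"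
          by (intro abs_of_nonneg sum_nonneg mult_nonneg_nonneg A_nonneg Q_nonneg) auto
        also have "\<dots> \<le> (\<Sum>m\<in>?J. n * A l (n - m) (x n) * (C / (real n / 2 * (sqrt n / 2))))"
          by (intro sum_mono mult_left_mono qm mult_nonneg_nonneg A_nonneg) auto
        also have "\<dots> = n * (C / (real n / 2 * (sqrt n / 2))) * (\<Sum>m\<in>?J. A l (n - m) (x n))"
          by (simp add: sum_distrib_left mult_ac)
        also have "(\<Sum>m\<in>?J. A l (n - m) (x n)) \<le> CS"
        proof -
          have "(\<Sum>m\<in>?J. A l (n - m) (x n)) = (\<Sum>j\<in>(\<lambda>m. n - m) ` ?J. A l j (x n))"
            by (subst sum.reindex) (auto simp: inj_on_def)
          also have "\<dots> \<le> (\<Sum>j<Suc n. A l j (x n))" by (intro sum_mono2) (auto simp: A_nonneg)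
          also have "\<dots> \<le> CS" by (rule CS(2))
          finally show ?thesis .
        qed
        then have "n * (C / (real n / 2 * (sqrt n / 2))) * (\<Sum>m\<in>?J. A l (n - m) (x n)) \<le> n * (C / (real n / 2 * (sqrt n / 2))) * CS"
          using C(1) by (intro mult_left_mono) auto
        also have "\<dots> = 4 * C * CS / sqrt n" using n0 by simp
        also have "\<dots> \<le> 8 * C * CS / sqrt n" using C(1) CS(1) by (intro divide_right_mono) auto
        finally show ?thesis by simp
      qed
      have b3: "\<bar>n * A l n (x n) * (?K - (\<Sum>m\<in>?I. ?q m))\<bar> \<le> CA * (?K - (\<Sum>m<Suc (n div 2). ?q m))"
      proof -
        have "(\<Sum>m\<in>?I. ?q m) \<le> ?K" using qs Q_nonneg by (intro sum_le_suminf) auto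
        moreover have "0 \<le> n * A l n (x n)" using A_nonneg by simp
        moreover have "n * A l n (x n) \<le> CA" using CA(2)[of 0 n "x n"] by simp
        ultimately show ?thesis unfolding lessThan_Suc_atMost abs_mult by (intro mult_mono) auto
      qed
      show ?case unfolding real_norm_def e using b2 b3 by linarith
    qed
  qed
qed

section \<open>Second ratio: \<open>Gneg\<close> against \<open>A\<close>\<close>

lemma stays_kernel_bound:
  assumes l: "0 < l" and u: "y < 0"
    and window: "\<And>i. (\<integral>w. of_bool (stays 0 w m \<and> psum w m \<le> - y) * gexp l (- real i + psum w m) \<partial>W) \<le> \<beta>"
  shows "(\<integral>w. of_bool (stays 0 w m) * max 0 (- (psum w m + y)) * A l j (x + (psum w m + y)) \<partial>W)
    \<le> - y * exp (2 * l) * \<beta> * (\<Sum>i<nat \<lceil>- y\<rceil>. A l j (x + y + (real i + 1)))"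
proof -
  have l0: "0 \<le> l" using l by simp
  \<comment> \<open>Where the integrand is positive, the position before the step y lies in [0, - y)
    and the overshoot is at most - y. On the slice [i, i + 1) slow decrease moves the argument of A
    to the right end, and \<open>gexp l (- real i + psum w m)\<close> is at least exp (- l), so it
    can stand in for the indicator of the slice. Each replacement costs a factor exp l.\<close>
  let ?g = "\<lambda>i w. - y * exp (2 * l) * A l j (x + y + (real i + 1)) *
     (of_bool (stays 0 w m \<and> psum w m \<le> - y) * gexp l (- real i + psum w m))"
  have ig: "integrable W (?g i)" for i
    by (intro integrable_mult_right gexp_of_bool_integrable l0) measurable
  have "(\<integral>w. of_bool (stays 0 w m) * max 0 (- (psum w m + y)) * A l j (x + (psum w m + y)) \<partial>W)
      \<le> (\<integral>w. (\<Sum>i<nat \<lceil>- y\<rceil>. ?g i w) \<partial>W)"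
  proof (rule integral_mono_AE')
    show "integrable W (\<lambda>w. \<Sum>i<nat \<lceil>- y\<rceil>. ?g i w)" by (intro Bochner_Integration.integrable_sum ig)
    have g0: "0 \<le> ?g i w" for i w using u A_nonneg[of l j] by (intro mult_nonneg_nonneg) auto
    then show "AE w in W. 0 \<le> (\<Sum>i<nat \<lceil>- y\<rceil>. ?g i w)" by (intro AE_I2 sum_nonneg)
    show "AE w in W. of_bool (stays 0 w m) * max 0 (- (psum w m + y)) * A l j (x + (psum w m + y)) \<le> (\<Sum>i<nat \<lceil>- y\<rceil>. ?g i w)"
    proof (rule AE_I2)
      fix w
      let ?s = "psum w m"
      show "of_bool (stays 0 w m) * max 0 (- (?s + y)) * A l j (x + (?s + y)) \<le> (\<Sum>i<nat \<lceil>- y\<rceil>. ?g i w)"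
      proof (cases "stays 0 w m \<and> ?s < - y")
        case False
        then have z: "of_bool (stays 0 w m) * max 0 (- (?s + y)) = 0" by auto
        have "0 \<le> (\<Sum>i<nat \<lceil>- y\<rceil>. ?g i w)" by (intro sum_nonneg g0)
        then show ?thesis by (simp only: z mult_zero_left)
      next
        case True
        then have s0: "0 \<le> ?s" by (auto simp: stays_def)
        define i where "i = nat \<lfloor>?s\<rfloor>"
        have i: "real i \<le> ?s" "?s < real i + 1" using s0 unfolding i_def by linarith+
        have iI: "i < nat \<lceil>- y\<rceil>" using i(1) True by linarith
        have "exp (- l) * A l j (x + (?s + y)) \<le> exp (- (l * (real i + 1 - ?s))) * A l j (x + (?s + y))"
        proof (intro mult_right_mono A_nonneg)
          have "l * (real i + 1 - ?s) \<le> l * 1" using i l by (intro mult_left_mono) auto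
          then show "exp (- l) \<le> exp (- (l * (real i + 1 - ?s)))" by simp
        qed
        also have "\<dots> \<le> A l j (x + (?s + y) + (real i + 1 - ?s))"
          using i by (intro A_slowly_decreasing[OF l0]) simp
        also have "x + (?s + y) + (real i + 1 - ?s) = x + y + (real i + 1)" by simp
        finally have "exp l * (exp (- l) * A l j (x + (?s + y))) \<le> exp l * A l j (x + y + (real i + 1))"
          by (intro mult_left_mono) auto
        then have a: "A l j (x + (?s + y)) \<le> exp l * A l j (x + y + (real i + 1))"
          by (simp add: exp_minus_inverse flip: mult.assoc)
        have "l * (?s - real i) \<le> l * 1" using i l by (intro mult_left_mono) auto
        then have "exp (- l) \<le> gexp l (- real i + ?s)" using i by (simp add: gexp_def algebra_simps)
        then have "exp l * exp (- l) \<le> exp l * gexp l (- real i + ?s)" by (intro mult_left_mono) auto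
        then have b: "1 \<le> exp l * gexp l (- real i + ?s)" by (simp add: exp_minus_inverse)
        have "of_bool (stays 0 w m) * max 0 (- (?s + y)) * A l j (x + (?s + y)) \<le> - y * (exp l * A l j (x + y + (real i + 1)))"
          using a True s0 A_nonneg u by (intro mult_mono) auto
        also have "\<dots> \<le> - y * (exp l * A l j (x + y + (real i + 1))) * (exp l * gexp l (- real i + ?s))"
        proof -
          have "0 \<le> - y * (exp l * A l j (x + y + (real i + 1)))" using u by (intro mult_nonneg_nonneg A_nonneg) auto
          from mult_left_mono[OF b this] show ?thesis by (simp only: mult_1_right)
        qed
        also have "\<dots> = ?g i w" using True by (simp add: exp_double[of l] power2_eq_square)
        also have "\<dots> \<le> (\<Sum>i<nat \<lceil>- y\<rceil>. ?g i w)" using iI g0 by (intro member_le_sum) auto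
        finally show ?thesis .
      qed
    qed
  qed
  also have "\<dots> = (\<Sum>i<nat \<lceil>- y\<rceil>. - y * exp (2 * l) * A l j (x + y + (real i + 1)) *
     (\<integral>w. of_bool (stays 0 w m \<and> psum w m \<le> - y) * gexp l (- real i + psum w m) \<partial>W))"
    using ig by (subst Bochner_Integration.integral_sum) auto
  also have "\<dots> \<le> (\<Sum>i<nat \<lceil>- y\<rceil>. - y * exp (2 * l) * A l j (x + y + (real i + 1)) * \<beta>)"
    using u A_nonneg[of l j] by (intro sum_mono mult_left_mono window mult_nonneg_nonneg) auto
  also have "\<dots> = - y * exp (2 * l) * \<beta> * (\<Sum>i<nat \<lceil>- y\<rceil>. A l j (x + y + (real i + 1)))"
    by (simp add: sum_distrib_left mult_ac)
  finally show ?thesis .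
qed

text \<open>The summand of \<open>Gneg_decomp\<close> with k = Suc m: the block after the last
  ladder time before the end.\<close>

definition last_block :: "real \<Rightarrow> nat \<Rightarrow> nat \<Rightarrow> real \<Rightarrow> real" where
  "last_block l m j x = (\<integral>w. of_bool (stays 0 w m) * max 0 (- psum w (Suc m)) * A l j (x + psum w (Suc m)) \<partial>W)"

lemma A_le_1: assumes "0 \<le> l" shows "A l j x \<le> 1"
proof -
  have "A l j x \<le> (\<integral>w. 1 \<partial>W)" unfolding A_def
    using assms by (intro integral_mono A_integrable) (auto simp: gexp_le_1)
  then show ?thesis using P.prob_space by simp
qed

lemma last_block_integrable:
  assumes l: "0 \<le> l"
  shows "integrable W (\<lambda>w. of_bool (stays 0 w m) * max 0 (- psum w (Suc m)) * A l j (x + psum w (Suc m)))"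
proof (rule integrable_dom)
  show "integrable W (\<lambda>w. \<bar>psum w (Suc m)\<bar>)" by simp
  fix w
  have "max 0 (- psum w (Suc m)) * A l j (x + psum w (Suc m)) \<le> \<bar>psum w (Suc m)\<bar> * 1"
    using A_le_1[OF l] A_nonneg[of l] by (intro mult_mono) auto
  then show "\<bar>of_bool (stays 0 w m) * max 0 (- psum w (Suc m)) * A l j (x + psum w (Suc m))\<bar> \<le> \<bar>psum w (Suc m)\<bar>"
    using A_nonneg[of l j "x + psum w (Suc m)"] by (auto simp: abs_mult)
qed measurable

text \<open>Conditioning on the last step \<open>y\<close> of the block, the position before it lies in a window of
  length \<open>- y\<close>, where the two available bounds on the walk staying nonnegative allow dominated
  convergence in \<open>y\<close>.\<close>

lemma long_last_block:
  assumes l: "0 < l"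
  shows "\<exists>\<tau>. \<tau> \<longlonglongrightarrow> 0 \<and> (\<forall>n\<ge>1. \<forall>x. n * (\<Sum>m\<in>{n div 2..<n}. last_block l m (n - Suc m) x) \<le> \<tau> n)"
proof -
  have l0: "0 \<le> l" using l by simp
  obtain C1 where C1: "C1 > 0" "\<And>n x t. 0 \<le> t \<Longrightarrow> (\<integral>w. of_bool (stays t w n) * gexp l (x + psum w n) \<partial>W) \<le> C1 * (1 + t) ^ 4 / (real n + 1)"
    using stays_G_bound[OF l] by blast
  obtain C2 where C2: "C2 > 0" "\<And>n x y. 0 \<le> y \<Longrightarrow> (\<integral>w. of_bool (stays 0 w n \<and> psum w n \<le> y) * gexp l (x + psum w n) \<partial>W)
    \<le> C2 * (1 + y) ^ 4 / ((real n + 1) * sqrt (real n + 1))" using stays_window_bound[OF l] by blast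
  obtain CS where CS: "CS > 0" "\<And>n x. (\<Sum>j<n. A l j x) \<le> CS" using A_sum_bound[OF l] by blast
  \<comment> \<open>Two bounds on the window integral, multiplied by n. The first does not grow with
    u, so that \<open>F\<close> stays below a quadratic in the step, which is integrable; the second
    grows like u^4 but tends to 0 in n for fixed u.\<close>
  define b where "b n u = min (2 * C1) (4 * C2 * (1 + u) ^ 4 / sqrt (real n))" for n :: nat and u :: real
  define F where "F n y = (let u = max 0 (- y) in u * (u + 1) * exp (2 * l) * CS * b n u)" for n :: nat and y :: real
  have b0: "0 \<le> b n u" "b n u \<le> 2 * C1" if "0 \<le> u" for n u
    using C1(1) C2(1) that by (auto simp: b_def)
  have F0: "0 \<le> F n y" for n y using b0 CS by (auto simp: F_def Let_def)
  have [measurable]: "F n \<in> borel_measurable borel" for n unfolding F_def[abs_def] b_def[abs_def] Let_def by measurable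
  let ?w = "\<lambda>w. exp (2 * l) * CS * (2 * C1) * ((w 0)\<^sup>2 + \<bar>w 0\<bar>)"
  have iw: "integrable W ?w"
    by (intro integrable_mult_right Bochner_Integration.integrable_add integrable_abs coord_integrable coord_square_integrable)
  have m0: "(\<lambda>w. w 0) \<in> borel_measurable W" by (rule coord_measurable)
  have FM: "(\<lambda>w. F n (w 0)) \<in> borel_measurable W" for n
    by (rule measurable_compose[OF m0]) measurable
  have Fw: "\<bar>F n (w 0)\<bar> \<le> ?w w" for n w
  proof -
    let ?u = "max 0 (- w 0)"
    have "\<bar>F n (w 0)\<bar> = ?u * (?u + 1) * exp (2 * l) * CS * b n ?u" using F0[of n "w 0"] by (simp add: F_def Let_def)
    also have "\<dots> \<le> ?u * (?u + 1) * exp (2 * l) * CS * (2 * C1)"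
      using b0[of ?u n] CS by (intro mult_left_mono) auto
    also have "\<dots> = exp (2 * l) * CS * (2 * C1) * (?u * (?u + 1))" by simp
    also have "\<dots> \<le> ?w w"
      using CS C1 by (intro mult_left_mono) (auto simp: max_def power2_eq_square algebra_simps)
    finally show ?thesis .
  qed
  have iF: "integrable W (\<lambda>w. F n (w 0))" for n
    by (rule integrable_dom[OF iw FM[of n]]) (rule Fw)
  have lim: "(\<lambda>n. \<integral>w. F n (w 0) \<partial>W) \<longlonglongrightarrow> (\<integral>w. 0 \<partial>W)"
  proof (rule integral_dominated_convergence[OF _ FM iw])
    show "AE w in W. (\<lambda>n. F n (w 0)) \<longlonglongrightarrow> 0"
    proof (rule AE_I2)
      fix w :: "nat \<Rightarrow> real"
      let ?u = "max 0 (- w 0)"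
      have "(\<lambda>n. ?u * (?u + 1) * exp (2 * l) * CS * (4 * C2 * (1 + ?u) ^ 4) * inverse (sqrt (real n))) \<longlonglongrightarrow>
          ?u * (?u + 1) * exp (2 * l) * CS * (4 * C2 * (1 + ?u) ^ 4) * 0"
        by (intro tendsto_intros tendsto_inverse_0_at_top filterlim_compose[OF sqrt_at_top filterlim_real_sequentially])
      then have lim0: "(\<lambda>n. ?u * (?u + 1) * exp (2 * l) * CS * (4 * C2 * (1 + ?u) ^ 4) * inverse (sqrt (real n))) \<longlonglongrightarrow> 0" by simp
      show "(\<lambda>n. F n (w 0)) \<longlonglongrightarrow> 0"
      proof (rule Lim_null_comparison[OF always_eventually lim0], rule allI)
        fix n
        have "norm (F n (w 0)) = ?u * (?u + 1) * exp (2 * l) * CS * b n ?u"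
          using F0[of n "w 0"] by (simp add: F_def Let_def)
        also have "\<dots> \<le> ?u * (?u + 1) * exp (2 * l) * CS * (4 * C2 * (1 + ?u) ^ 4 / sqrt (real n))"
          using CS by (intro mult_left_mono) (auto simp: b_def)
        finally show "norm (F n (w 0)) \<le> ?u * (?u + 1) * exp (2 * l) * CS * (4 * C2 * (1 + ?u) ^ 4) * inverse (sqrt (real n))"
          by (simp add: divide_inverse mult.assoc)
      qed
    qed
    show "AE w in W. norm (F n (w 0)) \<le> ?w w" for n using Fw by (intro AE_I2) simp
  qed simp
  have main: "n * (\<Sum>m\<in>{n div 2..<n}. last_block l m (n - Suc m) x) \<le> (\<integral>w. F n (w 0) \<partial>W)" if n: "1 \<le> n" for n x
  proof -
    have np: "0 < real n" using n by simp
    define U where "U m y = (\<integral>w. of_bool (stays 0 w m) * max 0 (- (psum w m + y)) * A l (n - Suc m) (x + (psum w m + y)) \<partial>W)" for m y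
    have [measurable]: "U m \<in> borel_measurable borel" for m unfolding U_def[abs_def] by measurable
    have UM: "(\<lambda>w. U m (w 0)) \<in> borel_measurable W" for m
      by (rule measurable_compose[OF m0]) measurable
    have U0: "0 \<le> U m y" for m y unfolding U_def by (intro Bochner_Integration.integral_nonneg) (simp add: A_nonneg)
    have Upos: "U m y = 0" if "0 \<le> y" for m y
    proof -
      have "of_bool (stays 0 w m) * max 0 (- (psum w m + y)) * A l (n - Suc m) (x + (psum w m + y)) = 0" for w
        using that by (auto simp: stays_def max_def)
      then show ?thesis by (simp only: U_def Bochner_Integration.integral_zero)
    qed
    have sumU: "n * (\<Sum>m\<in>{n div 2..<n}. U m y) \<le> F n y" for y
    proof (cases "0 \<le> y")
      case True
      then show ?thesis using F0 by (simp add: Upos)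
    next
      case False
      define u where "u = - y"
      have u: "0 < u" "y = - u" "max 0 (- y) = u" using False by (auto simp: u_def)
      have um: "U m y \<le> u * exp (2 * l) * (b n u / n) * (\<Sum>i<nat \<lceil>u\<rceil>. A l (n - Suc m) (x + y + (real i + 1)))"
        if m: "m \<in> {n div 2..<n}" for m
        unfolding U_def u_def
      proof (rule stays_kernel_bound[OF l])
        show "y < 0" using False by simp
        fix i
        have m1: "real n / 2 \<le> real m + 1" using m by auto
        have "(\<integral>w. of_bool (stays 0 w m \<and> psum w m \<le> u) * gexp l (- real i + psum w m) \<partial>W) \<le> 2 * C1 / n"
        proof -
          have "(\<integral>w. of_bool (stays 0 w m \<and> psum w m \<le> u) * gexp l (- real i + psum w m) \<partial>W)
            \<le> (\<integral>w. of_bool (stays 0 w m) * gexp l (- real i + psum w m) \<partial>W)"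
          proof (rule integral_mono)
            show "integrable W (\<lambda>w. of_bool (stays 0 w m \<and> psum w m \<le> u) * gexp l (- real i + psum w m))"
              by (rule gexp_of_bool_integrable[OF l0]) measurable
            show "integrable W (\<lambda>w. of_bool (stays 0 w m) * gexp l (- real i + psum w m))"
              by (rule gexp_of_bool_integrable[OF l0]) measurable
          qed (intro mult_right_mono, auto)
          also have "\<dots> \<le> C1 / (real m + 1)" using C1(2)[of 0 m "- real i"] by simp
          also have "\<dots> \<le> C1 / (real n / 2)" using m1 np C1(1) by (intro divide_left_mono) auto
          finally show ?thesis by (simp add: mult.commute)
        qed
        moreover have "(\<integral>w. of_bool (stays 0 w m \<and> psum w m \<le> u) * gexp l (- real i + psum w m) \<partial>W)
          \<le> 4 * C2 * (1 + u) ^ 4 / sqrt (real n) / n"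
        proof -
          have "(\<integral>w. of_bool (stays 0 w m \<and> psum w m \<le> u) * gexp l (- real i + psum w m) \<partial>W)
            \<le> C2 * (1 + u) ^ 4 / ((real m + 1) * sqrt (real m + 1))"
            by (rule C2(2)) (use u in simp)
          also have "\<dots> \<le> C2 * (1 + u) ^ 4 / ((real n / 2) * (sqrt n / 2))"
          proof (intro divide_left_mono mult_mono)
            have "sqrt (real n / 4) \<le> sqrt (real m + 1)" using m1 by (intro real_sqrt_le_mono) simp
            then show "sqrt n / 2 \<le> sqrt (real m + 1)" by (simp add: real_sqrt_divide)
          qed (use m1 np C2 u in auto)
          also have "\<dots> = 4 * C2 * (1 + u) ^ 4 / sqrt (real n) / n" by (simp add: mult.commute)
          finally show ?thesis .
        qed
        ultimately show "(\<integral>w. of_bool (stays 0 w m \<and> psum w m \<le> - y) * gexp l (- real i + psum w m) \<partial>W) \<le> b n (- y) / n"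
          unfolding u_def b_def by (auto simp: min_def)
      qed
      have "(\<Sum>m\<in>{n div 2..<n}. U m y) \<le> (\<Sum>m\<in>{n div 2..<n}. u * exp (2 * l) * (b n u / n) * (\<Sum>i<nat \<lceil>u\<rceil>. A l (n - Suc m) (x + y + (real i + 1))))"
        by (intro sum_mono um)
      also have "\<dots> = u * exp (2 * l) * (b n u / n) * (\<Sum>i<nat \<lceil>u\<rceil>. \<Sum>m\<in>{n div 2..<n}. A l (n - Suc m) (x + y + (real i + 1)))"
        unfolding sum_distrib_left[symmetric] by (subst sum.swap) simp
      also have "\<dots> \<le> u * exp (2 * l) * (b n u / n) * (\<Sum>i<nat \<lceil>u\<rceil>. CS)"
      proof (intro mult_left_mono sum_mono)
        fix i
        have "(\<Sum>m\<in>{n div 2..<n}. A l (n - Suc m) (x + y + (real i + 1))) = (\<Sum>j\<in>(\<lambda>m. n - Suc m) ` {n div 2..<n}. A l j (x + y + (real i + 1)))"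
          by (subst sum.reindex) (auto simp: inj_on_def)
        also have "\<dots> \<le> (\<Sum>j<n. A l j (x + y + (real i + 1)))" using n by (intro sum_mono2) (auto simp: A_nonneg)
        also have "\<dots> \<le> CS" by (rule CS(2))
        finally show "(\<Sum>m\<in>{n div 2..<n}. A l (n - Suc m) (x + y + (real i + 1))) \<le> CS" .
      qed (use u b0[of u n] in auto)
      also have "\<dots> \<le> u * exp (2 * l) * (b n u / n) * ((u + 1) * CS)"
      proof (intro mult_left_mono)
        have "real (nat \<lceil>u\<rceil>) \<le> u + 1" using u by linarith
        then show "(\<Sum>i<nat \<lceil>u\<rceil>. CS) \<le> (u + 1) * CS" using CS by (simp add: mult_right_mono)
      qed (use u b0[of u n] in auto)
      finally have "n * (\<Sum>m\<in>{n div 2..<n}. U m y) \<le> n * (u * exp (2 * l) * (b n u / n) * ((u + 1) * CS))"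
        by (rule mult_left_mono) simp
      also have "\<dots> = F n y" using np unfolding F_def Let_def u(3) by simp
      finally show ?thesis .
    qed
    have iU: "integrable W (\<lambda>w. U m (w 0))" if "m \<in> {n div 2..<n}" for m
    proof (rule integrable_dom[OF iF UM])
      fix w
      have "U m (w 0) \<le> (\<Sum>m\<in>{n div 2..<n}. U m (w 0))" using that U0 by (intro member_le_sum) auto
      also have "\<dots> \<le> n * (\<Sum>m\<in>{n div 2..<n}. U m (w 0))"
        using n mult_right_mono[of 1 "real n" "\<Sum>m\<in>{n div 2..<n}. U m (w 0)"] U0 by (simp add: sum_nonneg)
      also have "\<dots> \<le> F n (w 0)" by (rule sumU)
      finally show "\<bar>U m (w 0)\<bar> \<le> F n (w 0)" using U0[of m "w 0"] by simp
    qed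
    \<comment> \<open>Integrating the first m increments inside leaves the final step of the block
      as coordinate 0 of the outer path.\<close>
    have lb: "last_block l m (n - Suc m) x = (\<integral>w. U m (w 0) \<partial>W)" for m
      unfolding last_block_def U_def
      by (subst integral_split_swap[where k = m, OF last_block_integrable[OF l0]])
        (simp add: psum_comb_seq_ge psum_Suc comb_seq_def)
    have "n * (\<Sum>m\<in>{n div 2..<n}. last_block l m (n - Suc m) x) = (\<integral>w. n * (\<Sum>m\<in>{n div 2..<n}. U m (w 0)) \<partial>W)"
      unfolding lb using iU by (simp add: Bochner_Integration.integral_sum)
    also have "\<dots> \<le> (\<integral>w. F n (w 0) \<partial>W)"
      using iU iF sumU by (intro integral_mono integrable_mult_right Bochner_Integration.integrable_sum) auto
    finally show ?thesis .
  qed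
  show ?thesis using lim main by (intro exI[of _ "\<lambda>n. \<integral>w. F n (w 0) \<partial>W"]) simp
qed

text \<open>Summed over m this is the mean absolute value of the first strict descending ladder
  height. The partial sums are \<open>potential 0 n\<close>, hence bounded.\<close>

definition mean_drop :: "nat \<Rightarrow> real" where
  "mean_drop m = (\<integral>w. of_bool (stays 0 w m) * max 0 (- psum w (Suc m)) \<partial>W)"

lemma mean_drop_nonneg: "0 \<le> mean_drop m"
  unfolding mean_drop_def by (intro Bochner_Integration.integral_nonneg) simp

lemma mean_drop_summable: "summable mean_drop"
proof -
  obtain C where C: "\<And>n t. 0 \<le> t \<Longrightarrow> potential t n \<le> C * (1 + t) ^ 4" using potential_bound by blast
  have "(\<Sum>m<n. mean_drop m) = potential 0 n" for n
  proof (induction n)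
    case 0
    show ?case by (simp add: potential_def)
  next
    case (Suc n)
    then show ?case using potential_Suc[of 0 n] by (simp add: mean_drop_def)
  qed
  then show ?thesis
    using C[of 0] mean_drop_nonneg by (intro summableI_nonneg_bounded[where x = "C"]) auto
qed

lemma mean_drop_sum_pos: "0 < (\<Sum>m. mean_drop m)"
proof -
  obtain \<epsilon> where eps: "\<epsilon> > 0" "0 < measure \<nu> {..- \<epsilon>}" using exists_negative_step by blast
  have "\<epsilon> * measure \<nu> {..- \<epsilon>} = (\<integral>w. \<epsilon> * indicator {..- \<epsilon>} (w 0) \<partial>W)"
    using component_integral(1)[of "indicator {..- \<epsilon>}" 0] by (simp add: sets_nu)
  also have "\<dots> \<le> mean_drop 0"
    unfolding mean_drop_def
  proof (rule integral_mono)
    show "integrable W (\<lambda>w. \<epsilon> * indicator {..- \<epsilon>} (w 0))"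
      by (intro integrable_mult_right integrable_bounded[where c = 1]) (auto simp: coord_measurable)
    show "integrable W (\<lambda>w. of_bool (stays 0 w 0) * max 0 (- psum w (Suc 0)))"
      using overshoot_integrable[of 0 0 "Suc 0"] by simp
    show "\<epsilon> * indicator {..- \<epsilon>} (w 0) \<le> of_bool (stays 0 w 0) * max 0 (- psum w (Suc 0))" for w
      using eps by (auto simp: stays_0 psum_Suc indicator_def)
  qed
  finally have "\<epsilon> * measure \<nu> {..- \<epsilon>} \<le> mean_drop 0" .
  moreover have "0 < \<epsilon> * measure \<nu> {..- \<epsilon>}" using eps by (intro mult_pos_pos)
  ultimately have "0 < mean_drop 0" by linarith
  then show ?thesis using mean_drop_summable mean_drop_nonneg by (intro suminf_pos2[of _ 0]) auto
qed

text \<open>For last blocks of length at most n / 2, \<open>A_regular\<close> applies with lag Suc m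
  and shift equal to the depth of the block. Dominated convergence over the block and Tannery's
  theorem over m, with majorant \<open>CA * mean_drop m\<close>, pull A out;
  \<open>long_last_block\<close> covers the remaining blocks.\<close>

lemma Gneg_ratio:
  assumes l: "0 < l" and eta: "0 < \<eta>"
    and x: "\<forall>\<^sub>F n in sequentially. sqrt n / \<eta> \<le> x n \<and> x n \<le> \<eta> * sqrt n"
  shows "(\<lambda>n. Gneg l n (x n) - (\<Sum>m. mean_drop m) * (n * A l n (x n))) \<longlonglongrightarrow> 0"
proof -
  let ?h = mean_drop and ?H = "\<Sum>m. mean_drop m"
  have l0: "0 \<le> l" using l by simp
  obtain CA where CA: "CA > 0" "\<And>n k x. 2 * k \<le> n \<Longrightarrow> n * A l (n - k) x \<le> CA" using scaled_A_bound[OF l] by blast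
  obtain \<tau> where tau: "\<tau> \<longlonglongrightarrow> 0" "\<And>n x. 1 \<le> n \<Longrightarrow> n * (\<Sum>m\<in>{n div 2..<n}. last_block l m (n - Suc m) x) \<le> \<tau> n"
    using long_last_block[OF l] by blast
  let ?k = "\<lambda>m w. of_bool (stays 0 w m) * max 0 (- psum w (Suc m))"
  have ik: "integrable W (?k m)" for m using overshoot_integrable[of 0 m "Suc m"] by simp
  let ?D = "\<lambda>m n w. n * (A l (n - Suc m) (x n + psum w (Suc m)) - A l n (x n))"
  let ?f = "\<lambda>m n. if 2 * Suc m \<le> n then (\<integral>w. ?k m w * ?D m n w \<partial>W) else 0"
  have Db: "\<bar>?D m n w\<bar> \<le> CA" if "2 * Suc m \<le> n" for m n w
  proof -
    have "0 \<le> n * A l (n - Suc m) (x n + psum w (Suc m))" "0 \<le> n * A l n (x n)" using A_nonneg by auto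
    then show ?thesis using CA(2)[OF that, of "x n + psum w (Suc m)"] CA(2)[of 0 n "x n"]
      by (simp add: right_diff_distrib abs_le_iff)
  qed
  have kDb: "\<bar>?k m w * ?D m n w\<bar> \<le> CA * ?k m w" if "2 * Suc m \<le> n" for m n w
    using mult_left_mono[OF Db[OF that, of w], of "?k m w"] by (simp add: abs_mult mult.commute)
  have kDm: "(\<lambda>w. ?k m w * ?D m n w) \<in> borel_measurable W" for m n by measurable
  have iCk: "integrable W (\<lambda>w. CA * ?k m w)" for m using ik by simp
  have ikD: "integrable W (\<lambda>w. ?k m w * ?D m n w)" if "2 * Suc m \<le> n" for m n
    by (rule integrable_dom[OF iCk kDm kDb[OF that]])
  have "(\<lambda>n. \<Sum>m. ?f m n) \<longlonglongrightarrow> (\<Sum>m. 0)"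
  proof (rule tannerys_theorem[THEN conjunct2, THEN conjunct2])
    fix m
    have "(\<lambda>n. \<integral>w. (if 2 * Suc m \<le> n then ?k m w * ?D m n w else 0) \<partial>W) \<longlonglongrightarrow> (\<integral>w. 0 \<partial>W)"
    proof (rule integral_dominated_convergence[OF _ _ iCk[of m]])
      show "AE w in W. (\<lambda>n. if 2 * Suc m \<le> n then ?k m w * ?D m n w else 0) \<longlonglongrightarrow> 0"
      proof (rule AE_I2)
        fix w
        have "(\<lambda>n. ?k m w * ?D m n w) \<longlonglongrightarrow> 0"
        proof (cases "psum w (Suc m) < 0")
          case True
          then have "(\<lambda>n. ?D m n w) \<longlonglongrightarrow> 0"
            using A_regular[OF l eta _ x, of "- psum w (Suc m)" "Suc m"] by simp
          then show ?thesis by (rule tendsto_mult_right_zero)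
        qed simp
        then show "(\<lambda>n. if 2 * Suc m \<le> n then ?k m w * ?D m n w else 0) \<longlonglongrightarrow> 0"
          by (rule Lim_transform_eventually) (use eventually_ge_at_top[of "2 * Suc m"] in eventually_elim, simp)
      qed
      show "AE w in W. norm (if 2 * Suc m \<le> n then ?k m w * ?D m n w else 0) \<le> CA * ?k m w" for n
      proof (rule AE_I2)
        fix w
        show "norm (if 2 * Suc m \<le> n then ?k m w * ?D m n w else 0) \<le> CA * ?k m w"
          using kDb[of m n w] CA(1) by (cases "2 * Suc m \<le> n") auto
      qed
      show "(\<lambda>w. if 2 * Suc m \<le> n then ?k m w * ?D m n w else 0) \<in> borel_measurable W" for n
        using kDm by (cases "2 * Suc m \<le> n") simp_all
    qed simp
    then have "(\<lambda>n. \<integral>w. (if 2 * Suc m \<le> n then ?k m w * ?D m n w else 0) \<partial>W) \<longlonglongrightarrow> 0" by simp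
    moreover have "(\<integral>w. (if 2 * Suc m \<le> n then ?k m w * ?D m n w else 0) \<partial>W) = ?f m n" for n
      by (cases "2 * Suc m \<le> n") simp_all
    ultimately show "(\<lambda>n. ?f m n) \<longlonglongrightarrow> 0" by simp
  next
    show "summable (\<lambda>m. CA * ?h m)" using mean_drop_summable by (rule summable_mult)
    show "\<forall>\<^sub>F (m, n) in sequentially \<times>\<^sub>F sequentially. norm (?f m n) \<le> CA * ?h m"
    proof (rule always_eventually, clarify)
      fix m n :: nat
      show "norm (?f m n) \<le> CA * ?h m"
      proof (cases "2 * Suc m \<le> n")
        case True
        have "\<bar>\<integral>w. ?k m w * ?D m n w \<partial>W\<bar> \<le> (\<integral>w. CA * ?k m w \<partial>W)"
          by (rule order_trans[OF integral_abs_bound], rule integral_mono[OF integrable_abs[OF ikD[OF True]] iCk kDb[OF True]])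
        then show ?thesis using True by (simp add: mean_drop_def)
      qed (use CA mean_drop_nonneg in simp)
    qed
  qed simp
  then have lim1: "(\<lambda>n. \<Sum>m. ?f m n) \<longlonglongrightarrow> 0" by simp
  have "(\<lambda>n. \<Sum>m<n div 2. ?h m) \<longlonglongrightarrow> ?H"
    by (rule filterlim_compose[OF summable_LIMSEQ[OF mean_drop_summable] filterlim_half])
  then have lim3: "(\<lambda>n. CA * (?H - (\<Sum>m<n div 2. ?h m))) \<longlonglongrightarrow> CA * (?H - ?H)"
    by (intro tendsto_intros)
  have "(\<lambda>n. \<bar>\<Sum>m. ?f m n\<bar> + \<bar>\<tau> n\<bar> + CA * (?H - (\<Sum>m<n div 2. ?h m))) \<longlonglongrightarrow> \<bar>0\<bar> + \<bar>0\<bar> + CA * (?H - ?H)"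
    by (intro tendsto_add tendsto_rabs lim1 tau(1) lim3)
  then have lim: "(\<lambda>n. \<bar>\<Sum>m. ?f m n\<bar> + \<bar>\<tau> n\<bar> + CA * (?H - (\<Sum>m<n div 2. ?h m))) \<longlonglongrightarrow> 0" by simp
  show ?thesis
  proof (rule Lim_null_comparison[OF _ lim])
    show "\<forall>\<^sub>F n in sequentially. norm (Gneg l n (x n) - ?H * (n * A l n (x n)))
      \<le> \<bar>\<Sum>m. ?f m n\<bar> + \<bar>\<tau> n\<bar> + CA * (?H - (\<Sum>m<n div 2. ?h m))"
      using eventually_ge_at_top[of 1]
    proof eventually_elim
      case (elim n)
      let ?I = "{..<n div 2}" and ?J = "{n div 2..<n}"
      have s1: "(\<Sum>m. ?f m n) = (\<Sum>m\<in>?I. \<integral>w. ?k m w * ?D m n w \<partial>W)"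
      proof -
        have "(\<Sum>m. ?f m n) = (\<Sum>m\<in>?I. ?f m n)" by (rule suminf_finite) auto
        also have "\<dots> = (\<Sum>m\<in>?I. \<integral>w. ?k m w * ?D m n w \<partial>W)" by (intro sum.cong) auto
        finally show ?thesis .
      qed
      have "Gneg l n (x n) = n * (Gneg l n (x n) / n)" using elim by simp
      also have "Gneg l n (x n) / n = (\<Sum>m<n. last_block l m (n - Suc m) (x n))"
        unfolding Gneg_decomp[OF l0 elim] last_block_def
        by (rule sum.reindex_bij_witness[of _ Suc "\<lambda>k. k - 1"]) auto
      also have "{..<n} = ?I \<union> ?J" by auto
      also have "(\<Sum>m\<in>?I \<union> ?J. last_block l m (n - Suc m) (x n))
          = (\<Sum>m\<in>?I. last_block l m (n - Suc m) (x n)) + (\<Sum>m\<in>?J. last_block l m (n - Suc m) (x n))"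
        by (rule sum.union_disjoint) auto
      finally have g: "Gneg l n (x n) = (\<Sum>m\<in>?I. n * last_block l m (n - Suc m) (x n)) + n * (\<Sum>m\<in>?J. last_block l m (n - Suc m) (x n))"
        by (simp add: distrib_left sum_distrib_left)
      have "(\<Sum>m\<in>?I. n * last_block l m (n - Suc m) (x n)) = (\<Sum>m\<in>?I. (\<integral>w. ?k m w * ?D m n w \<partial>W) + n * A l n (x n) * ?h m)"
      proof (intro sum.cong refl)
        fix m assume "m \<in> ?I"
        then have m: "2 * Suc m \<le> n" by auto
        have "(\<integral>w. ?k m w * ?D m n w \<partial>W) + n * A l n (x n) * ?h m = (\<integral>w. ?k m w * ?D m n w + n * A l n (x n) * ?k m w \<partial>W)"
          unfolding mean_drop_def using ikD[OF m] ik[of m] by (subst Bochner_Integration.integral_add) auto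
        also have "\<dots> = (\<integral>w. n * (?k m w * A l (n - Suc m) (x n + psum w (Suc m))) \<partial>W)"
          by (intro Bochner_Integration.integral_cong refl) (simp add: algebra_simps)
        finally show "n * last_block l m (n - Suc m) (x n) = (\<integral>w. ?k m w * ?D m n w \<partial>W) + n * A l n (x n) * ?h m"
          by (simp add: last_block_def)
      qed
      also have "\<dots> = (\<Sum>m. ?f m n) + n * A l n (x n) * (\<Sum>m\<in>?I. ?h m)"
        unfolding s1 by (simp add: sum.distrib sum_distrib_left)
      finally have e: "Gneg l n (x n) - ?H * (n * A l n (x n)) = (\<Sum>m. ?f m n)
          + n * (\<Sum>m\<in>?J. last_block l m (n - Suc m) (x n)) - n * A l n (x n) * (?H - (\<Sum>m\<in>?I. ?h m))"
        using g by (simp add: algebra_simps)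
      have b2: "\<bar>n * (\<Sum>m\<in>?J. last_block l m (n - Suc m) (x n))\<bar> \<le> \<bar>\<tau> n\<bar>"
      proof -
        have "0 \<le> n * (\<Sum>m\<in>?J. last_block l m (n - Suc m) (x n))"
          unfolding last_block_def
          by (intro mult_nonneg_nonneg sum_nonneg Bochner_Integration.integral_nonneg) (auto simp: A_nonneg)
        then show ?thesis using tau(2)[OF elim, of "x n"] by linarith
      qed
      have b3: "\<bar>n * A l n (x n) * (?H - (\<Sum>m\<in>?I. ?h m))\<bar> \<le> CA * (?H - (\<Sum>m<n div 2. ?h m))"
      proof -
        have "(\<Sum>m\<in>?I. ?h m) \<le> ?H" using mean_drop_summable mean_drop_nonneg by (intro sum_le_suminf) auto
        moreover have "0 \<le> n * A l n (x n)" using A_nonneg by simp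
        moreover have "n * A l n (x n) \<le> CA" using CA(2)[of 0 n "x n"] by simp
        ultimately show ?thesis unfolding abs_mult by (intro mult_mono) auto
      qed
      show ?case unfolding real_norm_def e using b2 b3 by linarith
    qed
  qed
qed

definition Q_const :: "real \<Rightarrow> real" where
  "Q_const l = (\<Sum>m. Q l m 0) / (\<Sum>m. mean_drop m)"

lemma Q_asymp:
  assumes l: "0 < l" and eta: "0 < \<eta>"
    and x: "\<forall>\<^sub>F n in sequentially. sqrt n / \<eta> \<le> x n \<and> x n \<le> \<eta> * sqrt n"
  shows "(\<lambda>n. n * Q l n (x n) - Q_const l * rayleigh l (x n / (\<sigma> * sqrt n))) \<longlonglongrightarrow> 0"
proof -
  let ?H = "\<Sum>m. mean_drop m" and ?K = "\<Sum>m. Q l m 0"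
  have H: "0 < ?H" by (rule mean_drop_sum_pos)
  have g: "(\<lambda>n. Gneg l n (x n) - rayleigh l (x n / (\<sigma> * sqrt n))) \<longlonglongrightarrow> 0"
  proof (rule tendstoI)
    fix e :: real assume e: "0 < e"
    then have "0 < e / 2" by simp
    from x Gneg_limit[OF l eta this] show "\<forall>\<^sub>F n in sequentially. dist (Gneg l n (x n) - rayleigh l (x n / (\<sigma> * sqrt n))) 0 < e"
    proof eventually_elim
      case (elim n)
      then have "\<bar>Gneg l n (x n) - rayleigh l (x n / (\<sigma> * sqrt n))\<bar> \<le> e / 2" by blast
      then show ?case using e by simp
    qed
  qed
  \<comment> \<open>The combination is chosen so that the terms with \<open>n * A l n (x n)\<close>
    cancel.\<close>
  have lim: "(\<lambda>n. (n * Q l n (x n) - ?K * (n * A l n (x n))) - ?K / ?H * (Gneg l n (x n) - ?H * (n * A l n (x n)))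
      + ?K / ?H * (Gneg l n (x n) - rayleigh l (x n / (\<sigma> * sqrt n)))) \<longlonglongrightarrow> 0 - ?K / ?H * 0 + ?K / ?H * 0"
    by (intro tendsto_intros Q_ratio[OF l eta x] Gneg_ratio[OF l eta x] g)
  have eq: "(n * Q l n (x n) - ?K * (n * A l n (x n))) - ?K / ?H * (Gneg l n (x n) - ?H * (n * A l n (x n)))
      + ?K / ?H * (Gneg l n (x n) - rayleigh l (x n / (\<sigma> * sqrt n)))
    = n * Q l n (x n) - Q_const l * rayleigh l (x n / (\<sigma> * sqrt n))" for n
    using H by (simp add: Q_const_def algebra_simps)
  show ?thesis using lim unfolding eq by simp
qed

end

section \<open>Identification of the constant\<close>

lemma enat_less_exit_time:
  "enat n < exit_time x w \<longleftrightarrow> (\<forall>k\<in>{1..n}. 0 \<le> x + walk w k)"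
proof -
  have "enat n < exit_time x w \<longleftrightarrow> (\<forall>k. 1 \<le> k \<and> x + walk w k < 0 \<longrightarrow> Suc n \<le> k)"
    unfolding exit_time_def by (subst Suc_ile_eq[symmetric]) (auto simp: le_Inf_iff)
  also have "\<dots> \<longleftrightarrow> (\<forall>k\<in>{1..n}. 0 \<le> x + walk w k)"
    by (metis One_nat_def atLeastAtMost_iff linorder_not_less not_less_eq_eq)
  finally show ?thesis .
qed

text \<open>Bridges two indexings: \<open>walk\<close> starts at 1, whereas \<open>psum\<close>
  starts at 0 to fit the sequence-space operations \<open>comb_seq\<close> and
  \<open>case_nat\<close>.\<close>

definition increments :: "(nat \<Rightarrow> real) \<Rightarrow> nat \<Rightarrow> real" where
  "increments w i = w (i - 1)"

lemma walk_increments: "walk (increments w) n = psum w n"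
  unfolding walk_def psum_def increments_def by (rule sum.reindex_bij_witness[of _ Suc "\<lambda>i. i - 1"]) auto

lemma stays_iff_exit_time: "stays x w n \<longleftrightarrow> 0 \<le> x \<and> enat n < exit_time x (increments w)"
proof -
  have "stays x w n \<longleftrightarrow> 0 \<le> x \<and> (\<forall>k\<in>{1..n}. 0 \<le> x + psum w k)"
    unfolding stays_def by (metis One_nat_def Suc_leI add.right_neutral atLeastAtMost_iff bot_nat_0.extremum neq0_conv psum_0)
  then show ?thesis by (simp add: enat_less_exit_time walk_increments)
qed

context iid_walk begin

text \<open>The harmonic function of the walk killed on becoming negative, obtained as a monotone
  limit.\<close>

definition renewal :: "real \<Rightarrow> real" where
  "renewal t = (SUP n. potential t n)"

lemma potential_tendsto: assumes "0 \<le> t" shows "potential t \<longlonglongrightarrow> renewal t"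
proof -
  obtain C where "\<And>n. potential t n \<le> C * (1 + t) ^ 4" using potential_bound assms by blast
  then have "bdd_above (range (potential t))" by (auto intro!: bdd_aboveI)
  then show ?thesis unfolding renewal_def by (rule LIMSEQ_incseq_SUP) (rule potential_mono)
qed

text \<open>By optional stopping, \<open>potential t n = t * P (stays t w n) - E (S at exit; exit before n)\<close>.\<close>

lemma exit_mean:
  assumes t: "0 \<le> t"
  shows "(\<lambda>w. walk_at_exit t (increments w)) \<in> borel_measurable W"
    and "- (\<integral>w. walk_at_exit t (increments w) \<partial>W) = renewal t"
proof -
  let ?e = "\<lambda>w. walk_at_exit t (increments w)"
  \<comment> \<open>This summand is minus the exit position on the event of exit at time Suc m.
    Written as overshoot plus t times the exit indicator it is visibly nonnegative, so its partial
    sums \<open>Z n\<close> increase and monotone convergence applies.\<close>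
  let ?d = "\<lambda>m w. of_bool (stays t w m) * max 0 (- (t + psum w (Suc m))) + t * (of_bool (stays t w m) - of_bool (stays t w (Suc m)))"
  define Z where "Z n w = (\<Sum>m<n. ?d m w)" for n and w :: "nat \<Rightarrow> real"
  have d: "?d m w = (if stays t w m \<and> \<not> stays t w (Suc m) then - psum w (Suc m) else 0)" for m w
    by (auto simp: stays_Suc max_def)
  have ex: "?e w = psum w (Suc m)" if "stays t w m" "\<not> stays t w (Suc m)" for m w
  proof -
    have "exit_time t (increments w) = enat (Suc m)"
      using that t unfolding stays_iff_exit_time by (cases "exit_time t (increments w)") auto
    then show ?thesis by (simp add: walk_at_exit_def walk_increments)
  qed
  have Z: "Z n w = (if stays t w n then 0 else - ?e w)" for n w
  proof (induction n)
    case 0 then show ?case using t by (simp add: Z_def stays_0)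
  next
    case (Suc n)
    have "Z (Suc n) w = Z n w + ?d n w" by (simp add: Z_def)
    then show ?case unfolding Suc d using ex[of w n] by (auto simp: stays_Suc)
  qed
  have Zlim: "(\<lambda>n. Z n w) \<longlonglongrightarrow> - ?e w" for w
  proof (cases "\<exists>n. \<not> stays t w n")
    case True
    then obtain n where n: "\<not> stays t w n" by blast
    have "\<forall>\<^sub>F m in sequentially. Z m w = - ?e w"
      using eventually_ge_at_top[of n] by eventually_elim (use n stays_antimono Z in auto)
    then show ?thesis by (rule tendsto_eventually)
  next
    case False
    then have "enat n < exit_time t (increments w)" for n using stays_iff_exit_time by blast
    then have "exit_time t (increments w) = \<infinity>" by (metis enat.exhaust less_irrefl)
    \<comment> \<open>The default value 0 of \<open>walk_at_exit\<close> agrees with the limit of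
      \<open>Z n w\<close> on paths that never exit.\<close>
    then have "?e w = 0" by (simp add: walk_at_exit_def)
    then show ?thesis using False by (simp add: Z)
  qed
  have Z_Suc: "Z (Suc n) w = Z n w + ?d n w" for n w by (simp only: Z_def sum.lessThan_Suc)
  have id: "integrable W (?d m)" for m
    by (intro Bochner_Integration.integrable_add integrable_mult_right Bochner_Integration.integrable_diff
        overshoot_integrable stays_integrable)
  have iZ: "integrable W (Z n)" for n unfolding Z_def[abs_def] by (intro Bochner_Integration.integrable_sum id)
  have IZ: "(\<integral>w. Z n w \<partial>W) = potential t n - t * (\<integral>w. of_bool (stays t w n) \<partial>W)" for n
  proof (induction n)
    case 0 then show ?case using t P.prob_space by (simp add: Z_def potential_def stays_0)
  next
    case (Suc n)
    have "(\<integral>w. Z (Suc n) w \<partial>W) = (\<integral>w. Z n w \<partial>W) + (\<integral>w. ?d n w \<partial>W)"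
      using Bochner_Integration.integral_add[OF iZ[of n] id[of n]] unfolding Z_Suc .
    also have "(\<integral>w. ?d n w \<partial>W) = (\<integral>w. of_bool (stays t w n) * max 0 (- (t + psum w (Suc n))) \<partial>W)
        + t * ((\<integral>w. of_bool (stays t w n) \<partial>W) - (\<integral>w. of_bool (stays t w (Suc n)) \<partial>W))"
      by (subst Bochner_Integration.integral_add, intro overshoot_integrable,
          intro integrable_mult_right Bochner_Integration.integrable_diff stays_integrable)
        (simp add: Bochner_Integration.integral_diff[OF stays_integrable stays_integrable])
    finally show ?case unfolding Suc potential_Suc by (simp add: algebra_simps)
  qed
  obtain C where C: "C > 0" "\<And>n. (\<integral>w. of_bool (stays t w n) \<partial>W) \<le> C * (1 + t) ^ 4 / sqrt (real n + 1)"
    using stays_bound t by blast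
  have "(\<lambda>n. \<integral>w. of_bool (stays t w n) \<partial>W :: real) \<longlonglongrightarrow> 0"
  proof (rule tendsto_sandwich[OF _ _ tendsto_const])
    show "(\<lambda>n. C * (1 + t) ^ 4 / sqrt (real n + 1)) \<longlonglongrightarrow> 0" by real_asymp
  qed (use C(2) in \<open>auto intro!: always_eventually Bochner_Integration.integral_nonneg\<close>)
  then have "(\<lambda>n. potential t n - t * (\<integral>w. of_bool (stays t w n) \<partial>W)) \<longlonglongrightarrow> renewal t - t * 0"
    by (intro tendsto_intros potential_tendsto t)
  then have lim: "(\<lambda>n. \<integral>w. Z n w \<partial>W) \<longlonglongrightarrow> renewal t" by (simp add: IZ)
  have m: "(\<lambda>w. - ?e w) \<in> borel_measurable W"
    by (rule borel_measurable_LIMSEQ_real[OF Zlim]) (use iZ in auto)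
  have inc: "incseq (\<lambda>n. Z n w)" for w
    using t by (intro incseq_SucI) (auto simp: Z_def stays_Suc max_def)
  have "(\<integral>w. - ?e w \<partial>W) = renewal t"
    by (rule integral_monotone_convergence[OF iZ _ _ lim m]) (use inc Zlim in auto)
  then show "- (\<integral>w. ?e w \<partial>W) = renewal t" by simp
  show "?e \<in> borel_measurable W" using borel_measurable_uminus[OF m] by simp
qed

section \<open>Duality between \<open>Q\<close> and the reflected walk\<close>

definition dual_moment :: "nat \<Rightarrow> real \<Rightarrow> nat \<Rightarrow> real" where
  "dual_moment p t n = (\<integral>w. of_bool (below t w n) * (t - psum w n) ^ p \<partial>W)"

text \<open>The function \<open>V_star\<close> in coordinates starting at 0; see
  \<open>V_star_eq\<close>.\<close>

definition dual_renewal :: "real \<Rightarrow> real" where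
  "dual_renewal t = - (\<integral>w. walk_at_exit t (increments (\<lambda>i. - w i)) \<partial>W)"

lemma dual_moment_measurable [measurable]: "(\<lambda>t. dual_moment p t n) \<in> borel_measurable borel"
  unfolding dual_moment_def[abs_def] by measurable

lemma dual_moment_nonneg: "0 \<le> dual_moment p t n"
  unfolding dual_moment_def by (intro Bochner_Integration.integral_nonneg) (auto simp: below_def)

lemma dual_moment_reflected:
  "dual_moment p t n = (\<integral>w. of_bool (stays t w n) * (t + psum w n) ^ p \<partial>Pi\<^sub>M UNIV (\<lambda>_. distr \<nu> borel uminus))"
proof -
  have "dual_moment p t n = (\<integral>w. of_bool (stays t (\<lambda>i. - w i) n) * (t + psum (\<lambda>i. - w i) n) ^ p \<partial>W)"
    unfolding dual_moment_def using below_uminus[of t "\<lambda>i. - _ i" n] by (simp add: psum_uminus)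
  also have "\<dots> = (\<integral>w. of_bool (stays t w n) * (t + psum w n) ^ p \<partial>Pi\<^sub>M UNIV (\<lambda>_. distr \<nu> borel uminus))"
    by (rule integral_reflected) measurable
  finally show ?thesis .
qed

lemma dual_moment_facts:
  shows "incseq (dual_moment 1 t)"
    and "0 \<le> t \<Longrightarrow> dual_moment 1 t \<longlonglongrightarrow> dual_renewal t"
    and "\<exists>C>0. \<forall>n. \<forall>t\<ge>0. dual_moment 1 t n \<le> C * (1 + t) ^ 4"
    and "\<exists>C>0. \<forall>n. \<forall>t\<ge>0. dual_moment 2 t n \<le> C * (1 + t) ^ 4 * sqrt (real n + 1)"
proof -
  interpret R: iid_walk "distr \<nu> borel uminus" \<sigma> by (rule reflected_walk)
  have e1: "dual_moment 1 t n = R.potential t n" for t n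
    unfolding dual_moment_reflected R.potential_def by simp
  then have e: "dual_moment 1 t = R.potential t" for t by auto
  show "incseq (dual_moment 1 t)" unfolding e by (rule R.potential_mono)
  show "\<exists>C>0. \<forall>n. \<forall>t\<ge>0. dual_moment 1 t n \<le> C * (1 + t) ^ 4" unfolding e1 by (rule R.potential_bound)
  show "\<exists>C>0. \<forall>n. \<forall>t\<ge>0. dual_moment 2 t n \<le> C * (1 + t) ^ 4 * sqrt (real n + 1)"
    unfolding dual_moment_reflected by (rule R.killed_square_bound)
  assume t: "0 \<le> t"
  have "dual_renewal t = R.renewal t"
  proof -
    have "(\<lambda>w. walk_at_exit t (increments w)) \<in> borel_measurable seq_borel"
      using R.exit_mean(1)[OF t] by (simp cong: measurable_cong_sets add: R.sets_W)
    then show ?thesis unfolding R.exit_mean(2)[OF t, symmetric] dual_renewal_def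
      using integral_reflected[of "\<lambda>w. walk_at_exit t (increments w)"] by simp
  qed
  then show "dual_moment 1 t \<longlonglongrightarrow> dual_renewal t" unfolding e using R.potential_tendsto[OF t] by simp
qed

text \<open>For a fixed path the substitution t = y + \<open>psum w n\<close> exchanges start and
  end: the factor y^p becomes a moment of the reversed path's endpoint, and \<open>gexp\<close>
  becomes a weight on its starting level. Nonnegative integrals allow the exchange before
  integrability is known.\<close>

lemma dual_moment_duality:
  assumes l: "0 < l" and p: "p \<in> {1, 2}"
  shows "(\<integral>\<^sup>+y. ennreal (y ^ p * Q l n y) \<partial>lborel) = (\<integral>\<^sup>+t. ennreal (gexp l t * dual_moment p t n) \<partial>lborel)"
proof -
  have l0: "0 \<le> l" using l by simp
  interpret sigma_finite_measure W by unfold_locales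
  interpret LW: pair_sigma_finite lborel W by unfold_locales
  let ?g = "\<lambda>y w. y ^ p * (of_bool (stays y w n) * gexp l (y + psum w n))"
  let ?h = "\<lambda>t w. gexp l t * (of_bool (below t w n) * (t - psum w n) ^ p)"
  have g0: "0 \<le> ?g y w" for y w by (auto simp: stays_def dest!: spec[of _ 0])
  have h0: "0 \<le> ?h t w" for t w by (auto simp: below_def)
  have "(\<integral>\<^sup>+y. ennreal (y ^ p * Q l n y) \<partial>lborel) = (\<integral>\<^sup>+y. (\<integral>\<^sup>+w. ennreal (?g y w) \<partial>W) \<partial>lborel)"
  proof (rule nn_integral_cong)
    fix y
    have "(\<integral>\<^sup>+w. ennreal (?g y w) \<partial>W) = ennreal (\<integral>w. ?g y w \<partial>W)"
      by (intro nn_integral_eq_integral integrable_mult_right Q_integrable l0 AE_I2 g0)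
    then show "ennreal (y ^ p * Q l n y) = (\<integral>\<^sup>+w. ennreal (?g y w) \<partial>W)" by (simp add: Q_def)
  qed
  also have "\<dots> = (\<integral>\<^sup>+w. (\<integral>\<^sup>+y. ennreal (?g y w) \<partial>lborel) \<partial>W)"
    by (rule LW.Fubini'[symmetric]) measurable
  also have "\<dots> = (\<integral>\<^sup>+w. (\<integral>\<^sup>+t. ennreal (?h t (reversal n w)) \<partial>lborel) \<partial>W)"
  proof (rule nn_integral_cong)
    fix w
    have "stays (t - psum w n) w n \<longleftrightarrow> below t (reversal n w) n" for t
    proof -
      have "below t (reversal n w) n \<longleftrightarrow> (\<forall>j\<le>n. 0 \<le> t - psum w n + psum w (n - j))"
        by (auto simp: below_def psum_reversal)
      also have "\<dots> \<longleftrightarrow> stays (t - psum w n) w n" unfolding stays_def by (metis diff_diff_cancel diff_le_self)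
      finally show ?thesis ..
    qed
    then have eq: "?g (- psum w n + 1 * t) w = ?h t (reversal n w)" for t by (simp add: psum_reversal)
    have "(\<integral>\<^sup>+y. ennreal (?g y w) \<partial>lborel) = ennreal \<bar>1\<bar> * (\<integral>\<^sup>+t. ennreal (?g (- psum w n + 1 * t) w) \<partial>lborel)"
    proof (rule nn_integral_real_affine)
      have [measurable]: "(\<lambda>_. w) \<in> measurable borel seq_borel" by (simp add: space_PiM)
      show "(\<lambda>y. ennreal (?g y w)) \<in> borel_measurable borel" by measurable
    qed simp
    then show "(\<integral>\<^sup>+y. ennreal (?g y w) \<partial>lborel) = (\<integral>\<^sup>+t. ennreal (?h t (reversal n w)) \<partial>lborel)" unfolding eq by simp
  qed
  also have "\<dots> = (\<integral>\<^sup>+t. (\<integral>\<^sup>+w. ennreal (?h t (reversal n w)) \<partial>W) \<partial>lborel)"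
    by (rule LW.Fubini') measurable
  also have "\<dots> = (\<integral>\<^sup>+t. ennreal (gexp l t * dual_moment p t n) \<partial>lborel)"
  proof (rule nn_integral_cong)
    fix t
    have i1: "integrable W (\<lambda>w. (t - psum w n) ^ p)"
    proof (cases "p = 1")
      case False
      then have "p = 2" using p by simp
      moreover have "integrable W (\<lambda>w. (- t + psum w n)\<^sup>2)" by (rule psum_shift_square_integrable)
      moreover have "(- t + psum w n)\<^sup>2 = (t - psum w n)\<^sup>2" for w by (simp add: power2_commute)
      ultimately show ?thesis by simp
    qed (simp add: psum_integrable)
    have i: "integrable W (\<lambda>w. of_bool (below t (reversal n w) n) * (t - psum (reversal n w) n) ^ p)"
      by (rule integrable_dom[OF integrable_abs[OF i1]]) (auto simp: psum_reversal abs_mult)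
    have "(\<integral>\<^sup>+w. ennreal (?h t (reversal n w)) \<partial>W) = ennreal (\<integral>w. ?h t (reversal n w) \<partial>W)"
      by (intro nn_integral_eq_integral integrable_mult_right i AE_I2 h0)
    also have "(\<integral>w. ?h t (reversal n w) \<partial>W) = (\<integral>w. ?h t w \<partial>W)"
      by (rule integral_reversal) measurable
    finally show "(\<integral>\<^sup>+w. ennreal (?h t (reversal n w)) \<partial>W) = ennreal (gexp l t * dual_moment p t n)"
      by (simp add: dual_moment_def)
  qed
  finally show ?thesis .
qed

lemma gexp_weight_integrable:
  assumes l: "0 < l" shows "integrable lborel (\<lambda>t. gexp l t * (1 + t) ^ 4)"
proof (rule Bochner_Integration.integrable_bound)
  show "integrable lborel (\<lambda>t. (1 + 8 / l) ^ 4 * gexp (l / 2) t)"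
    using gexp_integral(1)[of "l / 2"] l by (intro integrable_mult_right) simp
  show "(\<lambda>t. gexp l t * (1 + t) ^ 4) \<in> borel_measurable lborel" by measurable
  show "AE t in lborel. norm (gexp l t * (1 + t) ^ 4) \<le> norm ((1 + 8 / l) ^ 4 * gexp (l / 2) t)"
  proof (rule AE_I2)
    fix t :: real
    show "norm (gexp l t * (1 + t) ^ 4) \<le> norm ((1 + 8 / l) ^ 4 * gexp (l / 2) t)"
    proof (cases "0 \<le> t")
      case True
      have "1 + t \<le> (1 + 8 / l) * (1 + l * t / 8)" using l True by (simp add: field_simps)
      also have "\<dots> \<le> (1 + 8 / l) * exp (l * t / 8)"
        using l exp_ge_add_one_self[of "l * t / 8"] by (intro mult_left_mono) auto
      finally have "(1 + t) ^ 4 \<le> ((1 + 8 / l) * exp (l * t / 8)) ^ 4" using True by (intro power_mono) auto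
      also have "\<dots> = (1 + 8 / l) ^ 4 * exp (l * t / 2)" by (simp add: power_mult_distrib flip: exp_of_nat_mult)
      finally have "exp (- (l * t)) * (1 + t) ^ 4 \<le> exp (- (l * t)) * ((1 + 8 / l) ^ 4 * exp (l * t / 2))"
        by (intro mult_left_mono) auto
      also have "\<dots> = (1 + 8 / l) ^ 4 * exp (- (l / 2 * t))" by (simp add: mult.left_commute mult_exp_exp)
      finally show ?thesis using True l by (simp add: gexp_def)
    qed (simp add: gexp_def)
  qed
qed

lemma integral_transfer_nonneg:
  fixes f g :: "real \<Rightarrow> real"
  assumes g: "integrable lborel g" "\<And>x. 0 \<le> g x" and f: "f \<in> borel_measurable borel" "\<And>x. 0 \<le> f x"
    and eq: "(\<integral>\<^sup>+x. ennreal (f x) \<partial>lborel) = (\<integral>\<^sup>+x. ennreal (g x) \<partial>lborel)"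
  shows "integrable lborel f" "(\<integral>x. f x \<partial>lborel) = (\<integral>x. g x \<partial>lborel)"
proof -
  have e: "(\<integral>\<^sup>+x. ennreal (f x) \<partial>lborel) = ennreal (\<integral>x. g x \<partial>lborel)"
    unfolding eq by (intro nn_integral_eq_integral g AE_I2)
  show i: "integrable lborel f" by (rule integrableI_nn_integral_finite[OF _ _ e]) (use f in auto)
  show "(\<integral>x. f x \<partial>lborel) = (\<integral>x. g x \<partial>lborel)"
    using e nn_integral_eq_integral[OF i] f(2) g(2)
    by (simp add: Bochner_Integration.integral_nonneg)
qed

lemma Q_neg: "x < 0 \<Longrightarrow> Q l n x = 0"
  unfolding Q_def by (subst integral_eq_zero_AE) (auto simp: stays_def intro!: AE_I2 exI[of _ 0])

lemma dual_renewal_const: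
  assumes l: "0 < l"
  defines "I \<equiv> (\<integral>t. gexp l t * dual_renewal t \<partial>lborel)"
  shows "(\<lambda>n. \<integral>t. gexp l t * dual_moment 1 t n \<partial>lborel) \<longlonglongrightarrow> I" "0 < I"
proof -
  obtain C where C: "C > 0" "\<And>n t. 0 \<le> t \<Longrightarrow> dual_moment 1 t n \<le> C * (1 + t) ^ 4" using dual_moment_facts(3) by blast
  have w: "integrable lborel (\<lambda>t. C * (gexp l t * (1 + t) ^ 4))" by (intro integrable_mult_right gexp_weight_integrable l)
  have bd: "norm (gexp l t * dual_moment 1 t n) \<le> C * (gexp l t * (1 + t) ^ 4)" for t n
  proof (cases "0 \<le> t")
    case True
    have "gexp l t * dual_moment 1 t n \<le> gexp l t * (C * (1 + t) ^ 4)" by (intro mult_left_mono C True) auto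
    then show ?thesis using dual_moment_nonneg[of 1 t n] by (simp add: abs_mult mult_ac)
  qed (simp add: gexp_def)
  have lim: "(\<lambda>n. gexp l t * dual_moment 1 t n) \<longlonglongrightarrow> gexp l t * dual_renewal t" for t
    using dual_moment_facts(2)[of t] by (cases "0 \<le> t") (auto simp: gexp_def intro!: tendsto_intros)
  have m: "(\<lambda>t. gexp l t * dual_renewal t) \<in> borel_measurable borel"
    by (rule borel_measurable_LIMSEQ_real[OF lim]) measurable
  show L: "(\<lambda>n. \<integral>t. gexp l t * dual_moment 1 t n \<partial>lborel) \<longlonglongrightarrow> I" unfolding I_def
  proof (rule integral_dominated_convergence[OF _ _ w])
    show "AE t in lborel. norm (gexp l t * dual_moment 1 t n) \<le> C * (gexp l t * (1 + t) ^ 4)" for n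
      by (intro AE_I2 bd)
  qed (use lim m in auto)
  \<comment> \<open>Positivity of I: \<open>dual_moment 1 t n\<close> increases in n from its value
    t at n = 0, so on [1, 2] the integrand is at least exp (- 2 * l).\<close>
  have "exp (- (l * 2)) = (\<integral>t. exp (- (l * 2)) * indicator {1..2::real} t \<partial>lborel)" by simp
  also have "\<dots> \<le> (\<integral>t. gexp l t * dual_moment 1 t n \<partial>lborel)" for n
  proof (rule integral_mono)
    show "integrable lborel (\<lambda>t. exp (- (l * 2)) * indicator {1..2::real} t)" by simp
    show "integrable lborel (\<lambda>t. gexp l t * dual_moment 1 t n)"
      by (rule Bochner_Integration.integrable_bound[OF w]) (measurable, intro AE_I2 order_trans[OF bd], simp)
    fix t :: real
    show "exp (- (l * 2)) * indicator {1..2} t \<le> gexp l t * dual_moment 1 t n"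
    proof (cases "t \<in> {1..2}")
      case True
      have "dual_moment 1 t 0 = t" using True P.prob_space by (simp add: dual_moment_def below_def)
      then have "1 \<le> dual_moment 1 t n" using True incseqD[OF dual_moment_facts(1), of 0 n t] by simp
      moreover have "exp (- (l * 2)) \<le> gexp l t" using True l by (simp add: gexp_def)
      ultimately have "exp (- (l * 2)) * 1 \<le> gexp l t * dual_moment 1 t n" by (intro mult_mono) auto
      then show ?thesis using True by simp
    qed (simp add: dual_moment_nonneg)
  qed
  finally have "exp (- (l * 2)) \<le> I" using L by (intro LIMSEQ_le_const) auto
  then show "0 < I" by (rule less_le_trans[rotated]) simp
qed

text \<open>The first moment determines the constant. The second supplies tightness: its order sqrt
  n makes the contribution of y beyond a * sqrt n to the first moment O(1 / a) uniformly in
  n.\<close>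

lemma Q_moments:
  assumes l: "0 < l"
  shows "integrable lborel (\<lambda>y. y * Q l n y)"
    and "(\<lambda>n. \<integral>y. y * Q l n y \<partial>lborel) \<longlonglongrightarrow> (\<integral>t. gexp l t * dual_renewal t \<partial>lborel)"
    and "integrable lborel (\<lambda>y. y\<^sup>2 * Q l n y)"
    and "\<exists>C>0. \<forall>n. (\<integral>y. y\<^sup>2 * Q l n y \<partial>lborel) \<le> C * sqrt (real n + 1)"
proof -
  have i: "integrable lborel (\<lambda>t. gexp l t * dual_moment p t n)" if "C > 0" "\<And>t. 0 \<le> t \<Longrightarrow> dual_moment p t n \<le> C * (1 + t) ^ 4" for p n C
  proof (rule Bochner_Integration.integrable_bound[OF integrable_mult_right[OF gexp_weight_integrable[OF l], of C]])
    show "AE t in lborel. norm (gexp l t * dual_moment p t n) \<le> norm (C * (gexp l t * (1 + t) ^ 4))"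
    proof (rule AE_I2)
      fix t :: real
      show "norm (gexp l t * dual_moment p t n) \<le> norm (C * (gexp l t * (1 + t) ^ 4))"
      proof (cases "0 \<le> t")
        case True
        have "gexp l t * dual_moment p t n \<le> gexp l t * (C * (1 + t) ^ 4)" by (intro mult_left_mono that True) auto
        then show ?thesis using dual_moment_nonneg[of p t n] that(1) by (simp add: abs_mult mult_ac)
      qed (simp add: gexp_def)
    qed
  qed measurable
  have tr: "integrable lborel (\<lambda>y. y ^ p * Q l n y)" "(\<integral>y. y ^ p * Q l n y \<partial>lborel) = (\<integral>t. gexp l t * dual_moment p t n \<partial>lborel)"
    if "p \<in> {1, 2}" "integrable lborel (\<lambda>t. gexp l t * dual_moment p t n)" for p n
  proof -
    have nn: "0 \<le> y ^ p * Q l n y" for y by (cases "0 \<le> y") (simp_all add: Q_nonneg Q_neg)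
    have m: "(\<lambda>y. y ^ p * Q l n y) \<in> borel_measurable borel" by measurable
    show "integrable lborel (\<lambda>y. y ^ p * Q l n y)" "(\<integral>y. y ^ p * Q l n y \<partial>lborel) = (\<integral>t. gexp l t * dual_moment p t n \<partial>lborel)"
      using integral_transfer_nonneg[OF that(2) _ m nn dual_moment_duality[OF l that(1)]]
      by (simp_all add: dual_moment_nonneg)
  qed
  obtain C1 where C1: "C1 > 0" "\<And>n t. 0 \<le> t \<Longrightarrow> dual_moment 1 t n \<le> C1 * (1 + t) ^ 4" using dual_moment_facts(3) by blast
  obtain C2 where C2: "C2 > 0" "\<And>n t. 0 \<le> t \<Longrightarrow> dual_moment 2 t n \<le> C2 * (1 + t) ^ 4 * sqrt (real n + 1)"
    using dual_moment_facts(4) by blast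
  have i1: "integrable lborel (\<lambda>t. gexp l t * dual_moment 1 t n)" for n by (rule i[OF C1])
  have i2: "integrable lborel (\<lambda>t. gexp l t * dual_moment 2 t n)" for n
    by (rule i[of "C2 * sqrt (real n + 1)"]) (use C2 in \<open>simp_all add: mult_ac\<close>)
  show "integrable lborel (\<lambda>y. y * Q l n y)" using tr(1)[of 1, OF _ i1] by simp
  show "integrable lborel (\<lambda>y. y\<^sup>2 * Q l n y)" using tr(1)[of 2, OF _ i2] by simp
  show "(\<lambda>n. \<integral>y. y * Q l n y \<partial>lborel) \<longlonglongrightarrow> (\<integral>t. gexp l t * dual_renewal t \<partial>lborel)"
    using tr(2)[of 1, OF _ i1] dual_renewal_const(1)[OF l] by simp
  let ?J = "\<integral>t. gexp l t * (1 + t) ^ 4 \<partial>lborel"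
  have J: "0 \<le> ?J" by (intro Bochner_Integration.integral_nonneg) (auto simp: gexp_def)
  have "(\<integral>y. y\<^sup>2 * Q l n y \<partial>lborel) \<le> (C2 * (?J + 1)) * sqrt (real n + 1)" for n
  proof -
    have "(\<integral>y. y\<^sup>2 * Q l n y \<partial>lborel) = (\<integral>t. gexp l t * dual_moment 2 t n \<partial>lborel)" using tr(2)[of 2, OF _ i2] by simp
    also have "\<dots> \<le> (\<integral>t. C2 * sqrt (real n + 1) * (gexp l t * (1 + t) ^ 4) \<partial>lborel)"
    proof (rule integral_mono[OF i2 integrable_mult_right[OF gexp_weight_integrable[OF l]]])
      fix t
      show "gexp l t * dual_moment 2 t n \<le> C2 * sqrt (real n + 1) * (gexp l t * (1 + t) ^ 4)"
      proof (cases "0 \<le> t")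
        case True
        have "gexp l t * dual_moment 2 t n \<le> gexp l t * (C2 * (1 + t) ^ 4 * sqrt (real n + 1))" by (intro mult_left_mono C2 True) auto
        then show ?thesis by (simp add: mult_ac)
      qed (simp add: gexp_def)
    qed
    also have "\<dots> = C2 * ?J * sqrt (real n + 1)" by simp
    also have "\<dots> \<le> C2 * (?J + 1) * sqrt (real n + 1)" using C2 by (intro mult_right_mono mult_left_mono) auto
    finally show ?thesis .
  qed
  moreover have "0 < C2 * (?J + 1)" using C2(1) J by (intro mult_pos_pos add_nonneg_pos) simp_all
  ultimately show "\<exists>C>0. \<forall>n. (\<integral>y. y\<^sup>2 * Q l n y \<partial>lborel) \<le> C * sqrt (real n + 1)" by blast
qed

end

section \<open>The constant from the limit of first moments\<close>

lemma phi_plus_moment: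
  "integrable lborel (\<lambda>s. s * phi_plus s)" "(\<integral>s. s * phi_plus s \<partial>lborel) = sqrt (2 * pi) / 2"
proof -
  let ?f = "\<lambda>x::real. indicator {0..} x *\<^sub>R (exp (-x\<^sup>2)*x^(2 * 1))"
  have h: "integrable lborel ?f" "(\<integral>x. ?f x \<partial>lborel) = sqrt pi / 4"
    using gaussian_moment_even_pos[of 1] by (auto simp: has_bochner_integral_iff)
  have c: "1 / sqrt 2 \<noteq> (0::real)" by simp
  have e: "?f (0 + 1 / sqrt 2 * s) = s * phi_plus s / 2" for s
    by (auto simp: phi_plus_def power_divide power2_eq_square indicator_def zero_le_divide_iff)
  have "integrable lborel (\<lambda>s. s * phi_plus s / 2)"
    using lborel_integrable_real_affine[OF h(1) c, of 0] unfolding e .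
  from integrable_mult_right[OF this, of 2] show "integrable lborel (\<lambda>s. s * phi_plus s)" by simp
  have "sqrt pi / 4 = \<bar>1 / sqrt 2\<bar> *\<^sub>R (\<integral>s. s * phi_plus s / 2 \<partial>lborel)"
    using lborel_integral_real_affine[OF c, of ?f 0] unfolding e h(2) .
  then show "(\<integral>s. s * phi_plus s \<partial>lborel) = sqrt (2 * pi) / 2"
    by (simp add: real_sqrt_mult field_simps)
qed

context nonlattice_walk begin

text \<open>In each term of the convolution one index is at least about n / 2. The factor with that
  index is O(1 / n), and the other factor has a bounded sum.\<close>

lemma Q_bound:
  assumes l: "0 < l" shows "\<exists>C>0. \<forall>n x. Q l n x \<le> C / (real n + 1)"
proof -
  obtain CA where CA: "CA > 0" "\<And>n x. A l n x \<le> CA / (real n + 1)" using A_bound[OF l] by blast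
  obtain CS where CS: "CS > 0" "\<And>n x. (\<Sum>j<n. A l j x) \<le> CS" using A_sum_bound[OF l] by blast
  obtain CQ where CQ: "CQ > 0" "\<And>n. Q l n 0 \<le> CQ / ((real n + 1) * sqrt (real n + 1))" using Q_0_bound[OF l] by blast
  let ?S = "\<Sum>m. Q l m 0"
  have S: "0 \<le> ?S" by (intro suminf_nonneg Q_0_summable l Q_nonneg)
  have "Q l n x \<le> (2 * CA * ?S + 2 * CQ * CS) / (real n + 1)" for n x
  proof -
    have np: "0 < real n + 1" by simp
    have "Q l n x = (\<Sum>k\<le>n. A l k x * Q l (n - k) 0)" by (rule Q_decomp) (use l in simp)
    also have "\<dots> \<le> (\<Sum>k\<le>n. 2 * CA / (real n + 1) * Q l (n - k) 0 + 2 * CQ / (real n + 1) * A l k x)"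
    proof (rule sum_mono)
      fix k assume k: "k \<in> {..n}"
      show "A l k x * Q l (n - k) 0 \<le> 2 * CA / (real n + 1) * Q l (n - k) 0 + 2 * CQ / (real n + 1) * A l k x"
      proof (cases "n \<le> 2 * k")
        case True
        have "A l k x \<le> CA / (real k + 1)" by (rule CA)
        also have "\<dots> \<le> CA / ((real n + 1) / 2)" using True CA(1) by (intro divide_left_mono) auto
        finally have "A l k x * Q l (n - k) 0 \<le> 2 * CA / (real n + 1) * Q l (n - k) 0"
          by (intro mult_right_mono Q_nonneg) (simp add: mult.commute)
        moreover have "0 \<le> 2 * CQ / (real n + 1) * A l k x" using CQ(1) A_nonneg by simp
        ultimately show ?thesis by linarith
      next
        case False
        have nk: "(real n + 1) / 2 \<le> real (n - k) + 1" using False by (simp add: of_nat_diff)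
        have "Q l (n - k) 0 \<le> CQ / ((real (n - k) + 1) * sqrt (real (n - k) + 1))" by (rule CQ)
        also have "\<dots> \<le> CQ / ((real n + 1) / 2 * 1)" using nk CQ(1) by (intro divide_left_mono mult_mono) auto
        finally have "A l k x * Q l (n - k) 0 \<le> A l k x * (2 * CQ / (real n + 1))"
          by (intro mult_left_mono A_nonneg) (simp add: mult.commute)
        moreover have "0 \<le> 2 * CA / (real n + 1) * Q l (n - k) 0" using CA(1) Q_nonneg by simp
        ultimately show ?thesis by (simp add: mult.commute)
      qed
    qed
    also have "\<dots> = 2 * CA / (real n + 1) * (\<Sum>k\<le>n. Q l (n - k) 0) + 2 * CQ / (real n + 1) * (\<Sum>k\<le>n. A l k x)"
      by (simp add: sum.distrib sum_distrib_left)
    also have "\<dots> \<le> 2 * CA / (real n + 1) * ?S + 2 * CQ / (real n + 1) * CS"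
    proof (intro add_mono mult_left_mono)
      have "(\<Sum>k\<le>n. Q l (n - k) 0) = (\<Sum>k<Suc n. Q l k 0)"
        by (rule sum.reindex_bij_witness[of _ "\<lambda>j. n - j" "\<lambda>k. n - k"]) auto
      also have "\<dots> \<le> ?S" by (intro sum_le_suminf Q_0_summable l) (auto simp: Q_nonneg)
      finally show "(\<Sum>k\<le>n. Q l (n - k) 0) \<le> ?S" .
      show "(\<Sum>k\<le>n. A l k x) \<le> CS" unfolding lessThan_Suc_atMost[symmetric] by (rule CS(2))
    qed (use CA CQ in auto)
    also have "\<dots> = (2 * CA * ?S + 2 * CQ * CS) / (real n + 1)" by (simp add: add_divide_distrib)
    finally show ?thesis .
  qed
  moreover have "0 < 2 * CA * ?S + 2 * CQ * CS" using CA CQ CS S by (intro add_nonneg_pos) auto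
  ultimately show ?thesis by blast
qed

text \<open>After rescaling, the integrands \<open>h n\<close> converge pointwise to
  \<open>g\<close>. For s up to a, \<open>Q_bound\<close> supplies a majorant; beyond a the second
  moment gives O(1 / a) uniformly in n. Letting a grow identifies the limit of the
  integrals.\<close>

lemma Q_const_eq:
  assumes l: "0 < l"
  shows "Q_const l = 2 * l * (\<integral>t. gexp l t * dual_renewal t \<partial>lborel) / \<sigma>\<^sup>2"
proof -
  let ?I = "\<integral>t. gexp l t * dual_renewal t \<partial>lborel"
  \<comment> \<open>The spatial scale at time Suc n; starting from time 1 keeps it positive.\<close>
  define c where "c n = \<sigma> * sqrt (Suc n)" for n :: nat
  have c: "0 < c n" "(c n)\<^sup>2 = \<sigma>\<^sup>2 * real (Suc n)" for n using sigma_pos by (auto simp: c_def power_mult_distrib)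
  define h where "h n s = s * (real (Suc n) * Q l (Suc n) (c n * s))" for n :: nat and s :: real
  define g where "g s = s * (Q_const l * rayleigh l s)" for s
  have h0: "0 \<le> h n s" for n s
    using c(1)[of n] by (cases "0 \<le> s") (simp_all add: h_def Q_nonneg Q_neg mult_pos_neg)
  have hm [measurable]: "h n \<in> borel_measurable borel" for n unfolding h_def[abs_def] by measurable
  have gm [measurable]: "g \<in> borel_measurable borel" unfolding g_def[abs_def] by measurable
  have hg: "(\<lambda>n. h n s) \<longlonglongrightarrow> g s" for s
  proof (cases "0 < s")
    case True
    \<comment> \<open>A single \<eta> that is at least \<sigma> * s and at least its inverse, so
      that the sequence \<sigma> * sqrt n * s lies in the range required by
      \<open>Q_asymp\<close>.\<close>
    define \<eta> where "\<eta> = \<sigma> * s + 1 / (\<sigma> * s)"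
    have \<sigma>s: "0 < \<sigma> * s" using True sigma_pos by simp
    then have eta: "0 < \<eta>" by (simp add: \<eta>_def add_pos_pos)
    have e1: "1 / \<eta> \<le> \<sigma> * s" 
    proof -
      have "\<sigma> * s * \<eta> = (\<sigma> * s)\<^sup>2 + 1" using True sigma_pos by (simp add: \<eta>_def distrib_left power2_eq_square)
      then have "1 \<le> \<sigma> * s * \<eta>" by simp
      then show ?thesis using eta by (simp add: divide_le_eq mult.commute)
    qed
    have e2: "\<sigma> * s \<le> \<eta>" using \<sigma>s by (simp add: \<eta>_def)
    have "\<forall>\<^sub>F n in sequentially. sqrt n / \<eta> \<le> \<sigma> * sqrt n * s \<and> \<sigma> * sqrt n * s \<le> \<eta> * sqrt n"
      using mult_right_mono[OF e1, of "sqrt _"] mult_right_mono[OF e2, of "sqrt _"] by (intro always_eventually) (auto simp: mult_ac)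
    from LIMSEQ_Suc[OF Q_asymp[OF l eta this]]
    have "(\<lambda>n. real (Suc n) * Q l (Suc n) (c n * s) - Q_const l * rayleigh l s) \<longlonglongrightarrow> 0"
      using sigma_pos by (simp add: c_def)
    then have "(\<lambda>n. real (Suc n) * Q l (Suc n) (c n * s)) \<longlonglongrightarrow> Q_const l * rayleigh l s" by (rule LIM_zero_cancel)
    then show ?thesis unfolding h_def g_def by (rule tendsto_mult[OF tendsto_const])
  next
    case False
    then have "h n s = 0" for n using c(1)[of n]
      by (cases "s = 0") (auto simp: h_def intro!: Q_neg mult_pos_neg)
    moreover have "g s = 0" using False by (cases "s = 0") (auto simp: g_def rayleigh_def phi_plus_def)
    ultimately show ?thesis by simp
  qed
  have gi: "integrable lborel g" "(\<integral>s. g s \<partial>lborel) = Q_const l / (2 * l)"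
  proof -
    have e: "g = (\<lambda>s. Q_const l / (l * sqrt (2 * pi)) * (s * phi_plus s))"
      by (auto simp: g_def rayleigh_def)
    show "integrable lborel g" unfolding e by (intro integrable_mult_right phi_plus_moment)
    show "(\<integral>s. g s \<partial>lborel) = Q_const l / (2 * l)" unfolding e by (simp add: phi_plus_moment)
  qed
  have ih: "integrable lborel (h n)" and Ih: "(\<integral>y. y * Q l (Suc n) y \<partial>lborel) = \<sigma>\<^sup>2 * (\<integral>s. h n s \<partial>lborel)" for n
  proof -
    have e: "(0 + c n * s) * Q l (Suc n) (0 + c n * s) = c n / real (Suc n) * h n s" for s by (simp add: h_def)
    have nz: "c n \<noteq> 0" "c n / real (Suc n) \<noteq> 0" using c(1)[of n] by auto
    have "integrable lborel (\<lambda>s. c n / real (Suc n) * h n s)"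
      using lborel_integrable_real_affine[OF Q_moments(1)[OF l, of "Suc n"] nz(1), of 0] unfolding e .
    then show "integrable lborel (h n)" using nz(2) by (simp only: integrable_mult_left_iff integrable_mult_right_iff) auto
    have "(\<integral>y. y * Q l (Suc n) y \<partial>lborel) = \<bar>c n\<bar> *\<^sub>R (\<integral>s. c n / real (Suc n) * h n s \<partial>lborel)"
      using lborel_integral_real_affine[OF nz(1), of "\<lambda>y. y * Q l (Suc n) y" 0] unfolding e .
    also have "\<dots> = (c n)\<^sup>2 / real (Suc n) * (\<integral>s. h n s \<partial>lborel)" using c(1)[of n] by (simp add: power2_eq_square)
    also have "(c n)\<^sup>2 / real (Suc n) = \<sigma>\<^sup>2" by (simp add: c(2) del: of_nat_Suc)
    finally show "(\<integral>y. y * Q l (Suc n) y \<partial>lborel) = \<sigma>\<^sup>2 * (\<integral>s. h n s \<partial>lborel)" .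
  qed
  obtain C2 where C2: "C2 > 0" "\<And>n. (\<integral>y. y\<^sup>2 * Q l n y \<partial>lborel) \<le> C2 * sqrt (real n + 1)" using Q_moments(4)[OF l] by blast
  have ih2: "integrable lborel (\<lambda>s. s * h n s)" and Ih2: "(\<integral>s. s * h n s \<partial>lborel) \<le> 2 * C2 / \<sigma> ^ 3" for n
  proof -
    have e: "(0 + c n * s)\<^sup>2 * Q l (Suc n) (0 + c n * s) = \<sigma>\<^sup>2 * (s * h n s)" for s
    proof -
      have "(c n * s)\<^sup>2 = \<sigma>\<^sup>2 * real (Suc n) * s\<^sup>2" by (simp only: power_mult_distrib c(2))
      then show ?thesis by (simp add: h_def power2_eq_square[of s] mult_ac del: of_nat_Suc)
    qed
    have nz: "c n \<noteq> 0" "\<sigma>\<^sup>2 \<noteq> 0" using c(1)[of n] sigma_pos by auto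
    have "integrable lborel (\<lambda>s. \<sigma>\<^sup>2 * (s * h n s))"
      using lborel_integrable_real_affine[OF Q_moments(3)[OF l, of "Suc n"] nz(1), of 0] unfolding e .
    from integrable_mult_right[OF this, of "1 / \<sigma>\<^sup>2"] show "integrable lborel (\<lambda>s. s * h n s)" using nz(2) by simp
    have "c n * (\<sigma>\<^sup>2 * (\<integral>s. s * h n s \<partial>lborel)) = (\<integral>y. y\<^sup>2 * Q l (Suc n) y \<partial>lborel)"
      using lborel_integral_real_affine[OF nz(1), of "\<lambda>y. y\<^sup>2 * Q l (Suc n) y" 0] c(1)[of n] unfolding e by simp
    also have "\<dots> \<le> C2 * sqrt (real (Suc n) + 1)" by (rule C2)
    also have "\<dots> \<le> C2 * (2 * sqrt (Suc n))"
    proof (intro mult_left_mono)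
      have "sqrt (real (Suc n) + 1) \<le> sqrt (4 * real (Suc n))" by (intro real_sqrt_le_mono) simp
      then show "sqrt (real (Suc n) + 1) \<le> 2 * sqrt (Suc n)" by (simp add: real_sqrt_mult del: of_nat_Suc)
    qed (use C2 in simp)
    finally have "sqrt (Suc n) * (\<sigma> ^ 3 * (\<integral>s. s * h n s \<partial>lborel)) \<le> sqrt (Suc n) * (2 * C2)"
      by (simp add: c_def power3_eq_cube power2_eq_square mult_ac del: of_nat_Suc)
    then have "\<sigma> ^ 3 * (\<integral>s. s * h n s \<partial>lborel) \<le> 2 * C2" by (simp del: of_nat_Suc)
    then show "(\<integral>s. s * h n s \<partial>lborel) \<le> 2 * C2 / \<sigma> ^ 3" using sigma_pos by (simp add: le_divide_eq mult.commute)
  qed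
  obtain CB where CB: "CB > 0" "\<And>n x. Q l n x \<le> CB / (real n + 1)" using Q_bound[OF l] by blast
  have near: "\<bar>?I / \<sigma>\<^sup>2 - (\<integral>s. g s * indicator {..a} s \<partial>lborel)\<bar> \<le> 2 * C2 / \<sigma> ^ 3 / a" if a: "0 < a" for a
  proof -
    have L1: "(\<lambda>n. \<integral>s. h n s * indicator {..a} s \<partial>lborel) \<longlonglongrightarrow> (\<integral>s. g s * indicator {..a} s \<partial>lborel)"
    proof (rule integral_dominated_convergence[where w = "\<lambda>s. a * CB * indicator {0..a} s"])
      show "integrable lborel (\<lambda>s. a * CB * indicator {0..a} s)"
        by (intro integrable_mult_right integrable_real_indicator) (auto simp: emeasure_lborel_Icc_eq)
      show "AE s in lborel. (\<lambda>n. h n s * indicator {..a} s) \<longlonglongrightarrow> g s * indicator {..a} s"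
        by (intro AE_I2 tendsto_intros hg)
      show "AE s in lborel. norm (h n s * indicator {..a} s) \<le> a * CB * indicator {0..a} s" for n
      proof (rule AE_I2)
        fix s :: real
        show "norm (h n s * indicator {..a} s) \<le> a * CB * indicator {0..a} s"
        proof (cases "0 \<le> s \<and> s \<le> a")
          case True
          have "real (Suc n) * Q l (Suc n) (c n * s) \<le> real (Suc n) * (CB / (real (Suc n) + 1))" by (intro mult_left_mono CB) simp
          also have "\<dots> \<le> CB" using CB(1) by (simp add: field_simps)
          finally have "h n s \<le> a * CB" unfolding h_def using True a by (intro mult_mono) (auto simp: Q_nonneg)
          then show ?thesis using True h0[of n s] by simp
        next
          case False
          have "h n s = 0" if "s < 0" using that c(1)[of n] by (simp add: h_def Q_neg mult_pos_neg)
          then show ?thesis using False by (auto simp: indicator_def)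
        qed
      qed
    qed auto
    have L2: "(\<lambda>n. \<integral>s. h n s \<partial>lborel) \<longlonglongrightarrow> ?I / \<sigma>\<^sup>2"
    proof -
      have "(\<lambda>n. (\<integral>y. y * Q l (Suc n) y \<partial>lborel) / \<sigma>\<^sup>2) \<longlonglongrightarrow> ?I / \<sigma>\<^sup>2"
        using LIMSEQ_Suc[OF Q_moments(2)[OF l]] sigma_pos by (intro tendsto_intros) auto
      then show ?thesis unfolding Ih using sigma_pos by simp
    qed
    have "(\<lambda>n. \<bar>(\<integral>s. h n s \<partial>lborel) - (\<integral>s. h n s * indicator {..a} s \<partial>lborel)\<bar>)
        \<longlonglongrightarrow> \<bar>?I / \<sigma>\<^sup>2 - (\<integral>s. g s * indicator {..a} s \<partial>lborel)\<bar>"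
      by (intro tendsto_intros L1 L2)
    moreover have "\<bar>(\<integral>s. h n s \<partial>lborel) - (\<integral>s. h n s * indicator {..a} s \<partial>lborel)\<bar> \<le> 2 * C2 / \<sigma> ^ 3 / a" for n
    proof -
      have ii: "integrable lborel (\<lambda>s. h n s * indicator {..a} s)" using ih by (intro integrable_real_mult_indicator) auto
      have "(\<integral>s. h n s \<partial>lborel) - (\<integral>s. h n s * indicator {..a} s \<partial>lborel) = (\<integral>s. h n s - h n s * indicator {..a} s \<partial>lborel)"
        using ih ii by simp
      also have "\<bar>\<dots>\<bar> \<le> (\<integral>s. s * h n s / a \<partial>lborel)"
      proof (rule order_trans[OF integral_abs_bound integral_mono])
        show "integrable lborel (\<lambda>s. \<bar>h n s - h n s * indicator {..a} s\<bar>)" using ih ii by simp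
        show "integrable lborel (\<lambda>s. s * h n s / a)" using ih2 by simp
        fix s
        have "0 \<le> s * h n s" using h0[of n s] c(1)[of n]
          by (cases "0 \<le> s") (simp_all add: h_def Q_neg mult_pos_neg)
        moreover have "h n s \<le> s * h n s / a" if "a < s"
          using mult_right_mono[of a s "h n s"] that h0[of n s] a by (simp add: le_divide_eq mult.commute)
        ultimately show "\<bar>h n s - h n s * indicator {..a} s\<bar> \<le> s * h n s / a"
          using h0[of n s] a by (auto simp: indicator_def)
      qed
      also have "\<dots> \<le> 2 * C2 / \<sigma> ^ 3 / a" using divide_right_mono[OF Ih2[of n], of a] a by simp
      finally show ?thesis .
    qed
    ultimately show ?thesis by (intro LIMSEQ_le_const2[where a = "2 * C2 / \<sigma> ^ 3 / a"]) blast+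
  qed
  have G: "(\<lambda>k. \<integral>s. g s * indicator {..real (Suc k)} s \<partial>lborel) \<longlonglongrightarrow> (\<integral>s. g s \<partial>lborel)"
  proof (rule integral_dominated_convergence[OF _ _ integrable_norm[OF gi(1)]])
    show "AE s in lborel. (\<lambda>k. g s * indicator {..real (Suc k)} s) \<longlonglongrightarrow> g s"
    proof (rule AE_I2, rule tendsto_eventually)
      fix s :: real
      show "\<forall>\<^sub>F k in sequentially. g s * indicator {..real (Suc k)} s = g s"
        using eventually_ge_at_top[of "nat \<lceil>s\<rceil>"] by eventually_elim (auto simp: indicator_def)
    qed
    show "AE s in lborel. norm (g s * indicator {..real (Suc k)} s) \<le> norm (g s)" for k
      by (intro AE_I2) (auto simp: indicator_def)
  qed auto
  have "(\<lambda>k. \<bar>?I / \<sigma>\<^sup>2 - (\<integral>s. g s * indicator {..real (Suc k)} s \<partial>lborel)\<bar>) \<longlonglongrightarrow> \<bar>?I / \<sigma>\<^sup>2 - (\<integral>s. g s \<partial>lborel)\<bar>"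
    by (intro tendsto_intros G)
  moreover have "(\<lambda>k. 2 * C2 / \<sigma> ^ 3 / real (Suc k)) \<longlonglongrightarrow> 0"
    by (rule LIMSEQ_Suc[OF lim_const_over_n])
  ultimately have "\<bar>?I / \<sigma>\<^sup>2 - (\<integral>s. g s \<partial>lborel)\<bar> \<le> 0"
    by (rule LIMSEQ_le) (intro exI[of _ 0] allI impI near, simp)
  then show ?thesis using gi(2) l by (simp add: field_simps)
qed

lemma Q_asymp_renewal:
  assumes l: "0 < l" and eta: "0 < \<eta>"
    and x: "\<forall>\<^sub>F n in sequentially. sqrt n / \<eta> \<le> x n \<and> x n \<le> \<eta> * sqrt n"
  shows "(\<lambda>n. n * Q l n (x n) - 2 * (\<integral>t. gexp l t * dual_renewal t \<partial>lborel) / (sqrt (2 * pi) * \<sigma>\<^sup>2)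
    * phi_plus (x n / (\<sigma> * sqrt n))) \<longlonglongrightarrow> 0"
  using Q_asymp[OF l eta x] l unfolding Q_const_eq[OF l] rayleigh_def by (simp add: mult_ac)

end

section \<open>Exponential tilting\<close>

lemma walk_cong: "(\<And>i. 1 \<le> i \<Longrightarrow> u i = v i) \<Longrightarrow> walk u n = walk v n"
  unfolding walk_def by (intro sum.cong) auto

lemma exit_time_cong:
  assumes "\<And>i. 1 \<le> i \<Longrightarrow> u i = v i"
  shows "exit_time x u = exit_time x v" "walk_at_exit x u = walk_at_exit x v"
proof -
  have "walk u n = walk v n" for n using assms by (rule walk_cong)
  then show "exit_time x u = exit_time x v" "walk_at_exit x u = walk_at_exit x v"
    by (simp_all add: exit_time_def walk_at_exit_def cong: enat.case_cong)
qed

lemma PiM_shift: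
  fixes \<mu> :: "real measure"
  assumes "prob_space \<mu>"
  shows "distr (\<Pi>\<^sub>M i\<in>{1..}. \<mu>) (Pi\<^sub>M UNIV (\<lambda>_. \<mu>)) (\<lambda>w n. w (Suc n)) = Pi\<^sub>M UNIV (\<lambda>_. \<mu>)"
  using distr_PiM_reindex[of "{1..}" "\<lambda>_. \<mu>" Suc UNIV] assms by (simp add: restrict_def)

lemma (in prob_space) distr_increments:
  fixes X :: "nat \<Rightarrow> 'a \<Rightarrow> real"
  assumes indep: "indep_vars (\<lambda>_. borel) X {1..}"
    and law: "\<And>i. 1 \<le> i \<Longrightarrow> distr M borel (X i) = \<mu>"
  shows "(\<lambda>\<omega> i. X (Suc i) \<omega>) \<in> measurable M seq_borel"
    and "distr M seq_borel (\<lambda>\<omega> i. X (Suc i) \<omega>) = Pi\<^sub>M UNIV (\<lambda>_. \<mu>)"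
proof -
  have X [measurable]: "random_variable borel (X i)" if "i \<in> {1..}" for i
    using indep that by (simp add: indep_vars_def2)
  have e: "\<mu> = distr M borel (X 1)" using law[of 1] by simp
  have mu: "prob_space \<mu>" "sets \<mu> = sets borel"
    unfolding e by (rule prob_space_distr[OF X], simp) simp
  have R: "(\<lambda>\<omega>. \<lambda>i\<in>{1..}. X i \<omega>) \<in> measurable M (\<Pi>\<^sub>M i\<in>{1..}. borel)"
    by (rule measurable_restrict) (rule X)
  have S: "(\<lambda>w n. w (Suc n)) \<in> measurable (\<Pi>\<^sub>M i\<in>{1..}. borel :: real measure) seq_borel"
    by (rule measurable_PiM_single') (auto intro!: measurable_component_singleton)
  have D: "distr M (\<Pi>\<^sub>M i\<in>{1..}. borel) (\<lambda>\<omega>. \<lambda>i\<in>{1..}. X i \<omega>) = (\<Pi>\<^sub>M i\<in>{1..}. \<mu>)"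
  proof -
    have "distr M (\<Pi>\<^sub>M i\<in>{1..}. borel) (\<lambda>\<omega>. \<lambda>i\<in>{1..}. X i \<omega>) = (\<Pi>\<^sub>M i\<in>{1..}. distr M borel (X i))"
      using indep_vars_iff_distr_eq_PiM'[where I = "{1..}" and M' = "\<lambda>_. borel" and X = X] indep X by simp
    also have "\<dots> = (\<Pi>\<^sub>M i\<in>{1..}. \<mu>)" by (intro PiM_cong refl law) auto
    finally show ?thesis .
  qed
  have "distr M seq_borel (\<lambda>\<omega> i. X (Suc i) \<omega>) = distr M seq_borel ((\<lambda>w n. w (Suc n)) \<circ> (\<lambda>\<omega>. \<lambda>i\<in>{1..}. X i \<omega>))"
    by (simp add: comp_def)
  also have "\<dots> = distr (distr M (\<Pi>\<^sub>M i\<in>{1..}. borel) (\<lambda>\<omega>. \<lambda>i\<in>{1..}. X i \<omega>)) seq_borel (\<lambda>w n. w (Suc n))"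
    by (rule distr_distr[OF S R, symmetric])
  also have "\<dots> = distr (\<Pi>\<^sub>M i\<in>{1..}. \<mu>) (Pi\<^sub>M UNIV (\<lambda>_. \<mu>)) (\<lambda>w n. w (Suc n))"
    unfolding D by (intro distr_cong refl sets_PiM_cong) (simp_all add: mu)
  also have "\<dots> = Pi\<^sub>M UNIV (\<lambda>_. \<mu>)" by (rule PiM_shift[OF mu(1)])
  finally show "distr M seq_borel (\<lambda>\<omega> i. X (Suc i) \<omega>) = Pi\<^sub>M UNIV (\<lambda>_. \<mu>)" .
  show "(\<lambda>\<omega> i. X (Suc i) \<omega>) \<in> measurable M seq_borel"
    by (rule measurable_PiM_single') auto
qed

lemma (in prob_space) exit_time_prob:
  fixes X :: "nat \<Rightarrow> 'a \<Rightarrow> real"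
  assumes indep: "indep_vars (\<lambda>_. borel) X {1..}"
    and law: "\<And>i. 1 \<le> i \<Longrightarrow> distr M borel (X i) = \<mu>"
    and x: "0 \<le> x"
  shows "prob {\<omega>\<in>space M. enat n < exit_time x (\<lambda>i. X i \<omega>)} = (\<integral>w. of_bool (stays x w n) \<partial>Pi\<^sub>M UNIV (\<lambda>_. \<mu>))"
proof -
  let ?Y = "\<lambda>\<omega> i. X (Suc i) \<omega>"
  have Y: "?Y \<in> measurable M seq_borel" by (rule distr_increments(1)[OF indep]) (rule law)
  have D: "distr M seq_borel ?Y = Pi\<^sub>M UNIV (\<lambda>_. \<mu>)" by (rule distr_increments(2)[OF indep]) (rule law)
  have "exit_time x (\<lambda>i. X i \<omega>) = exit_time x (increments (?Y \<omega>))" for \<omega>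
    by (rule exit_time_cong) (simp add: increments_def)
  then have "enat n < exit_time x (\<lambda>i. X i \<omega>) \<longleftrightarrow> stays x (?Y \<omega>) n" for \<omega>
    using x by (simp add: stays_iff_exit_time)
  then have "prob {\<omega>\<in>space M. enat n < exit_time x (\<lambda>i. X i \<omega>)} = prob {\<omega>\<in>space M. stays x (?Y \<omega>) n}" by simp
  also have "\<dots> = (\<integral>\<omega>. indicator {\<omega>\<in>space M. stays x (?Y \<omega>) n} \<omega> \<partial>M)"
    by (simp add: Int_absorb2 subset_iff)
  also have "\<dots> = (\<integral>\<omega>. of_bool (stays x (?Y \<omega>) n) \<partial>M)"
    by (intro Bochner_Integration.integral_cong) (auto simp: indicator_def)
  also have "\<dots> = (\<integral>w. of_bool (stays x w n) \<partial>Pi\<^sub>M UNIV (\<lambda>_. \<mu>))"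
    unfolding D[symmetric] by (rule integral_distr[OF Y, symmetric]) measurable
  finally show ?thesis .
qed

text \<open>This concerns the original law, which need not be centred, and therefore stands outside
  \<open>iid_walk\<close>.\<close>

lemma stays_prob_first_step:
  fixes \<mu> :: "real measure"
  assumes mu: "prob_space \<mu>" "sets \<mu> = sets borel"
  defines "S \<equiv> Pi\<^sub>M UNIV (\<lambda>_::nat. \<mu>)"
  shows "(\<integral>w. of_bool (stays x w (Suc n)) \<partial>S :: real) = of_bool (0 \<le> x) * (\<integral>y. (\<integral>w. of_bool (stays (x + y) w n) \<partial>S) \<partial>\<mu>)"
proof -
  interpret mu: prob_space \<mu> by fact
  interpret SP: product_prob_space "\<lambda>_::nat. \<mu>" UNIV by unfold_locales
  interpret SS: sequence_space \<mu> by (rule sequence_space.intro) (rule SP.product_prob_space_axioms)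
  interpret S: prob_space S unfolding S_def by (rule SP.prob_space_axioms)
  interpret PS: pair_prob_space \<mu> S by unfold_locales
  have sS [measurable_cong]: "sets S = sets seq_borel" unfolding S_def by (intro sets_PiM_cong) (simp_all add: mu)
  note mu(2) [measurable_cong]
  have m: "(\<lambda>(y, w). case_nat y w) \<in> measurable (\<mu> \<Otimes>\<^sub>M S) S"
    unfolding measurable_cong_sets[OF refl sS] case_prod_beta'
  proof (rule measurable_PiM_single')
    fix i show "(\<lambda>p. case_nat (fst p) (snd p) i) \<in> borel_measurable (\<mu> \<Otimes>\<^sub>M S)"
      by (cases i) measurable
  qed auto
  have d: "distr (\<mu> \<Otimes>\<^sub>M S) S (\<lambda>(y, w). case_nat y w) = S" unfolding S_def by (rule SS.PiM_iter)
  let ?F = "\<lambda>w. of_bool (stays x w (Suc n)) :: real"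
  have F: "?F \<in> borel_measurable S" by measurable
  have "integrable S ?F" by (rule S.integrable_const_bound[where B = 1]) (use F in auto)
  then have i: "integrable (\<mu> \<Otimes>\<^sub>M S) (\<lambda>p. ?F ((\<lambda>(y, w). case_nat y w) p))"
    using integrable_distr_eq[OF m F] unfolding d by simp
  have "(\<integral>w. ?F w \<partial>S) = (\<integral>p. ?F ((\<lambda>(y, w). case_nat y w) p) \<partial>(\<mu> \<Otimes>\<^sub>M S))"
    using integral_distr[OF m F] unfolding d by simp
  also have "\<dots> = (\<integral>y. (\<integral>w. ?F (case_nat y w) \<partial>S) \<partial>\<mu>)"
    using PS.integral_fst'[OF i] by simp
  also have "\<dots> = of_bool (0 \<le> x) * (\<integral>y. (\<integral>w. of_bool (stays (x + y) w n) \<partial>S) \<partial>\<mu>)"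
    by (cases "0 \<le> x") (simp_all add: stays_case_nat_Suc)
  finally show ?thesis .
qed

lemma (in iid_walk) Q_first_step:
  assumes "0 \<le> l"
  shows "Q l (Suc n) x = of_bool (0 \<le> x) * (\<integral>y. Q l n (x + y) \<partial>\<nu>)"
  unfolding Q_def by (subst first_step_integral(1)[OF Q_integrable[OF assms]], cases "0 \<le> x")
    (simp_all add: stays_case_nat_Suc psum_case_nat_Suc add.assoc)

section \<open>The tilted law\<close>

locale cramer_law =
  fixes \<mu> :: "real measure" and l \<delta> :: real
  assumes prob_space_mu: "prob_space \<mu>"
    and sets_mu [measurable_cong]: "sets \<mu> = sets borel"
    and l_pos: "0 < l" and delta_pos: "0 < \<delta>"
    and second_moment_pos: "0 < (\<integral>y. y\<^sup>2 \<partial>\<mu>)"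
    and centred: "(\<integral>y. y * exp (l * y) \<partial>\<mu>) = 0"
    and tilted_moment: "integrable \<mu> (\<lambda>y. \<bar>y\<bar> powr (2 + \<delta>) * exp (l * y))"
begin

sublocale mu: prob_space \<mu> by (rule prob_space_mu)

text \<open>Finiteness of the exponential moment follows from the tilted moment: to the left of 1
  the exponential is at most exp l, and to the right of 1 the power is at least 1.\<close>

lemma exp_integrable: "integrable \<mu> (\<lambda>y. exp (l * y))"
proof (rule Bochner_Integration.integrable_bound)
  show "integrable \<mu> (\<lambda>y. exp l + \<bar>y\<bar> powr (2 + \<delta>) * exp (l * y))"
    by (intro Bochner_Integration.integrable_add tilted_moment) simp
  show "AE y in \<mu>. norm (exp (l * y)) \<le> norm (exp l + \<bar>y\<bar> powr (2 + \<delta>) * exp (l * y))"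
  proof (rule AE_I2)
    fix y :: real
    have "exp (l * y) \<le> exp l + \<bar>y\<bar> powr (2 + \<delta>) * exp (l * y)"
    proof (cases "y \<le> 1")
      case True
      then have "exp (l * y) \<le> exp l" using l_pos by simp
      then show ?thesis by (simp add: add_increasing2)
    next
      case False
      then have "1 \<le> \<bar>y\<bar> powr (2 + \<delta>)" using delta_pos by (intro ge_one_powr_ge_zero) auto
      then have "1 * exp (l * y) \<le> \<bar>y\<bar> powr (2 + \<delta>) * exp (l * y)" by (intro mult_right_mono) auto
      then show ?thesis by (simp add: add_increasing)
    qed
    then show "norm (exp (l * y)) \<le> norm (exp l + \<bar>y\<bar> powr (2 + \<delta>) * exp (l * y))" by simp
  qed
qed simp

lemma square_exp_integrable: "integrable \<mu> (\<lambda>y. y\<^sup>2 * exp (l * y))"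
proof (rule Bochner_Integration.integrable_bound)
  show "integrable \<mu> (\<lambda>y. exp (l * y) + \<bar>y\<bar> powr (2 + \<delta>) * exp (l * y))"
    by (intro Bochner_Integration.integrable_add tilted_moment exp_integrable)
  show "AE y in \<mu>. norm (y\<^sup>2 * exp (l * y)) \<le> norm (exp (l * y) + \<bar>y\<bar> powr (2 + \<delta>) * exp (l * y))"
  proof (rule AE_I2)
    fix y :: real
    have "y\<^sup>2 \<le> 1 + \<bar>y\<bar> powr (2 + \<delta>)"
    proof (cases "\<bar>y\<bar> \<le> 1")
      case True
      then have "y\<^sup>2 \<le> 1" by (simp add: abs_square_le_1)
      then show ?thesis by (simp add: add_increasing2)
    next
      case False
      have "y\<^sup>2 = \<bar>y\<bar> powr 2" using False by simp
      also have "\<dots> \<le> \<bar>y\<bar> powr (2 + \<delta>)" using False delta_pos by (intro powr_mono) auto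
      finally show ?thesis by simp
    qed
    then have "y\<^sup>2 * exp (l * y) \<le> (1 + \<bar>y\<bar> powr (2 + \<delta>)) * exp (l * y)" by (intro mult_right_mono) auto
    then show "norm (y\<^sup>2 * exp (l * y)) \<le> norm (exp (l * y) + \<bar>y\<bar> powr (2 + \<delta>) * exp (l * y))"
      by (simp add: distrib_right)
  qed
qed simp

lemma mgf_pos: "0 < (\<integral>y. exp (l * y) \<partial>\<mu>)"
proof -
  have "(\<integral>y. exp (l * y) \<partial>\<mu>) \<noteq> 0"
    using integral_nonneg_eq_0_iff_AE[OF exp_integrable] mu.AE_False by auto
  moreover have "0 \<le> (\<integral>y. exp (l * y) \<partial>\<mu>)" by (intro Bochner_Integration.integral_nonneg) simp
  ultimately show ?thesis by linarith
qed

abbreviation \<Lambda> :: real where "\<Lambda> \<equiv> log_mgf \<mu> l"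

abbreviation \<nu> :: "real measure" where "\<nu> \<equiv> tilted_law \<mu> l"

lemma exp_log_mgf: "exp (l * y - \<Lambda>) = exp (l * y) / (\<integral>y. exp (l * y) \<partial>\<mu>)"
  using mgf_pos by (simp add: log_mgf_def exp_diff)

lemma sets_tilted: "sets \<nu> = sets borel"
  by (simp add: tilted_law_def sets_mu)

lemma tilted_integral:
  fixes f :: "real \<Rightarrow> real"
  assumes "f \<in> borel_measurable borel"
  shows "(\<integral>y. f y \<partial>\<nu>) = (\<integral>y. exp (l * y - \<Lambda>) * f y \<partial>\<mu>)"
    and "integrable \<nu> f \<longleftrightarrow> integrable \<mu> (\<lambda>y. exp (l * y - \<Lambda>) * f y)"
proof -
  have f: "f \<in> borel_measurable \<mu>" using assms by measurable
  have g: "(\<lambda>y. exp (l * y - \<Lambda>)) \<in> borel_measurable \<mu>" by measurable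
  show "(\<integral>y. f y \<partial>\<nu>) = (\<integral>y. exp (l * y - \<Lambda>) * f y \<partial>\<mu>)"
    unfolding tilted_law_def by (subst integral_density[OF f g]) auto
  show "integrable \<nu> f \<longleftrightarrow> integrable \<mu> (\<lambda>y. exp (l * y - \<Lambda>) * f y)"
    unfolding tilted_law_def by (subst integrable_density[OF f g]) auto
qed

lemma prob_space_tilted: "prob_space \<nu>"
proof (rule prob_spaceI)
  have i: "integrable \<mu> (\<lambda>y. exp (l * y - \<Lambda>))"
    unfolding exp_log_mgf by (intro integrable_divide exp_integrable)
  have "emeasure \<nu> (space \<nu>) = (\<integral>\<^sup>+y. ennreal (exp (l * y - \<Lambda>)) \<partial>\<mu>)"
    unfolding tilted_law_def by (subst emeasure_density) (auto intro!: nn_integral_cong)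
  also have "\<dots> = ennreal (\<integral>y. exp (l * y - \<Lambda>) \<partial>\<mu>)"
    by (rule nn_integral_eq_integral[OF i]) simp
  also have "(\<integral>y. exp (l * y - \<Lambda>) \<partial>\<mu>) = 1" unfolding exp_log_mgf using mgf_pos by simp
  finally show "emeasure \<nu> (space \<nu>) = 1" by simp
qed

text \<open>The density of \<open>\<nu>\<close> is positive everywhere, so \<open>\<nu>\<close>-null
  sets are \<open>\<mu>\<close>-null. This carries degeneracy and lattice structure back to the
  original law.\<close>

lemma AE_tilted:
  assumes "Measurable.pred borel R" "AE y in \<nu>. R y" shows "AE y in \<mu>. R y"
  using assms(2) unfolding tilted_law_def by (subst (asm) AE_density) auto

text \<open>A provisional instance with the deviation computed from \<open>\<nu>\<close> itself. Its
  lemmas on coordinates are used in \<open>iid_walk_tilted\<close> to identify that number with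
  \<open>tilted_sigma\<close>, which is defined on the path space.\<close>

lemma iid_walk_sqrt: "iid_walk \<nu> (sqrt (\<integral>y. y\<^sup>2 \<partial>\<nu>))"
proof (rule iid_walk.intro)
  show "prob_space \<nu>" by (rule prob_space_tilted)
  show "sets \<nu> = sets borel" by (rule sets_tilted)
  let ?Z = "\<integral>y. exp (l * y) \<partial>\<mu>"
  have e1: "exp (l * y - \<Lambda>) * y = y * exp (l * y) / ?Z" and e2: "exp (l * y - \<Lambda>) * y\<^sup>2 = y\<^sup>2 * exp (l * y) / ?Z" for y
    by (simp_all add: exp_log_mgf)
  have id: "(\<lambda>y::real. y) \<in> borel_measurable borel" by measurable
  show "(\<integral>y. y \<partial>\<nu>) = 0"
    unfolding tilted_integral(1)[OF id] e1 by (simp add: centred)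
  have sq: "(\<lambda>y::real. y\<^sup>2) \<in> borel_measurable borel" by measurable
  show i: "integrable \<nu> (\<lambda>y. y\<^sup>2)"
    unfolding tilted_integral(2)[OF sq] e2 by (intro integrable_divide square_exp_integrable)
  have nn: "0 \<le> (\<integral>y. y\<^sup>2 \<partial>\<nu>)" by (intro Bochner_Integration.integral_nonneg) simp
  then show "(\<integral>y. y\<^sup>2 \<partial>\<nu>) = (sqrt (\<integral>y. y\<^sup>2 \<partial>\<nu>))\<^sup>2" by simp
  have "(\<integral>y. y\<^sup>2 \<partial>\<nu>) \<noteq> 0"
  proof
    assume "(\<integral>y. y\<^sup>2 \<partial>\<nu>) = 0"
    then have "AE y in \<nu>. y = 0" using integral_nonneg_eq_0_iff_AE[OF i] by simp
    then have "AE y in \<mu>. y = 0" by (rule AE_tilted[rotated]) measurable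
    then have "AE y in \<mu>. y\<^sup>2 = 0" by simp
    then have "(\<integral>y. y\<^sup>2 \<partial>\<mu>) = 0" by (subst integral_eq_zero_AE) auto
    then show False using second_moment_pos by simp
  qed
  then have "0 < (\<integral>y. y\<^sup>2 \<partial>\<nu>)" using nn by linarith
  then show "0 < sqrt (\<integral>y. y\<^sup>2 \<partial>\<nu>)" by (rule real_sqrt_gt_zero)
qed

lemma tilted_shift: "distr (tilted_measure \<mu> l) seq_borel (\<lambda>w n. w (Suc n)) = Pi\<^sub>M UNIV (\<lambda>_. \<nu>)"
proof -
  have "distr (tilted_measure \<mu> l) seq_borel (\<lambda>w n. w (Suc n)) = distr (\<Pi>\<^sub>M i\<in>{1..}. \<nu>) (Pi\<^sub>M UNIV (\<lambda>_. \<nu>)) (\<lambda>w n. w (Suc n))"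
    unfolding tilted_measure_def by (intro distr_cong refl sets_PiM_cong) (simp_all add: sets_tilted)
  then show ?thesis unfolding PiM_shift[OF prob_space_tilted] .
qed

lemma integral_tilted_measure:
  fixes F :: "(nat \<Rightarrow> real) \<Rightarrow> real"
  assumes "F \<in> borel_measurable seq_borel"
  shows "(\<integral>w. F (\<lambda>n. w (Suc n)) \<partial>tilted_measure \<mu> l) = (\<integral>w. F w \<partial>Pi\<^sub>M UNIV (\<lambda>_. \<nu>))"
proof -
  have "sets (tilted_measure \<mu> l) = sets (\<Pi>\<^sub>M i\<in>{1..}. borel :: real measure)"
    unfolding tilted_measure_def by (intro sets_PiM_cong) (simp_all add: sets_tilted)
  moreover have "(\<lambda>w n. w (Suc n)) \<in> measurable (\<Pi>\<^sub>M i\<in>{1..}. borel :: real measure) seq_borel"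
    by (rule measurable_PiM_single') (auto intro!: measurable_component_singleton)
  ultimately have "(\<lambda>w n. w (Suc n)) \<in> measurable (tilted_measure \<mu> l) seq_borel"
    by (simp cong: measurable_cong_sets)
  from integral_distr[OF this assms] show ?thesis unfolding tilted_shift ..
qed

lemma iid_walk_tilted: "iid_walk \<nu> (tilted_sigma \<mu> l)"
proof -
  interpret I: iid_walk \<nu> "sqrt (\<integral>y. y\<^sup>2 \<partial>\<nu>)" by (rule iid_walk_sqrt)
  have "(\<integral>w. (w 1)\<^sup>2 \<partial>tilted_measure \<mu> l) = (\<integral>w. (w 0)\<^sup>2 \<partial>Pi\<^sub>M UNIV (\<lambda>_::nat. \<nu>))"
    using integral_tilted_measure[of "\<lambda>w. (w 0)\<^sup>2"] by simp
  also have "\<dots> = (\<integral>y. y\<^sup>2 \<partial>\<nu>)" by (rule I.component_integral) measurable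
  finally show ?thesis using iid_walk_sqrt by (simp add: tilted_sigma_def)
qed

sublocale iid_walk \<nu> "tilted_sigma \<mu> l" by (rule iid_walk_tilted)

lemma V_star_eq: assumes "0 \<le> t" shows "V_star \<mu> l t = dual_renewal t"
proof -
  interpret R: iid_walk "distr \<nu> borel uminus" "tilted_sigma \<mu> l" by (rule reflected_walk)
  have m: "(\<lambda>w. walk_at_exit t (increments w)) \<in> borel_measurable seq_borel"
    using R.exit_mean(1)[OF assms] by (simp cong: measurable_cong_sets add: R.sets_W)
  have "(\<lambda>w i. - w i) \<in> measurable seq_borel (seq_borel :: (nat \<Rightarrow> real) measure)"
    by (rule measurable_PiM_single') auto
  from measurable_compose[OF this m]
  have "(\<integral>w. walk_at_exit t (increments (\<lambda>i. - w (Suc i))) \<partial>tilted_measure \<mu> l) = - dual_renewal t"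
    unfolding dual_renewal_def by (subst integral_tilted_measure[symmetric]) simp_all
  moreover have "walk_at_exit t (increments (\<lambda>i. - w (Suc i))) = walk_at_exit t (\<lambda>i. - w i)" for w
    by (rule exit_time_cong) (simp add: increments_def)
  ultimately show ?thesis by (simp add: V_star_def)
qed

text \<open>By induction over the first step with a varying starting point: every step consumes one
  factor exp (l * y - \<Lambda>) of the tilting density, and the last one leaves the weight of the
  endpoint.\<close>

lemma change_of_measure:
  "(\<integral>w. of_bool (stays x w n) \<partial>Pi\<^sub>M UNIV (\<lambda>_. \<mu>)) = exp (n * \<Lambda> + l * x) * Q l n x"
proof (induction n arbitrary: x)
  case 0
  interpret S: prob_space "Pi\<^sub>M UNIV (\<lambda>_::nat. \<mu>)" by (rule prob_space_PiM) (rule prob_space_mu)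
  show ?case
    using P.prob_space S.prob_space by (auto simp: stays_0 Q_def gexp_def mult_exp_exp)
next
  case (Suc n)
  let ?c = "exp (Suc n * \<Lambda> + l * x)"
  have 1: "(\<integral>w. of_bool (stays x w (Suc n)) \<partial>Pi\<^sub>M UNIV (\<lambda>_. \<mu>) :: real)
      = of_bool (0 \<le> x) * (\<integral>y. (\<integral>w. of_bool (stays (x + y) w n) \<partial>Pi\<^sub>M UNIV (\<lambda>_. \<mu>)) \<partial>\<mu>)"
    by (rule stays_prob_first_step[OF prob_space_mu sets_mu])
  have 2: "(\<integral>w. of_bool (stays (x + y) w n) \<partial>Pi\<^sub>M UNIV (\<lambda>_. \<mu>)) = ?c * (exp (l * y - \<Lambda>) * Q l n (x + y))" for y
  proof -
    have "exp (n * \<Lambda> + l * (x + y)) = ?c * exp (l * y - \<Lambda>)"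
      by (simp add: algebra_simps flip: exp_add)
    then show ?thesis using Suc.IH[of "x + y"] by (simp only: mult.assoc)
  qed
  have 3: "(\<integral>y. exp (l * y - \<Lambda>) * Q l n (x + y) \<partial>\<mu>) = (\<integral>y. Q l n (x + y) \<partial>\<nu>)"
    by (rule tilted_integral(1)[symmetric]) measurable
  have 4: "Q l (Suc n) x = of_bool (0 \<le> x) * (\<integral>y. Q l n (x + y) \<partial>\<nu>)"
    using l_pos by (intro Q_first_step) simp
  show ?case unfolding 1 2 4 integral_mult_right_zero 3 by (rule mult.left_commute)
qed

text \<open>If the characteristic function has modulus 1 at \<open>t \<noteq> 0\<close>, then \<open>cos (t * y - a) = 1\<close> almost
  surely for some \<open>a\<close>, so the law sits on a lattice of span \<open>2 * pi / \<bar>t\<bar>\<close>.\<close>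

lemma lattice_if_char_eq_1:
  assumes t: "t \<noteq> 0" and c: "\<not> cmod (char \<nu> t) < 1"
  shows "\<exists>h>0. \<exists>a\<in>{0..<h}. AE y in \<mu>. \<exists>k::int. y = h * of_int k + a"
proof -
  interpret N: real_distribution \<nu> by (rule real_distribution_nu)
  have "cmod (char \<nu> t) = 1" using c N.cmod_char_le_1[of t] by simp
  then obtain a where a: "char \<nu> t = cis a"
    by (metis complex_eq_iff cis_Arg_unique cis_rcis_eq mult_1 rcis_cmod_Arg rcis_def of_real_1)
  have i: "integrable \<nu> (\<lambda>y. cis (t * y - a))"
    by (rule nu.integrable_const_bound[where B = 1]) (auto simp: cis_conv_exp)
  have "(\<integral>y. cis (t * y - a) \<partial>\<nu>) = cis (- a) * (\<integral>y. cis (t * y) \<partial>\<nu>)"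
    by (subst integral_mult_right_zero[symmetric]) (simp add: cis_mult algebra_simps)
  also have "(\<integral>y. cis (t * y) \<partial>\<nu>) = cis a" using a by (simp add: char_def cis_conv_exp)
  also have "cis (- a) * cis a = 1" by (simp add: cis_mult)
  finally have "(\<integral>y. Re (cis (t * y - a)) \<partial>\<nu>) = 1" using integral_Re[OF i] by simp
  then have c1: "(\<integral>y. cos (t * y - a) \<partial>\<nu>) = 1" by simp
  have ic: "integrable \<nu> (\<lambda>y. cos (t * y - a))"
    by (rule nu.integrable_const_bound[where B = 1]) auto
  have "(\<integral>y. 1 - cos (t * y - a) \<partial>\<nu>) = 0" using ic c1 nu.prob_space by simp
  then have "AE y in \<nu>. 1 - cos (t * y - a) = 0"
    using ic by (subst (asm) integral_nonneg_eq_0_iff_AE) auto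
  then have AE: "AE y in \<mu>. cos (t * y - a) = 1"
    by (intro AE_tilted) auto
  define h where "h = 2 * pi / \<bar>t\<bar>"
  \<comment> \<open>The number a / t reduced modulo h, because \<open>non_lattice\<close> speaks of
    offsets in [0, h).\<close>
  define b where "b = a / t - h * of_int \<lfloor>a / t / h\<rfloor>"
  have h: "0 < h" using t by (simp add: h_def)
  have fl: "of_int \<lfloor>a / t / h\<rfloor> \<le> a / t / h" "a / t / h < of_int \<lfloor>a / t / h\<rfloor> + 1" by linarith+
  have "b \<in> {0..<h}"
    using mult_left_mono[OF fl(1), of h] mult_strict_left_mono[OF fl(2), of h] h by (auto simp: b_def algebra_simps)
  moreover have "AE y in \<mu>. \<exists>k::int. y = h * of_int k + b"
    using AE
  proof eventually_elim
    case (elim y)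
    then obtain m :: int where m: "t * y - a = of_int m * 2 * pi" using cos_one_2pi_int by blast
    have "y = a / t + of_int m * (2 * pi / t)" using m t by (simp add: field_simps)
    also have "2 * pi / t = h * sgn t" using t by (simp add: h_def sgn_if)
    also have "a / t + of_int m * (h * sgn t) = h * of_int ((if 0 < t then m else - m) + \<lfloor>a / t / h\<rfloor>) + b"
      using t by (simp add: b_def algebra_simps)
    finally show ?case by blast
  qed
  ultimately show ?thesis using h by blast
qed

end

section \<open>Uniformity and conclusion\<close>

lemma (in nonlattice_walk) Q_asymp_uniform:
  assumes l: "0 < l" and eta: "1 \<le> \<eta>" and e: "0 < e"
  shows "\<forall>\<^sub>F n in sequentially. \<forall>x\<in>{inverse \<eta> * sqrt n..\<eta> * sqrt n}.
    \<bar>n * Q l n x - 2 * (\<integral>t. gexp l t * dual_renewal t \<partial>lborel) / (sqrt (2 * pi) * \<sigma>\<^sup>2)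
      * phi_plus (x / (\<sigma> * sqrt n))\<bar> < e"
proof -
  define err where "err n x = \<bar>n * Q l n x - 2 * (\<integral>t. gexp l t * dual_renewal t \<partial>lborel) / (sqrt (2 * pi) * \<sigma>\<^sup>2)
      * phi_plus (x / (\<sigma> * sqrt n))\<bar>" for n :: nat and x
  define R where "R n = {inverse \<eta> * sqrt n..\<eta> * sqrt n}" for n :: nat
  \<comment> \<open>Uniformity: test the sequential asymptotics along near-worst points.\<close>
  define bad where "bad n x \<longleftrightarrow> x \<in> R n \<and> \<not> err n x < e" for n x
  define x where "x n = (if \<exists>x. bad n x then SOME x. bad n x else sqrt n)" for n :: nat
  have bad: "bad n (x n)" if "bad n y" for n y
    using that unfolding x_def by (auto intro: someI)
  have "sqrt n \<in> R n" for n
    using eta mult_right_mono[of "inverse \<eta>" 1 "sqrt n"] mult_right_mono[of 1 \<eta> "sqrt n"]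
    by (simp add: R_def inverse_le_1_iff)
  then have "x n \<in> R n" for n
    using bad[of n] by (cases "\<exists>y. bad n y") (auto simp: bad_def, auto simp: x_def bad_def)
  then have "\<forall>\<^sub>F n in sequentially. sqrt n / \<eta> \<le> x n \<and> x n \<le> \<eta> * sqrt n"
    by (intro always_eventually) (auto simp: R_def field_simps)
  from Q_asymp_renewal[OF l _ this] eta
  have "(\<lambda>n. err n (x n)) \<longlonglongrightarrow> 0" by (auto simp: err_def intro!: tendsto_rabs_zero)
  from order_tendstoD(2)[OF this e] show ?thesis
    unfolding err_def[symmetric] R_def[symmetric]
    by eventually_elim (use bad in \<open>auto simp: bad_def\<close>)
qed

lemma phi_plus_lower_bound:
  assumes "0 < a" "a \<le> s" "s \<le> b"
  shows "a * exp (- b\<^sup>2 / 2) \<le> phi_plus s"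
proof -
  have "s\<^sup>2 \<le> b\<^sup>2" using assms by (intro power_mono) auto
  then have "a * exp (- b\<^sup>2 / 2) \<le> s * exp (- s\<^sup>2 / 2)" using assms by (intro mult_mono) auto
  then show ?thesis using assms by (simp add: phi_plus_def)
qed

theorem theorem1p10:
  fixes M :: "'a measure" and X :: "nat \<Rightarrow> 'a \<Rightarrow> real"
    and l \<delta> \<eta> :: real and \<mu> :: "real measure"
  defines "\<mu> \<equiv> distr M borel (X 1)"
  assumes "prob_space M"
    and "prob_space.indep_vars M (\<lambda>_. borel) X {1..}"
    and "\<And>i. 1 \<le> i \<Longrightarrow> distr M borel (X i) = distr M borel (X 1)"
    and "integrable M (\<lambda>\<omega>. (X 1 \<omega>)\<^sup>2)" and "(\<integral>\<omega>. (X 1 \<omega>)\<^sup>2 \<partial>M) > 0"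
    and "non_lattice M (X 1)"
    and "l > 0" and "\<delta> > 0"
    and "integrable M (\<lambda>\<omega>. X 1 \<omega> * exp (l * X 1 \<omega>))"
    and "(\<integral>\<omega>. X 1 \<omega> * exp (l * X 1 \<omega>) \<partial>M) = 0"
    and "integrable M (\<lambda>\<omega>. \<bar>X 1 \<omega>\<bar> powr (2 + \<delta>) * exp (l * X 1 \<omega>))"
    and "\<eta> \<ge> 1"
  shows "unif_asymp_equiv (\<lambda>n. {inverse \<eta> * sqrt (real n)..\<eta> * sqrt (real n)})
    (\<lambda>n x. measure M {\<omega>\<in>space M. exit_time x (\<lambda>i. X i \<omega>) > enat n})
    (\<lambda>n x. 2 * exp (real n * log_mgf \<mu> l + l * x)
        / (sqrt (2 * pi) * (tilted_sigma \<mu> l)\<^sup>2 * real n)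
      * phi_plus (x / (tilted_sigma \<mu> l * sqrt (real n)))
      * (LINT t:{0..}|lborel. exp (- l * t) * V_star \<mu> l t))"
proof -
  interpret M: prob_space M by fact
  have X1 [measurable]: "X 1 \<in> borel_measurable M"
    using assms(3) by (simp add: M.indep_vars_def2)
  interpret cramer_law \<mu> l \<delta>
  proof (rule cramer_law.intro)
    show "prob_space \<mu>" unfolding \<mu>_def by (rule M.prob_space_distr[OF X1])
    show "sets \<mu> = sets borel" by (simp add: \<mu>_def)
    show "0 < (\<integral>y. y\<^sup>2 \<partial>\<mu>)" using assms(6) unfolding \<mu>_def by (subst integral_distr[OF X1]) simp_all
    show "(\<integral>y. y * exp (l * y) \<partial>\<mu>) = 0" using assms(11) unfolding \<mu>_def by (subst integral_distr[OF X1]) simp_all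
    show "integrable \<mu> (\<lambda>y. \<bar>y\<bar> powr (2 + \<delta>) * exp (l * y))"
      unfolding \<mu>_def by (subst integrable_distr_eq[OF X1]) (use assms(12) in simp_all)
  qed fact+
  interpret nonlattice_walk "tilted_law \<mu> l" "tilted_sigma \<mu> l"
  proof
    fix t :: real assume t: "t \<noteq> 0"
    show "cmod (char (tilted_law \<mu> l) t) < 1"
    proof (rule ccontr)
      assume "\<not> cmod (char (tilted_law \<mu> l) t) < 1"
      then obtain h a where h: "0 < h" "a \<in> {0..<h}" and AE: "AE y in \<mu>. \<exists>k::int. y = h * of_int k + a"
        using lattice_if_char_eq_1[OF t] by blast
      have "AE \<omega> in M. \<exists>k::int. X 1 \<omega> = h * of_int k + a"
        using AE unfolding \<mu>_def by (rule AE_distrD[OF X1])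
      then have "measure M {\<omega>\<in>space M. \<exists>k::int. X 1 \<omega> = h * of_int k + a} = 1"
        by (intro M.prob_Collect_eq_1[THEN iffD2]) measurable
      then show False using assms(7) h by (auto simp: non_lattice_def)
    qed
  qed
  let ?\<sigma> = "tilted_sigma \<mu> l"
  define I where "I = (\<integral>t. gexp l t * dual_renewal t \<partial>lborel)"
  have I: "0 < I" unfolding I_def by (rule dual_renewal_const(2)[OF l_pos])
  have I_eq: "(LINT t:{0..}|lborel. exp (- l * t) * V_star \<mu> l t) = I"
    unfolding I_def set_lebesgue_integral_def
    by (intro Bochner_Integration.integral_cong refl) (auto simp: gexp_def V_star_eq)
  have tail: "measure M {\<omega>\<in>space M. exit_time x (\<lambda>i. X i \<omega>) > enat n} = exp (n * log_mgf \<mu> l + l * x) * Q l n x"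
    if x: "0 \<le> x" for n x
  proof -
    have "measure M {\<omega>\<in>space M. exit_time x (\<lambda>i. X i \<omega>) > enat n} = (\<integral>w. of_bool (stays x w n) \<partial>Pi\<^sub>M UNIV (\<lambda>_. \<mu>))"
    proof (rule M.exit_time_prob[OF assms(3) _ x])
      fix i :: nat assume "1 \<le> i" then show "distr M borel (X i) = \<mu>" unfolding \<mu>_def by (rule assms(4))
    qed
    also have "\<dots> = exp (n * log_mgf \<mu> l + l * x) * Q l n x" by (rule change_of_measure)
    finally show ?thesis .
  qed
  define K where "K = 2 * I / (sqrt (2 * pi) * ?\<sigma>\<^sup>2)"
  have K: "0 < K" using I sigma_pos by (simp add: K_def)
  \<comment> \<open>A lower bound for \<open>phi_plus\<close> on the range of x / (\<sigma> * sqrt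
    n), which lies between 1 / (\<eta> * \<sigma>) and \<eta> / \<sigma>. It converts the absolute
    error of \<open>Q_asymp_uniform\<close> into the relative error of the theorem.\<close>
  define c where "c = inverse \<eta> / ?\<sigma> * exp (- (\<eta> / ?\<sigma>)\<^sup>2 / 2)"
  have eta: "0 < \<eta>" using assms(13) by simp
  have c: "0 < c" using eta sigma_pos by (simp add: c_def)
  have ratio: "\<bar>measure M {\<omega>\<in>space M. exit_time x (\<lambda>i. X i \<omega>) > enat n} /
        (2 * exp (real n * log_mgf \<mu> l + l * x) / (sqrt (2 * pi) * ?\<sigma>\<^sup>2 * real n) * phi_plus (x / (?\<sigma> * sqrt (real n)))
          * (LINT t:{0..}|lborel. exp (- l * t) * V_star \<mu> l t)) - 1\<bar>
      \<le> \<bar>n * Q l n x - K * phi_plus (x / (?\<sigma> * sqrt n))\<bar> / (K * c)"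
    if n: "0 < n" and x: "x \<in> {inverse \<eta> * sqrt n..\<eta> * sqrt n}" for n x
  proof -
    define p where "p = phi_plus (x / (?\<sigma> * sqrt n))"
    define E where "E = exp (real n * log_mgf \<mu> l + l * x)"
    have sn: "0 < sqrt (real n)" using n by simp
    have "0 \<le> inverse \<eta> * sqrt n" using eta by simp
    then have x0: "0 \<le> x" using x unfolding atLeastAtMost_iff by (blast intro: order_trans)
    have "c \<le> p" unfolding c_def p_def
    proof (rule phi_plus_lower_bound)
      show "0 < inverse \<eta> / ?\<sigma>" using eta sigma_pos by simp
      have "inverse \<eta> * sqrt n / (?\<sigma> * sqrt n) \<le> x / (?\<sigma> * sqrt n)" using x sigma_pos by (intro divide_right_mono) auto
      then show "inverse \<eta> / ?\<sigma> \<le> x / (?\<sigma> * sqrt n)" using sn by simp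
      have "x / (?\<sigma> * sqrt n) \<le> \<eta> * sqrt n / (?\<sigma> * sqrt n)" using x sigma_pos by (intro divide_right_mono) auto
      then show "x / (?\<sigma> * sqrt n) \<le> \<eta> / ?\<sigma>" using sn by simp
    qed
    then have p: "0 < p" "K * c \<le> K * p" using c K by auto
    have E: "0 < E" by (simp add: E_def)
    have b: "2 * E / (sqrt (2 * pi) * ?\<sigma>\<^sup>2 * real n) * p * I = E / n * (K * p)" by (simp add: K_def mult_ac)
    have "E * Q l n x / (E / n * (K * p)) - 1 = (n * Q l n x - K * p) / (K * p)"
      using E n p(1) K by (simp add: divide_simps)
    then have "\<bar>E * Q l n x / (E / n * (K * p)) - 1\<bar> = \<bar>n * Q l n x - K * p\<bar> / (K * p)"
      using K p(1) by (simp add: abs_divide abs_mult)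
    also have "\<dots> \<le> \<bar>n * Q l n x - K * p\<bar> / (K * c)"
      using p(2) K c by (intro divide_left_mono) (auto intro: mult_pos_pos p(1))
    finally show ?thesis unfolding tail[OF x0] I_eq E_def[symmetric] p_def[symmetric] b .
  qed
  show ?thesis unfolding unif_asymp_equiv_def
  proof (rule order_tendstoI)
    fix a :: ennreal assume "0 < a"
    \<comment> \<open>An intermediate d is inserted because bounds at the individual points yield
      only a weak inequality for the supremum.\<close>
    then obtain d where d: "0 < d" "d < a" using dense by blast
    then have dt: "d < \<top>" using top.not_eq_extremum by fastforce
    define e where "e = enn2real d"
    have e: "0 < e" "ennreal e = d" using d dt by (simp_all add: e_def enn2real_positive_iff)
    have "0 < e * (K * c)" using e K c by simp
    from Q_asymp_uniform[OF l_pos assms(13) this]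
    show "\<forall>\<^sub>F n in sequentially. (SUP x\<in>{inverse \<eta> * sqrt (real n)..\<eta> * sqrt (real n)}.
      ennreal \<bar>measure M {\<omega>\<in>space M. exit_time x (\<lambda>i. X i \<omega>) > enat n} /
        (2 * exp (real n * log_mgf \<mu> l + l * x) / (sqrt (2 * pi) * ?\<sigma>\<^sup>2 * real n) * phi_plus (x / (?\<sigma> * sqrt (real n)))
          * (LINT t:{0..}|lborel. exp (- l * t) * V_star \<mu> l t)) - 1\<bar>) < a"
      using eventually_gt_at_top[of 0]
    proof eventually_elim
      case (elim n)
      show ?case
      proof (rule le_less_trans[OF SUP_least d(2)])
        fix x assume x: "x \<in> {inverse \<eta> * sqrt (real n)..\<eta> * sqrt (real n)}"
        have "\<bar>n * Q l n x - K * phi_plus (x / (?\<sigma> * sqrt n))\<bar> < e * (K * c)"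
          using elim(1) x unfolding K_def I_def by blast
        then have "\<bar>n * Q l n x - K * phi_plus (x / (?\<sigma> * sqrt n))\<bar> / (K * c) \<le> e"
          using K c by (simp add: divide_le_eq)
        from order_trans[OF ratio[OF elim(2) x] this]
        show "ennreal \<bar>measure M {\<omega>\<in>space M. exit_time x (\<lambda>i. X i \<omega>) > enat n} /
          (2 * exp (real n * log_mgf \<mu> l + l * x) / (sqrt (2 * pi) * ?\<sigma>\<^sup>2 * real n) * phi_plus (x / (?\<sigma> * sqrt (real n)))
            * (LINT t:{0..}|lborel. exp (- l * t) * V_star \<mu> l t)) - 1\<bar> \<le> d"
          unfolding e(2)[symmetric] by (rule ennreal_leI)
      qed
    qed
  qed simp
qed

end
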